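(* Let $H=\Omega+|g\rangle\langle h|$ be the rank one perturbation of the multiplication operator $\Omega$ described in the context, with resolvent $R(z)$, and let $K$, $G_0=G_1\times I$ be as in the context. Put $R_u(x)=R(x+iu)$. Define for a $C^\infty$ test function $\varphi$ with support in $G_0$ the operator-valued distribution $$R(\varphi)=\lim_{\varepsilon\downarrow0}\iint_{|u|>\varepsilon}dx\,du\,R(x+iu)\varphi(x+iu)=\lim_{\varepsilon\downarrow0}\int_{|u|>\varepsilon}du\,R_u(\varphi_u),\qquad \varphi_u(x)=\varphi(x+iu).$$ Then $R(\varphi)$ extends the function $R(z)$ on $G_0\setminus P(K)$ to a distribution on $G_0$, which fulfills the distribution resolvent equation. Its spectral Schwartz distribution $M=\frac1\pi\overline{\partial}R$ is $$M(x+iy)=\mu(x)\,\delta(y),\qquad \mu(x)=\frac{1}{2\pi i}\big(R(x-i0)-R(x+i0)\big).$$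
   Context: Setting. $G\subset\mathbb{R}^n$ is open and bounded, $P:G\to\mathbb{R}$ is $C^\infty$, bounded with all its derivatives, with $\nabla P(y)\ne0$ for all $y\in G$. $V=L^2(G)$ with scalar product $\langle f_1|f_2\rangle=\int\overline{f_1(y)}f_2(y)\,dy$; $(\Omega f)(y)=P(y)f(y)$; $R_\Omega(z)=1/(z-\Omega)$. $\mathcal{D}(\cdot)$ denotes $C^\infty$ functions with compact support in the indicated open set. Let $g,h\in\mathcal{D}(G)$ and $H=\Omega+|g\rangle\langle h|$, i.e. $Hf=\Omega f+\langle h|f\rangle g$. Its resolvent is $$R(z)=R_\Omega(z)+\frac{R_\Omega(z)|g\rangle\langle h|R_\Omega(z)}{C(z)},\qquad C(z)=1-\langle h|R_\Omega(z)|g\rangle=1-\int_G\frac{\overline{h(y)}g(y)}{z-P(y)}\,dy .$$ $K\subset G$ is a compact set containing the supports of $g$ and $h$. If $z\notin P(K)$ and $C(z)\neq0$, then $R(z)$ is taken to exist as a function, $z$ belonging to the resolvent set. The limits $C(x\pm i0)=\lim_{u\to0\pm}C(x+iu)$ exist for real $x$. Standing assumption: there are an open set $G_1\subset\mathbb{R}$ containing $P(K)$ and an open interval $I\ni0$ such that, with $G_0=G_1\times I=\{x+iu:x\in G_1,u\in I\}$, $C(z)$ is holomorphic and $\ne0$ in $G_0\setminus P(K)$ and $C(x\pm i0)\neq0$ for $x\in G_0\cap\mathbb{R}$. For $\psi\in\mathcal{D}(G_1)$ and $u\in I\setminus\{0\}$, $R_u(\psi)=\int dx\,R(x+iu)\psi(x)$;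 $R(x\pm i0)$ denotes the distribution on $G_1$ given by $\psi\mapsto\lim_{u\to0\pm}R_u(\psi)$ (limit in operator norm). $\mu(x)\delta(y)$ applied to $\varphi\in\mathcal{D}(G_0)$ is $\mu$ applied to the restriction of $\varphi$ to the real axis. An $L(V)$-valued distribution $R$ on $G_0$ ($L(V)$ = bounded operators on $V$) satisfies the distribution resolvent equation if for all $\varphi_1,\varphi_2\in\mathcal{D}(G_0)$ $$R(\varphi_1)R(\varphi_2)=\int d^2z_1\,R(z_1)\varphi_1(z_1)\int d^2z_2\,\frac{\varphi_2(z_2)}{z_2-z_1}-\int d^2z_2\,R(z_2)\varphi_2(z_2)\int d^2z_1\,\frac{\varphi_1(z_1)}{z_2-z_1},$$ with $d^2z=dx\,dy$ for $z=x+iy$. Further $\overline{\partial}=\frac12(\partial_x+i\partial_y)$ and $(\overline{\partial}T)(\varphi)=-T(\overline{\partial}\varphi)$. *)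

theory Defs
  imports "HOL-Analysis.Analysis"
begin

definition sq_integrable :: "('a::euclidean_space \<Rightarrow> complex) \<Rightarrow> bool" where
  "sq_integrable f \<longleftrightarrow>
     f \<in> borel_measurable lborel \<and> integrable lborel (\<lambda>x. (cmod (f x))\<^sup>2)"

(* l2 is the complex Hilbert space of square-integrable functions modulo equality almost
   everywhere; cinner is conjugate linear in its first argument. *)
definition l2eq :: "('a::euclidean_space \<Rightarrow> complex) \<Rightarrow> ('a \<Rightarrow> complex) \<Rightarrow> bool" where
  "l2eq f g \<longleftrightarrow> sq_integrable f \<and> sq_integrable g \<and> (AE x in lborel. f x = g x)"

lemma sq_integrable_zero [simp]: "sq_integrable (\<lambda>x. 0)"
  by (simp add: sq_integrable_def)

quotient_type (overloaded) 'a l2 = "'a::euclidean_space \<Rightarrow> complex" / partial: l2eq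
proof (rule part_equivpI)
  show "\<exists>x. l2eq x x" by (auto simp: l2eq_def intro!: exI[of _ "\<lambda>_. 0"])
  show "symp l2eq" by (auto simp: l2eq_def symp_def)
  show "transp l2eq" unfolding l2eq_def transp_def by (auto elim: eventually_elim2)
qed

lemma sq_integrable_scale:
  assumes "sq_integrable f" shows "sq_integrable (\<lambda>x. c * f x)"
  using assms by (auto simp: sq_integrable_def norm_mult power_mult_distrib)

lemma sq_integrable_add:
  assumes "sq_integrable f" "sq_integrable g" shows "sq_integrable (\<lambda>x. f x + g x)"
proof -
  have [measurable]: "f \<in> borel_measurable lborel" "g \<in> borel_measurable lborel"
    using assms by (auto simp: sq_integrable_def)
  have "integrable lborel (\<lambda>x. (cmod (f x + g x))\<^sup>2)"
  proof (rule Bochner_Integration.integrable_bound)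
    show "integrable lborel (\<lambda>x. 2 * ((cmod (f x))\<^sup>2 + (cmod (g x))\<^sup>2))"
      using assms by (auto simp: sq_integrable_def)
    have "(cmod (a + b))\<^sup>2 \<le> 2 * ((cmod a)\<^sup>2 + (cmod b)\<^sup>2)" for a b :: complex
    proof -
      have "(cmod (a + b))\<^sup>2 \<le> (cmod a + cmod b)\<^sup>2" by (simp add: norm_triangle_ineq power_mono)
      also have "\<dots> \<le> 2 * ((cmod a)\<^sup>2 + (cmod b)\<^sup>2)"
        using sum_squares_bound[of "cmod a" "cmod b"] by (simp add: power2_sum)
      finally show ?thesis .
    qed
    then show "AE x in lborel. norm ((cmod (f x + g x))\<^sup>2) \<le>
        norm (2 * ((cmod (f x))\<^sup>2 + (cmod (g x))\<^sup>2))" by simp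
  qed measurable
  then show ?thesis by (simp add: sq_integrable_def)
qed

lemma sq_integrable_mult_integrable:
  assumes "sq_integrable f" "sq_integrable g" shows "integrable lborel (\<lambda>x. cnj (f x) * g x)"
proof (rule Bochner_Integration.integrable_bound)
  have [measurable]: "f \<in> borel_measurable lborel" "g \<in> borel_measurable lborel"
    using assms by (auto simp: sq_integrable_def)
  show "integrable lborel (\<lambda>x. (cmod (f x))\<^sup>2 + (cmod (g x))\<^sup>2)"
    using assms by (auto simp: sq_integrable_def)
  show "(\<lambda>x. cnj (f x) * g x) \<in> borel_measurable lborel" 
    by (intro borel_measurable_times measurable_compose[of f lborel borel cnj borel]
        borel_measurable_continuous_onI continuous_intros) simp_all
  have "a * b \<le> a\<^sup>2 + b\<^sup>2" if "a \<ge> 0" "b \<ge> 0" for a b :: real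
    using sum_squares_bound[of a b] mult_nonneg_nonneg[OF that] by linarith
  then show "AE x in lborel. norm (cnj (f x) * g x) \<le> norm ((cmod (f x))\<^sup>2 + (cmod (g x))\<^sup>2)"
    by (simp add: norm_mult)
qed

lemma cnj_mult_eq: "cnj z * z = of_real ((cmod z)\<^sup>2)"
  by (metis complex_norm_square mult.commute)

lemma sq_integrable_uminus: "sq_integrable f \<Longrightarrow> sq_integrable (\<lambda>x. - f x)"
  using sq_integrable_scale[of f "-1"] by simp

lemma sq_integrable_diff:
  "sq_integrable f \<Longrightarrow> sq_integrable g \<Longrightarrow> sq_integrable (\<lambda>x. f x - g x)"
  using sq_integrable_add[OF _ sq_integrable_uminus] by simp

lemma l2eqD: "l2eq f g \<Longrightarrow> sq_integrable f" "l2eq f g \<Longrightarrow> sq_integrable g"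
  "l2eq f g \<Longrightarrow> AE x in lborel. f x = g x"
  by (auto simp: l2eq_def)

lemma l2eqI:
  "sq_integrable f \<Longrightarrow> sq_integrable g \<Longrightarrow> AE x in lborel. f x = g x \<Longrightarrow> l2eq f g"
  by (auto simp: l2eq_def)

lemma l2eqI':
  "sq_integrable f \<Longrightarrow> sq_integrable g \<Longrightarrow> (\<And>x. f x = g x) \<Longrightarrow> l2eq f g"
  by (auto simp: l2eq_def)

lemmas sq_intros = sq_integrable_add sq_integrable_diff sq_integrable_uminus
  sq_integrable_scale sq_integrable_zero l2eqD(1,2)

instantiation l2 :: (euclidean_space) real_vector
begin

lift_definition zero_l2 :: "'a l2" is "\<lambda>_. 0" by (simp add: l2eq_def)

lift_definition plus_l2 :: "'a l2 \<Rightarrow> 'a l2 \<Rightarrow> 'a l2" is "\<lambda>f g x. f x + g x"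
  subgoal for f1 f2 g1 g2 
    by (rule l2eqI, (rule sq_intros; assumption?)+) (use l2eqD(3)[of f1 f2] l2eqD(3)[of g1 g2] in auto)
  done

lift_definition uminus_l2 :: "'a l2 \<Rightarrow> 'a l2" is "\<lambda>f x. - f x"
  subgoal for f1 f2
    by (rule l2eqI, (rule sq_intros; assumption?)+) (use l2eqD(3)[of f1 f2] in auto)
  done

lift_definition minus_l2 :: "'a l2 \<Rightarrow> 'a l2 \<Rightarrow> 'a l2" is "\<lambda>f g x. f x - g x"
  subgoal for f1 f2 g1 g2 
    by (rule l2eqI, (rule sq_intros; assumption?)+) (use l2eqD(3)[of f1 f2] l2eqD(3)[of g1 g2] in auto)
  done

lift_definition scaleR_l2 :: "real \<Rightarrow> 'a l2 \<Rightarrow> 'a l2" is "\<lambda>c f x. of_real c * f x"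
  subgoal for c f1 f2
    by (rule l2eqI, (rule sq_intros; assumption?)+) (use l2eqD(3)[of f1 f2] in auto)
  done

instance
  by standard (transfer; rule l2eqI'; (intro sq_intros; assumption)?; simp add: algebra_simps)+

end

lift_definition cinner :: "'a::euclidean_space l2 \<Rightarrow> 'a l2 \<Rightarrow> complex"
  is "\<lambda>f g. LINT x|lborel. cnj (f x) * g x"
  subgoal for f1 f2 g1 g2
  proof -
    assume a: "l2eq f1 f2" "l2eq g1 g2"
    have "AE x in lborel. cnj (f1 x) * g1 x = cnj (f2 x) * g2 x"
      using l2eqD(3)[OF a(1)] l2eqD(3)[OF a(2)] by auto
    then show ?thesis
      by (intro integral_cong_AE borel_measurable_integrable sq_integrable_mult_integrable
          l2eqD(1)[OF a(1)] l2eqD(2)[OF a(1)] l2eqD(1)[OF a(2)] l2eqD(2)[OF a(2)])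
  qed
  done

lift_definition scaleC :: "complex \<Rightarrow> 'a::euclidean_space l2 \<Rightarrow> 'a l2" (infixr \<open>*\<^sub>C\<close> 75)
  is "\<lambda>c f x. c * f x"
  subgoal for c f1 f2
    by (rule l2eqI, (rule sq_intros; assumption?)+) (use l2eqD(3)[of f1 f2] in auto)
  done

lemma cinner_add_right: "cinner F (A + B) = cinner F A + cinner F B"
  by transfer
    (simp add: ring_distribs sq_integrable_mult_integrable l2eqD)

lemma cinner_scaleC_right: "cinner F (c *\<^sub>C A) = c * cinner F A"
proof transfer
  fix f g :: "'a \<Rightarrow> complex" and c :: complex
  have "(\<lambda>x. cnj (f x) * (c * g x)) = (\<lambda>x. c * (cnj (f x) * g x))" by (simp add: algebra_simps)
  then show "(LINT x|lborel. cnj (f x) * (c * g x)) = c * (LINT x|lborel. cnj (f x) * g x)"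
    by simp
qed

lemma cinner_commute: "cinner F A = cnj (cinner A F)"
proof transfer
  fix f g :: "'a \<Rightarrow> complex"
  have eq: "(\<lambda>x. cnj (f x) * g x) = (\<lambda>x. cnj (cnj (g x) * f x))" by (simp add: algebra_simps)
  show "(LINT x|lborel. cnj (f x) * g x) = cnj (LINT x|lborel. cnj (g x) * f x)"
    unfolding eq by (rule Bochner_Integration.integral_cnj)
qed

lemma cinner_add_left: "cinner (A + B) F = cinner A F + cinner B F"
  by (metis cinner_add_right cinner_commute complex_cnj_add)

lemma cinner_scaleC_left: "cinner (c *\<^sub>C A) F = cnj c * cinner A F"
  by (metis cinner_scaleC_right cinner_commute complex_cnj_mult)

lemma scaleR_scaleC: "r *\<^sub>R A = of_real r *\<^sub>C A"
  by transfer (rule l2eqI', (intro sq_intros; assumption)+, simp)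

lemma cinner_self_real: "cinner A A = of_real (Re (cinner A A))"
  using cinner_commute[of A A] by (metis Reals_cnj_iff of_real_Re)

lemma Re_cinner_self_raw:
  "Re (LINT x|lborel. cnj (f x) * f x) = (LINT x|lborel. (cmod (f x))\<^sup>2)"
  unfolding cnj_mult_eq by (simp only: integral_complex_of_real Re_complex_of_real)

lemma cinner_self_nonneg: "0 \<le> Re (cinner A A)"
  by transfer (unfold Re_cinner_self_raw, simp)

lemma cinner_self_eq_0: "Re (cinner A A) = 0 \<longleftrightarrow> A = 0"
proof transfer
  fix f :: "'a \<Rightarrow> complex" assume "l2eq f f"
  then have f: "sq_integrable f" by (rule l2eqD)
  then have i: "integrable lborel (\<lambda>x. (cmod (f x))\<^sup>2)" by (simp add: sq_integrable_def)
  have "(LINT x|lborel. (cmod (f x))\<^sup>2) = 0 \<longleftrightarrow> (AE x in lborel. (cmod (f x))\<^sup>2 = 0)"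
    by (rule integral_nonneg_eq_0_iff_AE[OF i]) simp
  also have "\<dots> \<longleftrightarrow> l2eq f (\<lambda>_. 0)"
    using f by (simp add: l2eq_def)
  finally show "Re (LINT x|lborel. cnj (f x) * f x) = 0 \<longleftrightarrow> l2eq f (\<lambda>_. 0)"
    by (simp only: Re_cinner_self_raw)
qed

instantiation l2 :: (euclidean_space) real_inner
begin

definition "inner_l2 A B = Re (cinner A (B :: 'a l2))"
definition "norm_l2 A = sqrt (inner A (A :: 'a l2))"
definition "sgn_l2 A = A /\<^sub>R norm (A :: 'a l2)"
definition "dist_l2 A B = norm (A - B :: 'a l2)"
definition
  "uniformity_l2 = (INF e\<in>{0<..}. principal {(x :: 'a l2, y). dist x y < e})"
definition
  "open_l2 (U :: 'a l2 set) \<longleftrightarrow> (\<forall>x\<in>U. \<forall>\<^sub>F (x', y) in uniformity. x' = x \<longrightarrow> y \<in> U)"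

instance
proof
  fix x y z :: "'a l2" and r :: real
  show "dist x y = norm (x - y)" by (rule dist_l2_def)
  show "sgn x = x /\<^sub>R norm x" by (rule sgn_l2_def)
  show "uniformity = (INF e\<in>{0<..}. principal {(x :: 'a l2, y). dist x y < e})"
    by (rule uniformity_l2_def)
  show "open U \<longleftrightarrow> (\<forall>x\<in>U. \<forall>\<^sub>F (x', y) in uniformity. x' = x \<longrightarrow> y \<in> U)" for U :: "'a l2 set"
    by (rule open_l2_def)
  show "x \<bullet> y = y \<bullet> x" unfolding inner_l2_def by (subst cinner_commute) simp
  show "(x + y) \<bullet> z = x \<bullet> z + y \<bullet> z" by (simp add: inner_l2_def cinner_add_left)
  show "(r *\<^sub>R x) \<bullet> y = r * (x \<bullet> y)"
    by (simp add: inner_l2_def scaleR_scaleC cinner_scaleC_left)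
  show "0 \<le> x \<bullet> x" by (simp add: inner_l2_def cinner_self_nonneg)
  show "x \<bullet> x = 0 \<longleftrightarrow> x = 0" by (simp add: inner_l2_def cinner_self_eq_0)
  show "norm x = sqrt (x \<bullet> x)" by (rule norm_l2_def)
qed

end

lemma scaleC_add_right: "c *\<^sub>C (A + B) = c *\<^sub>C A + c *\<^sub>C B"
  by transfer (rule l2eqI', (intro sq_intros; assumption)+, simp add: algebra_simps)

lemma scaleC_add_left: "(c + d) *\<^sub>C A = c *\<^sub>C A + d *\<^sub>C A"
  by transfer (rule l2eqI', (intro sq_intros; assumption)+, simp add: algebra_simps)

lemma scaleC_scaleC [simp]: "c *\<^sub>C (d *\<^sub>C A) = (c * d) *\<^sub>C A"
  by transfer (rule l2eqI', (intro sq_intros; assumption)+, simp add: algebra_simps)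

lemma scaleC_one [simp]: "1 *\<^sub>C A = A"
  by transfer simp

lemma norm_l2_sq: "(norm A)\<^sup>2 = Re (cinner A A)"
  by (simp add: power2_norm_eq_inner inner_l2_def)

lemma norm_scaleC: "norm (c *\<^sub>C A) = cmod c * norm A"
proof -
  have "cinner (c *\<^sub>C A) (c *\<^sub>C A) = of_real ((cmod c)\<^sup>2) * cinner A A"
    unfolding cnj_mult_eq[symmetric] by (simp add: cinner_scaleC_left cinner_scaleC_right)
  then have "(norm (c *\<^sub>C A))\<^sup>2 = (cmod c * norm A)\<^sup>2"
    by (simp add: norm_l2_sq power_mult_distrib)
  then show ?thesis by (simp add: power2_eq_iff_nonneg)
qed

lemma cinner_bound: "cmod (cinner A B) \<le> norm A * norm B"
proof (cases "cinner A B = 0")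
  case False
  define w where "w = cnj (cinner A B) / of_real (cmod (cinner A B))"
  have w: "cmod w = 1" using False by (simp add: w_def norm_divide)
  have "w * cinner A B = of_real (cmod (cinner A B))"
    using False by (simp add: w_def cnj_mult_eq power2_eq_square)
  then have "cmod (cinner A B) = A \<bullet> (w *\<^sub>C B)"
    by (simp add: inner_l2_def cinner_scaleC_right)
  also have "\<dots> \<le> norm A * norm (w *\<^sub>C B)" by (rule norm_cauchy_schwarz)
  finally show ?thesis by (simp add: norm_scaleC w)
qed simp

lemma l2eq_rep: "l2eq (rep_l2 F) (rep_l2 F)"
  using Quotient_rep_reflp[OF Quotient_l2] .

lemma sq_integrable_rep [simp]: "sq_integrable (rep_l2 F)"
  using l2eqD(1)[OF l2eq_rep] .

lemma abs_rep_l2 [simp]: "abs_l2 (rep_l2 F) = F"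
  using Quotient_abs_rep[OF Quotient_l2] .

lemma rep_abs_l2: "sq_integrable f \<Longrightarrow> AE x in lborel. rep_l2 (abs_l2 f) x = f x"
  by (rule l2eqD(3)[OF Quotient_rep_abs[OF Quotient_l2]]) (simp add: l2eq_def)

lemma abs_l2_eq_iff:
  "sq_integrable f \<Longrightarrow> sq_integrable g \<Longrightarrow> abs_l2 f = abs_l2 g \<longleftrightarrow> (AE x in lborel. f x = g x)"
  using Quotient_rel[OF Quotient_l2, of f g] by (simp add: l2eq_def)

lemma borel_measurable_rep [measurable]: "rep_l2 F \<in> borel_measurable lborel"
  using sq_integrable_rep[of F] by (simp add: sq_integrable_def)

lemma abs_l2_add: "sq_integrable f \<Longrightarrow> sq_integrable g \<Longrightarrow> abs_l2 (\<lambda>x. f x + g x) = abs_l2 f + abs_l2 g"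
  using plus_l2.abs_eq[of f g] by (simp add: l2eq_def eq_onp_def)

lemma abs_l2_diff: "sq_integrable f \<Longrightarrow> sq_integrable g \<Longrightarrow> abs_l2 (\<lambda>x. f x - g x) = abs_l2 f - abs_l2 g"
  using minus_l2.abs_eq[of f g] by (simp add: l2eq_def eq_onp_def)

lemma abs_l2_scaleC: "sq_integrable f \<Longrightarrow> abs_l2 (\<lambda>x. c * f x) = c *\<^sub>C abs_l2 f"
  using scaleC.abs_eq[of f c] by (simp add: l2eq_def eq_onp_def)

lemma cinner_abs_l2:
  "sq_integrable f \<Longrightarrow> sq_integrable g \<Longrightarrow> cinner (abs_l2 f) (abs_l2 g) = (LINT x|lborel. cnj (f x) * g x)"
  using cinner.abs_eq[of f g] by (simp add: l2eq_def eq_onp_def)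

lemma norm_abs_l2: "sq_integrable f \<Longrightarrow> (norm (abs_l2 f))\<^sup>2 = (LINT x|lborel. (cmod (f x))\<^sup>2)"
  by (simp only: norm_l2_sq cinner_abs_l2 Re_cinner_self_raw)

lemma nn_norm_abs_l2:
  assumes "sq_integrable f"
  shows "(\<integral>\<^sup>+x. ennreal ((cmod (f x))\<^sup>2) \<partial>lborel) = ennreal ((norm (abs_l2 f))\<^sup>2)"
  using assms by (subst nn_integral_eq_integral) (auto simp: norm_abs_l2 sq_integrable_def)

lemma sq_integrable_nnI:
  assumes [measurable]: "f \<in> borel_measurable lborel"
    and "(\<integral>\<^sup>+x. ennreal ((cmod (f x))\<^sup>2) \<partial>lborel) < \<infinity>"
  shows "sq_integrable f"
  unfolding sq_integrable_def
proof
  show "integrable lborel (\<lambda>x. (cmod (f x))\<^sup>2)"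
    by (rule integrableI_bounded) (use assms(2) in auto)
qed fact

lemma summable_of_weighted_squares:
  fixes d :: "nat \<Rightarrow> real"
  assumes d: "\<And>n. d n \<ge> 0" and s: "summable (\<lambda>n. 2 ^ n * (d n)\<^sup>2)"
  shows "summable d"
proof (rule summable_comparison_test')
  show "summable (\<lambda>n. (1/2) ^ n + 2 ^ n * (d n)\<^sup>2)"
    by (intro summable_add s summable_geometric) simp
  fix n :: nat assume "n \<ge> 0"
  have "d n \<le> (1/2) ^ n + 2 ^ n * (d n)\<^sup>2"
  proof (cases "d n \<le> (1/2)^n")
    case False
    then have "2 ^ n * (d n)\<^sup>2 \<ge> 2 ^ n * ((1/2)^n * d n)"
      using d[of n] by (auto simp: power2_eq_square intro!: mult_left_mono mult_right_mono)
    also have "2 ^ n * ((1/2)^n * d n) = d n" by (simp add: power_one_over)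
    finally have "d n \<le> 2 ^ n * (d n)\<^sup>2" .
    moreover have "(0::real) \<le> (1/2) ^ n" by simp
    ultimately show ?thesis by linarith
  next
    case True
    moreover have "0 \<le> 2 ^ n * (d n)\<^sup>2" by simp
    ultimately show ?thesis by linarith
  qed
  then show "norm (d n) \<le> (1/2) ^ n + 2 ^ n * (d n)\<^sup>2" using d[of n] by simp
qed

lemma l2_fast_Cauchy_AE:
  fixes f :: "nat \<Rightarrow> 'a::euclidean_space \<Rightarrow> complex"
  assumes sq: "\<And>n. sq_integrable (f n)"
    and fast: "\<And>n. norm (abs_l2 (f (Suc n)) - abs_l2 (f n)) < (1/2) ^ n"
  shows "AE x in lborel. convergent (\<lambda>n. f n x)"
proof -
  have [measurable]: "f n \<in> borel_measurable lborel" for n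
    using sq[of n] by (simp add: sq_integrable_def)
  define d where "d n x = cmod (f (Suc n) x - f n x)" for n x
  have [measurable]: "d n \<in> borel_measurable lborel" for n unfolding d_def by measurable
  have 1: "(\<integral>\<^sup>+x. ennreal (2 ^ n * (d n x)\<^sup>2) \<partial>lborel) \<le> ennreal ((1/2) ^ n)" for n
  proof -
    have "(\<integral>\<^sup>+x. ennreal (2 ^ n * (d n x)\<^sup>2) \<partial>lborel) = ennreal (2 ^ n) * (\<integral>\<^sup>+x. ennreal ((d n x)\<^sup>2) \<partial>lborel)"
      by (simp add: ennreal_mult nn_integral_cmult)
    also have "\<dots> = ennreal (2 ^ n * (norm (abs_l2 (f (Suc n)) - abs_l2 (f n)))\<^sup>2)"
      unfolding d_def by (simp add: nn_norm_abs_l2[OF sq_integrable_diff[OF sq sq]] abs_l2_diff sq ennreal_mult)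
    also have "\<dots> \<le> ennreal ((1/2) ^ n)"
    proof (rule ennreal_leI)
      have "2 ^ n * (norm (abs_l2 (f (Suc n)) - abs_l2 (f n)))\<^sup>2 \<le> 2 ^ n * ((1/2) ^ n)\<^sup>2"
        by (intro mult_left_mono power_mono less_imp_le[OF fast]) auto
      also have "\<dots> = (1/2) ^ n" by (simp add: power2_eq_square power_one_over)
      finally show "2 ^ n * (norm (abs_l2 (f (Suc n)) - abs_l2 (f n)))\<^sup>2 \<le> (1/2) ^ n" .
    qed
    finally show ?thesis .
  qed
  have "(\<integral>\<^sup>+x. (\<Sum>n. ennreal (2 ^ n * (d n x)\<^sup>2)) \<partial>lborel) = (\<Sum>n. \<integral>\<^sup>+x. ennreal (2 ^ n * (d n x)\<^sup>2) \<partial>lborel)"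
    by (rule nn_integral_suminf) measurable
  also have "\<dots> \<le> (\<Sum>n. ennreal ((1/2) ^ n))" by (rule suminf_le[OF 1]) auto
  also have "\<dots> = ennreal (\<Sum>n. (1/2) ^ n)" by (rule suminf_ennreal2) (auto intro: summable_geometric)
  finally have "(\<integral>\<^sup>+x. (\<Sum>n. ennreal (2 ^ n * (d n x)\<^sup>2)) \<partial>lborel) \<noteq> \<infinity>"
    by (auto simp: top_unique)
  then have "AE x in lborel. (\<Sum>n. ennreal (2 ^ n * (d n x)\<^sup>2)) \<noteq> \<infinity>"
    by (rule nn_integral_noteq_infinite[rotated]) measurable
  then show ?thesis
  proof eventually_elim
    case (elim x)
    have "summable (\<lambda>n. 2 ^ n * (d n x)\<^sup>2)"
      by (rule summable_suminf_not_top[OF _ elim[unfolded infinity_ennreal_def]]) simp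
    then have "summable (\<lambda>n. d n x)"
      by (rule summable_of_weighted_squares[rotated]) (simp add: d_def)
    then have "summable (\<lambda>n. f (Suc n) x - f n x)" unfolding d_def by (rule summable_norm_cancel)
    then have "convergent (\<lambda>n. \<Sum>i<n. f (Suc i) x - f i x)" by (simp add: summable_iff_convergent)
    then have "convergent (\<lambda>n. f n x - f 0 x)"
      unfolding sum_lessThan_telescope[of "\<lambda>n. f n x"] .
    then have "convergent (\<lambda>n. (f n x - f 0 x) + f 0 x)"
      by (intro convergent_add convergent_const)
    then show ?case by simp
  qed
qed

lemma l2_Fatou:
  fixes f :: "nat \<Rightarrow> 'a::euclidean_space \<Rightarrow> complex"
  assumes sq: "\<And>n. sq_integrable (f n)" and g [measurable]: "g \<in> borel_measurable lborel"
    and lim: "AE x in lborel. (\<lambda>n. f n x) \<longlonglongrightarrow> g x"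
    and bd: "\<And>n. n \<ge> N \<Longrightarrow> norm (abs_l2 (f n) - abs_l2 (f N)) \<le> e" and "e \<ge> 0"
  shows "sq_integrable g" "norm (abs_l2 g - abs_l2 (f N)) \<le> e"
proof -
  have [measurable]: "f n \<in> borel_measurable lborel" for n
    using sq[of n] by (simp add: sq_integrable_def)
  have "(\<integral>\<^sup>+x. ennreal ((cmod (g x - f N x))\<^sup>2) \<partial>lborel) =
      (\<integral>\<^sup>+x. liminf (\<lambda>n. ennreal ((cmod (f n x - f N x))\<^sup>2)) \<partial>lborel)"
  proof (rule nn_integral_cong_AE, use lim in eventually_elim)
    case (elim x)
    have "(\<lambda>n. ennreal ((cmod (f n x - f N x))\<^sup>2)) \<longlonglongrightarrow> ennreal ((cmod (g x - f N x))\<^sup>2)"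
      by (intro tendsto_intros tendsto_ennrealI elim)
    from lim_imp_Liminf[OF _ this] show ?case by simp
  qed
  also have "\<dots> \<le> liminf (\<lambda>n. \<integral>\<^sup>+x. ennreal ((cmod (f n x - f N x))\<^sup>2) \<partial>lborel)"
    by (rule nn_integral_liminf) measurable
  also have "\<dots> = liminf (\<lambda>n. ennreal ((norm (abs_l2 (f n) - abs_l2 (f N)))\<^sup>2))"
    by (simp add: nn_norm_abs_l2[OF sq_integrable_diff[OF sq sq]] abs_l2_diff sq)
  also have "\<dots> \<le> ennreal (e\<^sup>2)"
  proof -
    have "eventually (\<lambda>n. ennreal ((norm (abs_l2 (f n) - abs_l2 (f N)))\<^sup>2) \<le> ennreal (e\<^sup>2)) sequentially"
      using eventually_ge_at_top[of N]
      by eventually_elim (intro ennreal_leI power_mono bd norm_ge_zero)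
    from Liminf_mono[OF this] show ?thesis by (simp add: Liminf_const)
  qed
  finally have le: "(\<integral>\<^sup>+x. ennreal ((cmod (g x - f N x))\<^sup>2) \<partial>lborel) \<le> ennreal (e\<^sup>2)" .
  have d: "sq_integrable (\<lambda>x. g x - f N x)"
    by (rule sq_integrable_nnI) (measurable, use le in \<open>auto simp: less_top[symmetric] top_unique\<close>)
  show g: "sq_integrable g" using sq_integrable_add[OF d sq[of N]] by simp
  have "(norm (abs_l2 g - abs_l2 (f N)))\<^sup>2 \<le> e\<^sup>2"
    using le by (simp add: nn_norm_abs_l2[OF d] abs_l2_diff g sq ennreal_le_iff)
  then show "norm (abs_l2 g - abs_l2 (f N)) \<le> e" using \<open>e \<ge> 0\<close> by (rule power2_le_imp_le)
qed

instance l2 :: (euclidean_space) complete_space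
proof
  fix F :: "nat \<Rightarrow> 'a l2" assume F: "Cauchy F"
  have "\<exists>M. \<forall>m\<ge>M. \<forall>n\<ge>M. dist (F m) (F n) < (1/2) ^ k" for k
    using metric_CauchyD[OF F, of "(1/2)^k"] by auto
  then obtain M where M: "dist (F m) (F n) < (1/2) ^ k" if "m \<ge> M k" "n \<ge> M k" for k m n
    by metis
  define r where "r k = (\<Sum>i\<le>k. M i) + k" for k
  have rM: "M k \<le> r k" for k
  proof -
    have "M k \<le> (\<Sum>i\<le>k. M i)" by (rule member_le_sum) auto
    then show ?thesis by (simp add: r_def)
  qed
  have rS: "r k < r (Suc k)" for k by (simp add: r_def)
  then have r: "strict_mono r" by (simp add: strict_mono_Suc_iff)
  have mono: "M k \<le> r l" if "k \<le> l" for k l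
    using order_trans[OF rM[of k] monoD[OF strict_mono_mono[OF r] that]] .
  define f where "f k = rep_l2 (F (r k))" for k
  have [measurable]: "f k \<in> borel_measurable lborel" for k by (simp add: f_def)
  have sq: "sq_integrable (f k)" for k by (simp add: f_def)
  have af: "abs_l2 (f k) = F (r k)" for k by (simp add: f_def)
  have bd: "norm (abs_l2 (f l) - abs_l2 (f k)) < (1/2) ^ k" if "l \<ge> k" for k l
    using M[of k "r l" "r k"] mono[OF that] rM[of k] by (simp add: af dist_norm)
  define g where "g x = lim (\<lambda>n. f n x)" for x
  have [measurable]: "g \<in> borel_measurable lborel" unfolding g_def by measurable
  have "AE x in lborel. convergent (\<lambda>n. f n x)"
    by (rule l2_fast_Cauchy_AE) (auto simp: sq intro!: bd)
  then have lim: "AE x in lborel. (\<lambda>n. f n x) \<longlonglongrightarrow> g x"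
    unfolding g_def by eventually_elim (simp add: convergent_LIMSEQ_iff)
  have "norm (abs_l2 g - F (r k)) \<le> (1/2) ^ k" for k
    using l2_Fatou(2)[of f g k "(1/2) ^ k"] sq lim less_imp_le[OF bd] by (simp add: af)
  then have "(\<lambda>k. norm (F (r k) - abs_l2 g)) \<longlonglongrightarrow> 0"
    by (intro tendsto_sandwich[OF _ _ tendsto_const LIMSEQ_power_zero[of "1/2 :: real"]])
      (auto simp: norm_minus_commute)
  then have "(F \<circ> r) \<longlonglongrightarrow> abs_l2 g"
    by (simp add: tendsto_norm_zero_iff LIM_zero_iff comp_def)
  then have "F \<longlonglongrightarrow> abs_l2 g"
    using Cauchy_converges_subseq[OF F r] by simp
  then show "convergent F" by (rule convergentI)
qed

instance l2 :: (euclidean_space) banach ..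

(* V = L^2(G) is the closed subspace of classes vanishing a.e. outside G, and an operator on V
   is represented by its extension by 0 to the orthogonal complement of V. This identifies L(V)
   isometrically, as an algebra, with ops G below; the identity of V becomes id_op G. *)
definition ops :: "'a::euclidean_space set \<Rightarrow> ('a l2 \<Rightarrow>\<^sub>L 'a l2) set" where
  "ops G = {A :: 'a l2 \<Rightarrow>\<^sub>L 'a l2. (\<forall>c F. A (c *\<^sub>C F) = c *\<^sub>C A F) \<and>
               (\<forall>F. AE y in lborel. y \<notin> G \<longrightarrow> rep_l2 (A F) y = 0) \<and>
               (\<forall>F. (AE y in lborel. y \<in> G \<longrightarrow> rep_l2 F y = 0) \<longrightarrow> A F = 0)}"

definition mult_op :: "'a::euclidean_space set \<Rightarrow> ('a \<Rightarrow> complex) \<Rightarrow> 'a l2 \<Rightarrow>\<^sub>L 'a l2" where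
  "mult_op G m = Blinfun (\<lambda>F. abs_l2 (\<lambda>y. if y \<in> G then m y * rep_l2 F y else 0))"

abbreviation id_op :: "'a::euclidean_space set \<Rightarrow> 'a l2 \<Rightarrow>\<^sub>L 'a l2" where
  "id_op G \<equiv> mult_op G (\<lambda>_. 1)"

(* |g><h| in bra-ket notation *)
definition rank_one :: "'a::euclidean_space l2 \<Rightarrow> 'a l2 \<Rightarrow> 'a l2 \<Rightarrow>\<^sub>L 'a l2" where
  "rank_one g h = Blinfun (\<lambda>F. cinner h F *\<^sub>C g)"

definition scale_op :: "complex \<Rightarrow> ('a::euclidean_space l2 \<Rightarrow>\<^sub>L 'a l2) \<Rightarrow> 'a l2 \<Rightarrow>\<^sub>L 'a l2"
    (infixr \<open>*\<^sub>O\<close> 75) where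
  "c *\<^sub>O A = Blinfun (\<lambda>F. c *\<^sub>C A F)"

definition is_resolvent ::
  "'a::euclidean_space set \<Rightarrow> ('a l2 \<Rightarrow>\<^sub>L 'a l2) \<Rightarrow> complex \<Rightarrow> ('a l2 \<Rightarrow>\<^sub>L 'a l2) \<Rightarrow> bool" where
  "is_resolvent G A z B \<longleftrightarrow> B \<in> ops G \<and>
     B o\<^sub>L (z *\<^sub>O id_op G - A) = id_op G \<and> (z *\<^sub>O id_op G - A) o\<^sub>L B = id_op G"

definition resolvent_set :: "'a::euclidean_space set \<Rightarrow> ('a l2 \<Rightarrow>\<^sub>L 'a l2) \<Rightarrow> complex set" where
  "resolvent_set G A = {z. \<exists>B. is_resolvent G A z B}"

(* Only points of the resolvent set matter; the value 0 elsewhere is a dummy. *)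
definition resolvent ::
  "'a::euclidean_space set \<Rightarrow> ('a l2 \<Rightarrow>\<^sub>L 'a l2) \<Rightarrow> complex \<Rightarrow> 'a l2 \<Rightarrow>\<^sub>L 'a l2" where
  "resolvent G A z = (if z \<in> resolvent_set G A then THE B. is_resolvent G A z B else 0)"

lemma scale_op_apply [simp]: "(c *\<^sub>O A) F = c *\<^sub>C A F"
proof -
  have "bounded_linear (\<lambda>F. c *\<^sub>C A F)"
  proof (rule bounded_linear_intro)
    show "c *\<^sub>C A (F + F') = c *\<^sub>C A F + c *\<^sub>C A F'" for F F'
      by (simp add: blinfun.add_right scaleC_add_right)
    show "c *\<^sub>C A (r *\<^sub>R F) = r *\<^sub>R c *\<^sub>C A F" for r F
      unfolding blinfun.scaleR_right by (simp add: scaleR_scaleC mult.commute)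
    show "norm (c *\<^sub>C A F) \<le> norm F * (cmod c * norm A)" for F
      using mult_left_mono[OF norm_blinfun[of A F], of "cmod c"]
      by (simp add: norm_scaleC mult_ac)
  qed
  then show ?thesis by (simp add: scale_op_def bounded_linear_Blinfun_apply)
qed

lemma rank_one_apply [simp]: "rank_one g h F = cinner h F *\<^sub>C g"
proof -
  have "bounded_linear (\<lambda>F. cinner h F *\<^sub>C g)"
  proof (rule bounded_linear_intro)
    show "cinner h (F + F') *\<^sub>C g = cinner h F *\<^sub>C g + cinner h F' *\<^sub>C g" for F F'
      by (simp add: cinner_add_right scaleC_add_left)
    show "cinner h (r *\<^sub>R F) *\<^sub>C g = r *\<^sub>R cinner h F *\<^sub>C g" for r F
      by (simp add: scaleR_scaleC cinner_scaleC_right)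
    show "norm (cinner h F *\<^sub>C g) \<le> norm F * (norm h * norm g)" for F
      using mult_right_mono[OF cinner_bound[of h F], of "norm g"]
      by (simp add: norm_scaleC mult_ac)
  qed
  then show ?thesis by (simp add: rank_one_def bounded_linear_Blinfun_apply)
qed

definition multiplier :: "'a::euclidean_space set \<Rightarrow> ('a \<Rightarrow> complex) \<Rightarrow> bool" where
  "multiplier G m \<longleftrightarrow>
     (\<lambda>y. if y \<in> G then m y else 0) \<in> borel_measurable lborel \<and> bounded (m ` G)"

lemma multiplier_sq:
  assumes "multiplier G m" "sq_integrable f"
  shows "sq_integrable (\<lambda>y. if y \<in> G then m y * f y else 0)"
    and "\<exists>c\<ge>0. \<forall>f. sq_integrable f \<longrightarrow>
      norm (abs_l2 (\<lambda>y. if y \<in> G then m y * f y else 0)) \<le> c * norm (abs_l2 f)"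
proof -
  define m' where "m' y = (if y \<in> G then m y else 0)" for y
  have [measurable]: "m' \<in> borel_measurable lborel"
    using assms by (simp add: multiplier_def m'_def[abs_def])
  obtain c where c: "c > 0" "\<And>y. y \<in> G \<Longrightarrow> cmod (m y) \<le> c"
    using assms by (auto simp: multiplier_def bounded_pos)
  have c': "cmod (m' y) \<le> c" for y using c by (simp add: m'_def)
  have eq: "(\<lambda>y. if y \<in> G then m y * f y else 0) = (\<lambda>y. m' y * f y)" for f
    by (auto simp: m'_def)
  have nn: "(\<integral>\<^sup>+y. ennreal ((cmod (m' y * f y))\<^sup>2) \<partial>lborel) \<le> ennreal ((c * norm (abs_l2 f))\<^sup>2)"
    if sf: "sq_integrable f" for f
  proof -
    have [measurable]: "f \<in> borel_measurable lborel" using sf by (simp add: sq_integrable_def)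
    have "(\<integral>\<^sup>+y. ennreal ((cmod (m' y * f y))\<^sup>2) \<partial>lborel) \<le>
        (\<integral>\<^sup>+y. ennreal (c\<^sup>2) * ennreal ((cmod (f y))\<^sup>2) \<partial>lborel)"
    proof (rule nn_integral_mono)
      fix y
      have "(cmod (m' y * f y))\<^sup>2 \<le> c\<^sup>2 * (cmod (f y))\<^sup>2"
        unfolding norm_mult power_mult_distrib
        by (intro mult_right_mono power_mono c') auto
      then show "ennreal ((cmod (m' y * f y))\<^sup>2) \<le> ennreal (c\<^sup>2) * ennreal ((cmod (f y))\<^sup>2)"
        by (simp flip: ennreal_mult)
    qed
    also have "\<dots> = ennreal ((c * norm (abs_l2 f))\<^sup>2)"
      by (subst nn_integral_cmult) (measurable, simp add: nn_norm_abs_l2[OF sf] power_mult_distrib flip: ennreal_mult)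
    finally show ?thesis .
  qed
  have sq: "sq_integrable (\<lambda>y. m' y * f y)" if sf: "sq_integrable f" for f
  proof (rule sq_integrable_nnI)
    have [measurable]: "f \<in> borel_measurable lborel" using sf by (simp add: sq_integrable_def)
    show "(\<lambda>y. m' y * f y) \<in> borel_measurable lborel" by measurable
    show "(\<integral>\<^sup>+y. ennreal ((cmod (m' y * f y))\<^sup>2) \<partial>lborel) < \<infinity>"
      using nn[OF sf] by (rule le_less_trans) simp
  qed
  show "sq_integrable (\<lambda>y. if y \<in> G then m y * f y else 0)"
    unfolding eq by (rule sq[OF assms(2)])
  have "norm (abs_l2 (\<lambda>y. m' y * f y)) \<le> c * norm (abs_l2 f)" if sf: "sq_integrable f" for f
  proof (rule power2_le_imp_le)
    show "(norm (abs_l2 (\<lambda>y. m' y * f y)))\<^sup>2 \<le> (c * norm (abs_l2 f))\<^sup>2"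
      using nn[OF sf] unfolding nn_norm_abs_l2[OF sq[OF sf]] by (simp add: ennreal_le_iff)
    show "0 \<le> c * norm (abs_l2 f)" using c by simp
  qed
  then show "\<exists>c\<ge>0. \<forall>f. sq_integrable f \<longrightarrow>
      norm (abs_l2 (\<lambda>y. if y \<in> G then m y * f y else 0)) \<le> c * norm (abs_l2 f)"
    unfolding eq using c by (auto intro!: exI[of _ c])
qed

lemma rep_add: "AE y in lborel. rep_l2 (F + F') y = rep_l2 F y + rep_l2 F' y"
proof -
  have "abs_l2 (\<lambda>y. rep_l2 F y + rep_l2 F' y) = F + F'" by (simp add: abs_l2_add)
  then show ?thesis
    using rep_abs_l2[OF sq_integrable_add[OF sq_integrable_rep sq_integrable_rep], of F F'] by simp
qed

lemma rep_scaleC: "AE y in lborel. rep_l2 (c *\<^sub>C F) y = c * rep_l2 F y"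
proof -
  have "abs_l2 (\<lambda>y. c * rep_l2 F y) = c *\<^sub>C F" by (simp add: abs_l2_scaleC)
  then show ?thesis
    using rep_abs_l2[OF sq_integrable_scale[OF sq_integrable_rep], of c F] by simp
qed

lemma mult_op_apply:
  assumes m: "multiplier G m"
  shows "mult_op G m F = abs_l2 (\<lambda>y. if y \<in> G then m y * rep_l2 F y else 0)"
proof -
  have "bounded_linear (\<lambda>F. abs_l2 (\<lambda>y. if y \<in> G then m y * rep_l2 F y else 0))"
  proof -
    note sq = multiplier_sq(1)[OF m sq_integrable_rep]
    obtain c where c: "\<And>f. sq_integrable f \<Longrightarrow>
      norm (abs_l2 (\<lambda>y. if y \<in> G then m y * f y else 0)) \<le> c * norm (abs_l2 f)"
      using multiplier_sq(2)[OF m sq_integrable_rep] by blast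
    show ?thesis
    proof (rule bounded_linear_intro)
      fix F F' :: "'a l2" and r :: real
      show "abs_l2 (\<lambda>y. if y \<in> G then m y * rep_l2 (F + F') y else 0) =
          abs_l2 (\<lambda>y. if y \<in> G then m y * rep_l2 F y else 0) +
          abs_l2 (\<lambda>y. if y \<in> G then m y * rep_l2 F' y else 0)"
        unfolding abs_l2_add[OF sq sq, symmetric]
        by (subst abs_l2_eq_iff[OF sq sq_integrable_add[OF sq sq]])
          (use rep_add[of F F'] in \<open>eventually_elim, auto simp: ring_distribs\<close>)
      show "abs_l2 (\<lambda>y. if y \<in> G then m y * rep_l2 (r *\<^sub>R F) y else 0) =
          r *\<^sub>R abs_l2 (\<lambda>y. if y \<in> G then m y * rep_l2 F y else 0)"
        unfolding scaleR_scaleC abs_l2_scaleC[OF sq, symmetric]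
        by (subst abs_l2_eq_iff[OF sq sq_integrable_scale[OF sq]])
          (use rep_scaleC[of "of_real r" F] in \<open>eventually_elim, auto\<close>)
      show "norm (abs_l2 (\<lambda>y. if y \<in> G then m y * rep_l2 F y else 0)) \<le> norm F * c"
        using c[of "rep_l2 F"] by (simp add: mult.commute)
    qed
  qed
  then show ?thesis by (simp add: mult_op_def bounded_linear_Blinfun_apply)
qed

lemma rep_mult_op:
  assumes m: "multiplier G m"
  shows "AE y in lborel. rep_l2 (mult_op G m F) y = (if y \<in> G then m y * rep_l2 F y else 0)"
  unfolding mult_op_apply[OF m] by (rule rep_abs_l2[OF multiplier_sq(1)[OF m sq_integrable_rep]])

lemma l2_eqI: "AE y in lborel. rep_l2 F y = rep_l2 F' y \<Longrightarrow> F = F'"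
  using abs_l2_eq_iff[OF sq_integrable_rep sq_integrable_rep, of F F'] by simp

lemma mult_op_comp:
  assumes "multiplier G m" "multiplier G n" "multiplier G k" "\<And>y. y \<in> G \<Longrightarrow> m y * n y = k y"
  shows "mult_op G m (mult_op G n F) = mult_op G k F"
  by (rule l2_eqI, use rep_mult_op[OF assms(1), of "mult_op G n F"] rep_mult_op[OF assms(2), of F]
      rep_mult_op[OF assms(3), of F] in eventually_elim) (use assms(4) in \<open>auto simp flip: mult.assoc\<close>)

lemma mult_op_scaleC:
  assumes m: "multiplier G m" shows "mult_op G m (c *\<^sub>C F) = c *\<^sub>C mult_op G m F"
  by (rule l2_eqI, use rep_mult_op[OF m, of F] rep_mult_op[OF m, of "c *\<^sub>C F"] rep_scaleC[of c F]
      rep_scaleC[of c "mult_op G m F"] in eventually_elim) auto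

lemma multiplier_const: "G \<in> sets borel \<Longrightarrow> multiplier G (\<lambda>_. c)"
  by (auto simp: multiplier_def intro: bounded_subset[of "{c}"])

lemma rep_zero: "AE y in lborel. rep_l2 0 y = 0"
  using rep_abs_l2[OF sq_integrable_zero] by (simp add: zero_l2_def)

lemma mult_op_in_ops: 
  assumes m: "multiplier G m" shows "mult_op G m \<in> ops G"
  unfolding ops_def
proof (safe)
  show "mult_op G m (c *\<^sub>C F) = c *\<^sub>C mult_op G m F" for c F by (rule mult_op_scaleC[OF m])
  show "AE y in lborel. y \<notin> G \<longrightarrow> rep_l2 (mult_op G m F) y = 0" for F
    using rep_mult_op[OF m, of F] by eventually_elim simp
  fix F :: "'a l2" assume a: "AE y in lborel. y \<in> G \<longrightarrow> rep_l2 F y = 0"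
  show "mult_op G m F = 0"
    by (rule l2_eqI, use a rep_zero rep_mult_op[OF m, of F] in eventually_elim) auto
qed

lemma id_op_eqI:
  assumes "G \<in> sets borel" "AE y in lborel. y \<notin> G \<longrightarrow> rep_l2 F y = 0"
  shows "id_op G F = F"
  by (rule l2_eqI, use assms(2) rep_mult_op[OF multiplier_const[OF assms(1)], of 1 F] in eventually_elim) auto

lemma id_op_ops:
  assumes "G \<in> sets borel" "A \<in> ops G"
  shows "id_op G o\<^sub>L A = A" "A o\<^sub>L id_op G = A"
proof -
  show "id_op G o\<^sub>L A = A"
    by (rule blinfun_eqI) (use assms in \<open>auto simp: ops_def intro!: id_op_eqI\<close>)
  have "A (F - id_op G F) = 0" for F
  proof -
    have "AE y in lborel. rep_l2 (F - id_op G F) y = rep_l2 F y - rep_l2 (id_op G F) y"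
      using rep_add[of "F - id_op G F" "id_op G F"] by eventually_elim simp
    then have "AE y in lborel. y \<in> G \<longrightarrow> rep_l2 (F - id_op G F) y = 0"
      using rep_mult_op[OF multiplier_const[OF assms(1)], of 1 F] by eventually_elim auto
    then show ?thesis using assms(2) by (auto simp: ops_def)
  qed
  then show "A o\<^sub>L id_op G = A"
    by (intro blinfun_eqI) (simp add: blinfun.diff_right)
qed

lemma resolvent_eqI:
  assumes "G \<in> sets borel" "is_resolvent G A z B"
  shows "z \<in> resolvent_set G A" "resolvent G A z = B"
proof -
  show z: "z \<in> resolvent_set G A" using assms by (auto simp: resolvent_set_def)
  have "B' = B" if "is_resolvent G A z B'" for B'
  proof -
    have "B' = B' o\<^sub>L ((z *\<^sub>O id_op G - A) o\<^sub>L B)"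
      using assms that by (simp add: is_resolvent_def id_op_ops)
    also have "\<dots> = (B' o\<^sub>L (z *\<^sub>O id_op G - A)) o\<^sub>L B"
      by (rule blinfun_eqI) simp
    also have "\<dots> = B"
      using assms that by (simp add: is_resolvent_def id_op_ops)
    finally show ?thesis .
  qed
  then show "resolvent G A z = B"
    unfolding resolvent_def if_P[OF z] by (rule the_equality[where P = "is_resolvent G A z", OF assms(2)])
qed


lemma scaleC_zero_left [simp]: "0 *\<^sub>C F = 0"
  using scaleR_scaleC[of 0 F] by simp

lemma scaleC_zero_right [simp]: "c *\<^sub>C 0 = 0"
  using norm_scaleC[of c 0] by simp

lemma cinner_zero_right [simp]: "cinner F 0 = 0"
  using cinner_bound[of F 0] by simp

lemma cinner_zero_left [simp]: "cinner 0 F = 0"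
  using cinner_bound[of 0 F] by simp

lemma scaleC_diff_left: "(c - d) *\<^sub>C F = c *\<^sub>C F - d *\<^sub>C F"
  using scaleC_add_left[of "c - d" d F] by (simp add: algebra_simps)

lemma scaleC_diff_right: "c *\<^sub>C (F - F') = c *\<^sub>C F - c *\<^sub>C F'"
  using scaleC_add_right[of c "F - F'" F'] by (simp add: algebra_simps)

lemma cinner_diff_right: "cinner H (F - F') = cinner H F - cinner H F'"
  using cinner_add_right[of H "F - F'" F'] by (simp add: algebra_simps)

lemma multiplier_of_real:
  assumes "open G" "continuous_on G P" "bounded (P ` G)"
  shows "multiplier G (\<lambda>y. of_real (P y))"
proof -
  have "(\<lambda>y. of_real (P y) :: complex) \<in> borel_measurable (restrict_space borel G)"
    by (intro borel_measurable_continuous_on_restrict continuous_intros assms)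
  then have "(\<lambda>y. if y \<in> G then of_real (P y) :: complex else 0) \<in> borel_measurable borel"
    using assms(1) by (subst (asm) measurable_restrict_space_iff) auto
  moreover have "bounded ((\<lambda>y. of_real (P y) :: complex) ` G)"
    using assms(3) by (auto simp: bounded_iff)
  ultimately show ?thesis by (simp add: multiplier_def)
qed

lemma multiplier_inverse_diff:
  assumes "G \<in> sets borel" "multiplier G p" "\<delta> > 0" "\<And>y. y \<in> G \<Longrightarrow> \<delta> \<le> cmod (z - p y)"
  shows "multiplier G (\<lambda>y. 1 / (z - p y))" "multiplier G (\<lambda>y. z - p y)"
proof -
  define q where "q y = (if y \<in> G then p y else 0)" for y
  have [measurable]: "G \<in> sets borel" "q \<in> borel_measurable borel"
    using assms by (simp_all add: multiplier_def q_def[abs_def])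
  have m: "(\<lambda>y. indicator G y * (1 / (z - q y))) \<in> borel_measurable borel"
    "(\<lambda>y. indicator G y * (z - q y)) \<in> borel_measurable borel" by measurable
  have "(\<lambda>y. if y \<in> G then 1 / (z - p y) else 0) = (\<lambda>y. indicator G y * (1 / (z - q y)))"
    "(\<lambda>y. if y \<in> G then z - p y else 0) = (\<lambda>y. indicator G y * (z - q y))"
    by (auto simp: q_def)
  moreover have "bounded ((\<lambda>y. 1 / (z - p y)) ` G)"
  proof -
    have "norm (1 / (z - p y)) \<le> 1 / \<delta>" if "y \<in> G" for y
      unfolding norm_divide norm_one using assms(3) assms(4)[OF that]
      by (intro divide_left_mono mult_pos_pos) auto
    then show ?thesis by (auto simp: bounded_iff)
  qed
  moreover have "bounded ((\<lambda>y. z - p y) ` G)"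
  proof -
    obtain b where "\<And>y. y \<in> G \<Longrightarrow> norm (p y) \<le> b"
      using assms(2) by (auto simp: multiplier_def bounded_iff)
    then have "norm (z - p y) \<le> norm z + b" if "y \<in> G" for y
      using norm_triangle_ineq4[of z "p y"] that by fastforce
    then show ?thesis by (auto simp: bounded_iff)
  qed
  ultimately show "multiplier G (\<lambda>y. 1 / (z - p y))" "multiplier G (\<lambda>y. z - p y)"
    using m by (simp_all add: multiplier_def)
qed

lemma cinner_mult_op:
  assumes "multiplier G m" "sq_integrable g" "sq_integrable h"
  shows "cinner (abs_l2 h) (mult_op G m (abs_l2 g)) = (LINT y:G|lborel. cnj (h y) * m y * g y)"
proof -
  note sq = multiplier_sq(1)[OF assms(1,2)]
  have "mult_op G m (abs_l2 g) = abs_l2 (\<lambda>y. if y \<in> G then m y * g y else 0)"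
    unfolding mult_op_apply[OF assms(1)]
    by (subst abs_l2_eq_iff[OF multiplier_sq(1)[OF assms(1) sq_integrable_rep] sq])
      (use rep_abs_l2[OF assms(2)] in \<open>eventually_elim, auto\<close>)
  then have "cinner (abs_l2 h) (mult_op G m (abs_l2 g)) =
      (LINT y|lborel. cnj (h y) * (if y \<in> G then m y * g y else 0))"
    by (simp add: cinner_abs_l2[OF assms(3) sq])
  also have "\<dots> = (LINT y:G|lborel. cnj (h y) * m y * g y)"
    unfolding set_lebesgue_integral_def by (intro Bochner_Integration.integral_cong) auto
  finally show ?thesis .
qed

lemma rank_one_in_ops:
  assumes "AE y in lborel. y \<notin> G \<longrightarrow> rep_l2 g y = 0" "AE y in lborel. y \<notin> G \<longrightarrow> rep_l2 h y = 0"
  shows "rank_one g h \<in> ops G"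
  unfolding ops_def
proof safe
  show "rank_one g h (c *\<^sub>C F) = c *\<^sub>C rank_one g h F" for c F
    by (simp add: cinner_scaleC_right)
  show "AE y in lborel. y \<notin> G \<longrightarrow> rep_l2 (rank_one g h F) y = 0" for F
    using assms(1) rep_scaleC[of "cinner h F" g] by eventually_elim simp
  fix F :: "'a l2" assume a: "AE y in lborel. y \<in> G \<longrightarrow> rep_l2 F y = 0"
  have "cinner (abs_l2 (rep_l2 h)) (abs_l2 (rep_l2 F)) = (LINT y|(lborel :: 'a measure). 0)"
    unfolding cinner_abs_l2[OF sq_integrable_rep sq_integrable_rep]
  proof (rule integral_cong_AE)
    show "AE y in lborel. cnj (rep_l2 h y) * rep_l2 F y = 0"
      using a assms(2) by eventually_elim auto
    show "(\<lambda>y. cnj (rep_l2 h y) * rep_l2 F y) \<in> borel_measurable lborel"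
      by (intro borel_measurable_integrable sq_integrable_mult_integrable) auto
  qed simp
  then show "rank_one g h F = 0"
    by simp
qed

lemma ops_add: "A \<in> ops G \<Longrightarrow> B \<in> ops G \<Longrightarrow> A + B \<in> ops G"
  unfolding ops_def
proof safe
  fix F :: "'a l2"
  assume "\<forall>F. AE y in lborel. y \<notin> G \<longrightarrow> rep_l2 (A F) y = 0" "\<forall>F. AE y in lborel. y \<notin> G \<longrightarrow> rep_l2 (B F) y = 0"
  then have a: "AE y in lborel. y \<notin> G \<longrightarrow> rep_l2 (A F) y = 0"
    and b: "AE y in lborel. y \<notin> G \<longrightarrow> rep_l2 (B F) y = 0" by auto
  show "AE y in lborel. y \<notin> G \<longrightarrow> rep_l2 ((A + B) F) y = 0"
    unfolding blinfun.add_left using a b rep_add[of "A F" "B F"] by eventually_elim auto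
qed (simp_all add: blinfun.add_left scaleC_add_right)

lemma ops_scale: "A \<in> ops G \<Longrightarrow> c *\<^sub>O A \<in> ops G"
  unfolding ops_def
proof safe
  fix F :: "'a l2"
  assume "\<forall>F. AE y in lborel. y \<notin> G \<longrightarrow> rep_l2 (A F) y = 0"
  then have a: "AE y in lborel. y \<notin> G \<longrightarrow> rep_l2 (A F) y = 0" by auto
  show "AE y in lborel. y \<notin> G \<longrightarrow> rep_l2 ((c *\<^sub>O A) F) y = 0"
    unfolding scale_op_apply using a rep_scaleC[of c "A F"] by eventually_elim auto
qed (simp_all add: mult.commute)

lemma ops_comp: "A \<in> ops G \<Longrightarrow> B \<in> ops G \<Longrightarrow> A o\<^sub>L B \<in> ops G"
  by (auto simp: ops_def blinfun.zero_right)

(* Sherman-Morrison: the resolvent of H is given by Krein's formula. *)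
theorem resolvent_formula:
  fixes G :: "'a::euclidean_space set" and P :: "'a \<Rightarrow> real" and z :: complex
  assumes G: "open G" and P: "continuous_on G P" "bounded (P ` G)"
    and \<delta>: "\<delta> > 0" "\<And>y. y \<in> G \<Longrightarrow> \<delta> \<le> cmod (z - of_real (P y))"
    and sq: "sq_integrable g" "sq_integrable h"
    and supp: "\<And>y. y \<notin> G \<Longrightarrow> g y = 0" "\<And>y. y \<notin> G \<Longrightarrow> h y = 0"
    and C: "C = 1 - (LINT y:G|lborel. cnj (h y) * g y / (z - of_real (P y)))" "C \<noteq> 0"
  defines "A \<equiv> mult_op G (\<lambda>y. of_real (P y)) + rank_one (abs_l2 g) (abs_l2 h)"
    and "R0 \<equiv> mult_op G (\<lambda>y. 1 / (z - of_real (P y)))"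
  shows "z \<in> resolvent_set G A"
    and "resolvent G A z = R0 + (1 / C) *\<^sub>O (R0 o\<^sub>L rank_one (abs_l2 g) (abs_l2 h) o\<^sub>L R0)"
proof -
  let ?g = "abs_l2 g" and ?h = "abs_l2 h"
  have Gb: "G \<in> sets borel" using G by simp
  note mP = multiplier_of_real[OF G P]
  have mR: "multiplier G (\<lambda>y. 1 / (z - of_real (P y)))" and mD: "multiplier G (\<lambda>y. z - of_real (P y))"
    by (rule multiplier_inverse_diff[OF Gb mP \<delta>(1)], erule \<delta>(2))+
  note m1 = multiplier_const[OF Gb, of 1]
  have ne: "z \<noteq> of_real (P y)" if "y \<in> G" for y using \<delta>(1) \<delta>(2)[OF that] by auto
  define D where "D = mult_op G (\<lambda>y. z - of_real (P y))"
  have DR: "D (R0 F) = id_op G F" and RD: "R0 (D F) = id_op G F" for F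
    unfolding D_def R0_def using ne
    by (auto intro!: mult_op_comp[OF mD mR m1] mult_op_comp[OF mR mD m1])
  have supp_g: "AE y in lborel. y \<notin> G \<longrightarrow> rep_l2 ?g y = 0"
    using rep_abs_l2[OF sq(1)] by eventually_elim (use supp in auto)
  have supp_h: "AE y in lborel. y \<notin> G \<longrightarrow> rep_l2 ?h y = 0"
    using rep_abs_l2[OF sq(2)] by eventually_elim (use supp in auto)
  have g1: "id_op G ?g = ?g" by (rule id_op_eqI[OF Gb supp_g])
  have zA: "(z *\<^sub>O id_op G - A) F = D F - cinner ?h F *\<^sub>C ?g" for F
  proof -
    have "z *\<^sub>C id_op G F - mult_op G (\<lambda>y. of_real (P y)) F = D F"
    proof -
      have "z *\<^sub>C id_op G F = D F + mult_op G (\<lambda>y. of_real (P y)) F"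
        unfolding D_def
        by (rule l2_eqI, use rep_mult_op[OF m1, of F] rep_mult_op[OF mP, of F] rep_mult_op[OF mD, of F]
          rep_scaleC[of z "id_op G F"]
          rep_add[of "mult_op G (\<lambda>y. z - of_real (P y)) F" "mult_op G (\<lambda>y. of_real (P y)) F"]
          in eventually_elim) (auto simp: algebra_simps)
      then show ?thesis by simp
    qed
    then show ?thesis by (simp add: A_def blinfun.diff_left blinfun.add_left diff_diff_eq[symmetric])
  qed
  have c: "cinner ?h (R0 ?g) = 1 - C"
    unfolding R0_def cinner_mult_op[OF mR sq] C by (simp add: divide_inverse mult_ac)
  have h1: "cinner ?h (id_op G F) = cinner ?h F" for F
  proof -
    have "cinner ?h (F - id_op G F) = 0"
    proof -
      have "AE y in lborel. rep_l2 (F - id_op G F) y = rep_l2 F y - rep_l2 (id_op G F) y"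
        using rep_add[of "F - id_op G F" "id_op G F"] by eventually_elim simp
      then have "AE y in lborel. y \<in> G \<longrightarrow> rep_l2 (F - id_op G F) y = 0"
        using rep_mult_op[OF m1, of F] by eventually_elim auto
      then have "rank_one ?h ?h (F - id_op G F) = 0"
        using rank_one_in_ops[OF supp_h supp_h] by (auto simp: ops_def)
      then have "cinner ?h (F - id_op G F) * cinner ?h ?h = 0"
        by (metis cinner_scaleC_right cinner_zero_right rank_one_apply)
      then consider "cinner ?h (F - id_op G F) = 0" | "cinner ?h ?h = 0" by auto
      then show ?thesis
      proof cases
        case 2
        then have "?h = 0" using cinner_self_eq_0[of ?h] by simp
        then show ?thesis by simp
      qed
    qed
    then show ?thesis by (simp add: cinner_diff_right)
  qed
  define B where "B = R0 + (1 / C) *\<^sub>O (R0 o\<^sub>L rank_one ?g ?h o\<^sub>L R0)"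
  have R0s: "R0 (k *\<^sub>C F) = k *\<^sub>C R0 F" for k F unfolding R0_def by (rule mult_op_scaleC[OF mR])
  have Ds: "D (k *\<^sub>C F) = k *\<^sub>C D F" for k F unfolding D_def by (rule mult_op_scaleC[OF mD])
  have B: "B F = R0 F + (cinner ?h (R0 F) / C) *\<^sub>C R0 ?g" for F
    by (simp add: B_def blinfun.add_left R0s)
  have "is_resolvent G A z B"
    unfolding is_resolvent_def
  proof (intro conjI blinfun_eqI)
    have R0o: "R0 \<in> ops G" unfolding R0_def by (rule mult_op_in_ops[OF mR])
    show "B \<in> ops G" unfolding B_def
      by (intro ops_add ops_scale ops_comp R0o rank_one_in_ops supp_g supp_h)
  next
    fix F
    have "(z *\<^sub>O id_op G - A) (B F) = id_op G F +
        (cinner ?h (R0 F) / C - (cinner ?h (R0 F) + cinner ?h (R0 F) / C * (1 - C))) *\<^sub>C ?g"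
      unfolding zA unfolding B
      by (simp add: blinfun.add_right DR Ds g1 c cinner_add_right cinner_scaleC_right scaleC_diff_left algebra_simps)
    also have "cinner ?h (R0 F) / C - (cinner ?h (R0 F) + cinner ?h (R0 F) / C * (1 - C)) = 0"
      using C(2) by (simp add: field_simps)
    finally show "((z *\<^sub>O id_op G - A) o\<^sub>L B) F = id_op G F"
by simp
  next
    fix F
    have "B ((z *\<^sub>O id_op G - A) F) = id_op G F +
        ((cinner ?h F - cinner ?h F * (1 - C)) / C - cinner ?h F) *\<^sub>C R0 ?g"
      unfolding zA unfolding B
      by (simp add: blinfun.diff_right RD R0s c h1 cinner_diff_right cinner_scaleC_right scaleC_diff_left)
    also have "(cinner ?h F - cinner ?h F * (1 - C)) / C - cinner ?h F = 0"
      using C(2) by (simp add: field_simps)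
    finally show "(B o\<^sub>L (z *\<^sub>O id_op G - A)) F = id_op G F"
by simp
  qed
  from resolvent_eqI[OF Gb this] show "z \<in> resolvent_set G A"
    "resolvent G A z = R0 + (1 / C) *\<^sub>O (R0 o\<^sub>L rank_one ?g ?h o\<^sub>L R0)"
    by (simp_all add: B_def)
qed

(* partials [b1, ..., bk] f is the iterated directional derivative d/db1 ... d/dbk f. *)
primrec partials :: "'a list \<Rightarrow> ('a::euclidean_space \<Rightarrow> 'b::real_normed_vector) \<Rightarrow> 'a \<Rightarrow> 'b" where
  "partials [] f = f"
| "partials (b # bs) f = (\<lambda>x. frechet_derivative (partials bs f) (at x) b)"

definition smooth_on :: "'a::euclidean_space set \<Rightarrow> ('a \<Rightarrow> 'b::real_normed_vector) \<Rightarrow> bool" where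
  "smooth_on U f \<longleftrightarrow> (\<forall>bs\<in>lists Basis. \<forall>x\<in>U. partials bs f differentiable at x)"

definition supp :: "('a::topological_space \<Rightarrow> 'b::zero) \<Rightarrow> 'a set" where
  "supp f = closure {x. f x \<noteq> 0}"

definition test_functions :: "'a::euclidean_space set \<Rightarrow> ('a \<Rightarrow> complex) set" where
  "test_functions U = {\<phi>. smooth_on UNIV \<phi> \<and> compact (supp \<phi>) \<and> supp \<phi> \<subseteq> U}"

definition Cm_norm :: "nat \<Rightarrow> ('a::euclidean_space \<Rightarrow> complex) \<Rightarrow> real" where
  "Cm_norm m \<phi> = (\<Sum>bs | set bs \<subseteq> Basis \<and> length bs \<le> m. SUP x. cmod (partials bs \<phi> x))"

(* L(V)-valued distributions on U, with V = L^2(G) *)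
definition op_distribution :: "'a::euclidean_space set \<Rightarrow> 'b::euclidean_space set \<Rightarrow>
    (('b \<Rightarrow> complex) \<Rightarrow> 'a l2 \<Rightarrow>\<^sub>L 'a l2) \<Rightarrow> bool" where
  "op_distribution G U T \<longleftrightarrow>
     (\<forall>\<phi>\<in>test_functions U. T \<phi> \<in> ops G) \<and>
     (\<forall>\<phi>\<in>test_functions U. \<forall>\<psi>\<in>test_functions U. T (\<lambda>x. \<phi> x + \<psi> x) = T \<phi> + T \<psi>) \<and>
     (\<forall>c. \<forall>\<phi>\<in>test_functions U. T (\<lambda>x. c * \<phi> x) = c *\<^sub>O T \<phi>) \<and>
     (\<forall>L. compact L \<and> L \<subseteq> U \<longrightarrow>
        (\<exists>c m. \<forall>\<phi>\<in>test_functions U. supp \<phi> \<subseteq> L \<longrightarrow> norm (T \<phi>) \<le> c * Cm_norm m \<phi>))"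

definition dist_resolvent_eq ::
  "complex set \<Rightarrow> ((complex \<Rightarrow> complex) \<Rightarrow> 'a::euclidean_space l2 \<Rightarrow>\<^sub>L 'a l2) \<Rightarrow> bool" where
  "dist_resolvent_eq U T \<longleftrightarrow> (\<forall>\<phi>\<^sub>1\<in>test_functions U. \<forall>\<phi>\<^sub>2\<in>test_functions U.
     T \<phi>\<^sub>1 o\<^sub>L T \<phi>\<^sub>2 =
       T (\<lambda>z\<^sub>1. \<phi>\<^sub>1 z\<^sub>1 * (LINT z\<^sub>2|lborel. \<phi>\<^sub>2 z\<^sub>2 / (z\<^sub>2 - z\<^sub>1)))
       - T (\<lambda>z\<^sub>2. \<phi>\<^sub>2 z\<^sub>2 * (LINT z\<^sub>1|lborel. \<phi>\<^sub>1 z\<^sub>1 / (z\<^sub>2 - z\<^sub>1))))"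

definition dbar :: "(complex \<Rightarrow> complex) \<Rightarrow> complex \<Rightarrow> complex" where
  "dbar \<phi> z = (frechet_derivative \<phi> (at z) 1 + \<i> * frechet_derivative \<phi> (at z) \<i>) / 2"

definition dbar_dist :: "((complex \<Rightarrow> complex) \<Rightarrow> 'a::euclidean_space l2 \<Rightarrow>\<^sub>L 'a l2) \<Rightarrow>
    (complex \<Rightarrow> complex) \<Rightarrow> 'a l2 \<Rightarrow>\<^sub>L 'a l2" where
  "dbar_dist T \<phi> = - T (dbar \<phi>)"

definition spectral_dist :: "((complex \<Rightarrow> complex) \<Rightarrow> 'a::euclidean_space l2 \<Rightarrow>\<^sub>L 'a l2) \<Rightarrow>
    (complex \<Rightarrow> complex) \<Rightarrow> 'a l2 \<Rightarrow>\<^sub>L 'a l2" where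
  "spectral_dist T \<phi> = (1 / of_real pi) *\<^sub>O dbar_dist T \<phi>"

(* For u \<noteq> 0 the operator-valued integrands below are norm continuous with compact support
   (after cutting off at |Im z| > \<epsilon>), so the gauge integral is the usual norm-convergent one. *)
definition slice :: "(complex \<Rightarrow> 'a::euclidean_space l2 \<Rightarrow>\<^sub>L 'a l2) \<Rightarrow> real \<Rightarrow>
    (real \<Rightarrow> complex) \<Rightarrow> 'a l2 \<Rightarrow>\<^sub>L 'a l2" where
  "slice R u \<psi> = integral UNIV (\<lambda>x. \<psi> x *\<^sub>O R (Complex x u))"

definition cut_integral :: "(complex \<Rightarrow> 'a::euclidean_space l2 \<Rightarrow>\<^sub>L 'a l2) \<Rightarrow> real \<Rightarrow>
    (complex \<Rightarrow> complex) \<Rightarrow> 'a l2 \<Rightarrow>\<^sub>L 'a l2" where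
  "cut_integral R \<epsilon> \<phi> = integral {z. \<epsilon> < \<bar>Im z\<bar>} (\<lambda>z. \<phi> z *\<^sub>O R z)"

definition resolvent_dist :: "(complex \<Rightarrow> 'a::euclidean_space l2 \<Rightarrow>\<^sub>L 'a l2) \<Rightarrow>
    (complex \<Rightarrow> complex) \<Rightarrow> 'a l2 \<Rightarrow>\<^sub>L 'a l2" where
  "resolvent_dist R \<phi> = Lim (at_right 0) (\<lambda>\<epsilon>. cut_integral R \<epsilon> \<phi>)"

(* R(x + i0) and R(x - i0) *)
definition upper_value :: "(complex \<Rightarrow> 'a::euclidean_space l2 \<Rightarrow>\<^sub>L 'a l2) \<Rightarrow>
    (real \<Rightarrow> complex) \<Rightarrow> 'a l2 \<Rightarrow>\<^sub>L 'a l2" where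
  "upper_value R \<psi> = Lim (at_right 0) (\<lambda>u. slice R u \<psi>)"

definition lower_value :: "(complex \<Rightarrow> 'a::euclidean_space l2 \<Rightarrow>\<^sub>L 'a l2) \<Rightarrow>
    (real \<Rightarrow> complex) \<Rightarrow> 'a l2 \<Rightarrow>\<^sub>L 'a l2" where
  "lower_value R \<psi> = Lim (at_left 0) (\<lambda>u. slice R u \<psi>)"

definition jump_dist :: "(complex \<Rightarrow> 'a::euclidean_space l2 \<Rightarrow>\<^sub>L 'a l2) \<Rightarrow>
    (real \<Rightarrow> complex) \<Rightarrow> 'a l2 \<Rightarrow>\<^sub>L 'a l2" where
  "jump_dist R \<psi> = (1 / (2 * of_real pi * \<i>)) *\<^sub>O (lower_value R \<psi> - upper_value R \<psi>)"

(* the distribution \<mu>(x) \<delta>(y) *)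
definition times_delta :: "((real \<Rightarrow> complex) \<Rightarrow> 'a::euclidean_space l2 \<Rightarrow>\<^sub>L 'a l2) \<Rightarrow>
    (complex \<Rightarrow> complex) \<Rightarrow> 'a l2 \<Rightarrow>\<^sub>L 'a l2" where
  "times_delta \<mu> \<phi> = \<mu> (\<lambda>x. \<phi> (of_real x))"

end

theory Submission
  imports Defs
begin

text \<open>
  Integrating by parts along \<open>\<nabla>P / |\<nabla>P|\<^sup>2\<close> three times turns \<open>\<integral> k / (z - P)\<close> into
  \<open>\<integral> k\<^sub>3 L(z - P)\<close> with \<open>L' = w Ln w - w\<close> locally bounded, so such integrals are Lipschitz up to the
  real axis from either side. Hence \<open>C\<close> is bounded away from \<open>0\<close> near the axis, and since
  \<open>\<integral> |g|\<^sup>2 / |z - P|\<^sup>2 = - Im (\<integral> |g|\<^sup>2 / (z - P)) / Im z\<close>, the resolvent satisfies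
  \<open>\<parallel>R(z)\<parallel> \<le> M / |Im z|\<close> on compact subsets of \<open>G\<^sub>0\<close>.

  The rest uses only this bound, holomorphy and the resolvent identity. By holomorphy
  \<open>d/du \<integral> R(x + iu) \<psi>(x) dx = - i \<integral> R(x + iu) \<psi>'(x) dx\<close>, so one derivative of the test function
  improves the bound on the slice from \<open>1 / |u|\<close> to \<open>|u|\<^bsup>-1/2\<^esup>\<close>, which is integrable, and a second
  one yields the boundary values. The same formula for \<open>\<phi>(x + iu)\<close> is Stokes' theorem and
  identifies \<open>M\<close>. The distribution resolvent equation is Fubini's theorem for test functions
  vanishing near the axis; the general case follows by cutting off in \<open>Im z\<close>, which does not
  affect the horizontal derivatives that control \<open>R(\<phi>)\<close>. Off \<open>P(K)\<close> the rank one part of the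
  resolvent is continuous, and only the free part needs a separate argument.
\<close>

section \<open>Smooth functions\<close>

text \<open>Three integrations by parts rather than two, because boundedness is not enough for the
  lower bound on \<open>C\<close>. Its limits are given along vertical lines only, while a sequence
  with \<open>C\<close> tending to 0 may approach the axis in any manner; a Lipschitz bound up to
  the axis makes the two comparable.

  The bound \<open>M / |Im z|\<close> just fails to be integrable across the axis, so derivatives of
  the test function are traded for integrations in \<open>u\<close>: \<open>1 / u\<close> becomes a
  logarithm, which is dominated by \<open>1 / sqrt u\<close>, and this in turn becomes
  \<open>sqrt u\<close>. The calculus is done for matrix elements; constants proportional to
  \<open>norm F * norm F'\<close> carry the estimates back to the operator norm.

  The extension statement is delicate at real points of \<open>P(G)\<close> outside
  \<open>P(K)\<close>. There the free resolvent does not exist and its norm grows like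
  \<open>1 / |Im z|\<close>, so the integrand need not be absolutely integrable. But it is a
  multiplication operator: the norms of its Riemann sums are controlled by suprema of scalar Riemann
  sums, for which a common gauge exists.\<close>

lemma partials_append: "partials (bs @ cs) f = partials bs (partials cs f)"
  by (induction bs) auto

lemma frechet_derivative_cong_open:
  assumes "open U" "x \<in> U" "\<And>y. y \<in> U \<Longrightarrow> f y = g y"
  shows "frechet_derivative f (at x) = frechet_derivative g (at x)"
proof -
  have "(f has_derivative D) (at x) \<longleftrightarrow> (g has_derivative D) (at x)" for D
    using has_derivative_transform_within_open[OF _ assms(1,2), of f D UNIV g]
      has_derivative_transform_within_open[OF _ assms(1,2), of g D UNIV f] assms(3) by auto
  then show ?thesis by (simp add: frechet_derivative_def)
qed

lemma partials_cong_open: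
  assumes "open U" "x \<in> U" "\<And>y. y \<in> U \<Longrightarrow> f y = g y"
  shows "partials bs f x = partials bs g x"
  using assms(2)
proof (induction bs arbitrary: x)
  case (Cons b bs)
  then show ?case
    by (auto dest: frechet_derivative_cong_open[OF assms(1), of x "partials bs f" "partials bs g"])
qed (simp add: assms)

text \<open>Finite-order version of \<open>smooth_on\<close>, introduced because closure under
  products and reciprocals needs induction on the order: their derivatives contain the
  undifferentiated functions again. All partials up to order \<open>k\<close> are differentiable, so
  order 0 already means differentiable.\<close>

definition Ck_on :: "nat \<Rightarrow> 'a::euclidean_space set \<Rightarrow> ('a \<Rightarrow> 'b::real_normed_vector) \<Rightarrow> bool" where
  "Ck_on k U f \<longleftrightarrow> (\<forall>bs\<in>lists Basis. length bs \<le> k \<longrightarrow> (\<forall>x\<in>U. partials bs f differentiable at x))"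

lemma smooth_on_iff_Ck_on: "smooth_on U f \<longleftrightarrow> (\<forall>k. Ck_on k U f)"
  unfolding smooth_on_def Ck_on_def by auto

lemma Ck_on_0: "Ck_on 0 U f \<longleftrightarrow> (\<forall>x\<in>U. f differentiable at x)"
  by (auto simp: Ck_on_def)

text \<open>The derivative taken off is the innermost one, last in the list, so that an induction
  hypothesis can be applied to \<open>partials [b] f\<close>, which the rules of differentiation
  compute.\<close>

lemma Ck_on_Suc:
  fixes f :: "'a::euclidean_space \<Rightarrow> 'b::real_normed_vector"
  shows "Ck_on (Suc k) U f \<longleftrightarrow> (\<forall>x\<in>U. f differentiable at x) \<and> (\<forall>b\<in>Basis. Ck_on k U (partials [b] f))"
proof safe
  fix x assume "Ck_on (Suc k) U f" "x \<in> U"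
  then show "f differentiable at x" by (auto simp: Ck_on_def dest!: bspec[of _ _ "[]"])
next
  fix b :: 'a assume *: "Ck_on (Suc k) U f" "b \<in> Basis"
  show "Ck_on k U (partials [b] f)"
    unfolding Ck_on_def
  proof (intro ballI impI)
    fix bs :: "'a list" and x assume "bs \<in> lists Basis" "length bs \<le> k" "x \<in> U"
    then have "bs @ [b] \<in> lists Basis" "length (bs @ [b]) \<le> Suc k" "x \<in> U" using * by auto
    with *(1) have "partials (bs @ [b]) f differentiable at x"
      unfolding Ck_on_def by blast
    then show "partials bs (partials [b] f) differentiable at x"
      by (simp only: partials_append)
  qed
next
  assume *: "\<forall>x\<in>U. f differentiable at x" "\<forall>b\<in>Basis. Ck_on k U (partials [b] f)"
  show "Ck_on (Suc k) U f"
    unfolding Ck_on_def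
  proof (intro ballI impI)
    fix bs :: "'a list" and x assume b: "bs \<in> lists Basis" "length bs \<le> Suc k" "x \<in> U"
    show "partials bs f differentiable at x"
    proof (cases bs rule: rev_cases)
      case Nil then show ?thesis using * b by simp
    next
      case (snoc cs c)
      then show ?thesis using * b unfolding snoc partials_append by (auto simp: Ck_on_def)
    qed
  qed
qed

lemma Ck_on_mono: "Ck_on k U f \<Longrightarrow> j \<le> k \<Longrightarrow> V \<subseteq> U \<Longrightarrow> Ck_on j V f"
  unfolding Ck_on_def by (meson order_trans subsetD)

lemma Ck_on_cong:
  fixes f :: "'a::euclidean_space \<Rightarrow> 'b::real_normed_vector"
  assumes "open U" "\<And>y. y \<in> U \<Longrightarrow> f y = g y" "Ck_on k U f"
  shows "Ck_on k U g"
  unfolding Ck_on_def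
proof (intro ballI impI)
  fix bs :: "'a list" and x assume b: "bs \<in> lists Basis" "length bs \<le> k" "x \<in> U"
  then have "partials bs f differentiable at x" using assms(3) by (auto simp: Ck_on_def)
  then obtain D where "(partials bs f has_derivative D) (at x)" by (auto simp: differentiable_def)
  then have "(partials bs g has_derivative D) (at x)"
    by (rule has_derivative_transform_within_open[OF _ assms(1) b(3)])
      (rule partials_cong_open[OF assms(1)], use assms(2) in auto)
  then show "partials bs g differentiable at x" by (auto simp: differentiable_def)
qed

declare partials.simps(2) [simp del]

lemma partial_eq: "(f has_derivative D) (at x) \<Longrightarrow> partials [b] f x = D b"
  by (simp add: partials.simps frechet_derivative_at[symmetric])

lemma differentiable_has_derivative:
  "f differentiable at x \<Longrightarrow> (f has_derivative (\<lambda>b. partials [b] f x)) (at x)"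
  unfolding frechet_derivative_works by (simp add: partials.simps)

lemma Ck_on_const [simp]: "Ck_on k (U :: 'a::euclidean_space set) (\<lambda>_. c)"
proof (induction k arbitrary: c)
  case (Suc k)
  have "partials [b] (\<lambda>_. c) = (\<lambda>_. 0)" for b :: 'a by (rule ext, simp add: partials.simps)
  then show ?case unfolding Ck_on_Suc using Suc by auto
qed (simp add: Ck_on_0)

lemma Ck_on_linear:
  fixes f :: "'a::euclidean_space \<Rightarrow> 'b::real_normed_vector"
  assumes "bounded_linear h" "open U" "Ck_on k U f"
  shows "Ck_on k U (\<lambda>x. h (f x))"
  using assms(3)
proof (induction k arbitrary: f)
  case 0
  then show ?case by (auto simp: Ck_on_0 simp: differentiable_def intro: bounded_linear.has_derivative[OF assms(1)])
next
  case (Suc k)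
  have D: "((\<lambda>x. h (f x)) has_derivative (\<lambda>b. h (partials [b] f x))) (at x)" if "x \<in> U" for x
    using bounded_linear.has_derivative[OF assms(1) differentiable_has_derivative[of f x]] that Suc.prems
    by (auto simp: Ck_on_Suc)
  show ?case
    unfolding Ck_on_Suc
  proof safe
    fix x assume "x \<in> U" then show "(\<lambda>x. h (f x)) differentiable at x"
      using D by (auto simp: differentiable_def)
  next
    fix b :: 'a assume "b \<in> Basis"
    then have "Ck_on k U (\<lambda>x. h (partials [b] f x))" using Suc by (auto simp: Ck_on_Suc)
    then show "Ck_on k U (partials [b] (\<lambda>x. h (f x)))"
      by (rule Ck_on_cong[OF assms(2), rotated]) (use partial_eq[OF D] in simp)
  qed
qed

lemma Ck_on_add:
  fixes f :: "'a::euclidean_space \<Rightarrow> 'b::real_normed_vector"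
  assumes "open U" "Ck_on k U f" "Ck_on k U g"
  shows "Ck_on k U (\<lambda>x. f x + g x)"
  using assms(2,3)
proof (induction k arbitrary: f g)
  case 0
  then show ?case by (auto simp: Ck_on_0)
next
  case (Suc k)
  have D: "((\<lambda>x. f x + g x) has_derivative (\<lambda>b. partials [b] f x + partials [b] g x)) (at x)" if "x \<in> U" for x
    using that Suc.prems
    by (intro has_derivative_add differentiable_has_derivative) (auto simp: Ck_on_Suc)
  show ?case
    unfolding Ck_on_Suc
  proof safe
    fix x assume "x \<in> U" then show "(\<lambda>x. f x + g x) differentiable at x"
      using D by (auto simp: differentiable_def)
  next
    fix b :: 'a assume "b \<in> Basis"
    then have "Ck_on k U (\<lambda>x. partials [b] f x + partials [b] g x)" using Suc by (auto simp: Ck_on_Suc)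
    then show "Ck_on k U (partials [b] (\<lambda>x. f x + g x))"
      by (rule Ck_on_cong[OF assms(1), rotated]) (use partial_eq[OF D] in simp)
  qed
qed

lemma Ck_on_bilinear:
  fixes f :: "'a::euclidean_space \<Rightarrow> 'b::real_normed_vector"
    and g :: "'a \<Rightarrow> 'c::real_normed_vector" and m :: "'b \<Rightarrow> 'c \<Rightarrow> 'd::real_normed_vector"
  assumes "bounded_bilinear m" "open U" "Ck_on k U f" "Ck_on k U g"
  shows "Ck_on k U (\<lambda>x. m (f x) (g x))"
  using assms(3,4)
proof (induction k arbitrary: f g)
  case 0
  then show ?case using bounded_bilinear.FDERIV[OF assms(1)] by (fastforce simp: Ck_on_0 differentiable_def)
next
  case (Suc k)
  have D: "((\<lambda>x. m (f x) (g x)) has_derivative (\<lambda>b. m (f x) (partials [b] g x) + m (partials [b] f x) (g x))) (at x)"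
    if "x \<in> U" for x
    using that Suc.prems
    by (intro bounded_bilinear.FDERIV[OF assms(1)] differentiable_has_derivative) (auto simp: Ck_on_Suc)
  show ?case
    unfolding Ck_on_Suc
  proof safe
    fix x assume "x \<in> U" then show "(\<lambda>x. m (f x) (g x)) differentiable at x"
      using D by (auto simp: differentiable_def)
  next
    fix b :: 'a assume b: "b \<in> Basis"
    have "Ck_on k U f" "Ck_on k U g" using Suc.prems by (auto intro: Ck_on_mono)
    with b Suc have "Ck_on k U (\<lambda>x. m (f x) (partials [b] g x) + m (partials [b] f x) (g x))"
      by (intro Ck_on_add assms Suc.IH) (auto simp: Ck_on_Suc)
    then show "Ck_on k U (partials [b] (\<lambda>x. m (f x) (g x)))"
      by (rule Ck_on_cong[OF assms(2), rotated]) (use partial_eq[OF D] in simp)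
  qed
qed

text \<open>Induction with \<open>f\<close> fixed: the derivative \<open>- (1/f) f' (1/f)\<close>
  contains only \<open>f'\<close> and \<open>1/f\<close> itself, which the induction hypothesis
  covers.\<close>

lemma Ck_on_inverse:
  fixes f :: "'a::euclidean_space \<Rightarrow> real"
  assumes "open U" "\<And>x. x \<in> U \<Longrightarrow> f x \<noteq> 0" "Ck_on k U f"
  shows "Ck_on k U (\<lambda>x. inverse (f x))"
  using assms(3)
proof (induction k)
  case 0
  then show ?case using assms(2) by (auto simp: Ck_on_0 intro!: differentiable_inverse)
next
  case (Suc k)
  have D: "((\<lambda>x. inverse (f x)) has_derivative
      (\<lambda>b. - (inverse (f x) * partials [b] f x * inverse (f x)))) (at x)" if "x \<in> U" for x
    using that Suc.prems assms(2)
    by (intro Deriv.has_derivative_inverse differentiable_has_derivative) (auto simp: Ck_on_Suc)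
  show ?case
    unfolding Ck_on_Suc
  proof safe
    fix x assume "x \<in> U" then show "(\<lambda>x. inverse (f x)) differentiable at x"
      using D by (auto simp: differentiable_def)
  next
    fix b :: 'a assume b: "b \<in> Basis"
    have "Ck_on k U f" using Suc.prems by (rule Ck_on_mono) auto
    then have "Ck_on k U (\<lambda>x. inverse (f x))" by (rule Suc.IH)
    then have "Ck_on k U (\<lambda>x. - (inverse (f x) * partials [b] f x * inverse (f x)))" using b Suc.prems
      by (intro Ck_on_linear[OF bounded_linear_minus[OF bounded_linear_ident]]
          Ck_on_bilinear[OF bounded_bilinear_mult] assms) (auto simp: Ck_on_Suc)
    then show "Ck_on k U (partials [b] (\<lambda>x. inverse (f x)))"
      by (rule Ck_on_cong[OF assms(1), rotated]) (use partial_eq[OF D] in simp)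
  qed
qed

lemma smooth_on_open_Un:
  assumes "smooth_on U f" "smooth_on V f"
  shows "smooth_on (U \<union> V) f"
  using assms by (auto simp: smooth_on_def)


lemma smooth_on_partial: "smooth_on U f \<Longrightarrow> b \<in> Basis \<Longrightarrow> smooth_on U (partials [b] f)"
  unfolding smooth_on_iff_Ck_on using Ck_on_Suc by blast

lemma smooth_on_subset: "smooth_on U f \<Longrightarrow> V \<subseteq> U \<Longrightarrow> smooth_on V f"
  by (auto simp: smooth_on_def)

lemma smooth_on_cong:
  "open U \<Longrightarrow> (\<And>y. y \<in> U \<Longrightarrow> f y = g y) \<Longrightarrow> smooth_on U f \<Longrightarrow> smooth_on U g"
  unfolding smooth_on_iff_Ck_on using Ck_on_cong by blast

lemma smooth_on_bilinear:
  "bounded_bilinear m \<Longrightarrow> open U \<Longrightarrow> smooth_on U f \<Longrightarrow> smooth_on U g \<Longrightarrow> smooth_on U (\<lambda>x. m (f x) (g x))"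
  unfolding smooth_on_iff_Ck_on using Ck_on_bilinear by blast

lemma smooth_on_sum:
  assumes "open U" "\<And>i. i \<in> A \<Longrightarrow> smooth_on U (f i)"
  shows "smooth_on U (\<lambda>x. \<Sum>i\<in>A. f i x)"
  using assms(2)
proof (induction A rule: infinite_finite_induct)
  case (insert i A)
  then show ?case using Ck_on_add[OF assms(1), of _ "f i"] by (auto simp: smooth_on_iff_Ck_on)
qed (auto simp: smooth_on_iff_Ck_on)

lemma smooth_on_inverse:
  fixes f :: "'a::euclidean_space \<Rightarrow> real"
  shows "open U \<Longrightarrow> (\<And>x. x \<in> U \<Longrightarrow> f x \<noteq> 0) \<Longrightarrow> smooth_on U f \<Longrightarrow> smooth_on U (\<lambda>x. inverse (f x))"
  unfolding smooth_on_iff_Ck_on using Ck_on_inverse by blast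

lemma smooth_on_differentiable: "smooth_on U f \<Longrightarrow> x \<in> U \<Longrightarrow> f differentiable at x"
  by (auto simp: smooth_on_def dest!: bspec[of _ _ "[]"])

lemma smooth_on_continuous: "smooth_on U f \<Longrightarrow> continuous_on U f"
  by (meson continuous_at_imp_continuous_on differentiable_imp_continuous_within smooth_on_differentiable)

section \<open>Integration by parts along the level sets of \<open>P\<close>\<close>

text \<open>\<open>G\<close> and the complement of \<open>K\<close> are open, cover the space, and
  the function is continuous on each of them.\<close>

lemma continuous_on_extend_zero:
  fixes f :: "'a::topological_space \<Rightarrow> 'b::{topological_space, zero}"
  assumes "open G" "closed K" "K \<subseteq> G" "continuous_on G f" "\<And>y. y \<notin> K \<Longrightarrow> f y = 0"
  shows "continuous_on UNIV f"
proof -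
  have "continuous_on (- K) f"
    by (rule continuous_on_eq[of _ "\<lambda>_. 0"]) (use assms in auto)
  then have "continuous_on (G \<union> - K) f"
    by (intro continuous_on_open_Un assms) (use assms in auto)
  moreover have "G \<union> - K = UNIV" using assms by auto
  ultimately show ?thesis by simp
qed

lemma integrable_compact_support:
  fixes f :: "'a::euclidean_space \<Rightarrow> 'b::{banach, second_countable_topology}"
  assumes "compact K" "continuous_on UNIV f" "\<And>y. y \<notin> K \<Longrightarrow> f y = 0"
  shows "integrable lborel f"
proof -
  have "integrable lborel (\<lambda>x. indicator K x *\<^sub>R f x)"
    by (intro borel_integrable_compact assms continuous_on_subset[OF assms(2)]) auto
  also have "(\<lambda>x. indicator K x *\<^sub>R f x) = f"
    using assms(3) by (auto simp: fun_eq_iff indicator_def)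
  finally show ?thesis .
qed

lemma bounded_compact_support:
  fixes f :: "'a::topological_space \<Rightarrow> 'b::real_normed_vector"
  assumes "compact K" "continuous_on UNIV f" "\<And>y. y \<notin> K \<Longrightarrow> f y = 0"
  obtains B where "B > 0" "\<And>x. norm (f x) \<le> B"
proof -
  have "bounded (f ` K)"
    by (intro compact_imp_bounded compact_continuous_image continuous_on_subset[OF assms(2)] assms) auto
  then obtain B where "B > 0" "\<And>x. x \<in> K \<Longrightarrow> norm (f x) \<le> B" by (auto simp: bounded_pos)
  then show ?thesis using assms(3) by (intro that[of B]) (metis less_imp_le norm_zero)+
qed

lemma lborel_integral_translate:
  fixes f :: "'a::euclidean_space \<Rightarrow> 'b::{banach, second_countable_topology}"
  assumes "f \<in> borel_measurable borel"
  shows "(LINT x|lborel. f (a + x)) = (LINT x|lborel. f x)"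
    and "integrable lborel (\<lambda>x. f (a + x)) \<longleftrightarrow> integrable lborel f"
proof -
  have "(LINT x|lborel. f x) = (LINT x|distr lborel borel ((+) a). f x)"
    by (simp add: lborel_distr_plus)
  also have "\<dots> = (LINT x|lborel. f (a + x))"
    using assms by (subst integral_distr) auto
  finally show "(LINT x|lborel. f (a + x)) = (LINT x|lborel. f x)" by simp
  have "integrable lborel f \<longleftrightarrow> integrable (distr lborel borel ((+) a)) f"
    by (simp add: lborel_distr_plus)
  also have "\<dots> \<longleftrightarrow> integrable lborel (\<lambda>x. f (a + x))"
    using assms by (subst integrable_distr_eq) auto
  finally show "integrable lborel (\<lambda>x. f (a + x)) \<longleftrightarrow> integrable lborel f" by simp
qed

lemma partial_outside_support:
  assumes "closed K" "\<And>y. y \<notin> K \<Longrightarrow> f y = 0" "x \<notin> K"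
  shows "(f has_derivative (\<lambda>_. 0)) (at x)" "partials [b] f x = 0"
proof -
  show D: "(f has_derivative (\<lambda>_. 0)) (at x)"
    by (rule has_derivative_transform_within_open[OF has_derivative_const[of 0], of "- K"])
      (use assms in auto)
  show "partials [b] f x = 0" using partial_eq[OF D] by simp
qed

lemma has_vector_derivative_partial:
  assumes "f differentiable at (x + t *\<^sub>R b)"
  shows "((\<lambda>t. f (x + t *\<^sub>R b)) has_vector_derivative partials [b] f (x + t *\<^sub>R b)) (at t within S)"
proof -
  have "((\<lambda>t. x + t *\<^sub>R b) has_derivative (\<lambda>h. h *\<^sub>R b)) (at t within S)"
    by (auto intro!: derivative_eq_intros)
  from has_derivative_compose[OF this differentiable_has_derivative[OF assms]]
  have D: "((\<lambda>t. f (x + t *\<^sub>R b)) has_derivative (\<lambda>h. partials [h *\<^sub>R b] f (x + t *\<^sub>R b))) (at t within S)" .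
  have "linear (\<lambda>b. partials [b] f (x + t *\<^sub>R b'))" if "f differentiable at (x + t *\<^sub>R b')" for b'
    using has_derivative_linear[OF differentiable_has_derivative[OF that]] .
  from linear_cmul[OF this[OF assms]] D show ?thesis
    unfolding has_vector_derivative_def by simp
qed

text \<open>Difference quotients in direction \<open>b\<close> have integral zero by translation
  invariance, and dominated convergence carries this over to the derivative.\<close>

lemma integral_partial_eq_0:
  fixes f :: "'a::euclidean_space \<Rightarrow> complex"
  assumes diff: "\<And>x. f differentiable at x" and cont: "continuous_on UNIV (partials [b] f)"
    and K: "compact K" "\<And>y. y \<notin> K \<Longrightarrow> f y = 0"
  shows "(LINT x|lborel. partials [b] f x) = 0"
proof -
  have contf: "continuous_on UNIV f"
    by (simp add: assms(1) continuous_at_imp_continuous_on differentiable_imp_continuous_within)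
  have fi: "integrable lborel f" by (rule integrable_compact_support[OF K(1) contf K(2)])
  have [measurable]: "f \<in> borel_measurable borel" "partials [b] f \<in> borel_measurable borel"
    using contf cont by (simp_all only: borel_measurable_continuous_onI)
  obtain B where B: "B > 0" "\<And>x. norm (partials [b] f x) \<le> B"
    by (rule bounded_compact_support[OF K(1) cont
          partial_outside_support(2)[OF compact_imp_closed[OF K(1)] K(2)]], assumption+, rule that)
  obtain r where r: "r > 0" "\<And>x. x \<in> K \<Longrightarrow> norm x \<le> r"
    using compact_imp_bounded[OF K(1)] by (auto simp: bounded_pos)
  define t where "t n = 1 / real (Suc n)" for n
  have t: "t n > 0" "t n \<le> 1" for n by (auto simp: t_def)
  define q where "q n x = (1 / t n) *\<^sub>R (f (t n *\<^sub>R b + x) - f x)" for n x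
  have "(\<lambda>n. LINT x|lborel. q n x) \<longlonglongrightarrow> (LINT x|lborel. partials [b] f x)"
  proof (rule integral_dominated_convergence)
    \<comment> \<open>Since \<open>t n \<le> 1\<close>, all translates of \<open>K\<close> by
      \<open>- t n *\<^sub>R b\<close> stay in the ball of radius \<open>r + norm b\<close>; inside
      it the mean value inequality bounds the quotient by \<open>B\<close>.\<close>
    show "integrable lborel (\<lambda>x. indicat_real (cball 0 (r + norm b)) x *\<^sub>R B)"
      by (intro integrable_scaleR_left integrable_real_indicator)
        (use emeasure_lborel_cball_finite in auto)
    show "AE x in lborel. (\<lambda>n. q n x) \<longlonglongrightarrow> partials [b] f x"
    proof (rule AE_I2)
      fix x
      have "((\<lambda>s. f (x + s *\<^sub>R b)) has_vector_derivative partials [b] f (x + 0 *\<^sub>R b)) (at 0)"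
        by (rule has_vector_derivative_partial[OF diff])
      then have t1: "((\<lambda>s. norm (f (x + s *\<^sub>R b) - f x - s *\<^sub>R partials [b] f x) / norm s) \<longlongrightarrow> 0) (at 0)"
        by (simp add: has_vector_derivative_def has_derivative_iff_norm)
      have t2: "norm (f (x + s *\<^sub>R b) - f x - s *\<^sub>R partials [b] f x) / norm s =
          norm ((1 / s) *\<^sub>R (f (x + s *\<^sub>R b) - f x) - partials [b] f x)" if "s \<noteq> 0" for s
      proof -
        have "(1 / s) *\<^sub>R (f (x + s *\<^sub>R b) - f x) - partials [b] f x =
            (1 / s) *\<^sub>R (f (x + s *\<^sub>R b) - f x - s *\<^sub>R partials [b] f x)"
          using that by (simp add: scaleR_diff_right)
        then show ?thesis by (simp only: norm_scaleR) simp
      qed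
      have "((\<lambda>s. norm ((1 / s) *\<^sub>R (f (x + s *\<^sub>R b) - f x) - partials [b] f x)) \<longlongrightarrow> 0) (at 0)"
        by (rule Lim_transform_eventually[OF t1]) (simp add: eventually_at_filter always_eventually t2[simplified])
      then have "((\<lambda>s. (1 / s) *\<^sub>R (f (x + s *\<^sub>R b) - f x)) \<longlongrightarrow> partials [b] f x) (at 0)"
        by (rule LIM_zero_cancel[OF tendsto_norm_zero_cancel])
      moreover have "filterlim t (at 0) sequentially"
        unfolding filterlim_at t_def using t LIMSEQ_Suc[OF lim_1_over_n] by (auto simp: t_def)
      ultimately show "(\<lambda>n. q n x) \<longlonglongrightarrow> partials [b] f x"
        unfolding q_def add.commute[of _ x] by (rule filterlim_compose)
    qed
    show "AE x in lborel. norm (q n x) \<le> indicat_real (cball 0 (r + norm b)) x *\<^sub>R B" for n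
    proof (rule AE_I2)
      fix x
      show "norm (q n x) \<le> indicat_real (cball 0 (r + norm b)) x *\<^sub>R B"
      proof (cases "x \<in> cball 0 (r + norm b)")
        case False
        then have x: "norm x > r + norm b" by simp
        have "norm (t n *\<^sub>R b + x) > r"
        proof -
          have "norm x \<le> norm (t n *\<^sub>R b + x) + norm (t n *\<^sub>R b)" using norm_triangle_ineq4[of "t n *\<^sub>R b + x" "t n *\<^sub>R b"] by simp
          moreover have "norm (t n *\<^sub>R b) \<le> norm b" using t[of n] by (simp add: mult_left_le_one_le)
          ultimately show ?thesis using x by linarith
        qed
        moreover have "norm x > r" using x by (smt (verit) norm_ge_zero)
        ultimately have "f (t n *\<^sub>R b + x) = 0" "f x = 0" using r(2) K(2) by (meson not_less)+
        then show ?thesis using B by (simp add: q_def)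
      next
        case True
        have "norm (f (x + t n *\<^sub>R b) - f (x + 0 *\<^sub>R b)) \<le> B * t n - B * 0"
        proof (rule differentiable_bound_general[where f' = "\<lambda>s. partials [b] f (x + s *\<^sub>R b)" and \<phi>' = "\<lambda>_. B"])
          show D: "((\<lambda>s. f (x + s *\<^sub>R b)) has_vector_derivative partials [b] f (x + s *\<^sub>R b)) (at s)" for s
            by (rule has_vector_derivative_partial[OF diff])
          show "continuous_on {0..t n} (\<lambda>s. f (x + s *\<^sub>R b))"
            using D by (meson continuous_at_imp_continuous_on has_vector_derivative_continuous)
          show "((\<lambda>s. B * s) has_vector_derivative B) (at s)" for s
            by (auto intro!: derivative_eq_intros simp: has_vector_derivative_def)
        qed (use t[of n] B in \<open>auto intro!: continuous_intros\<close>)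
        then have "norm (q n x) \<le> B"
          using t[of n] unfolding q_def norm_scaleR add.commute[of _ x] by (simp add: field_simps)
        then show ?thesis using True by simp
      qed
    qed
  qed (auto simp: q_def)
  moreover have "(LINT x|lborel. q n x) = 0" for n
    using fi lborel_integral_translate[of f "t n *\<^sub>R b"] by (simp add: q_def)
  ultimately show ?thesis by (simp add: LIMSEQ_const_iff)
qed

section \<open>Functions supported in \<open>K\<close> and the divergence along the level
  field\<close>

lemma smooth_on_extend_zero:
  fixes f :: "'a::euclidean_space \<Rightarrow> 'b::real_normed_vector"
  assumes "closed K" "K \<subseteq> G" "smooth_on G f" "\<And>y. y \<notin> K \<Longrightarrow> f y = 0"
  shows "smooth_on UNIV f"
proof -
  have "smooth_on (- K) (\<lambda>_. 0 :: 'b)" by (simp add: smooth_on_iff_Ck_on)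
  then have "smooth_on (- K) f" by (rule smooth_on_cong[rotated 2]) (use assms in auto)
  then have "smooth_on (G \<union> - K) f" using assms by (intro smooth_on_open_Un)
  moreover have "G \<union> - K = UNIV" using assms by auto
  ultimately show ?thesis by simp
qed

text \<open>A fixed \<open>K\<close> instead of the support, so that \<open>level_div\<close> maps
  the class to itself and can be iterated.\<close>

definition smooth_in :: "'a::euclidean_space set \<Rightarrow> ('a \<Rightarrow> complex) \<Rightarrow> bool" where
  "smooth_in K k \<longleftrightarrow> smooth_on UNIV k \<and> (\<forall>y. y \<notin> K \<longrightarrow> k y = 0)"

text \<open>Along this field \<open>P\<close> has derivative one, so the function
  \<open>F (P y)\<close> has derivative \<open>F' (P y)\<close>.\<close>

definition grad_field :: "('a::euclidean_space \<Rightarrow> real) \<Rightarrow> 'a \<Rightarrow> 'a \<Rightarrow> real" where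
  "grad_field P b y = partials [b] P y * inverse (\<Sum>c\<in>Basis. (partials [c] P y)\<^sup>2)"

text \<open>The formal adjoint, up to sign, of differentiation with respect to the value of \<open>P\<close>.\<close>
definition level_div :: "('a::euclidean_space \<Rightarrow> real) \<Rightarrow> ('a \<Rightarrow> complex) \<Rightarrow> 'a \<Rightarrow> complex" where
  "level_div P k y = (\<Sum>b\<in>Basis. partials [b] (\<lambda>y. grad_field P b y *\<^sub>R k y) y)"

context
  fixes G K :: "'a::euclidean_space set" and P :: "'a \<Rightarrow> real"
  assumes G: "open G" and K: "compact K" "K \<subseteq> G" and P: "smooth_on G P"
    and grad: "\<And>y. y \<in> G \<Longrightarrow> (\<Sum>c\<in>Basis. (partials [c] P y)\<^sup>2) \<noteq> 0"
begin

lemma smooth_in_grad_field: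
  assumes "smooth_in K k" "b \<in> Basis"
  shows "smooth_in K (\<lambda>y. grad_field P b y *\<^sub>R k y)"
proof -
  have "smooth_on G (\<lambda>y. (\<Sum>c\<in>Basis. partials [c] P y * partials [c] P y))"
    by (intro smooth_on_sum smooth_on_bilinear[OF bounded_bilinear_mult] smooth_on_partial G P)
  from smooth_on_inverse[OF G _ this] grad
  have "smooth_on G (grad_field P b)"
    unfolding grad_field_def[abs_def] power2_eq_square
    by (intro smooth_on_bilinear[OF bounded_bilinear_mult] smooth_on_partial G P assms)
      (auto simp: power2_eq_square)
  then have "smooth_on G (\<lambda>y. grad_field P b y *\<^sub>R k y)"
    using assms by (intro smooth_on_bilinear[OF bounded_bilinear_scaleR] G) (auto simp: smooth_in_def intro: smooth_on_subset)
  then have "smooth_on UNIV (\<lambda>y. grad_field P b y *\<^sub>R k y)"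
    by (rule smooth_on_extend_zero[OF compact_imp_closed[OF K(1)] K(2)])
      (use assms in \<open>auto simp: smooth_in_def\<close>)
  then show ?thesis using assms by (simp add: smooth_in_def)
qed

lemma smooth_in_level_div:
  assumes "smooth_in K k" shows "smooth_in K (level_div P k)"
proof -
  have s: "smooth_in K (\<lambda>y. grad_field P b y *\<^sub>R k y)" if "b \<in> Basis" for b
    by (rule smooth_in_grad_field[OF assms that])
  have "smooth_on UNIV (level_div P k)"
    unfolding level_div_def[abs_def]
    by (intro smooth_on_sum smooth_on_partial) (use s in \<open>auto simp: smooth_in_def\<close>)
  moreover have "level_div P k y = 0" if "y \<notin> K" for y
    unfolding level_div_def
  proof (rule sum.neutral, rule ballI)
    fix b :: 'a assume b: "b \<in> Basis"
    show "partials [b] (\<lambda>y. grad_field P b y *\<^sub>R k y) y = 0"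
      by (rule partial_outside_support(2)[OF compact_imp_closed[OF K(1)] _ that])
        (use s[OF b] in \<open>auto simp: smooth_in_def\<close>)
  qed
  ultimately show ?thesis by (simp add: smooth_in_def)
qed

lemma continuous_smooth_in_compose:
  assumes "smooth_in K k" "continuous_on UNIV F"
  shows "continuous_on UNIV (\<lambda>y. k y * F (P y))" "integrable lborel (\<lambda>y. k y * F (P y))"
proof -
  have "continuous_on G (\<lambda>y. k y * F (P y))"
    using assms by (intro continuous_intros continuous_on_compose2[OF assms(2)] smooth_on_continuous[OF P])
      (auto simp: smooth_in_def intro: smooth_on_continuous smooth_on_subset)
  then show c: "continuous_on UNIV (\<lambda>y. k y * F (P y))"
    by (rule continuous_on_extend_zero[OF G compact_imp_closed[OF K(1)] K(2)])
      (use assms in \<open>auto simp: smooth_in_def\<close>)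
  show "integrable lborel (\<lambda>y. k y * F (P y))"
    by (rule integrable_compact_support[OF K(1) c]) (use assms in \<open>auto simp: smooth_in_def\<close>)
qed

text \<open>The field with components \<open>grad_field P b y * k y * F (P y)\<close> vanishes off
  \<open>K\<close>, so its divergence integrates to zero. The part of the divergence in which
  \<open>F\<close> is differentiated collapses to \<open>k y * F' (P y)\<close>, because
  \<open>P\<close> changes at unit rate along \<open>grad_field\<close>.\<close>

lemma integral_by_parts_level:
  assumes k: "smooth_in K k" and F: "\<And>p. (F has_vector_derivative F' p) (at p)" and F': "continuous_on UNIV F'"
  shows "(LINT y|lborel. k y * F' (P y)) = - (LINT y|lborel. level_div P k y * F (P y))"
proof -
  have contF: "continuous_on UNIV F"
    using F by (meson continuous_at_imp_continuous_on has_vector_derivative_continuous)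
  define m where "m b y = grad_field P b y *\<^sub>R k y" for b y
  have m: "smooth_in K (m b)" if "b \<in> Basis" for b
    unfolding m_def[abs_def] by (rule smooth_in_grad_field[OF k that])
  have clK: "closed K" using K by (rule_tac compact_imp_closed)
  have D: "((\<lambda>y. m b y * F (P y)) has_derivative
      (\<lambda>c. m b y * (partials [c] P y *\<^sub>R F' (P y)) + partials [c] (m b) y * F (P y))) (at y)"
    if b: "b \<in> Basis" and y: "y \<in> G" for b y
  proof -
    have "((\<lambda>y. F (P y)) has_derivative (\<lambda>c. partials [c] P y *\<^sub>R F' (P y))) (at y)"
      using has_derivative_compose[OF differentiable_has_derivative[OF smooth_on_differentiable[OF P y]]
          F[of "P y", unfolded has_vector_derivative_def]] .
    moreover have "(m b has_derivative (\<lambda>c. partials [c] (m b) y)) (at y)"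
      using m[OF b] by (intro differentiable_has_derivative smooth_on_differentiable[of UNIV]) (auto simp: smooth_in_def)
    ultimately show ?thesis
      by (intro has_derivative_mult)
  qed
  have D0: "((\<lambda>y. m b y * F (P y)) has_derivative (\<lambda>_. 0)) (at y)" "partials [b] (m b) y = 0"
    if b: "b \<in> Basis" and y: "y \<notin> K" for b y
    by (rule partial_outside_support[OF clK _ y], use m[OF b] in \<open>simp add: smooth_in_def\<close>)+
  have eq: "partials [b] (\<lambda>y. m b y * F (P y)) y =
      m b y * (partials [b] P y *\<^sub>R F' (P y)) + partials [b] (m b) y * F (P y)" if b: "b \<in> Basis" for b y
  proof (cases "y \<in> G")
    case True then show ?thesis using partial_eq[OF D[OF b True]] by simp
  next
    case False
    then have y: "y \<notin> K" using K by auto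
    then show ?thesis using partial_eq[OF D0(1)[OF b y]] D0(2)[OF b y] m[OF b] by (simp add: smooth_in_def)
  qed
  have c1: "continuous_on UNIV (\<lambda>y. m b y * (partials [b] P y *\<^sub>R F' (P y)))" if b: "b \<in> Basis" for b
  proof (rule continuous_on_extend_zero[OF G clK K(2)])
    have "smooth_on G (m b)" using m[OF b] by (auto simp: smooth_in_def intro: smooth_on_subset)
    then show "continuous_on G (\<lambda>y. m b y * (partials [b] P y *\<^sub>R F' (P y)))"
      by (intro continuous_intros continuous_on_compose2[OF F'] smooth_on_continuous P smooth_on_partial b) auto
  qed (use m[OF b] in \<open>auto simp: smooth_in_def\<close>)
  have c2: "continuous_on UNIV (\<lambda>y. partials [b] (m b) y * F (P y))" if b: "b \<in> Basis" for b
  proof (rule continuous_on_extend_zero[OF G clK K(2)])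
    have "smooth_on UNIV (m b)" using m[OF b] by (auto simp: smooth_in_def)
    then have "smooth_on G (partials [b] (m b))" by (intro smooth_on_subset[OF smooth_on_partial[OF _ b]]) auto
    then show "continuous_on G (\<lambda>y. partials [b] (m b) y * F (P y))"
      by (intro continuous_intros continuous_on_compose2[OF contF] smooth_on_continuous P) auto
  qed (use D0(2)[OF b] in auto)
  have i1: "integrable lborel (\<lambda>y. m b y * (partials [b] P y *\<^sub>R F' (P y)))" if b: "b \<in> Basis" for b
    by (rule integrable_compact_support[OF K(1) c1[OF b]]) (use m[OF b] in \<open>auto simp: smooth_in_def\<close>)
  have i2: "integrable lborel (\<lambda>y. partials [b] (m b) y * F (P y))" if b: "b \<in> Basis" for b
    by (rule integrable_compact_support[OF K(1) c2[OF b]]) (use D0(2)[OF b] in auto)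
  have 0: "(LINT y|lborel. m b y * (partials [b] P y *\<^sub>R F' (P y))) + (LINT y|lborel. partials [b] (m b) y * F (P y)) = 0"
    if b: "b \<in> Basis" for b
  proof -
    have "(LINT y|lborel. partials [b] (\<lambda>y. m b y * F (P y)) y) = 0"
    proof (rule integral_partial_eq_0[OF _ _ K(1)])
      show "(\<lambda>y. m b y * F (P y)) differentiable at y" for y
        using D[OF b, of y] D0(1)[OF b, of y] K(2) unfolding differentiable_def by blast
      show "continuous_on UNIV (partials [b] (\<lambda>y. m b y * F (P y)))"
        unfolding ext[of "partials [b] (\<lambda>y. m b y * F (P y))", OF eq[OF b]] by (intro continuous_intros c1 c2 b)
      show "m b y * F (P y) = 0" if "y \<notin> K" for y using m[OF b] that by (auto simp: smooth_in_def)
    qed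
    then show ?thesis unfolding eq[OF b] by (simp only: Bochner_Integration.integral_add[OF i1[OF b] i2[OF b]])
  qed
  \<comment> \<open>On \<open>G\<close> this is the unit derivative of \<open>P\<close> along the
    field; off \<open>G\<close> both sides vanish with \<open>k\<close>.\<close>
  have "(\<Sum>b\<in>Basis. m b y * (partials [b] P y *\<^sub>R F' (P y))) = k y * F' (P y)" for y
  proof (cases "y \<in> G")
    case True
    have "(\<Sum>b\<in>Basis. m b y * (partials [b] P y *\<^sub>R F' (P y))) =
        (\<Sum>b\<in>Basis. partials [b] P y * grad_field P b y) *\<^sub>R (k y * F' (P y))"
      unfolding scaleR_sum_left by (intro sum.cong) (auto simp: m_def algebra_simps)
    also have "(\<Sum>b\<in>Basis. partials [b] P y * grad_field P b y) = 1"
      using grad[OF True] unfolding grad_field_def mult.assoc[symmetric] power2_eq_square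
      by (simp flip: sum_distrib_right)
    finally show ?thesis by simp
  next
    case False
    then have y: "y \<notin> K" using K by auto
    then have "m b y = 0" if "b \<in> Basis" for b using m[OF that] by (simp add: smooth_in_def)
    then show ?thesis using k y by (simp add: smooth_in_def)
  qed
  then have "(LINT y|lborel. k y * F' (P y)) = (\<Sum>b\<in>Basis. LINT y|lborel. m b y * (partials [b] P y *\<^sub>R F' (P y)))"
    using i1 by (subst Bochner_Integration.integral_sum[symmetric]) auto
  also have "\<dots> = (\<Sum>b\<in>Basis. - (LINT y|lborel. partials [b] (m b) y * F (P y)))"
    using 0 by (intro sum.cong) (auto simp: eq_neg_iff_add_eq_0)
  also have "\<dots> = - (LINT y|lborel. level_div P k y * F (P y))"
    unfolding level_div_def sum_distrib_right m_def[symmetric]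
    using i2 by (subst Bochner_Integration.integral_sum) (auto simp: sum_negf)
  finally show ?thesis .
qed

end

section \<open>Iterated primitives of \<open>1/w\<close> and level integrals up to the axis\<close>

definition log_prim2 :: "complex \<Rightarrow> complex" where "log_prim2 w = w * Ln w - w"

text \<open>The third iterated primitive of \<open>1/w\<close>; its derivative \<open>log_prim2\<close> stays bounded at \<open>0\<close>.\<close>
definition log_prim3 :: "complex \<Rightarrow> complex" where "log_prim3 w = w\<^sup>2 / 2 * Ln w - 3 / 4 * w\<^sup>2"

lemma Ln_prims_deriv:
  assumes "Im w \<noteq> 0"
  shows "(Ln has_field_derivative 1 / w) (at w)"
    "(log_prim2 has_field_derivative Ln w) (at w)"
    "(log_prim3 has_field_derivative log_prim2 w) (at w)"
proof -
  have w: "w \<notin> \<real>\<^sub>\<le>\<^sub>0" "w \<noteq> 0" using assms by (auto simp: complex_nonpos_Reals_iff)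
  show "(Ln has_field_derivative 1 / w) (at w)"
    using has_field_derivative_Ln[OF w(1)] by (simp add: divide_inverse)
  show "(log_prim2 has_field_derivative Ln w) (at w)"
    unfolding log_prim2_def using w by (auto intro!: derivative_eq_intros)
  show "(log_prim3 has_field_derivative log_prim2 w) (at w)"
    unfolding log_prim3_def log_prim2_def using w
    by (auto intro!: derivative_eq_intros simp: field_simps power2_eq_square)
qed

text \<open>Split \<open>Ln w\<close> into modulus and argument. The terms \<open>1\<close> and
  \<open>r\<^sup>2\<close> bound \<open>|w| |ln |w||\<close> inside and outside the unit disc, by
  \<open>ln x \<le> x - 1\<close>; \<open>r * pi\<close> comes from the argument and the last
  \<open>r\<close> from the summand \<open>- w\<close>.\<close>

lemma norm_log_prim2_le:
  assumes "norm w \<le> r" "w \<noteq> 0"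
  shows "norm (log_prim2 w) \<le> 1 + r\<^sup>2 + r * pi + r"
proof -
  have r: "r \<ge> 0" using assms(1) by (rule order_trans[OF norm_ge_zero])
  have "norm (Ln w) \<le> \<bar>ln (norm w)\<bar> + pi"
    using cmod_le[of "Ln w"] Im_Ln_le_pi[OF assms(2)] mpi_less_Im_Ln[OF assms(2)] assms(2) by simp
  then have "norm w * norm (Ln w) \<le> norm w * \<bar>ln (norm w)\<bar> + norm w * pi"
    by (simp add: mult_left_mono flip: distrib_left)
  moreover have "norm w * \<bar>ln (norm w)\<bar> \<le> 1 + r\<^sup>2"
  proof (cases "norm w \<le> 1")
    case True
    have "\<bar>ln (norm w)\<bar> = ln (1 / norm w)" using True assms by (simp add: ln_div)
    also have "\<dots> \<le> 1 / norm w" using assms ln_le_minus_one[of "1 / norm w"] by simp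
    finally have "norm w * \<bar>ln (norm w)\<bar> \<le> 1" using assms by (simp add: field_simps)
    then show ?thesis by (smt (verit) zero_le_power2)
  next
    case False
    then have "\<bar>ln (norm w)\<bar> = ln (norm w)" by simp
    also have "\<dots> \<le> norm w" using assms ln_le_minus_one[of "norm w"] by simp
    finally have "norm w * \<bar>ln (norm w)\<bar> \<le> norm w * norm w" by (simp add: mult_left_mono)
    also have "\<dots> \<le> r\<^sup>2" unfolding power2_eq_square using assms r by (intro mult_mono) auto
    finally show ?thesis by simp
  qed
  moreover have "norm w * pi \<le> r * pi" using assms by (intro mult_right_mono) auto
  moreover have "norm (log_prim2 w) \<le> norm w * norm (Ln w) + norm w"
    unfolding log_prim2_def by (rule order_trans[OF norm_triangle_ineq4]) (simp add: norm_mult)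
  ultimately show ?thesis using assms by linarith
qed

text \<open>Each open half disc is convex and misses the branch cut of \<open>Ln\<close>, so the
  mean value inequality applies with the bound on \<open>log_prim2\<close>. Across the cut
  \<open>log_prim3\<close> jumps, hence both points must lie on the same side.\<close>

lemma log_prim3_Lipschitz:
  assumes "norm w \<le> r" "norm w' \<le> r" "Im w * Im w' > 0"
  shows "norm (log_prim3 w - log_prim3 w') \<le> (1 + r\<^sup>2 + r * pi + r) * norm (w - w')"
proof -
  define S where "S = {v. Im v * Im w > 0} \<inter> cball 0 r"
  have "S = (if Im w > 0 then {v. Im v > 0} else {v. Im v < 0}) \<inter> cball 0 r"
    using assms(3) by (auto simp: S_def zero_less_mult_iff)
  then have "convex S"
    by (auto intro!: convex_Int convex_halfspace_Im_gt convex_halfspace_Im_lt)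
  then show ?thesis
  proof (rule field_differentiable_bound)
    show "(log_prim3 has_field_derivative log_prim2 v) (at v within S)" if "v \<in> S" for v
      by (rule has_field_derivative_at_within[OF Ln_prims_deriv(3)]) (use that in \<open>auto simp: S_def\<close>)
    show "norm (log_prim2 v) \<le> 1 + r\<^sup>2 + r * pi + r" if "v \<in> S" for v
      by (rule norm_log_prim2_le) (use that in \<open>auto simp: S_def\<close>)
    show "w \<in> S" "w' \<in> S" using assms by (auto simp: S_def mult.commute zero_less_mult_iff)
  qed
qed

text \<open>The sign is put on the primitive: with \<open>- F (z - p)\<close> as antiderivative in
  \<open>p\<close> it cancels the minus sign of \<open>integral_by_parts_level\<close>, so the
  repeated integrations carry no signs.\<close>

lemma has_vector_derivative_compose_minus:
  assumes "\<And>w. Im w \<noteq> 0 \<Longrightarrow> (F has_field_derivative F' w) (at w)" "Im z \<noteq> 0"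
  shows "((\<lambda>p. - F (z - of_real p)) has_vector_derivative F' (z - of_real p)) (at p)"
    and "continuous_on UNIV (\<lambda>p. F (z - of_real p))"
proof -
  have "((\<lambda>p. z - of_real p) has_vector_derivative -1) (at p)" for p
    by (auto intro!: derivative_eq_intros simp: has_vector_derivative_def fun_eq_iff scaleR_conv_of_real)
  from field_vector_diff_chain_at[OF this assms(1)] 
  have *: "((\<lambda>p. F (z - of_real p)) has_vector_derivative - F' (z - of_real p)) (at p)" for p
    using assms(2) by (simp add: o_def)
  from has_vector_derivative_minus[OF this]
  show "((\<lambda>p. - F (z - of_real p)) has_vector_derivative F' (z - of_real p)) (at p)" by simp
  show "continuous_on UNIV (\<lambda>p. F (z - of_real p))"
    using * by (meson continuous_at_imp_continuous_on has_vector_derivative_continuous)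
qed

context
  fixes G K :: "'a::euclidean_space set" and P :: "'a \<Rightarrow> real"
  assumes G: "open G" and K: "compact K" "K \<subseteq> G" and P: "smooth_on G P"
    and grad: "\<And>y. y \<in> G \<Longrightarrow> (\<Sum>c\<in>Basis. (partials [c] P y)\<^sup>2) \<noteq> 0"
begin

lemma level_integral_eq_log_prim3:
  assumes "smooth_in K k" "Im z \<noteq> 0"
  shows "(LINT y|lborel. k y / (z - of_real (P y))) =
    (LINT y|lborel. (level_div P ^^ 3) k y * log_prim3 (z - of_real (P y)))"
proof -
  note parts = integral_by_parts_level[OF G K P grad]
  note D = smooth_in_level_div[OF G K P grad]
  note F = has_vector_derivative_compose_minus[OF _ assms(2)]
  have "(LINT y|lborel. k y / (z - of_real (P y))) = (LINT y|lborel. level_div P k y * Ln (z - of_real (P y)))"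
  proof -
    \<comment> \<open>Serves to obtain the continuity of \<open>1 / (z - p)\<close> in
      \<open>p\<close> from \<open>F(2)\<close>.\<close>
    have "((\<lambda>w. 1 / w) has_field_derivative - 1 / w\<^sup>2) (at w)" if "Im w \<noteq> 0" for w :: complex
      using that by (auto intro!: derivative_eq_intros simp: power2_eq_square)
    from parts[OF _ assms(1) F(1)[OF Ln_prims_deriv(1)] F(2)[OF this]] show ?thesis by simp
  qed
  also have "\<dots> = (LINT y|lborel. level_div P (level_div P k) y * log_prim2 (z - of_real (P y)))"
    using parts[OF _ D[OF _ assms(1)] F(1)[OF Ln_prims_deriv(2)]] F(2)[OF Ln_prims_deriv(1)] by auto
  also have "\<dots> = (LINT y|lborel. level_div P (level_div P (level_div P k)) y * log_prim3 (z - of_real (P y)))"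
    using parts[OF _ D[OF _ D[OF _ assms(1)]] F(1)[OF Ln_prims_deriv(3)]] F(2)[OF Ln_prims_deriv(2)] by auto
  finally show ?thesis by (simp add: eval_nat_numeral)
qed

text \<open>The constant does not involve \<open>Im z\<close>, so the estimate holds up to the axis:
  it is the Lipschitz constant of \<open>log_prim3\<close> on a disc containing all
  \<open>z - P y\<close>, times the integral of \<open>norm (l y)\<close>, where \<open>l\<close> is
  the threefold \<open>level_div\<close> of \<open>k\<close>. Across the axis the integral may
  jump.\<close>

lemma level_integral_Lipschitz:
  assumes "smooth_in K k"
  obtains c where "c \<ge> 0" "\<And>z z'. norm z \<le> r \<Longrightarrow> norm z' \<le> r \<Longrightarrow> Im z * Im z' > 0 \<Longrightarrow>
    norm ((LINT y|lborel. k y / (z - of_real (P y))) - (LINT y|lborel. k y / (z' - of_real (P y)))) \<le> c * norm (z - z')"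
proof -
  note D = smooth_in_level_div[OF G K P grad]
  define l where "l = (level_div P ^^ 3) k"
  have l: "smooth_in K l" using D[OF _ D[OF _ D[OF _ assms]]] by (simp add: l_def eval_nat_numeral)
  then have li: "integrable lborel l"
    by (intro integrable_compact_support[OF K(1)]) (auto simp: smooth_in_def smooth_on_continuous)
  have "bounded (P ` K)"
    by (intro compact_imp_bounded compact_continuous_image K smooth_on_continuous[OF smooth_on_subset[OF P K(2)]])
  then obtain p where p: "p > 0" "\<And>y. y \<in> K \<Longrightarrow> \<bar>P y\<bar> \<le> p" by (auto simp: bounded_pos)
  define s where "s = \<bar>r\<bar> + p"
  define m where "m = 1 + s\<^sup>2 + s * pi + s"
  have m: "m \<ge> 0" using p by (simp add: m_def s_def)
  show thesis
  proof (rule that)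
    show "0 \<le> m * (LINT y|lborel. norm (l y))" using m by simp
    fix z z' :: complex assume z: "norm z \<le> r" "norm z' \<le> r" "Im z * Im z' > 0"
    then have nz: "Im z \<noteq> 0" "Im z' \<noteq> 0" by auto
    have int: "integrable lborel (\<lambda>y. l y * log_prim3 (v - of_real (P y)))" if "Im v \<noteq> 0" for v
      by (rule continuous_smooth_in_compose[OF G K P grad l])
        (use has_vector_derivative_compose_minus(2)[OF Ln_prims_deriv(3) that] in auto)
    have "norm ((LINT y|lborel. k y / (z - of_real (P y))) - (LINT y|lborel. k y / (z' - of_real (P y)))) =
        norm (LINT y|lborel. l y * (log_prim3 (z - of_real (P y)) - log_prim3 (z' - of_real (P y))))"
      using int[OF nz(1)] int[OF nz(2)] nz assms
      by (simp add: level_integral_eq_log_prim3 right_diff_distrib flip: l_def)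
    also have "\<dots> \<le> (LINT y|lborel. norm (l y) * (m * norm (z - z')))"
    proof (rule Bochner_Integration.integral_norm_bound_integral)
      show "integrable lborel (\<lambda>y. l y * (log_prim3 (z - of_real (P y)) - log_prim3 (z' - of_real (P y))))"
        using int[OF nz(1)] int[OF nz(2)] by (simp add: right_diff_distrib)
      show "integrable lborel (\<lambda>y. norm (l y) * (m * norm (z - z')))" using li by simp
      fix y
      show "norm (l y * (log_prim3 (z - of_real (P y)) - log_prim3 (z' - of_real (P y)))) \<le> norm (l y) * (m * norm (z - z'))"
      proof (cases "y \<in> K")
        case True
        have "norm (v - of_real (P y)) \<le> s" if "norm v \<le> r" for v :: complex
          using norm_triangle_ineq4[of v "of_real (P y)"] p(2)[OF True] that by (simp add: s_def)
        then have "norm (log_prim3 (z - of_real (P y)) - log_prim3 (z' - of_real (P y))) \<le> m * norm (z - z')"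
          using log_prim3_Lipschitz[of "z - of_real (P y)" s "z' - of_real (P y)"] z by (simp add: m_def)
        then show ?thesis by (simp add: norm_mult mult_left_mono)
      qed (use l in \<open>simp add: smooth_in_def\<close>)
    qed
    also have "\<dots> = m * (LINT y|lborel. norm (l y)) * norm (z - z')" by simp
    finally show "norm ((LINT y|lborel. k y / (z - of_real (P y))) - (LINT y|lborel. k y / (z' - of_real (P y)))) \<le>
      m * (LINT y|lborel. norm (l y)) * norm (z - z')" .
  qed
qed

lemma level_integral_bounded:
  assumes "smooth_in K k"
  obtains c where "c \<ge> 0" "\<And>z. norm z \<le> r \<Longrightarrow> Im z \<noteq> 0 \<Longrightarrow> norm (LINT y|lborel. k y / (z - of_real (P y))) \<le> c"
proof -
  define J where "J z = (LINT y|lborel. k y / (z - of_real (P y)))" for z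
  define s where "s = max r 1"
  obtain c where c: "c \<ge> 0" "\<And>z z'. norm z \<le> s \<Longrightarrow> norm z' \<le> s \<Longrightarrow> Im z * Im z' > 0 \<Longrightarrow>
    norm (J z - J z') \<le> c * norm (z - z')"
    unfolding J_def by (rule level_integral_Lipschitz[OF assms, of s]) blast
  show thesis
  proof (rule that[folded J_def])
    show "0 \<le> norm (J \<i>) + norm (J (- \<i>)) + c * (s + 1)" using c by (simp add: s_def)
    fix z :: complex assume z: "norm z \<le> r" "Im z \<noteq> 0"
    define v where "v = (if Im z > 0 then \<i> else - \<i>)"
    have "norm (J z - J v) \<le> c * norm (z - v)"
      by (rule c) (use z in \<open>auto simp: v_def s_def\<close>)
    also have "\<dots> \<le> c * (s + 1)"
      using z norm_triangle_ineq4[of z v] by (intro mult_left_mono c) (auto simp: v_def s_def)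
    finally have "norm (J z - J v) \<le> c * (s + 1)" .
    moreover have "norm (J z) \<le> norm (J v) + norm (J z - J v)" by (metis add.commute norm_triangle_sub)
    moreover have "norm (J v) \<le> norm (J \<i>) + norm (J (- \<i>))" by (auto simp: v_def)
    ultimately show "norm (J z) \<le> norm (J \<i>) + norm (J (- \<i>)) + c * (s + 1)" by linarith
  qed
qed

end

section \<open>Operators on \<open>L\<^sup>2(G)\<close>\<close>

lemma mult_op_abs_l2:
  assumes "multiplier G m" "sq_integrable g"
  shows "mult_op G m (abs_l2 g) = abs_l2 (\<lambda>y. if y \<in> G then m y * g y else 0)"
  unfolding mult_op_apply[OF assms(1)]
  by (subst abs_l2_eq_iff[OF multiplier_sq(1)[OF assms(1) sq_integrable_rep] multiplier_sq(1)[OF assms]])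
    (use rep_abs_l2[OF assms(2)] in \<open>eventually_elim, auto\<close>)

lemma norm_mult_op_le:
  assumes m: "multiplier G m" and c: "c \<ge> 0" "\<And>y. y \<in> G \<Longrightarrow> norm (m y) \<le> c"
  shows "norm (mult_op G m) \<le> c"
proof (rule norm_blinfun_bound[OF c(1)])
  fix F
  note sq = multiplier_sq(1)[OF m sq_integrable_rep[of F]]
  have "(norm (mult_op G m F))\<^sup>2 = (LINT y|lborel. (cmod (if y \<in> G then m y * rep_l2 F y else 0))\<^sup>2)"
    unfolding mult_op_apply[OF m] by (rule norm_abs_l2[OF sq])
  also have "\<dots> \<le> (LINT y|lborel. c\<^sup>2 * (cmod (rep_l2 F y))\<^sup>2)"
  proof (rule integral_mono)
    show "integrable lborel (\<lambda>y. (cmod (if y \<in> G then m y * rep_l2 F y else 0))\<^sup>2)"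
      using sq by (simp add: sq_integrable_def)
    show "integrable lborel (\<lambda>y. c\<^sup>2 * (cmod (rep_l2 F y))\<^sup>2)"
      using sq_integrable_rep[of F] by (simp add: sq_integrable_def)
    show "(cmod (if y \<in> G then m y * rep_l2 F y else 0))\<^sup>2 \<le> c\<^sup>2 * (cmod (rep_l2 F y))\<^sup>2" for y
      using c by (auto simp: norm_mult power_mult_distrib intro!: mult_right_mono power_mono)
  qed
  also have "\<dots> = (c * norm F)\<^sup>2"
    using norm_abs_l2[OF sq_integrable_rep, of F] by (simp add: power_mult_distrib)
  finally show "norm (mult_op G m F) \<le> c * norm F"
    by (rule power2_le_imp_le) (use c in simp)
qed

lemma multiplier_add: "multiplier G m \<Longrightarrow> multiplier G n \<Longrightarrow> multiplier G (\<lambda>y. m y + n y)"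
proof -
  assume a: "multiplier G m" "multiplier G n"
  have "(\<lambda>y. if y \<in> G then m y + n y else 0) = (\<lambda>y. (if y \<in> G then m y else 0) + (if y \<in> G then n y else 0))"
    by auto
  then show ?thesis using a by (auto simp: multiplier_def intro!: bounded_plus_comp)
qed

lemma multiplier_cmult: "multiplier G m \<Longrightarrow> multiplier G (\<lambda>y. c * m y)"
proof -
  assume a: "multiplier G m"
  have "(\<lambda>y. if y \<in> G then c * m y else 0) = (\<lambda>y. c * (if y \<in> G then m y else 0))" by auto
  then show ?thesis using a bounded_linear_image[OF _ bounded_linear_mult_right[of c], of "m ` G"]
    by (auto simp: multiplier_def image_image)
qed

lemma mult_op_add:
  assumes "multiplier G m" "multiplier G n"
  shows "mult_op G (\<lambda>y. m y + n y) = mult_op G m + mult_op G n"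
proof (rule blinfun_eqI)
  fix F
  show "mult_op G (\<lambda>y. m y + n y) F = (mult_op G m + mult_op G n) F"
    by (rule l2_eqI, use rep_mult_op[OF multiplier_add[OF assms], of F] rep_mult_op[OF assms(1), of F]
      rep_mult_op[OF assms(2), of F] rep_add[of "mult_op G m F" "mult_op G n F"] in eventually_elim)
      (auto simp: blinfun.add_left algebra_simps)
qed

lemma mult_op_cmult:
  assumes "multiplier G m"
  shows "mult_op G (\<lambda>y. c * m y) = c *\<^sub>O mult_op G m"
proof (rule blinfun_eqI)
  fix F
  show "mult_op G (\<lambda>y. c * m y) F = (c *\<^sub>O mult_op G m) F"
    by (rule l2_eqI, use rep_mult_op[OF multiplier_cmult[OF assms], of c F] rep_mult_op[OF assms(1), of F]
      rep_scaleC[of c "mult_op G m F"] in eventually_elim) auto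
qed

text \<open>The operators form a real normed space here; as a bounded bilinear map the complex
  scaling gets its continuity, its limits and its commutation with integrals.\<close>

lemma bounded_bilinear_scale_op: "bounded_bilinear (*\<^sub>O)"
proof
  fix c d :: complex and A B :: "'a l2 \<Rightarrow>\<^sub>L 'a l2" and r :: real
  show "(c + d) *\<^sub>O A = c *\<^sub>O A + d *\<^sub>O A"
    by (rule blinfun_eqI) (simp add: blinfun.add_left scaleC_add_left)
  show "c *\<^sub>O (A + B) = c *\<^sub>O A + c *\<^sub>O B"
    by (rule blinfun_eqI) (simp add: blinfun.add_left scaleC_add_right)
  show "(r *\<^sub>R c) *\<^sub>O A = r *\<^sub>R (c *\<^sub>O A)"
    by (rule blinfun_eqI) (simp add: blinfun.scaleR_left scaleR_scaleC scaleR_conv_of_real)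
  show "c *\<^sub>O (r *\<^sub>R A) = r *\<^sub>R (c *\<^sub>O A)"
    by (rule blinfun_eqI) (simp add: blinfun.scaleR_left scaleR_scaleC mult.commute)
  have "norm (c *\<^sub>O A) \<le> norm c * norm A" for c and A :: "'a l2 \<Rightarrow>\<^sub>L 'a l2"
  proof (rule norm_blinfun_bound)
    fix F show "norm ((c *\<^sub>O A) F) \<le> norm c * norm A * norm F"
      using mult_left_mono[OF norm_blinfun[of A F], of "norm c"] by (simp add: norm_scaleC mult.assoc)
  qed simp
  then show "\<exists>K. \<forall>c (A :: 'a l2 \<Rightarrow>\<^sub>L 'a l2). norm (c *\<^sub>O A) \<le> norm c * norm A * K"
    by (intro exI[of _ 1]) simp
qed

interpretation scale_op: bounded_bilinear "(*\<^sub>O)" by (rule bounded_bilinear_scale_op)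

lemmas [continuous_intros] = scale_op.continuous_on
lemmas [tendsto_intros] = scale_op.tendsto

lemma norm_scale_op: "norm (c *\<^sub>O A) = norm c * norm A"
proof (rule antisym)
  have le: "norm (c *\<^sub>O A) \<le> norm c * norm A" for c and A :: "'a l2 \<Rightarrow>\<^sub>L 'a l2"
  proof (rule norm_blinfun_bound)
    fix F show "norm ((c *\<^sub>O A) F) \<le> norm c * norm A * norm F"
      using mult_left_mono[OF norm_blinfun[of A F], of "norm c"] by (simp add: norm_scaleC mult.assoc)
  qed simp
  then show "norm (c *\<^sub>O A) \<le> norm c * norm A" .
  show "norm c * norm A \<le> norm (c *\<^sub>O A)"
  proof (cases "c = 0")
    case False
    have "(1 / c) *\<^sub>O (c *\<^sub>O A) = A" by (rule blinfun_eqI) (use False in simp)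
    then have "norm A \<le> norm (1 / c) * norm (c *\<^sub>O A)" using le[of "1 / c" "c *\<^sub>O A"] by simp
    then show ?thesis using False by (simp add: norm_divide field_simps)
  qed simp
qed

lemma scale_op_scale_op [simp]: "c *\<^sub>O (d *\<^sub>O A) = (c * d) *\<^sub>O A"
  by (rule blinfun_eqI) simp

lemma scale_op_one [simp]: "1 *\<^sub>O A = A"
  by (rule blinfun_eqI) simp

section \<open>Matrix elements, and stability of \<open>ops G\<close> under limits and
  integrals\<close>

lemma bounded_linear_matrix_element:
  fixes F :: "'a::euclidean_space l2" and F' :: "'b::euclidean_space l2"
  shows "bounded_linear (\<lambda>A. cinner F (blinfun_apply A F'))"
proof (rule bounded_linear_intro)
  show "cinner F ((A + B) F') = cinner F (A F') + cinner F (B F')" for A B :: "'b l2 \<Rightarrow>\<^sub>L 'a l2"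
    by (simp add: blinfun.add_left cinner_add_right)
  show "cinner F ((r *\<^sub>R A) F') = r *\<^sub>R cinner F (A F')" for r and A :: "'b l2 \<Rightarrow>\<^sub>L 'a l2"
    by (simp add: blinfun.scaleR_left scaleR_scaleC cinner_scaleC_right scaleR_conv_of_real)
  show "norm (cinner F (blinfun_apply A F')) \<le> norm A * (norm F * norm F')" for A :: "'b l2 \<Rightarrow>\<^sub>L 'a l2"
  proof -
    have "norm (cinner F (A F')) \<le> norm F * norm (A F')" by (rule cinner_bound)
    also have "\<dots> \<le> norm F * (norm A * norm F')" by (intro mult_left_mono norm_blinfun) auto
    finally show ?thesis by (simp add: mult_ac)
  qed
qed

lemma norm_matrix_element_le: "norm (cinner F (blinfun_apply A F')) \<le> norm A * (norm F * norm F')"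
proof -
  have "norm (cinner F (A F')) \<le> norm F * norm (A F')" by (rule cinner_bound)
  also have "\<dots> \<le> norm F * (norm A * norm F')" by (intro mult_left_mono norm_blinfun) auto
  finally show ?thesis by (simp add: mult_ac)
qed

text \<open>Testing with the vector \<open>A F\<close> itself bounds its squared norm by
  \<open>c * norm (A F) * norm F\<close>. This turns scalar estimates with constants uniform in
  \<open>F\<close> and \<open>F'\<close> into operator norm estimates.\<close>

lemma norm_op_le_matrix_element:
  assumes "c \<ge> 0" "\<And>F F'. norm (cinner F (blinfun_apply A F')) \<le> c * (norm F * norm F')"
  shows "norm A \<le> c"
proof (rule norm_blinfun_bound[OF assms(1)])
  fix F
  have "(norm (A F))\<^sup>2 \<le> norm (cinner (A F) (A F))"
    unfolding norm_l2_sq by (rule order_trans[OF abs_ge_self abs_Re_le_cmod])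
  also have "\<dots> \<le> c * (norm (A F) * norm F)" by (rule assms(2))
  finally have "norm (A F) * norm (A F) \<le> norm (A F) * (c * norm F)" by (simp add: power2_eq_square mult_ac)
  then show "norm (A F) \<le> c * norm F"
    using assms(1) by (cases "A F = 0") auto
qed

lemma op_eq_matrix_element:
  assumes "\<And>F F'. cinner F (blinfun_apply A F') = cinner F (blinfun_apply B F')"
  shows "A = B"
proof -
  have "norm (A - B) \<le> 0"
    by (rule norm_op_le_matrix_element) (simp_all add: blinfun.diff_left cinner_diff_right assms)
  then show ?thesis by simp
qed

lemma ops_iff:
  assumes "G \<in> sets borel"
  shows "A \<in> ops G \<longleftrightarrow> (\<forall>c F. blinfun_apply A (c *\<^sub>C F) - c *\<^sub>C A F = 0) \<and> (\<forall>F. id_op G (A F) - A F = 0) \<and>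
    (\<forall>F. (AE y in lborel. y \<in> G \<longrightarrow> rep_l2 F y = 0) \<longrightarrow> A F = 0)"
proof -
  have "(AE y in lborel. y \<notin> G \<longrightarrow> rep_l2 F y = 0) \<longleftrightarrow> id_op G F = F" for F :: "'a l2"
  proof
    show "id_op G F = F" if "AE y in lborel. y \<notin> G \<longrightarrow> rep_l2 F y = 0"
      by (rule id_op_eqI[OF assms that])
    show "AE y in lborel. y \<notin> G \<longrightarrow> rep_l2 F y = 0" if "id_op G F = F"
      using rep_mult_op[OF multiplier_const[OF assms], of 1 F] unfolding that by eventually_elim (rule impI, erule trans, simp)
  qed
  then show ?thesis by (simp add: ops_def)
qed

text \<open>As a common kernel of bounded linear maps, \<open>ops G\<close> is closed under norm
  limits and integrals. The condition on the support of the image, stated almost everywhere, enters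
  as the equation \<open>id_op G (A F) = A F\<close>.\<close>

lemma ops_bounded_linear_functionals:
  assumes "G \<in> sets borel"
  shows "\<exists>\<Lambda> :: (('a::euclidean_space l2 \<Rightarrow>\<^sub>L 'a l2) \<Rightarrow> 'a l2) set.
    (\<forall>l\<in>\<Lambda>. bounded_linear l) \<and> (\<forall>A. A \<in> ops G \<longleftrightarrow> (\<forall>l\<in>\<Lambda>. l A = 0))"
proof -
  define \<Lambda> :: "(('a l2 \<Rightarrow>\<^sub>L 'a l2) \<Rightarrow> 'a l2) set" where
    "\<Lambda> = {(\<lambda>A. blinfun_apply A (c *\<^sub>C F) - c *\<^sub>C A F) | c F. True} \<union>
      {(\<lambda>A. id_op G (blinfun_apply A F) - A F) | F. True} \<union>
      {(\<lambda>A. blinfun_apply A F) | F. AE y in lborel. y \<in> G \<longrightarrow> rep_l2 F y = 0}"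
  have ap: "bounded_linear (\<lambda>A. blinfun_apply A F)" for F :: "'a l2"
    by (rule blinfun.bounded_linear_left)
  have sc: "bounded_linear (\<lambda>F. c *\<^sub>C F :: 'a l2)" for c
    using blinfun.bounded_linear_right[of "c *\<^sub>O id_blinfun :: 'a l2 \<Rightarrow>\<^sub>L 'a l2"] by simp
  show ?thesis
  proof (intro exI[of _ \<Lambda>] conjI ballI allI)
    show "bounded_linear l" if "l \<in> \<Lambda>" for l
    proof -
      have "bounded_linear (\<lambda>A :: 'a l2 \<Rightarrow>\<^sub>L 'a l2. blinfun_apply A (c *\<^sub>C F) - c *\<^sub>C blinfun_apply A F)" for c and F :: "'a l2"
        using bounded_linear_sub[OF ap[of "c *\<^sub>C F"] bounded_linear_compose[OF sc[of c] ap[of F]]] by simp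
      moreover have "bounded_linear (\<lambda>A. id_op G (blinfun_apply A F) - blinfun_apply A F)" for F :: "'a l2"
        using bounded_linear_sub[OF bounded_linear_compose[OF blinfun.bounded_linear_right[of "id_op G"] ap[of F]] ap[of F]] by simp
      ultimately show ?thesis using that ap unfolding \<Lambda>_def by blast
    qed
    show "A \<in> ops G \<longleftrightarrow> (\<forall>l\<in>\<Lambda>. l A = 0)" for A
    proof
      assume "A \<in> ops G"
      then show "\<forall>l\<in>\<Lambda>. l A = 0" unfolding ops_iff[OF assms] \<Lambda>_def by fast
    next
      assume *: "\<forall>l\<in>\<Lambda>. l A = 0"
      have "A (c *\<^sub>C F) - c *\<^sub>C A F = 0" for c F
        by (rule bspec[OF *]) (unfold \<Lambda>_def, blast)
      moreover have "id_op G (A F) - A F = 0" for F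
        by (rule bspec[OF *]) (unfold \<Lambda>_def, blast)
      moreover have "A F = 0" if "AE y in lborel. y \<in> G \<longrightarrow> rep_l2 F y = 0" for F
        by (rule bspec[OF *]) (use that in \<open>unfold \<Lambda>_def, blast\<close>)
      ultimately show "A \<in> ops G" unfolding ops_iff[OF assms] by blast
    qed
  qed
qed

lemma ops_limit:
  assumes "G \<in> sets borel" "(f \<longlongrightarrow> A) net" "net \<noteq> bot" "eventually (\<lambda>x. f x \<in> ops G) net"
  shows "A \<in> ops G"
proof -
  obtain \<Lambda> :: "(('a l2 \<Rightarrow>\<^sub>L 'a l2) \<Rightarrow> 'a l2) set" where
    "(\<forall>l\<in>\<Lambda>. bounded_linear l) \<and> (\<forall>A. A \<in> ops G \<longleftrightarrow> (\<forall>l\<in>\<Lambda>. l A = 0))"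
    using ops_bounded_linear_functionals[OF assms(1)] by (rule exE)
  then have \<Lambda>: "\<And>l. l \<in> \<Lambda> \<Longrightarrow> bounded_linear l" "\<And>A. A \<in> ops G \<longleftrightarrow> (\<forall>l\<in>\<Lambda>. l A = 0)"
    by simp_all
  have "l A = 0" if l: "l \<in> \<Lambda>" for l
  proof -
    have "((\<lambda>x. l (f x)) \<longlongrightarrow> l A) net" by (rule bounded_linear.tendsto[OF \<Lambda>(1)[OF l] assms(2)])
    moreover have "((\<lambda>x. l (f x)) \<longlongrightarrow> 0) net"
    proof (rule tendsto_eventually, rule eventually_mono[OF assms(4)])
      fix x assume "f x \<in> ops G"
      then show "l (f x) = 0" using \<Lambda>(2)[of "f x"] l by simp
    qed
    ultimately show ?thesis by (rule tendsto_unique[OF assms(3)])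
  qed
  then show ?thesis using \<Lambda>(2) by simp
qed

lemma ops_zero: "0 \<in> ops G"
  by (auto simp: ops_def intro: eventually_mono[OF rep_zero])

lemma ops_integral:
  assumes "G \<in> sets borel" "\<And>x. x \<in> S \<Longrightarrow> f x \<in> ops G"
  shows "integral S f \<in> ops G"
proof (cases "f integrable_on S")
  case True
  obtain \<Lambda> :: "(('a l2 \<Rightarrow>\<^sub>L 'a l2) \<Rightarrow> 'a l2) set" where
    "(\<forall>l\<in>\<Lambda>. bounded_linear l) \<and> (\<forall>A. A \<in> ops G \<longleftrightarrow> (\<forall>l\<in>\<Lambda>. l A = 0))"
    using ops_bounded_linear_functionals[OF assms(1)] by (rule exE)
  then have \<Lambda>: "\<And>l. l \<in> \<Lambda> \<Longrightarrow> bounded_linear l" "\<And>A. A \<in> ops G \<longleftrightarrow> (\<forall>l\<in>\<Lambda>. l A = 0)"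
    by simp_all
  have "l (integral S f) = 0" if l: "l \<in> \<Lambda>" for l
  proof -
    have "l (integral S f) = integral S (l \<circ> f)"
      using integral_linear[OF True \<Lambda>(1)[OF l]] by simp
    also have "\<dots> = integral S (\<lambda>_. 0)"
    proof (rule Henstock_Kurzweil_Integration.integral_cong)
      fix x assume "x \<in> S"
      then show "(l \<circ> f) x = 0" using \<Lambda>(2)[of "f x"] assms(2)[of x] l by simp
    qed
    finally show ?thesis by simp
  qed
  then show ?thesis using \<Lambda>(2) by simp
\<comment> \<open>A non-integrable function has the default integral 0, which lies in
  \<open>ops G\<close> as well.\<close>
qed (simp add: not_integrable_integral ops_zero)

lemma ops_apply_scaleC: "A \<in> ops G \<Longrightarrow> blinfun_apply A (c *\<^sub>C F) = c *\<^sub>C A F"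
  by (simp add: ops_def)

lemma resolvent_is_resolvent:
  assumes "G \<in> sets borel" "z \<in> resolvent_set G A"
  shows "is_resolvent G A z (resolvent G A z)"
  using assms resolvent_eqI(2)[OF assms(1)] by (auto simp: resolvent_set_def)

text \<open>Compute \<open>B ((w - A) - (z - A)) B'\<close> in two ways. The unit of the algebra is
  \<open>id_op G\<close> and not the identity; \<open>i1\<close> and \<open>i2\<close> absorb it
  because \<open>B\<close> and \<open>B'\<close> lie in \<open>ops G\<close>.\<close>

lemma resolvent_identity:
  assumes G: "G \<in> sets borel" and "is_resolvent G A z B" "is_resolvent G A w B'"
  shows "B - B' = (w - z) *\<^sub>O (B o\<^sub>L B')"
proof (rule blinfun_eqI)
  fix F
  have B: "B \<in> ops G" "B' \<in> ops G" using assms by (auto simp: is_resolvent_def)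
  have 1: "B ((z *\<^sub>O id_op G - A) X) = id_op G X" for X
    using assms(2) by (metis is_resolvent_def blinfun_apply_blinfun_compose)
  have 2: "(w *\<^sub>O id_op G - A) (B' X) = id_op G X" for X
    using assms(3) by (metis is_resolvent_def blinfun_apply_blinfun_compose)
  have i1: "id_op G (B' X) = B' X" for X using id_op_ops(1)[OF G B(2)] by (metis blinfun_apply_blinfun_compose)
  have i2: "B (id_op G X) = B X" for X using id_op_ops(2)[OF G B(1)] by (metis blinfun_apply_blinfun_compose)
  have "(w - z) *\<^sub>C B (B' F) = B ((w - z) *\<^sub>C id_op G (B' F))" using B by (simp add: ops_apply_scaleC i1)
  also have "(w - z) *\<^sub>C id_op G (B' F) = (w *\<^sub>O id_op G - A) (B' F) - (z *\<^sub>O id_op G - A) (B' F)"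
    by (simp add: blinfun.diff_left scaleC_diff_left)
  also have "B \<dots> = B F - B' F" by (simp add: blinfun.diff_right 1 2 i1 i2)
  finally show "(B - B') F = ((w - z) *\<^sub>O (B o\<^sub>L B')) F" by (simp add: blinfun.diff_left)
qed

lemma cinner_mult_op_adjoint:
  assumes "multiplier G m" "multiplier G (\<lambda>y. cnj (m y))"
  shows "cinner A (mult_op G m B) = cinner (mult_op G (\<lambda>y. cnj (m y)) A) B"
proof -
  have "cinner A (mult_op G m B) = (LINT y|lborel. cnj (rep_l2 A y) * rep_l2 (mult_op G m B) y)"
    using cinner_abs_l2[OF sq_integrable_rep sq_integrable_rep, of A "mult_op G m B"] by simp
  also have "\<dots> = (LINT y|lborel. cnj (rep_l2 (mult_op G (\<lambda>y. cnj (m y)) A) y) * rep_l2 B y)"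
  proof (rule integral_cong_AE)
    show "AE y in lborel. cnj (rep_l2 A y) * rep_l2 (mult_op G m B) y =
        cnj (rep_l2 (mult_op G (\<lambda>y. cnj (m y)) A) y) * rep_l2 B y"
      using rep_mult_op[OF assms(1), of B] rep_mult_op[OF assms(2), of A] by eventually_elim auto
  qed (intro borel_measurable_integrable sq_integrable_mult_integrable sq_integrable_rep)+
  also have "\<dots> = cinner (mult_op G (\<lambda>y. cnj (m y)) A) B"
    using cinner_abs_l2[OF sq_integrable_rep sq_integrable_rep, of "mult_op G (\<lambda>y. cnj (m y)) A" B] by simp
  finally show ?thesis .
qed

section \<open>The resolvent near the real axis\<close>

lemma smooth_in_cnj_mult:
  assumes "smooth_in K f" "smooth_in K g"
  shows "smooth_in K (\<lambda>y. cnj (f y) * g y)"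
proof -
  have "smooth_on UNIV (\<lambda>y. cnj (f y))"
    using assms Ck_on_linear[OF bounded_linear_cnj open_UNIV, of _ f]
    by (auto simp: smooth_in_def smooth_on_iff_Ck_on)
  then have "smooth_on UNIV (\<lambda>y. cnj (f y) * g y)"
    using assms by (intro smooth_on_bilinear[OF bounded_bilinear_mult]) (auto simp: smooth_in_def)
  then show ?thesis using assms by (simp add: smooth_in_def)
qed

lemma smooth_in_sq_integrable:
  assumes "compact K" "smooth_in K k" shows "sq_integrable k"
proof -
  have c: "continuous_on UNIV k" using assms by (auto simp: smooth_in_def intro: smooth_on_continuous)
  have "integrable lborel (\<lambda>x. (cmod (k x))\<^sup>2)"
    by (rule integrable_compact_support[OF assms(1)])
      (use assms c in \<open>auto simp: smooth_in_def intro!: continuous_intros\<close>)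
  then show ?thesis using c by (simp add: sq_integrable_def borel_measurable_continuous_onI)
qed

lemma cmod_minus_of_real_ge: "\<bar>Im z\<bar> \<le> cmod (z - of_real p)"
  using abs_Im_le_cmod[of "z - of_real p"] by simp

locale rank_one_perturbation =
  fixes G K :: "'a::euclidean_space set" and P :: "'a \<Rightarrow> real" and g h :: "'a \<Rightarrow> complex"
    and G1 I :: "real set" and C :: "complex \<Rightarrow> complex"
    and H :: "'a l2 \<Rightarrow>\<^sub>L 'a l2" and R :: "complex \<Rightarrow> 'a l2 \<Rightarrow>\<^sub>L 'a l2"
  assumes C_eq: "C = (\<lambda>z. 1 - (LINT y:G|lborel. cnj (h y) * g y / (z - of_real (P y))))"
    and H_eq: "H = mult_op G (\<lambda>y. of_real (P y)) + rank_one (abs_l2 g) (abs_l2 h)"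
    and R_eq: "R = resolvent G H"
    and G: "open G" and K: "compact K" "K \<subseteq> G"
    and P: "smooth_on G P" and Pb: "bounded (P ` G)"
    and grad: "\<And>y. y \<in> G \<Longrightarrow> (\<Sum>c\<in>Basis. (partials [c] P y)\<^sup>2) \<noteq> 0"
    and g: "smooth_in K g" and h: "smooth_in K h"
    and C_hol: "C holomorphic_on ({z. Re z \<in> G1 \<and> Im z \<in> I} - of_real ` P ` K)"
    and C_nz: "\<And>z. Re z \<in> G1 \<Longrightarrow> Im z \<in> I \<Longrightarrow> z \<notin> of_real ` P ` K \<Longrightarrow> C z \<noteq> 0"
    and C_upper: "\<And>x. x \<in> G1 \<Longrightarrow> \<exists>c. ((\<lambda>u. C (Complex x u)) \<longlongrightarrow> c) (at_right 0) \<and> c \<noteq> 0"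
    and C_lower: "\<And>x. x \<in> G1 \<Longrightarrow> \<exists>c. ((\<lambda>u. C (Complex x u)) \<longlongrightarrow> c) (at_left 0) \<and> c \<noteq> 0"
begin

definition R0 :: "complex \<Rightarrow> 'a l2 \<Rightarrow>\<^sub>L 'a l2" where
  "R0 z = mult_op G (\<lambda>y. 1 / (z - of_real (P y)))"

lemma Gb: "G \<in> sets borel" using G by simp

lemma P_multiplier: "multiplier G (\<lambda>y. of_real (P y))"
  by (rule multiplier_of_real[OF G smooth_on_continuous[OF P] Pb])

lemma R0_multiplier: "Im z \<noteq> 0 \<Longrightarrow> multiplier G (\<lambda>y. 1 / (z - of_real (P y)))"
  by (rule multiplier_inverse_diff[OF Gb P_multiplier, of "\<bar>Im z\<bar>"]) (auto simp: cmod_minus_of_real_ge)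

lemma norm_R0_le: "Im z \<noteq> 0 \<Longrightarrow> norm (R0 z) \<le> 1 / \<bar>Im z\<bar>"
  unfolding R0_def
  by (rule norm_mult_op_le[OF R0_multiplier])
    (auto simp: norm_divide intro!: divide_left_mono mult_pos_pos cmod_minus_of_real_ge)

lemma C_alt: "C z = 1 - (LINT y|lborel. cnj (h y) * g y / (z - of_real (P y)))"
proof -
  have "(LINT y:G|lborel. cnj (h y) * g y / (z - of_real (P y))) = (LINT y|lborel. cnj (h y) * g y / (z - of_real (P y)))"
    unfolding set_lebesgue_integral_def
    by (intro Bochner_Integration.integral_cong) (use g K in \<open>auto simp: smooth_in_def indicator_def\<close>)
  then show ?thesis by (simp add: C_eq)
qed

lemma resolvent_at:
  assumes "Re z \<in> G1" "Im z \<in> I" "Im z \<noteq> 0"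
  shows "z \<in> resolvent_set G H"
    and "R z = R0 z + (1 / C z) *\<^sub>O (R0 z o\<^sub>L rank_one (abs_l2 g) (abs_l2 h) o\<^sub>L R0 z)"
proof -
  have z: "z \<notin> of_real ` P ` K" using assms by auto
  have supp: "g y = 0" "h y = 0" if "y \<notin> G" for y
    using g h K that by (auto simp: smooth_in_def)
  note r = resolvent_formula[OF G smooth_on_continuous[OF P] Pb, of "\<bar>Im z\<bar>" z g h "C z",
      OF _ cmod_minus_of_real_ge smooth_in_sq_integrable[OF K(1) g] smooth_in_sq_integrable[OF K(1) h] supp]
  show "z \<in> resolvent_set G H" unfolding H_eq
    by (rule r(1)) (use assms C_nz[OF assms(1,2) z] in \<open>auto simp: C_eq\<close>)
  show "R z = R0 z + (1 / C z) *\<^sub>O (R0 z o\<^sub>L rank_one (abs_l2 g) (abs_l2 h) o\<^sub>L R0 z)"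
    unfolding R_eq H_eq R0_def
    by (rule r(2)) (use assms C_nz[OF assms(1,2) z] in \<open>auto simp: C_eq\<close>)
qed

lemma R_is_resolvent:
  "Re z \<in> G1 \<Longrightarrow> Im z \<in> I \<Longrightarrow> Im z \<noteq> 0 \<Longrightarrow> is_resolvent G H z (R z)"
  unfolding R_eq by (intro resolvent_is_resolvent resolvent_at(1) Gb)

text \<open>Compactness: a sequence in \<open>L\<close> with \<open>C\<close> tending to 0
  accumulates at some \<open>w\<close>. Off the axis this contradicts \<open>C w \<noteq> 0\<close>;
  on the axis the nonzero vertical limit is transferred to the sequence by the Lipschitz estimate.
  The sign \<open>s\<close> separates the two sides, whose boundary values may differ.\<close>

lemma C_lower_bound:
  assumes L: "compact L" "\<And>z. z \<in> L \<Longrightarrow> Re z \<in> G1 \<and> Im z \<in> I" and s: "s \<in> {-1, 1 :: real}"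
  obtains c where "c > 0" "\<And>z. z \<in> L \<Longrightarrow> s * Im z > 0 \<Longrightarrow> c \<le> norm (C z)"
proof -
  obtain r where r: "r > 0" "\<And>z. z \<in> L \<Longrightarrow> norm z \<le> r"
    using compact_imp_bounded[OF L(1)] by (auto simp: bounded_pos)
  \<comment> \<open>Radius \<open>r + 1\<close> leaves room for the comparison points
    \<open>Complex (Re w) (u n)\<close>, which may lie outside \<open>L\<close>.\<close>
  obtain l where l: "l \<ge> 0" "\<And>z z'. norm z \<le> r + 1 \<Longrightarrow> norm z' \<le> r + 1 \<Longrightarrow> Im z * Im z' > 0 \<Longrightarrow>
      norm (C z - C z') \<le> l * norm (z - z')"
    unfolding C_alt
    by (rule level_integral_Lipschitz[OF G K P grad smooth_in_cnj_mult[OF h g], of "r + 1"])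
      (auto simp: norm_minus_commute)
  have "\<exists>n. \<forall>z\<in>L. s * Im z > 0 \<longrightarrow> 1 / real (Suc n) \<le> norm (C z)"
  proof (rule ccontr)
    assume "\<not> ?thesis"
    then have "\<forall>n. \<exists>z. z \<in> L \<and> s * Im z > 0 \<and> norm (C z) < 1 / real (Suc n)" by (auto simp: not_le)
    then obtain z where z: "\<And>n. z n \<in> L" "\<And>n. s * Im (z n) > 0" "\<And>n. norm (C (z n)) < 1 / real (Suc n)"
      by metis
    from L(1) z(1) obtain w \<sigma> where w: "w \<in> L" "strict_mono \<sigma>" "(z \<circ> \<sigma>) \<longlonglongrightarrow> w"
      unfolding compact_def by metis
    have Cz: "(\<lambda>n. C (z n)) \<longlonglongrightarrow> 0"
      by (rule tendsto_norm_zero_cancel[OF tendsto_sandwich[OF _ _ tendsto_const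
            LIMSEQ_Suc[OF lim_1_over_n[where 'a = real]]]])
        (intro eventuallyI less_imp_le[OF z(3)] norm_ge_zero)+
    then have Czs: "(\<lambda>n. C (z (\<sigma> n))) \<longlonglongrightarrow> 0"
      using LIMSEQ_subseq_LIMSEQ[OF Cz w(2)] by (simp add: o_def)
    have sIm: "s * Im w \<ge> 0"
      using z(2) by (intro LIMSEQ_le_const[OF tendsto_mult_left[OF tendsto_Im[OF w(3)], of s]])
        (auto intro: less_imp_le)
    \<comment> \<open>Height of the comparison points over \<open>Re w\<close>: they approach
      \<open>w\<close> vertically if it is real and equal \<open>w\<close> otherwise, in both cases
      on the side given by \<open>s\<close>.\<close>
    define u where "u n = (if Im w = 0 then s / real (Suc n) else Im w)" for n
    have u: "s * u n > 0" "\<bar>u n\<bar> \<le> \<bar>Im w\<bar> + 1" for n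
      using sIm s by (auto simp: u_def mult_less_0_iff zero_less_mult_iff field_simps)
    have u': "u \<longlonglongrightarrow> Im w"
    proof (cases "Im w = 0")
      case True
      then show ?thesis
        using tendsto_mult_right_zero[OF LIMSEQ_Suc[OF lim_1_over_n[where 'a = real]], of s] by (simp add: u_def[abs_def])
    qed (simp add: u_def[abs_def])
    obtain c where c: "(\<lambda>n. C (Complex (Re w) (u n))) \<longlonglongrightarrow> c" "c \<noteq> 0"
    proof (cases "Im w = 0")
      case True
      have wG: "Re w \<in> G1" using L(2)[OF w(1)] by simp
      show ?thesis
      proof (cases "s = 1")
        case s1: True
        obtain c where c: "((\<lambda>u. C (Complex (Re w) u)) \<longlongrightarrow> c) (at_right 0)" "c \<noteq> 0"
          using C_upper[OF wG] by blast
        have "filterlim u (at_right 0) sequentially"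
          using u' True u(1) s1 by (simp add: filterlim_at less_imp_neq[THEN not_sym] always_eventually)
        from that[OF filterlim_compose[OF c(1) this] c(2)] show ?thesis .
      next
        case False
        then have s1: "s = -1" using s by auto
        obtain c where c: "((\<lambda>u. C (Complex (Re w) u)) \<longlongrightarrow> c) (at_left 0)" "c \<noteq> 0"
          using C_lower[OF wG] by blast
        have "filterlim u (at_left 0) sequentially"
          using u' True u(1) s1 by (simp add: filterlim_at less_imp_neq always_eventually)
        from that[OF filterlim_compose[OF c(1) this] c(2)] show ?thesis .
      qed
    next
      case False
      have "C w \<noteq> 0" using L(2)[OF w(1)] False by (intro C_nz) auto
      then show ?thesis using False by (intro that[of "C w"]) (auto simp: u_def)
    qed
    have "(\<lambda>n. C (z (\<sigma> n)) - C (Complex (Re w) (u n))) \<longlonglongrightarrow> 0"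
    proof (rule tendsto_norm_zero_cancel[OF tendsto_sandwich[OF _ _ tendsto_const]])
      show "\<forall>\<^sub>F n in sequentially. 0 \<le> norm (C (z (\<sigma> n)) - C (Complex (Re w) (u n)))" by simp
      show "\<forall>\<^sub>F n in sequentially. norm (C (z (\<sigma> n)) - C (Complex (Re w) (u n))) \<le>
          l * norm (z (\<sigma> n) - Complex (Re w) (u n))"
      proof (rule eventuallyI)
        fix n
        have "norm (Complex (Re w) (u n)) \<le> r + 1"
        proof (cases "Im w = 0")
          case True
          then have "norm (Complex (Re w) (u n)) \<le> \<bar>Re w\<bar> + 1"
            using u(2)[of n] cmod_le[of "Complex (Re w) (u n)"] by simp
          then show ?thesis using abs_Re_le_cmod[of w] r(2)[OF w(1)] by simp
        next
          case False
          then have "Complex (Re w) (u n) = w" by (simp add: u_def complex_eq_iff)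
          then show ?thesis using r(2)[OF w(1)] by simp
        qed
        moreover have "norm (z (\<sigma> n)) \<le> r + 1" using r(2)[OF z(1)[of "\<sigma> n"]] by simp
        moreover have "Im (z (\<sigma> n)) * Im (Complex (Re w) (u n)) > 0"
          using z(2)[of "\<sigma> n"] u(1)[of n] s by (auto simp: zero_less_mult_iff)
        ultimately show "norm (C (z (\<sigma> n)) - C (Complex (Re w) (u n))) \<le>
          l * norm (z (\<sigma> n) - Complex (Re w) (u n))" by (intro l(2))
      qed
      have "(\<lambda>n. Complex (Re w) (u n)) \<longlonglongrightarrow> Complex (Re w) (Im w)" by (intro tendsto_intros u')
      then have "(\<lambda>n. z (\<sigma> n) - Complex (Re w) (u n)) \<longlonglongrightarrow> w - w"
        using w(3) by (intro tendsto_diff) (simp_all add: o_def)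
      then show "(\<lambda>n. l * norm (z (\<sigma> n) - Complex (Re w) (u n))) \<longlonglongrightarrow> 0"
        by (intro tendsto_mult_right_zero tendsto_norm_zero) simp
    qed
    from tendsto_diff[OF Czs this] have "(\<lambda>n. C (Complex (Re w) (u n))) \<longlonglongrightarrow> 0" by simp
    with c show False using LIMSEQ_unique by blast
  qed
  then obtain n where "\<forall>z\<in>L. s * Im z > 0 \<longrightarrow> 1 / real (Suc n) \<le> norm (C z)" ..
  then show ?thesis by (intro that[of "1 / real (Suc n)"]) auto
qed

text \<open>A square root is gained over \<open>norm_R0_le\<close>: the vectors \<open>R0 z\<close>
  applied to \<open>g\<close> and \<open>R0 (cnj z)\<close> applied to \<open>h\<close> have norm of
  order \<open>1 / sqrt |Im z|\<close>, so the rank one term of the resolvent is of order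
  \<open>1 / |Im z|\<close> instead of the square of this.\<close>

lemma norm_R0_apply:
  assumes "smooth_in K k"
  obtains c where "c \<ge> 0" "\<And>z. norm z \<le> r \<Longrightarrow> Im z \<noteq> 0 \<Longrightarrow> (norm (R0 z (abs_l2 k)))\<^sup>2 \<le> c / \<bar>Im z\<bar>"
proof -
  obtain c where c: "c \<ge> 0" "\<And>z. norm z \<le> r \<Longrightarrow> Im z \<noteq> 0 \<Longrightarrow>
      norm (LINT y|lborel. cnj (k y) * k y / (z - of_real (P y))) \<le> c"
    by (rule level_integral_bounded[OF G K P grad smooth_in_cnj_mult[OF assms assms], of r]) auto
  have "(norm (R0 z (abs_l2 k)))\<^sup>2 \<le> c / \<bar>Im z\<bar>" if z: "norm z \<le> r" "Im z \<noteq> 0" for z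
  proof -
    define q where "q y = cnj (k y) * k y / (z - of_real (P y))" for y
    have k0: "k y = 0" if "y \<notin> G" for y using assms K that by (auto simp: smooth_in_def)
    note sqk = smooth_in_sq_integrable[OF K(1) assms]
    note sq = multiplier_sq(1)[OF R0_multiplier[OF z(2)] sqk]
    have q: "(cmod (if y \<in> G then 1 / (z - of_real (P y)) * k y else 0))\<^sup>2 = - Im (q y) / Im z" for y
    proof -
      have "Im (q y) = (cmod (k y))\<^sup>2 * Im (1 / (z - of_real (P y)))"
        unfolding q_def cnj_mult_eq by (simp add: Im_divide field_simps)
      also have "Im (1 / (z - of_real (P y))) = - Im z / (cmod (z - of_real (P y)))\<^sup>2"
        by (simp add: Im_divide cmod_power2)
      finally show ?thesis using z(2) k0[of y] by (auto simp: norm_mult norm_divide power_mult_distrib power_divide)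
    qed
    have "integrable lborel (\<lambda>y. (cmod (if y \<in> G then 1 / (z - of_real (P y)) * k y else 0))\<^sup>2)"
      using sq by (simp add: sq_integrable_def)
    then have iq: "integrable lborel (\<lambda>y. - Im (q y) / Im z)" unfolding q .
    have "integrable lborel q"
    proof -
      have "continuous_on UNIV (\<lambda>p. 1 / (z - of_real p))"
        using z(2) by (intro continuous_intros) (auto simp: complex_eq_iff)
      from continuous_smooth_in_compose(2)[OF G K P grad smooth_in_cnj_mult[OF assms assms] this]
      show ?thesis by (simp add: q_def[abs_def])
    qed
    have "(norm (R0 z (abs_l2 k)))\<^sup>2 = (LINT y|lborel. - Im (q y) / Im z)"
      unfolding R0_def mult_op_abs_l2[OF R0_multiplier[OF z(2)] sqk] norm_abs_l2[OF sq] q ..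
    also have "\<dots> = - Im (LINT y|lborel. q y) / Im z"
      using \<open>integrable lborel q\<close> by simp
    also have "\<dots> \<le> \<bar>Im (LINT y|lborel. q y)\<bar> / \<bar>Im z\<bar>"
      by (metis abs_divide abs_ge_self abs_minus_cancel)
    also have "\<dots> \<le> c / \<bar>Im z\<bar>"
      using order_trans[OF abs_Im_le_cmod c(2)[OF z]] by (intro divide_right_mono) (simp_all add: q_def[abs_def])
    finally show ?thesis .
  qed
  with c(1) show ?thesis by (rule that)
qed

lemma norm_R_le:
  assumes L: "compact L" "\<And>z. z \<in> L \<Longrightarrow> Re z \<in> G1 \<and> Im z \<in> I"
  obtains M where "M \<ge> 0" "\<And>z. z \<in> L \<Longrightarrow> Im z \<noteq> 0 \<Longrightarrow> norm (R z) \<le> M / \<bar>Im z\<bar>"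
proof -
  obtain r where r: "r > 0" "\<And>z. z \<in> L \<Longrightarrow> norm z \<le> r"
    using compact_imp_bounded[OF L(1)] by (auto simp: bounded_pos)
  obtain c1 where c1: "c1 > 0" "\<And>z. z \<in> L \<Longrightarrow> 1 * Im z > 0 \<Longrightarrow> c1 \<le> norm (C z)"
    by (rule C_lower_bound[OF L, of 1]) auto
  obtain c2 where c2: "c2 > 0" "\<And>z. z \<in> L \<Longrightarrow> -1 * Im z > 0 \<Longrightarrow> c2 \<le> norm (C z)"
    by (rule C_lower_bound[OF L, of "-1"]) auto
  define c where "c = min c1 c2"
  have c: "c > 0" "c \<le> norm (C z)" if "z \<in> L" "Im z \<noteq> 0" for z
    using c1(1) c2(1) c1(2)[OF that(1)] c2(2)[OF that(1)] that(2) by (auto simp: c_def neq_iff)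
  have c0: "c > 0" using c1 c2 by (simp add: c_def)
  obtain a where a: "a \<ge> 0" "\<And>z. norm z \<le> r \<Longrightarrow> Im z \<noteq> 0 \<Longrightarrow> (norm (R0 z (abs_l2 g)))\<^sup>2 \<le> a / \<bar>Im z\<bar>"
    by (rule norm_R0_apply[OF g, of r]) auto
  obtain b where b: "b \<ge> 0" "\<And>z. norm z \<le> r \<Longrightarrow> Im z \<noteq> 0 \<Longrightarrow> (norm (R0 z (abs_l2 h)))\<^sup>2 \<le> b / \<bar>Im z\<bar>"
    by (rule norm_R0_apply[OF h, of r]) auto
  show thesis
  proof (rule that)
    show "0 \<le> 1 + (a + b) / c" using a b c0 by simp
    fix z assume z: "z \<in> L" "Im z \<noteq> 0"
    \<comment> \<open>Size of the rank one term before division by \<open>C\<close>: the adjoint of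
      \<open>R0 z\<close> is \<open>R0 (cnj z)\<close>, so the term maps \<open>F\<close> to the
      vector \<open>R0 z\<close> of \<open>g\<close>, times the scalar product of
      \<open>R0 (cnj z)\<close> of \<open>h\<close> with \<open>F\<close>.\<close>
    define q where "q = norm (R0 (cnj z) (abs_l2 h)) * norm (R0 z (abs_l2 g))"
    have "q \<le> (norm (R0 (cnj z) (abs_l2 h)))\<^sup>2 + (norm (R0 z (abs_l2 g)))\<^sup>2"
      unfolding q_def using sum_squares_bound[of "norm (R0 (cnj z) (abs_l2 h))" "norm (R0 z (abs_l2 g))"]
        mult_nonneg_nonneg[OF norm_ge_zero norm_ge_zero, of "R0 (cnj z) (abs_l2 h)" "R0 z (abs_l2 g)"] by linarith
    also have "\<dots> \<le> (a + b) / \<bar>Im z\<bar>"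
      using a(2)[of z] b(2)[of "cnj z"] r(2)[OF z(1)] z(2) by (simp add: add_divide_distrib)
    finally have q: "q \<le> (a + b) / \<bar>Im z\<bar>" .
    have q0: "0 \<le> q" by (simp add: q_def)
    have "norm (R0 z o\<^sub>L rank_one (abs_l2 g) (abs_l2 h) o\<^sub>L R0 z) \<le> q"
    proof (rule norm_blinfun_bound[OF q0])
      fix F
      have m: "multiplier G (\<lambda>y. cnj (1 / (z - of_real (P y))))"
        using R0_multiplier[of "cnj z"] z(2) by simp
      have "cinner (abs_l2 h) (R0 z F) = cinner (R0 (cnj z) (abs_l2 h)) F"
        using cinner_mult_op_adjoint[OF R0_multiplier[OF z(2)] m] by (simp add: R0_def)
      then have "norm (cinner (abs_l2 h) (R0 z F)) \<le> norm (R0 (cnj z) (abs_l2 h)) * norm F"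
        using cinner_bound[of "R0 (cnj z) (abs_l2 h)" F] by simp
      then have "norm (cinner (abs_l2 h) (R0 z F)) * norm (R0 z (abs_l2 g)) \<le>
          norm (R0 (cnj z) (abs_l2 h)) * norm F * norm (R0 z (abs_l2 g))" by (rule mult_right_mono) simp
      moreover have "(R0 z o\<^sub>L rank_one (abs_l2 g) (abs_l2 h) o\<^sub>L R0 z) F =
          cinner (abs_l2 h) (R0 z F) *\<^sub>C R0 z (abs_l2 g)"
        using mult_op_in_ops[OF R0_multiplier[OF z(2)]] by (simp add: ops_apply_scaleC R0_def)
      ultimately show "norm ((R0 z o\<^sub>L rank_one (abs_l2 g) (abs_l2 h) o\<^sub>L R0 z) F) \<le> q * norm F"
        by (simp add: norm_scaleC q_def mult_ac)
    qed
    then have "norm ((1 / C z) *\<^sub>O (R0 z o\<^sub>L rank_one (abs_l2 g) (abs_l2 h) o\<^sub>L R0 z)) \<le> (1 / c) * q"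
      unfolding norm_scale_op using c[OF z] q0
      by (intro mult_mono) (auto simp: norm_divide intro!: divide_left_mono mult_pos_pos)
    also have "\<dots> \<le> (1 / c) * ((a + b) / \<bar>Im z\<bar>)" using q c0 by (intro mult_left_mono) auto
    finally have 2: "norm ((1 / C z) *\<^sub>O (R0 z o\<^sub>L rank_one (abs_l2 g) (abs_l2 h) o\<^sub>L R0 z)) \<le> (1 / c) * ((a + b) / \<bar>Im z\<bar>)" .
    have "norm (R z) \<le> 1 / \<bar>Im z\<bar> + (1 / c) * ((a + b) / \<bar>Im z\<bar>)"
      using L(2)[OF z(1)] z(2)
      by (subst resolvent_at(2))
        (auto simp only: intro!: norm_triangle_le[OF add_mono] norm_R0_le 2)
    also have "\<dots> = (1 + (a + b) / c) / \<bar>Im z\<bar>" by (simp add: add_divide_distrib mult.commute)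
    finally show "norm (R z) \<le> (1 + (a + b) / c) / \<bar>Im z\<bar>" .
  qed
qed

end

section \<open>The Cauchy kernel in the plane\<close>

lemma has_vector_derivative_iff_quotient:
  "(f has_vector_derivative D) (at x) \<longleftrightarrow> ((\<lambda>h. (1 / h) *\<^sub>R (f (x + h) - f x)) \<longlongrightarrow> D) (at 0)"
proof -
  have eq: "norm (f (x + h) - f x - h *\<^sub>R D) / norm h = norm ((1 / h) *\<^sub>R (f (x + h) - f x) - D)"
    if "h \<noteq> 0" for h
  proof -
    have "(1 / h) *\<^sub>R (f (x + h) - f x) - D = (1 / h) *\<^sub>R (f (x + h) - f x - h *\<^sub>R D)"
      using that by (simp add: scaleR_diff_right)
    then show ?thesis by (simp only: norm_scaleR) simp
  qed
  have "(f has_vector_derivative D) (at x) \<longleftrightarrow> ((\<lambda>h. norm (f (x + h) - f x - h *\<^sub>R D) / norm h) \<longlongrightarrow> 0) (at 0)"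
    by (simp add: has_vector_derivative_def has_derivative_at bounded_linear_scaleR_left)
  also have "\<dots> \<longleftrightarrow> ((\<lambda>h. norm ((1 / h) *\<^sub>R (f (x + h) - f x) - D)) \<longlongrightarrow> 0) (at 0)"
    by (rule filterlim_cong) (simp_all add: eventually_at_filter eq[simplified] always_eventually)
  also have "\<dots> \<longleftrightarrow> ((\<lambda>h. (1 / h) *\<^sub>R (f (x + h) - f x)) \<longlongrightarrow> D) (at 0)"
    by (simp add: tendsto_norm_zero_iff LIM_zero_iff)
  finally show ?thesis .
qed

lemma Basis_complex_prod: "(\<Prod>b\<in>Basis. f b) = f 1 * f \<i>"
  by (simp add: Basis_complex_def)

text \<open>Transport along the volume preserving map from pairs \<open>(u, x)\<close> to
  \<open>Complex x u\<close>. The imaginary part comes first, so that the outer integral is over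
  \<open>u\<close> and the inner one is a slice.\<close>

lemma complex_box_Fubini:
  fixes f :: "complex \<Rightarrow> 'b::banach"
  assumes f: "continuous_on (cbox (Complex a c) (Complex b d)) f"
  shows "integral (cbox (Complex a c) (Complex b d)) f = integral {c..d} (\<lambda>u. integral {a..b} (\<lambda>x. f (Complex x u)))"
proof -
  define q where "q p = Complex (snd p) (fst p)" for p
  define q' where "q' z = (Im z, Re z)" for z
  have "(f has_integral integral (cbox (Complex a c) (Complex b d)) f) (cbox (Complex a c) (Complex b d))"
    using integrable_continuous[OF f] by (rule integrable_integral)
  then have "((\<lambda>p. f (q p)) has_integral (1 / 1) *\<^sub>R integral (cbox (Complex a c) (Complex b d)) f)
      (q' ` cbox (Complex a c) (Complex b d))"
  proof (rule has_integral_twiddle[rotated -1])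
    have img: "q ` cbox u v = cbox (Complex (snd u) (fst u)) (Complex (snd v) (fst v))" for u v
    proof
      show "q ` cbox u v \<subseteq> cbox (Complex (snd u) (fst u)) (Complex (snd v) (fst v))"
        by (cases u; cases v) (auto simp: q_def in_cbox_complex_iff cbox_Pair_eq)
      show "cbox (Complex (snd u) (fst u)) (Complex (snd v) (fst v)) \<subseteq> q ` cbox u v"
      proof
        fix z assume "z \<in> cbox (Complex (snd u) (fst u)) (Complex (snd v) (fst v))"
        then have "(Im z, Re z) \<in> cbox u v"
          by (cases u; cases v) (auto simp: in_cbox_complex_iff cbox_Pair_eq)
        then show "z \<in> q ` cbox u v" by (rule rev_image_eqI) (simp add: q_def)
      qed
    qed
    show "\<exists>w z. q ` cbox u v = cbox w z" for u v unfolding img by blast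
    have "q' ` cbox u v = cbox (Im u, Re u) (Im v, Re v)" for u v
      by (auto simp: q'_def in_cbox_complex_iff cbox_Pair_eq image_iff intro!: bexI[of _ "Complex _ _"])
    then show "\<exists>w z. q' ` cbox u v = cbox w z" for u v by blast
    show "measure lborel (q ` cbox u v) = 1 * measure lborel (cbox u v)" for u v
      unfolding img
      by (cases u; cases v) (simp add: content_Pair, simp add: measure_lborel_cbox_eq Basis_complex_prod,
          auto simp: Basis_complex_def)
    show "continuous (at p) q" for p
      unfolding q_def Complex_eq by (intro continuous_intros)
  qed (auto simp: q_def q'_def)
  moreover have "q' ` cbox (Complex a c) (Complex b d) = cbox (c, a) (d, b)"
    by (auto simp: q'_def in_cbox_complex_iff cbox_Pair_eq image_iff intro!: bexI[of _ "Complex _ _"])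
  ultimately have "integral (cbox (c, a) (d, b)) (\<lambda>p. f (q p)) = integral (cbox (Complex a c) (Complex b d)) f"
    by (simp add: integral_unique)
  moreover have "continuous_on (cbox (c, a) (d, b)) (\<lambda>p. f (q p))"
    unfolding q_def Complex_eq
    by (intro continuous_on_compose2[OF f] continuous_intros) (auto simp: in_cbox_complex_iff cbox_Pair_eq)
  ultimately show ?thesis
    by (simp add: integral_prod_continuous q_def)
qed

text \<open>Lebesgue measure on \<open>complex\<close> is the image of the product measure, since
  the two agree on boxes.\<close>

lemma nn_integral_complex:
  assumes [measurable]: "f \<in> borel_measurable borel"
  shows "(\<integral>\<^sup>+z. f z \<partial>lborel) = (\<integral>\<^sup>+u. \<integral>\<^sup>+x. f (Complex x u) \<partial>lborel \<partial>lborel)"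
proof -
  have [measurable]: "(\<lambda>p. Complex (snd p) (fst p)) \<in> borel_measurable (lborel \<Otimes>\<^sub>M lborel)"
  proof -
    have "(\<lambda>p. Complex (snd p) (fst p)) \<in> borel_measurable borel"
      unfolding Complex_eq by (intro borel_measurable_continuous_onI continuous_intros)
    then show ?thesis by (simp add: lborel_prod)
  qed
  have E: "lborel = distr (lborel \<Otimes>\<^sub>M lborel) borel (\<lambda>p. Complex (snd p) (fst p))"
  proof (rule lborel_eqI)
    fix l u :: complex assume le: "\<And>b. b \<in> Basis \<Longrightarrow> l \<bullet> b \<le> u \<bullet> b"
    have "(\<lambda>p. Complex (snd p) (fst p)) -` box l u \<inter> space (lborel \<Otimes>\<^sub>M lborel) = {Im l<..<Im u} \<times> {Re l<..<Re u}"
      by (auto simp: in_box_complex_iff space_pair_measure)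
    then have "emeasure (distr (lborel \<Otimes>\<^sub>M lborel) borel (\<lambda>p. Complex (snd p) (fst p))) (box l u) =
        emeasure (lborel \<Otimes>\<^sub>M lborel) ({Im l<..<Im u} \<times> {Re l<..<Re u})"
      by (subst emeasure_distr) auto
    also have "\<dots> = ennreal (\<Prod>b\<in>Basis. (u - l) \<bullet> b)"
      using le[of 1] le[of \<i>] unfolding Basis_complex_prod
      by (subst lborel.emeasure_pair_measure_Times)
        (auto simp: Basis_complex_def mult.commute simp flip: ennreal_mult)
    finally show "emeasure (distr (lborel \<Otimes>\<^sub>M lborel) borel (\<lambda>p. Complex (snd p) (fst p))) (box l u) =
        ennreal (\<Prod>b\<in>Basis. (u - l) \<bullet> b)" .
  qed simp
  have "(\<integral>\<^sup>+z. f z \<partial>lborel) = (\<integral>\<^sup>+z. f z \<partial>distr (lborel \<Otimes>\<^sub>M lborel) borel (\<lambda>p. Complex (snd p) (fst p)))"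
    by (rule arg_cong[where f = "\<lambda>M. nn_integral M f", OF E])
  also have "\<dots> = (\<integral>\<^sup>+p. f (Complex (snd p) (fst p)) \<partial>(lborel \<Otimes>\<^sub>M lborel))"
    by (rule nn_integral_distr) simp_all
  also have "\<dots> = (\<integral>\<^sup>+u. \<integral>\<^sup>+x. f (Complex x u) \<partial>lborel \<partial>lborel)"
    by (subst lborel.nn_integral_fst[symmetric]) simp_all
  finally show ?thesis .
qed

text \<open>\<open>sqrt\<close> is extended to negative reals as an odd function, which makes
  \<open>2 * sqrt (x - v)\<close> a primitive of \<open>1 / sqrt |x - v|\<close> on both sides of
  \<open>v\<close>. The factor 2 is for an interval that contains the singularity.\<close>

lemma sqrt_shift_diff_le: "l \<ge> 0 \<Longrightarrow> sqrt (s + l) - sqrt s \<le> 2 * sqrt l"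
proof -
  assume l: "l \<ge> 0"
  have *: "sqrt (s + l) - sqrt s \<le> sqrt l" if "s \<ge> 0" for s
    using sqrt_add_le_add_sqrt[OF that l] by simp
  consider "s \<ge> 0" | "s + l \<le> 0" | "s < 0" "s + l > 0" by linarith
  then show ?thesis
  proof cases
    case 1 then show ?thesis using *[of s] l real_sqrt_ge_zero[OF l] by linarith
  next
    case 2
    have "- (s + l) + l = - s" by simp
    then have "sqrt (- s) - sqrt (- (s + l)) \<le> sqrt l" using *[of "- (s + l)"] 2 by (simp only:)
    then show ?thesis using real_sqrt_ge_zero[OF l] unfolding real_sqrt_minus by linarith
  next
    case 3
    have "sqrt (s + l) \<le> sqrt l" "sqrt (- s) \<le> sqrt l" using 3 by auto
    then show ?thesis unfolding real_sqrt_minus by linarith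
  qed
qed

lemma nn_integral_inverse_sqrt_le:
  assumes "a \<le> b"
  shows "(\<integral>\<^sup>+x. ennreal (indicator {a..b} x / sqrt \<bar>x - v\<bar>) \<partial>lborel) \<le> ennreal (4 * sqrt (b - a))"
proof -
  have "((\<lambda>x. 1 / sqrt \<bar>x - v\<bar>) has_integral 2 * sqrt (b - v) - 2 * sqrt (a - v)) {a..b}"
  proof (rule fundamental_theorem_of_calculus_interior_strong[of "{v}"])
    fix x assume "x \<in> {a<..<b} - {v}"
    then have "x \<noteq> v" by auto
    have "((\<lambda>x. 2 * sqrt (x - v)) has_field_derivative 1 / sqrt \<bar>x - v\<bar>) (at x)"
    proof (cases "x > v")
      case True
      then show ?thesis by (auto intro!: derivative_eq_intros simp: field_simps)
    next
      case False
      then have "x - v < 0" using \<open>x \<noteq> v\<close> by auto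
      moreover have "((\<lambda>x. x - v) has_field_derivative 1) (at x)" by (auto intro!: derivative_eq_intros)
      ultimately have "((\<lambda>x. sqrt (x - v)) has_field_derivative (- inverse (sqrt (x - v)) / 2) * 1) (at x)"
        by (intro DERIV_chain2[where f = sqrt] DERIV_real_sqrt_generic) auto
      from DERIV_cmult[OF this, of 2]
      have "((\<lambda>x. 2 * sqrt (x - v)) has_field_derivative - (1 / sqrt (x - v))) (at x)"
        by (rule DERIV_cong) (simp add: inverse_eq_divide)
      moreover have "- (1 / sqrt (x - v)) = 1 / sqrt \<bar>x - v\<bar>"
        using \<open>x - v < 0\<close> real_sqrt_minus[of "x - v"] by simp
      ultimately show ?thesis by simp
    qed
    then show "((\<lambda>x. 2 * sqrt (x - v)) has_vector_derivative 1 / sqrt \<bar>x - v\<bar>) (at x)"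
      by (simp only: has_real_derivative_iff_has_vector_derivative)
  qed (use assms in \<open>auto intro!: continuous_intros\<close>)
  then have "((\<lambda>x. if x \<in> {a..b} then 1 / sqrt \<bar>x - v\<bar> else 0) has_integral 2 * sqrt (b - v) - 2 * sqrt (a - v)) UNIV"
    by (simp only: has_integral_restrict_UNIV)
  also have "(\<lambda>x. if x \<in> {a..b} then 1 / sqrt \<bar>x - v\<bar> else 0) = (\<lambda>x. indicator {a..b} x / sqrt \<bar>x - v\<bar>)"
    by (auto simp: fun_eq_iff indicator_def)
  finally have "(\<integral>\<^sup>+x. ennreal (indicator {a..b} x / sqrt \<bar>x - v\<bar>) \<partial>lborel) = ennreal (2 * sqrt (b - v) - 2 * sqrt (a - v))"
    by (intro nn_integral_has_integral_lborel) auto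
  also have "\<dots> \<le> ennreal (4 * sqrt (b - a))"
    using sqrt_shift_diff_le[of "b - a" "a - v"] assms by (intro ennreal_leI) (simp add: algebra_simps)
  finally show ?thesis .
qed

text \<open>Since \<open>|a| |b| \<le> |a + \<i> b|\<^sup>2\<close>, the kernel is dominated by a
  product of two one-dimensional kernels \<open>1 / sqrt |t|\<close>. The bound does not depend on
  \<open>z\<close> and tends to 0 with the height of the box; the latter controls thin strips around
  the axis.\<close>

lemma nn_integral_cauchy_kernel_le:
  assumes "a \<le> b" "c \<le> d"
  shows "(\<integral>\<^sup>+w. ennreal (indicator (cbox (Complex a c) (Complex b d)) w / norm (w - z)) \<partial>lborel)
    \<le> ennreal (16 * sqrt ((b - a) * (d - c)))"
proof -
  \<comment> \<open>The lines through \<open>z\<close> are excluded: there the right-hand side is 0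
    because \<open>1 / 0 = 0\<close>, while the left-hand side need not be.\<close>
  have ineq: "indicator (cbox (Complex a c) (Complex b d)) (Complex x u) / norm (Complex x u - z) \<le>
      (indicator {c..d} u / sqrt \<bar>u - Im z\<bar>) * (indicator {a..b} x / sqrt \<bar>x - Re z\<bar>)" (is "?l \<le> ?r")
    if "x \<noteq> Re z" "u \<noteq> Im z" for x u
  proof (cases "x \<in> {a..b} \<and> u \<in> {c..d}")
    case True
    have "\<bar>u - Im z\<bar> * \<bar>x - Re z\<bar> \<le> (norm (Complex x u - z)) * (norm (Complex x u - z))"
      using abs_Re_le_cmod[of "Complex x u - z"] abs_Im_le_cmod[of "Complex x u - z"] by (intro mult_mono) auto
    then have "sqrt (\<bar>u - Im z\<bar> * \<bar>x - Re z\<bar>) \<le> norm (Complex x u - z)"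
      by (intro real_le_lsqrt) (auto simp: power2_eq_square)
    then have "1 / norm (Complex x u - z) \<le> 1 / (sqrt \<bar>u - Im z\<bar> * sqrt \<bar>x - Re z\<bar>)"
      using that by (intro divide_left_mono) (auto simp: real_sqrt_mult complex_eq_iff intro!: mult_pos_pos)
    then show ?thesis using True by (simp add: indicator_def in_cbox_complex_iff)
  qed (auto simp: indicator_def in_cbox_complex_iff)
  have "(\<integral>\<^sup>+w. ennreal (indicator (cbox (Complex a c) (Complex b d)) w / norm (w - z)) \<partial>lborel) =
      (\<integral>\<^sup>+u. \<integral>\<^sup>+x. ennreal (indicator (cbox (Complex a c) (Complex b d)) (Complex x u) / norm (Complex x u - z)) \<partial>lborel \<partial>lborel)"
    by (rule nn_integral_complex) measurable
  also have "\<dots> \<le> (\<integral>\<^sup>+u. \<integral>\<^sup>+x. ennreal (indicator {c..d} u / sqrt \<bar>u - Im z\<bar>) * ennreal (indicator {a..b} x / sqrt \<bar>x - Re z\<bar>) \<partial>lborel \<partial>lborel)"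
  proof (rule nn_integral_mono_AE)
    have "AE u in lborel. u \<noteq> Im z" by (rule AE_lborel_singleton)
    then show "AE u in lborel. (\<integral>\<^sup>+x. ennreal (indicator (cbox (Complex a c) (Complex b d)) (Complex x u) / norm (Complex x u - z)) \<partial>lborel)
      \<le> (\<integral>\<^sup>+x. ennreal (indicator {c..d} u / sqrt \<bar>u - Im z\<bar>) * ennreal (indicator {a..b} x / sqrt \<bar>x - Re z\<bar>) \<partial>lborel)"
    proof eventually_elim
      case (elim u)
      show ?case
      proof (rule nn_integral_mono_AE)
        have "AE x in lborel. x \<noteq> Re z" by (rule AE_lborel_singleton)
        then show "AE x in lborel. ennreal (indicator (cbox (Complex a c) (Complex b d)) (Complex x u) / norm (Complex x u - z))
          \<le> ennreal (indicator {c..d} u / sqrt \<bar>u - Im z\<bar>) * ennreal (indicator {a..b} x / sqrt \<bar>x - Re z\<bar>)"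
        proof eventually_elim
          fix x assume "x \<noteq> Re z"
          from ineq[OF this elim] show "ennreal (indicator (cbox (Complex a c) (Complex b d)) (Complex x u) / norm (Complex x u - z))
            \<le> ennreal (indicator {c..d} u / sqrt \<bar>u - Im z\<bar>) * ennreal (indicator {a..b} x / sqrt \<bar>x - Re z\<bar>)"
            by (subst ennreal_mult[symmetric]) (auto intro!: ennreal_leI)
        qed
      qed
    qed
  qed
  also have "\<dots> = (\<integral>\<^sup>+u. ennreal (indicator {c..d} u / sqrt \<bar>u - Im z\<bar>) * (\<integral>\<^sup>+x. ennreal (indicator {a..b} x / sqrt \<bar>x - Re z\<bar>) \<partial>lborel) \<partial>lborel)"
    by (intro nn_integral_cong nn_integral_cmult) measurable
  also have "\<dots> = (\<integral>\<^sup>+u. ennreal (indicator {c..d} u / sqrt \<bar>u - Im z\<bar>) \<partial>lborel) * (\<integral>\<^sup>+x. ennreal (indicator {a..b} x / sqrt \<bar>x - Re z\<bar>) \<partial>lborel)"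
    by (rule nn_integral_multc) measurable
  also have "\<dots> \<le> ennreal (4 * sqrt (d - c)) * ennreal (4 * sqrt (b - a))"
    by (intro mult_mono nn_integral_inverse_sqrt_le assms) auto
  also have "\<dots> = ennreal (16 * sqrt ((b - a) * (d - c)))"
    using assms by (simp add: real_sqrt_mult mult_ac flip: ennreal_mult)
  finally show ?thesis .
qed

section \<open>The Cauchy transform and its horizontal derivative\<close>

definition cauchy_transform :: "(complex \<Rightarrow> complex) \<Rightarrow> complex \<Rightarrow> complex" where
  "cauchy_transform f z = (LINT w|lborel. f w / (w - z))"

lemma cauchy_transform_bound:
  assumes f: "f \<in> borel_measurable borel" and box: "a \<le> b" "c \<le> d"
    and supp: "\<And>w. w \<notin> cbox (Complex a c) (Complex b d) \<Longrightarrow> f w = 0" and N: "\<And>w. norm (f w) \<le> N"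
  shows "integrable lborel (\<lambda>w. f w / (w - z))"
    and "integrable lborel (\<lambda>w. norm (f w) / norm (w - z))"
    and "(LINT w|lborel. norm (f w) / norm (w - z)) \<le> 16 * sqrt ((b - a) * (d - c)) * N"
    and "norm (cauchy_transform f z) \<le> 16 * sqrt ((b - a) * (d - c)) * N"
proof -
  have [measurable]: "f \<in> borel_measurable borel" by (rule f)
  have N0: "N \<ge> 0" by (rule order_trans[OF norm_ge_zero N])
  have nn: "(\<integral>\<^sup>+w. ennreal (norm (f w / (w - z))) \<partial>lborel) \<le> ennreal (16 * sqrt ((b - a) * (d - c)) * N)"
  proof -
    have "(\<integral>\<^sup>+w. ennreal (norm (f w / (w - z))) \<partial>lborel) \<le>
        (\<integral>\<^sup>+w. ennreal (indicator (cbox (Complex a c) (Complex b d)) w / norm (w - z)) * ennreal N \<partial>lborel)"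
    proof (rule nn_integral_mono)
      fix w
      have "norm (f w / (w - z)) \<le> indicator (cbox (Complex a c) (Complex b d)) w / norm (w - z) * N"
        using supp[of w] N[of w] by (auto simp: norm_divide indicator_def intro: divide_right_mono)
      then show "ennreal (norm (f w / (w - z))) \<le> ennreal (indicator (cbox (Complex a c) (Complex b d)) w / norm (w - z)) * ennreal N"
        using N0 by (simp flip: ennreal_mult'')
    qed
    also have "\<dots> = (\<integral>\<^sup>+w. ennreal (indicator (cbox (Complex a c) (Complex b d)) w / norm (w - z)) \<partial>lborel) * ennreal N"
      by (rule nn_integral_multc) measurable
    also have "\<dots> \<le> ennreal (16 * sqrt ((b - a) * (d - c))) * ennreal N"
      by (intro mult_right_mono nn_integral_cauchy_kernel_le box) auto
    finally show ?thesis using N0 by (simp flip: ennreal_mult'')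
  qed
  show i: "integrable lborel (\<lambda>w. f w / (w - z))"
    by (rule integrableI_bounded) (use nn in \<open>auto intro: le_less_trans\<close>)
  from integrable_norm[OF i] show "integrable lborel (\<lambda>w. norm (f w) / norm (w - z))"
    by (simp add: norm_divide)
  have "ennreal (LINT w|lborel. norm (f w / (w - z))) \<le> ennreal (16 * sqrt ((b - a) * (d - c)) * N)"
    using nn by (subst nn_integral_eq_integral[symmetric]) (auto intro: integrable_norm i)
  then have le: "(LINT w|lborel. norm (f w / (w - z))) \<le> 16 * sqrt ((b - a) * (d - c)) * N"
    using N0 box by (subst (asm) ennreal_le_iff) auto
  then show "(LINT w|lborel. norm (f w) / norm (w - z)) \<le> 16 * sqrt ((b - a) * (d - c)) * N"
    by (simp add: norm_divide)
  show "norm (cauchy_transform f z) \<le> 16 * sqrt ((b - a) * (d - c)) * N"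
    unfolding cauchy_transform_def by (rule order_trans[OF integral_norm_bound le])
qed

lemma vector_derivative_bound:
  fixes f :: "real \<Rightarrow> 'a::real_normed_vector"
  assumes "\<And>t. (f has_vector_derivative f' t) (at t)" "\<And>t. norm (f' t) \<le> B"
  shows "norm (f b - f a) \<le> B * \<bar>b - a\<bar>"
proof -
  have *: "norm (f b - f a) \<le> B * b - B * a" if "a < b" for a b
  proof (rule differentiable_bound_general[OF that])
    show "continuous_on {a..b} f"
      using assms(1) by (meson continuous_at_imp_continuous_on has_vector_derivative_continuous)
    show "((\<lambda>s. B * s) has_vector_derivative B) (at s)" for s
      by (auto intro!: derivative_eq_intros simp: has_vector_derivative_def)
  qed (auto intro!: continuous_intros assms)
  consider "a < b" | "a = b" | "b < a" by linarith
  then show ?thesis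
  proof cases
    case 1 then show ?thesis using *[OF 1] by (simp add: algebra_simps)
  next
    case 3 then show ?thesis using *[OF 3] by (simp add: algebra_simps norm_minus_commute)
  qed simp
qed

text \<open>This is what a derivative or an integrand of size \<open>1 / sqrt t\<close> provides
  after integration. Being dominated by \<open>sqrt\<close>, the function is uniformly continuous on
  \<open>{0<..d}\<close> and extends to 0. It is applied to slices and to truncated
  integrals.\<close>

lemma sqrt_Cauchy_limit:
  fixes f :: "real \<Rightarrow> 'a::banach"
  assumes d: "d > 0" and K: "\<And>a b. 0 < a \<Longrightarrow> a \<le> b \<Longrightarrow> b \<le> d \<Longrightarrow> norm (f b - f a) \<le> K * (sqrt b - sqrt a)"
  shows "(f \<longlongrightarrow> Lim (at_right 0) f) (at_right 0)"
    and "\<And>a. 0 < a \<Longrightarrow> a \<le> d \<Longrightarrow> norm (f a - Lim (at_right 0) f) \<le> K * sqrt a"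
proof -
  \<comment> \<open>Made positive, since \<open>e / k\<close> is used below and \<open>K\<close> may
    be 0.\<close>
  define k where "k = \<bar>K\<bar> + 1"
  have k': "norm (f b - f a) \<le> k * \<bar>sqrt b - sqrt a\<bar>" if ab: "0 < a" "a \<le> b" "b \<le> d" for a b
  proof -
    have "K * (sqrt b - sqrt a) \<le> k * (sqrt b - sqrt a)"
      using ab by (intro mult_right_mono) (auto simp: k_def)
    then show ?thesis using K[OF ab] ab by simp
  qed
  have k: "dist (f b) (f a) \<le> k * \<bar>sqrt b - sqrt a\<bar>" if "0 < a" "0 < b" "b \<le> d" "a \<le> d" for a b
  proof (cases "a \<le> b")
    case True
    show ?thesis unfolding dist_norm by (rule k'[OF that(1) True that(3)])
  next
    case False
    then have "b \<le> a" by simp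
    from k'[OF that(2) this that(4)] show ?thesis
      by (simp only: dist_norm norm_minus_commute[of "f b"] abs_minus_commute[of "sqrt b"])
  qed
  have us: "uniformly_continuous_on {0..d} sqrt"
    by (intro compact_uniformly_continuous continuous_intros) auto
  have "uniformly_continuous_on {0<..d} f"
    unfolding uniformly_continuous_on_def
  proof (intro allI impI)
    fix e :: real assume "e > 0"
    then have "e / k > 0" by (simp add: k_def)
    from us[unfolded uniformly_continuous_on_def, rule_format, OF this]
    obtain r where r: "r > 0" "\<And>x y. x \<in> {0..d} \<Longrightarrow> y \<in> {0..d} \<Longrightarrow> dist y x < r \<Longrightarrow> dist (sqrt y) (sqrt x) < e / k"
      by blast
    show "\<exists>r>0. \<forall>x\<in>{0<..d}. \<forall>y\<in>{0<..d}. dist y x < r \<longrightarrow> dist (f y) (f x) < e"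
    proof (intro exI[of _ r] conjI ballI impI r(1))
      fix x y assume xy: "x \<in> {0<..d}" "y \<in> {0<..d}" "dist y x < r"
      have "dist (f y) (f x) \<le> k * \<bar>sqrt y - sqrt x\<bar>" using xy by (intro k) auto
      also have "\<dots> < k * (e / k)"
        using r(2)[of x y] xy by (intro mult_strict_left_mono) (auto simp: dist_real_def k_def)
      finally show "dist (f y) (f x) < e" by (simp add: k_def)
    qed
  qed
  moreover have "0 \<in> closure {0<..d}" using d by (simp add: closure_greaterThanAtMost)
  ultimately obtain l where l: "(f \<longlongrightarrow> l) (at 0 within {0<..d})"
    by (rule uniformly_continuous_on_extension_at_closure)
  have "at 0 within {0<..d} = at_right 0"
    using d by (intro at_within_nhd[of _ "{..<d}"]) auto
  with l have l: "(f \<longlongrightarrow> l) (at_right 0)" by simp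
  then have L: "Lim (at_right 0) f = l" by (intro tendsto_Lim) auto
  with l show "(f \<longlongrightarrow> Lim (at_right 0) f) (at_right 0)" by simp
  fix a :: real assume a: "0 < a" "a \<le> d"
  have "norm (f a - l) \<le> K * (sqrt a - sqrt 0)"
  proof (rule tendsto_le)
    show "((\<lambda>t. norm (f a - f t)) \<longlongrightarrow> norm (f a - l)) (at_right 0)" by (intro tendsto_intros l)
    show "((\<lambda>t. K * (sqrt a - sqrt t)) \<longlongrightarrow> K * (sqrt a - sqrt 0)) (at_right 0)" by (intro tendsto_intros)
    show "\<forall>\<^sub>F t in at_right 0. norm (f a - f t) \<le> K * (sqrt a - sqrt t)"
      using eventually_at_right_less[of 0] eventually_at_right_real[OF a(1)]
      by eventually_elim (use a in \<open>auto intro!: K\<close>)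
  qed simp
  then show "norm (f a - Lim (at_right 0) f) \<le> K * sqrt a" by (simp add: L)
qed

text \<open>Only horizontal derivatives enter the estimates, which permits cutoffs depending on
  the imaginary part.\<close>
definition xreg :: "complex set \<Rightarrow> (complex \<Rightarrow> complex) \<Rightarrow> (complex \<Rightarrow> complex) \<Rightarrow> bool" where
  "xreg L f f' \<longleftrightarrow> continuous_on UNIV f \<and> continuous_on UNIV f' \<and> (\<forall>z. z \<notin> L \<longrightarrow> f z = 0 \<and> f' z = 0) \<and>
    (\<forall>x u. ((\<lambda>x. f (Complex x u)) has_vector_derivative f' (Complex x u)) (at x))"

lemma in_centered_cbox: "norm w \<le> s \<Longrightarrow> w \<in> cbox (Complex (- s) (- s)) (Complex s s)"
  using abs_Re_le_cmod[of w] abs_Im_le_cmod[of w] by (auto simp: in_cbox_complex_iff)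

lemma compact_complex_box:
  assumes "compact L"
  obtains s where "s > 0" "L \<subseteq> cbox (Complex (- s) (- s)) (Complex s s)" "\<And>z. z \<in> L \<Longrightarrow> norm z \<le> s"
proof -
  obtain s where "s > 0" "\<And>z. z \<in> L \<Longrightarrow> norm z \<le> s"
    using compact_imp_bounded[OF assms] by (auto simp: bounded_pos)
  then show ?thesis
    using that[of s] in_centered_cbox by (metis subsetI)
qed

lemma integrable_cauchy_kernel_box:
  assumes "a \<le> b" "c \<le> d"
  shows "integrable lborel (\<lambda>w. indicator (cbox (Complex a c) (Complex b d)) w * N / norm (w - z))"
proof -
  have "integrable lborel (\<lambda>w. norm (indicator (cbox (Complex a c) (Complex b d)) w :: complex) / norm (w - z))"
    by (rule cauchy_transform_bound(2)[OF _ assms, where N = 1]) (auto simp: indicator_def)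
  from integrable_mult_right[OF this, of N]
  show ?thesis
    by (rule Bochner_Integration.integrable_cong[THEN iffD1, rotated -1]) (auto simp: indicator_def)
qed

lemma cauchy_transform_translate:
  assumes [measurable]: "f \<in> borel_measurable borel"
  shows "cauchy_transform f (z + t) = (LINT w|lborel. f (t + w) / (w - z))"
  unfolding cauchy_transform_def
  using lborel_integral_translate(1)[of "\<lambda>w. f w / (w - (z + t))" t] by simp

text \<open>Translation moves the singularity to the fixed point 0 and the dependence on
  \<open>z\<close> into \<open>f\<close>; dominated convergence then applies with the majorant
  \<open>N / norm w\<close> on a box containing all translated supports.\<close>

lemma continuous_cauchy_transform:
  assumes f: "continuous_on UNIV f" and L: "compact L" "\<And>z. z \<notin> L \<Longrightarrow> f z = 0"
  shows "continuous_on UNIV (cauchy_transform f)"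
  unfolding continuous_on_eq_continuous_at[OF open_UNIV] continuous_at_sequentially
proof (intro ballI allI impI)
  fix z and Z :: "nat \<Rightarrow> complex" assume Z: "Z \<longlonglongrightarrow> z"
  have [measurable]: "f \<in> borel_measurable borel" using f by (rule borel_measurable_continuous_onI)
  obtain r where r: "r > 0" "\<And>n. norm (Z n) \<le> r"
    using convergent_imp_Bseq[OF convergentI[OF Z]] by (auto simp: Bseq_def)
  obtain s where s: "s > 0" "\<And>z. z \<in> L \<Longrightarrow> norm z \<le> s" by (rule compact_complex_box[OF L(1)]) blast
  obtain N where N: "N > 0" "\<And>z. norm (f z) \<le> N" using bounded_compact_support[OF L(1) f L(2)] by auto
  define B where "B = cbox (Complex (- (r + s)) (- (r + s))) (Complex (r + s) (r + s))"
  have zero: "f (v + w) = 0" if "norm v \<le> r" "w \<notin> B" for v w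
  proof (rule L(2), rule notI)
    assume "v + w \<in> L"
    from s(2)[OF this] that(1) norm_triangle_ineq4[of "v + w" v] have "norm w \<le> r + s" by simp
    with that(2) show False unfolding B_def by (auto dest: in_centered_cbox)
  qed
  have eq: "cauchy_transform f v = (LINT w|lborel. f (v + w) / (w - 0))" for v
    using cauchy_transform_translate[of f 0 v] by simp
  have "(\<lambda>n. LINT w|lborel. f (Z n + w) / (w - 0)) \<longlonglongrightarrow> (LINT w|lborel. f (z + w) / (w - 0))"
  proof (rule integral_dominated_convergence)
    show "integrable lborel (\<lambda>w. indicator B w * N / norm (w - 0))"
      unfolding B_def using r s by (intro integrable_cauchy_kernel_box) auto
    show "AE w in lborel. (\<lambda>n. f (Z n + w) / (w - 0)) \<longlonglongrightarrow> f (z + w) / (w - 0)"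
    proof (rule AE_I2)
      fix w
      have "(\<lambda>n. f (Z n + w)) \<longlonglongrightarrow> f (z + w)"
        by (rule continuous_on_tendsto_compose[OF f]) (auto intro!: tendsto_intros Z)
      then show "(\<lambda>n. f (Z n + w) / (w - 0)) \<longlonglongrightarrow> f (z + w) / (w - 0)"
        unfolding divide_inverse by (rule tendsto_mult_right)
    qed
    show "AE w in lborel. norm (f (Z n + w) / (w - 0)) \<le> indicator B w * N / norm (w - 0)" for n
      using N zero[OF r(2)[of n]] by (intro AE_I2) (auto simp: norm_divide indicator_def intro: divide_right_mono)
  qed auto
  then show "(cauchy_transform f \<circ> Z) \<longlonglongrightarrow> cauchy_transform f z" by (simp only: o_def eq[symmetric])
qed

text \<open>After translation the difference quotient falls on \<open>f\<close>, where the
  horizontal mean value bound \<open>N\<close> applies; the singular kernel itself is never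
  differentiated.\<close>

lemma has_vector_derivative_cauchy_transform:
  assumes f: "xreg L f f'" and L: "compact L"
  shows "((\<lambda>x. cauchy_transform f (Complex x u)) has_vector_derivative cauchy_transform f' (Complex x u)) (at x)"
  unfolding has_vector_derivative_iff_quotient tendsto_at_iff_sequentially
proof (intro allI impI)
  fix X :: "nat \<Rightarrow> real" assume X: "\<forall>i. X i \<in> UNIV - {0}" "X \<longlonglongrightarrow> 0"
  define z where "z = Complex x u"
  have cont: "continuous_on UNIV f" "continuous_on UNIV f'" and zL: "\<And>z. z \<notin> L \<Longrightarrow> f z = 0" "\<And>z. z \<notin> L \<Longrightarrow> f' z = 0"
    and D: "\<And>x u. ((\<lambda>x. f (Complex x u)) has_vector_derivative f' (Complex x u)) (at x)"
    using f by (auto simp: xreg_def)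
  have [measurable]: "f \<in> borel_measurable borel" "f' \<in> borel_measurable borel"
    using cont by (auto intro: borel_measurable_continuous_onI)
  obtain r where r: "r > 0" "\<And>n. norm (X n) \<le> r"
    using convergent_imp_Bseq[OF convergentI[OF X(2)]] by (auto simp: Bseq_def)
  obtain s where s: "s > 0" "L \<subseteq> cbox (Complex (- s) (- s)) (Complex s s)" "\<And>z. z \<in> L \<Longrightarrow> norm z \<le> s"
    by (rule compact_complex_box[OF L]) blast
  obtain N where N: "N > 0" "\<And>z. norm (f' z) \<le> N" using bounded_compact_support[OF L cont(2) zL(2)] by auto
  obtain N' where N': "N' > 0" "\<And>z. norm (f z) \<le> N'" using bounded_compact_support[OF L cont(1) zL(1)] by auto
  have quot: "norm (f (of_real t + w) - f w) \<le> N * \<bar>t\<bar>" for t w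
  proof -
    have "norm (f (Complex (Re w + t) (Im w)) - f (Complex (Re w) (Im w))) \<le> N * \<bar>Re w + t - Re w\<bar>"
      by (rule vector_derivative_bound[OF D N(2)])
    moreover have "Complex (Re w + t) (Im w) = of_real t + w" by (simp add: complex_eq_iff)
    ultimately show ?thesis by simp
  qed
  define B where "B = cbox (Complex (- (r + s)) (- (r + s))) (Complex (r + s) (r + s))"
  have zero: "f (of_real (X n) + w) = 0" "f w = 0" if "w \<notin> B" for w n
  proof -
    have "norm w > r + s" using that unfolding B_def by (meson in_centered_cbox not_le)
    then have "norm (of_real (X n) + w) > s" "norm w > s"
      using norm_triangle_ineq4[of "of_real (X n) + w" "of_real (X n)"] r(1) r(2)[of n] by auto
    then show "f (of_real (X n) + w) = 0" "f w = 0" using s(3) zL(1) by (meson not_le)+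
  qed
  have int: "integrable lborel (\<lambda>w. f w / (w - z))" for z
    using s(1,2) zL(1) by (intro cauchy_transform_bound(1)[of _ "-s" s "-s" s N'] N') auto
  have int': "integrable lborel (\<lambda>w. f (of_real t + w) / (w - z))" for t
    using int[of "z + of_real t"] lborel_integral_translate(2)[of "\<lambda>w. f w / (w - (z + of_real t))" "of_real t"]
    by simp
  have "(\<lambda>n. LINT w|lborel. (1 / X n) *\<^sub>R (f (of_real (X n) + w) - f w) / (w - z)) \<longlonglongrightarrow> (LINT w|lborel. f' w / (w - z))"
  proof (rule integral_dominated_convergence)
    show "integrable lborel (\<lambda>w. indicator B w * N / norm (w - z))"
      unfolding B_def using r s by (intro integrable_cauchy_kernel_box) auto
    show "AE w in lborel. (\<lambda>n. (1 / X n) *\<^sub>R (f (of_real (X n) + w) - f w) / (w - z)) \<longlonglongrightarrow> f' w / (w - z)"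
    proof (rule AE_I2)
      fix w
      have "((\<lambda>h. (1 / h) *\<^sub>R (f (Complex (Re w + h) (Im w)) - f (Complex (Re w) (Im w)))) \<longlongrightarrow> f' (Complex (Re w) (Im w))) (at 0)"
        using D[of "Im w" "Re w"] unfolding has_vector_derivative_iff_quotient .
      from this[unfolded tendsto_at_iff_sequentially, rule_format, OF X(1)[rule_format] X(2)]
      have "(\<lambda>n. (1 / X n) *\<^sub>R (f (Complex (Re w + X n) (Im w)) - f (Complex (Re w) (Im w)))) \<longlonglongrightarrow> f' (Complex (Re w) (Im w))"
        by (simp only: o_def)
      moreover have "Complex (Re w + t) (Im w) = of_real t + w" for t by (simp add: complex_eq_iff)
      ultimately have "(\<lambda>n. (1 / X n) *\<^sub>R (f (of_real (X n) + w) - f w)) \<longlonglongrightarrow> f' w" by simp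
      then show "(\<lambda>n. (1 / X n) *\<^sub>R (f (of_real (X n) + w) - f w) / (w - z)) \<longlonglongrightarrow> f' w / (w - z)"
        unfolding divide_inverse[of _ "w - z"] by (rule tendsto_mult_right)
    qed
    show "AE w in lborel. norm ((1 / X n) *\<^sub>R (f (of_real (X n) + w) - f w) / (w - z)) \<le> indicator B w * N / norm (w - z)" for n
    proof (rule AE_I2)
      fix w
      have "norm ((1 / X n) *\<^sub>R (f (of_real (X n) + w) - f w)) \<le> N"
        using quot[of "X n" w] X(1)[rule_format, of n] unfolding norm_scaleR by (simp add: field_simps)
      then show "norm ((1 / X n) *\<^sub>R (f (of_real (X n) + w) - f w) / (w - z)) \<le> indicator B w * N / norm (w - z)"
        using zero(1)[of w n] zero(2)[of w] unfolding norm_divide[of _ "w - z"]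
        by (cases "w \<in> B") (simp_all only: indicator_simps mult_1 divide_right_mono norm_ge_zero, simp)
    qed
  qed auto
  moreover have "(LINT w|lborel. (1 / X n) *\<^sub>R (f (of_real (X n) + w) - f w) / (w - z)) =
      (1 / X n) *\<^sub>R (cauchy_transform f (Complex (x + X n) u) - cauchy_transform f (Complex x u))" for n
  proof -
    have "Complex (x + X n) u = z + of_real (X n)" by (simp add: z_def complex_eq_iff)
    then have "cauchy_transform f (Complex (x + X n) u) - cauchy_transform f (Complex x u) =
        (LINT w|lborel. f (of_real (X n) + w) / (w - z) - f w / (w - z))"
      using int int' by (simp add: cauchy_transform_translate) (simp add: cauchy_transform_def z_def)
    also have "(1 / X n) *\<^sub>R \<dots> = (LINT w|lborel. (1 / X n) *\<^sub>R (f (of_real (X n) + w) / (w - z) - f w / (w - z)))"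
      by simp
    finally show ?thesis by (simp add: diff_divide_distrib scaleR_conv_of_real mult.commute)
  qed
  ultimately show "((\<lambda>h. (1 / h) *\<^sub>R (cauchy_transform f (Complex (x + h) u) - cauchy_transform f (Complex x u))) \<circ> X)
      \<longlonglongrightarrow> cauchy_transform f' (Complex x u)"
    by (simp add: o_def z_def cauchy_transform_def)
qed

text \<open>The right-hand side of the distribution resolvent equation applies \<open>R\<close> to
  such products, which must therefore belong to the class in which \<open>R(f)\<close> is estimated.
  The transform is not compactly supported; the factor \<open>f\<close> provides the support
  \<open>L\<close>.\<close>

lemma xreg_mult_cauchy_transform:
  assumes f: "xreg L f f'" "compact L" and k: "xreg L' k k'" "compact L'"
  shows "xreg L (\<lambda>z. f z * cauchy_transform k z) (\<lambda>z. f z * cauchy_transform k' z + f' z * cauchy_transform k z)"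
proof -
  have c: "continuous_on UNIV (cauchy_transform k)" "continuous_on UNIV (cauchy_transform k')"
    using k by (auto simp: xreg_def intro!: continuous_cauchy_transform)
  show ?thesis
    using f c unfolding xreg_def
    by (auto intro!: continuous_intros derivative_eq_intros has_vector_derivative_cauchy_transform[OF k])
qed

section \<open>Slices of a resolvent of moderate growth\<close>

lemma has_integral_zero_extend:
  fixes f :: "'n::euclidean_space \<Rightarrow> 'b::banach"
  assumes "f integrable_on S" "S \<subseteq> T" "\<And>x. x \<notin> S \<Longrightarrow> f x = 0"
  shows "f integrable_on T" "integral T f = integral S f"
proof -
  have "(f has_integral integral S f) T"
    by (rule has_integral_on_superset[OF integrable_integral[OF assms(1)]]) (use assms in auto)
  then show "f integrable_on T" "integral T f = integral S f" by (auto simp: integral_unique)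
qed

lemma bounded_linear_cinner: "bounded_linear (cinner F)"
  by (rule bounded_linear_intro[of _ "norm F"])
    (use cinner_bound[of F] in \<open>auto simp: cinner_add_right scaleR_scaleC cinner_scaleC_right scaleR_conv_of_real mult.commute\<close>)

lemma compact_real_interval:
  fixes K :: "real set"
  assumes "compact K"
  obtains a b where "a < b" "K \<subseteq> {a<..<b}"
proof -
  obtain r where "r > 0" "\<And>x. x \<in> K \<Longrightarrow> \<bar>x\<bar> \<le> r"
    using compact_imp_bounded[OF assms] by (auto simp: bounded_pos)
  then show ?thesis by (intro that[of "- (r + 1)" "r + 1"]) (auto simp: abs_le_iff, fastforce+)
qed

text \<open>Holomorphy is not listed: the resolvent identity and the local bound imply it, see
  \<open>continuous_R\<close> and \<open>matrix_element_deriv\<close>. The set \<open>L\<close> in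
  \<open>R_bound\<close> may meet the axis, and this is the substance of the assumption.\<close>

locale boundary_resolvent =
  fixes G :: "'a::euclidean_space set" and G1 I :: "real set" and R :: "complex \<Rightarrow> 'a l2 \<Rightarrow>\<^sub>L 'a l2"
  assumes Gb: "G \<in> sets borel"
    and G1: "open G1" and I: "open I" "is_interval I" "0 \<in> I"
    and R_ops: "\<And>z. Re z \<in> G1 \<Longrightarrow> Im z \<in> I \<Longrightarrow> Im z \<noteq> 0 \<Longrightarrow> R z \<in> ops G"
    and R_id: "\<And>z w. Re z \<in> G1 \<Longrightarrow> Im z \<in> I \<Longrightarrow> Im z \<noteq> 0 \<Longrightarrow> Re w \<in> G1 \<Longrightarrow> Im w \<in> I \<Longrightarrow> Im w \<noteq> 0 \<Longrightarrow>
      R z - R w = (w - z) *\<^sub>O (R z o\<^sub>L R w)"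
    and R_bound: "\<And>L. compact L \<Longrightarrow> (\<And>z. z \<in> L \<Longrightarrow> Re z \<in> G1 \<and> Im z \<in> I) \<Longrightarrow>
      \<exists>M\<ge>0. \<forall>z\<in>L. Im z \<noteq> 0 \<longrightarrow> norm (R z) \<le> M / \<bar>Im z\<bar>"
begin

definition U :: "complex set" where "U = {z. Re z \<in> G1 \<and> Im z \<in> I \<and> Im z \<noteq> 0}"

lemma U_iff: "z \<in> U \<longleftrightarrow> Re z \<in> G1 \<and> Im z \<in> I \<and> Im z \<noteq> 0" by (simp add: U_def)

lemma open_U: "open U"
proof -
  have "U = Re -` G1 \<inter> Im -` (I - {0})" by (auto simp: U_def)
  then show ?thesis
    using G1 I by (auto intro!: open_Int open_vimage open_Diff continuous_intros)
qed

lemma norm_R_locally_bounded: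
  assumes "z \<in> U"
  obtains e B where "e > 0" "ball z e \<subseteq> U" "B \<ge> 0" "\<And>w. w \<in> ball z e \<Longrightarrow> norm (R w) \<le> B"
proof -
  obtain d where d: "d > 0" "cball z d \<subseteq> U" using open_U assms open_contains_cball by blast
  define e where "e = min d (\<bar>Im z\<bar> / 2)"
  have e: "e > 0" using d assms by (auto simp: e_def U_iff)
  obtain M where M: "M \<ge> 0" "\<And>w. w \<in> cball z d \<Longrightarrow> Im w \<noteq> 0 \<Longrightarrow> norm (R w) \<le> M / \<bar>Im w\<bar>"
    using R_bound[of "cball z d"] d(2) by (auto simp: U_iff subset_iff)
  show ?thesis
  proof (rule that[OF e])
    show "ball z e \<subseteq> U" using d by (auto simp: e_def subset_iff)
    show "0 \<le> M / (\<bar>Im z\<bar> / 2)" using M by simp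
    fix w assume w: "w \<in> ball z e"
    then have "\<bar>Im z - Im w\<bar> < \<bar>Im z\<bar> / 2"
      using abs_Im_le_cmod[of "z - w"] by (simp add: dist_norm e_def)
    then have iw: "\<bar>Im w\<bar> \<ge> \<bar>Im z\<bar> / 2" by linarith
    have iz: "Im z \<noteq> 0" using assms by (simp add: U_iff)
    have "norm (R w) \<le> M / \<bar>Im w\<bar>" using w iw iz by (intro M) (auto simp: e_def)
    also have "\<dots> \<le> M / (\<bar>Im z\<bar> / 2)" using iw iz M by (intro divide_left_mono) auto
    finally show "norm (R w) \<le> M / (\<bar>Im z\<bar> / 2)" .
  qed
qed

lemma R_diff: "z \<in> U \<Longrightarrow> w \<in> U \<Longrightarrow> R z - R w = (w - z) *\<^sub>O (R z o\<^sub>L R w)"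
  by (rule R_id) (auto simp: U_iff)

lemma continuous_R: "continuous_on U R"
  unfolding continuous_on_eq_continuous_at[OF open_U]
proof
  fix z assume z: "z \<in> U"
  obtain e B where e: "e > 0" "ball z e \<subseteq> U" and B: "B \<ge> 0" "\<And>w. w \<in> ball z e \<Longrightarrow> norm (R w) \<le> B"
    by (rule norm_R_locally_bounded[OF z]) blast
  have "((\<lambda>w. norm (R w - R z)) \<longlongrightarrow> 0) (at z)"
  proof (rule tendsto_sandwich[OF _ _ tendsto_const])
    show "\<forall>\<^sub>F w in at z. norm (R w - R z) \<le> norm (z - w) * (B * B)"
      using eventually_at_in_open'[OF open_ball, of z z e]
    proof (rule eventually_mono)
      fix w assume w: "w \<in> ball z e"
      have "norm (R w - R z) = norm (z - w) * norm (R w o\<^sub>L R z)"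
        using w e z by (subst R_diff) (auto simp: norm_scale_op)
      also have "\<dots> \<le> norm (z - w) * (B * B)"
        using w e by (intro mult_left_mono order_trans[OF norm_blinfun_compose] mult_mono B) auto
      finally show "norm (R w - R z) \<le> norm (z - w) * (B * B)" .
    qed (use e in simp)
    show "((\<lambda>w. norm (z - w) * (B * B)) \<longlongrightarrow> 0) (at z)"
      by (auto intro!: tendsto_eq_intros)
  qed auto
  then show "isCont R z" by (simp add: isCont_def LIM_zero_iff tendsto_norm_zero_iff)
qed

lemma continuous_matrix_element:
  "continuous_on U (\<lambda>z. cinner F (blinfun_apply (R z) F'))"
  "continuous_on U (\<lambda>z. cinner F (blinfun_apply (R z) (blinfun_apply (R z) F')))"
  by (intro bounded_linear.continuous_on[OF bounded_linear_cinner] blinfun.continuous_on continuous_R continuous_on_const)+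

text \<open>By the resolvent identity the difference quotient is exactly
  \<open>- cinner F (R w (R z F'))\<close>, so the continuity of \<open>R\<close> gives the
  limit.\<close>

lemma matrix_element_deriv:
  assumes z: "z \<in> U"
  shows "((\<lambda>z. cinner F (blinfun_apply (R z) F')) has_field_derivative - cinner F (R z (R z F'))) (at z)"
  unfolding has_field_derivative_iff
proof (rule Lim_transform_eventually)
  have "continuous_on U (\<lambda>w. - cinner F (blinfun_apply (R w) (R z F')))"
    by (intro continuous_intros continuous_matrix_element)
  then show "((\<lambda>w. - cinner F (blinfun_apply (R w) (R z F'))) \<longlongrightarrow> - cinner F (R z (R z F'))) (at z)"
    using z open_U by (auto simp: continuous_on_eq_continuous_at isCont_def)
  show "\<forall>\<^sub>F w in at z. - cinner F (blinfun_apply (R w) (R z F')) =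
      (cinner F (blinfun_apply (R w) F') - cinner F (blinfun_apply (R z) F')) / (w - z)"
    using eventually_at_in_open[OF open_U z]
  proof eventually_elim
    case (elim w)
    have "cinner F (blinfun_apply (R w) F') - cinner F (blinfun_apply (R z) F') = cinner F ((R w - R z) F')"
      by (simp add: blinfun.diff_left cinner_diff_right)
    also have "\<dots> = (z - w) * cinner F (R w (R z F'))"
      using elim z by (subst R_diff) (auto simp: cinner_scaleC_right)
    also have "\<dots> / (w - z) = - cinner F (R w (R z F'))"
      using elim by (simp add: field_simps)
    finally show ?case by simp
  qed
qed

lemma slice_continuous:
  assumes K1: "compact K1" "K1 \<subseteq> G1" and \<psi>: "continuous_on UNIV \<psi>" "\<And>x. x \<notin> K1 \<Longrightarrow> \<psi> x = 0"
    and u: "u \<in> I" "u \<noteq> 0"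
  shows "continuous_on UNIV (\<lambda>x. \<psi> x *\<^sub>O R (Complex x u))"
proof (rule continuous_on_extend_zero[OF G1 compact_imp_closed[OF K1(1)] K1(2)])
  have "continuous_on G1 (\<lambda>x. R (Complex x u))"
    by (rule continuous_on_compose2[OF continuous_R]) (use u in \<open>auto simp: U_iff Complex_eq intro!: continuous_intros\<close>)
  then show "continuous_on G1 (\<lambda>x. \<psi> x *\<^sub>O R (Complex x u))"
    by (intro continuous_intros continuous_on_subset[OF \<psi>(1)]) auto
qed (simp add: \<psi>(2) scale_op.zero_left)

lemma slice_eq:
  assumes K1: "compact K1" "K1 \<subseteq> G1" and \<psi>: "continuous_on UNIV \<psi>" "\<And>x. x \<notin> K1 \<Longrightarrow> \<psi> x = 0"
    and u: "u \<in> I" "u \<noteq> 0" and ab: "K1 \<subseteq> {a..b}"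
  shows "(\<lambda>x. \<psi> x *\<^sub>O R (Complex x u)) integrable_on UNIV"
    "slice R u \<psi> = integral {a..b} (\<lambda>x. \<psi> x *\<^sub>O R (Complex x u))"
    "(\<lambda>x. \<psi> x * cinner F (R (Complex x u) F')) integrable_on {a..b}"
    "cinner F (slice R u \<psi> F') = integral {a..b} (\<lambda>x. \<psi> x * cinner F (R (Complex x u) F'))"
proof -
  let ?f = "\<lambda>x. \<psi> x *\<^sub>O R (Complex x u)"
  have i: "?f integrable_on {a..b}"
    by (intro integrable_continuous_real continuous_on_subset[OF slice_continuous[OF K1 \<psi> u]]) auto
  have z: "?f x = 0" if "x \<notin> {a..b}" for x
  proof -
    have "x \<notin> K1" using ab that by auto
    then show ?thesis by (simp add: \<psi>(2) scale_op.zero_left)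
  qed
  show "?f integrable_on UNIV" by (rule has_integral_zero_extend(1)[OF i _ z]) auto
  show s: "slice R u \<psi> = integral {a..b} ?f"
    unfolding slice_def by (rule has_integral_zero_extend(2)[OF i _ z]) auto
  show "cinner F (slice R u \<psi> F') = integral {a..b} (\<lambda>x. \<psi> x * cinner F (R (Complex x u) F'))"
    using integral_linear[OF i bounded_linear_matrix_element[of F F']] by (simp add: s o_def cinner_scaleC_right)
  show "(\<lambda>x. \<psi> x * cinner F (R (Complex x u) F')) integrable_on {a..b}"
    using integrable_linear[OF i bounded_linear_matrix_element[of F F']] by (simp add: o_def cinner_scaleC_right)
qed

lemma slice_diff:
  assumes K1: "compact K1" "K1 \<subseteq> G1" and u: "u \<in> I" "u \<noteq> 0"
    and \<psi>: "continuous_on UNIV \<psi>" "\<And>x. x \<notin> K1 \<Longrightarrow> \<psi> x = 0"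
    and \<psi>': "continuous_on UNIV \<psi>'" "\<And>x. x \<notin> K1 \<Longrightarrow> \<psi>' x = 0"
  shows "slice R u (\<lambda>x. \<psi> x - \<psi>' x) = slice R u \<psi> - slice R u \<psi>'"
    "slice R u (\<lambda>x. \<psi> x + \<psi>' x) = slice R u \<psi> + slice R u \<psi>'"
    "slice R u (\<lambda>x. c * \<psi> x) = c *\<^sub>O slice R u \<psi>"
proof -
  obtain a b where ab: "K1 \<subseteq> {a<..<b}" by (rule compact_real_interval[OF K1(1)])
  then have ab: "K1 \<subseteq> {a..b}" by auto
  have i: "(\<lambda>x. \<psi> x *\<^sub>O R (Complex x u)) integrable_on UNIV" "(\<lambda>x. \<psi>' x *\<^sub>O R (Complex x u)) integrable_on UNIV"
    using slice_eq(1)[OF K1 \<psi> u ab] slice_eq(1)[OF K1 \<psi>' u ab] by auto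
  show "slice R u (\<lambda>x. \<psi> x - \<psi>' x) = slice R u \<psi> - slice R u \<psi>'"
    "slice R u (\<lambda>x. \<psi> x + \<psi>' x) = slice R u \<psi> + slice R u \<psi>'"
    using i unfolding slice_def
    by (simp_all add: scale_op.diff_left scale_op.add_left Henstock_Kurzweil_Integration.integral_diff
        Henstock_Kurzweil_Integration.integral_add)
  show "slice R u (\<lambda>x. c * \<psi> x) = c *\<^sub>O slice R u \<psi>"
    using integral_linear[OF i(1) scale_op.bounded_linear_right[of c]] by (simp add: slice_def o_def)
qed

lemma slice_ops:
  assumes K1: "compact K1" "K1 \<subseteq> G1" and \<psi>: "\<And>x. x \<notin> K1 \<Longrightarrow> \<psi> x = 0" and u: "u \<in> I" "u \<noteq> 0"
  shows "slice R u \<psi> \<in> ops G"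
  unfolding slice_def
proof (rule ops_integral[OF Gb])
  fix x show "\<psi> x *\<^sub>O R (Complex x u) \<in> ops G"
  proof (cases "x \<in> K1")
    case True
    then show ?thesis using K1(2) u by (intro ops_scale R_ops) auto
  qed (simp add: \<psi> scale_op.zero_left ops_zero)
qed

text \<open>The derivative falls on the test function because \<open>R\<close> is holomorphic off the real axis.\<close>
lemma slice_has_vector_derivative:
  assumes K1: "compact K1" "K1 \<subseteq> G1"
    and D: "\<And>z. (\<phi> has_derivative (\<lambda>h. Re h *\<^sub>R \<phi>x z + Im h *\<^sub>R \<phi>u z)) (at z)"
    and cont: "continuous_on UNIV \<phi>x" "continuous_on UNIV \<phi>u"
    and zero: "\<And>z. Re z \<notin> K1 \<Longrightarrow> \<phi> z = 0"
    and u: "u \<in> I" "u \<noteq> 0"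
  shows "((\<lambda>u. cinner F (slice R u (\<lambda>x. \<phi> (Complex x u)) F')) has_vector_derivative
    cinner F (slice R u (\<lambda>x. \<phi>u (Complex x u) - \<i> * \<phi>x (Complex x u)) F')) (at u)"
proof -
  define r where "r z = cinner F (R z F')" for z
  define r' where "r' z = - cinner F (R z (R z F'))" for z
  have rD: "(r has_derivative (\<lambda>h. r' z * h)) (at z)" if "z \<in> U" for z
    using matrix_element_deriv[OF that, of F F'] unfolding r_def r'_def has_field_derivative_def .
  have r_cont: "continuous_on U r" "continuous_on U r'"
    unfolding r_def r'_def by (intro continuous_intros continuous_matrix_element)+
  have c\<phi>: "continuous_on UNIV \<phi>" using D by (meson continuous_at_imp_continuous_on has_derivative_continuous)
  have clK: "closed {z. Re z \<in> K1}"
    using continuous_closed_vimage[OF compact_imp_closed[OF K1(1)], of Re] by (simp add: vimage_def continuous_intros)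
  have zD: "(\<phi> has_derivative (\<lambda>_. 0)) (at z)" if "Re z \<notin> K1" for z
    by (rule partial_outside_support(1)[OF clK]) (use that zero in auto)
  have zero': "\<phi>x z = 0" "\<phi>u z = 0" if "Re z \<notin> K1" for z
  proof -
    have "(\<lambda>h. Re h *\<^sub>R \<phi>x z + Im h *\<^sub>R \<phi>u z) = (\<lambda>_. 0)"
      by (rule has_derivative_unique[OF D zD[OF that]])
    from fun_cong[OF this, of 1] fun_cong[OF this, of \<i>] show "\<phi>x z = 0" "\<phi>u z = 0" by auto
  qed
  \<comment> \<open>The strip on which the integrands live after extension by zero: the interval
    \<open>{a..b}\<close> chosen below contains \<open>K1\<close> but may leave
    \<open>G1\<close>.\<close>
  define W where "W = {z. Im z \<in> I \<and> Im z \<noteq> 0}"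
  have W: "continuous_on W h" if "continuous_on U h" "\<And>z. Re z \<notin> K1 \<Longrightarrow> h z = 0" for h :: "complex \<Rightarrow> complex"
  proof -
    have "continuous_on (- {z. Re z \<in> K1}) h"
      by (rule continuous_on_eq[of _ "\<lambda>_. 0"]) (use that in auto)
    then have "continuous_on (U \<union> - {z. Re z \<in> K1}) h"
      using that(1) by (intro continuous_on_open_Un open_U) (use clK in auto)
    then show ?thesis by (rule continuous_on_subset) (use K1 in \<open>auto simp: W_def U_iff\<close>)
  qed
  define q where "q z = \<phi> z * r z" for z
  define qx where "qx z = \<phi>x z * r z + \<phi> z * r' z" for z
  define qu where "qu z = \<phi>u z * r z + \<phi> z * (\<i> * r' z)" for z
  have q_cont: "continuous_on W q" "continuous_on W qx" "continuous_on W qu"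
    unfolding q_def qx_def qu_def
    by (rule W; (intro continuous_intros r_cont continuous_on_subset[OF cont(1)] continuous_on_subset[OF cont(2)]
          continuous_on_subset[OF c\<phi>])?; simp add: zero zero')+
  have qD: "(q has_derivative (\<lambda>h. Re h *\<^sub>R qx z + Im h *\<^sub>R qu z)) (at z)" if z: "z \<in> W" for z
  proof (cases "Re z \<in> K1")
    case True
    then have "z \<in> U" using z K1 by (auto simp: U_iff W_def)
    have "(q has_derivative (\<lambda>h. \<phi> z * (r' z * h) + (Re h *\<^sub>R \<phi>x z + Im h *\<^sub>R \<phi>u z) * r z)) (at z)"
      unfolding q_def by (rule has_derivative_mult[OF D rD[OF \<open>z \<in> U\<close>]])
    moreover have "\<phi> z * (r' z * h) + (Re h *\<^sub>R \<phi>x z + Im h *\<^sub>R \<phi>u z) * r z = Re h *\<^sub>R qx z + Im h *\<^sub>R qu z" for h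
      by (subst (1) complex_eq[of h]) (simp add: qx_def qu_def scaleR_conv_of_real algebra_simps)
    ultimately show ?thesis by simp
  next
    case False
    have "(q has_derivative (\<lambda>_. 0)) (at z)"
      by (rule partial_outside_support(1)[OF clK]) (use False zero in \<open>auto simp: q_def\<close>)
    then show ?thesis using zero'[OF False] zero[OF False] by (simp add: qx_def qu_def)
  qed
  have qDx: "((\<lambda>x. q (Complex x u)) has_vector_derivative qx (Complex x u)) (at x)" if "u \<in> I" "u \<noteq> 0" for x u
  proof -
    have "((\<lambda>x. Complex x u) has_derivative (\<lambda>h. of_real h)) (at x)"
      unfolding Complex_eq by (auto intro!: derivative_eq_intros)
    from has_derivative_compose[OF this qD] that show ?thesis
      by (simp add: W_def has_vector_derivative_def)
  qed
  have qDu: "((\<lambda>u. q (Complex x u)) has_vector_derivative qu (Complex x u)) (at u)" if "u \<in> I" "u \<noteq> 0" for x u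
  proof -
    have "((\<lambda>u. Complex x u) has_derivative (\<lambda>h. \<i> * of_real h)) (at u)"
      unfolding Complex_eq by (auto intro!: derivative_eq_intros)
    from has_derivative_compose[OF this qD] that show ?thesis
      by (simp add: W_def has_vector_derivative_def)
  qed
  obtain a b where ab: "a < b" "K1 \<subseteq> {a<..<b}" by (rule compact_real_interval[OF K1(1)])
  have ab': "K1 \<subseteq> {a..b}" using ab by auto
  obtain e where e: "e > 0" "ball u e \<subseteq> I - {0}"
    using open_contains_ball[of "I - {0}"] open_Diff[OF I(1), of "{0}"] u by auto
  have eI: "v \<in> I" "v \<noteq> 0" if "v \<in> ball u e" for v using subsetD[OF e(2) that] by auto
  have cs: "continuous_on {a..b} (\<lambda>x. k (Complex x v))" if "continuous_on W k" "v \<in> I" "v \<noteq> 0" for k :: "complex \<Rightarrow> complex" and v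
    by (rule continuous_on_compose2[OF that(1)]) (use that in \<open>auto simp: W_def Complex_eq intro!: continuous_intros\<close>)
  have "((\<lambda>u. integral (cbox a b) (\<lambda>x. q (Complex x u))) has_vector_derivative integral (cbox a b) (\<lambda>x. qu (Complex x u)))
      (at u within ball u e)"
  proof (rule leibniz_rule_vector_derivative)
    show "((\<lambda>u. q (Complex t u)) has_vector_derivative qu (Complex t v)) (at v within ball u e)"
      if "v \<in> ball u e" for v t
      by (rule has_vector_derivative_at_within[OF qDu[OF eI[OF that]]])
    show "(\<lambda>x. q (Complex x v)) integrable_on cbox a b" if "v \<in> ball u e" for v
      using eI[OF that] by (auto intro!: integrable_continuous_real cs q_cont)
    show "continuous_on (ball u e \<times> cbox a b) (\<lambda>(v, t). qu (Complex t v))"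
      unfolding case_prod_beta
    proof (rule continuous_on_compose2[OF q_cont(3)])
      show "continuous_on (ball u e \<times> cbox a b) (\<lambda>p. Complex (snd p) (fst p))"
        unfolding Complex_eq by (intro continuous_intros)
      show "(\<lambda>p. Complex (snd p) (fst p)) ` (ball u e \<times> cbox a b) \<subseteq> W"
        using eI by (force simp: W_def simp del: mem_ball)
    qed
    show "u \<in> ball u e" using e(1) by simp
  qed (rule convex_ball)
  then have 1: "((\<lambda>u. integral {a..b} (\<lambda>x. q (Complex x u))) has_vector_derivative integral {a..b} (\<lambda>x. qu (Complex x u))) (at u)"
    using e(1) by (simp add: at_within_open[of u "ball u e"])
  have "((\<lambda>x. qx (Complex x u)) has_integral q (Complex b u) - q (Complex a u)) {a..b}"
    using ab qDx[OF u] by (intro fundamental_theorem_of_calculus) (auto intro: has_vector_derivative_at_within)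
  moreover have "q (Complex b u) = 0" "q (Complex a u) = 0"
    using ab zero[of "Complex b u"] zero[of "Complex a u"] by (auto simp: q_def subset_iff)
  ultimately have 0: "((\<lambda>x. qx (Complex x u)) has_integral 0) {a..b}" by simp
  \<comment> \<open>Subtracting \<open>\<i>\<close> times the vanishing integral of the horizontal
    derivative cancels the terms with \<open>r'\<close>, by the Cauchy-Riemann equations for
    \<open>r\<close>; only derivatives of \<open>\<phi>\<close> remain.\<close>
  have "integral {a..b} (\<lambda>x. qu (Complex x u)) = integral {a..b} (\<lambda>x. qu (Complex x u) - \<i> * qx (Complex x u))"
  proof -
    have "(\<lambda>x. qu (Complex x u)) integrable_on {a..b}"
      using u by (intro integrable_continuous_real cs q_cont)
    from has_integral_diff[OF integrable_integral[OF this] has_integral_mult_right[OF 0, of \<i>]]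
    show ?thesis by (simp add: integral_unique)
  qed
  also have "\<dots> = integral {a..b} (\<lambda>x. (\<phi>u (Complex x u) - \<i> * \<phi>x (Complex x u)) * cinner F (R (Complex x u) F'))"
    by (intro Henstock_Kurzweil_Integration.integral_cong) (simp add: qu_def qx_def r_def algebra_simps)
  also have "\<dots> = cinner F (slice R u (\<lambda>x. \<phi>u (Complex x u) - \<i> * \<phi>x (Complex x u)) F')"
    by (rule slice_eq(4)[OF K1 _ _ u ab', symmetric])
      (auto simp: zero' Complex_eq intro!: continuous_intros continuous_on_compose2[OF cont(1)] continuous_on_compose2[OF cont(2)])
  finally have 2: "integral {a..b} (\<lambda>x. qu (Complex x u)) = cinner F (slice R u (\<lambda>x. \<phi>u (Complex x u) - \<i> * \<phi>x (Complex x u)) F')" .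
  have 3: "integral {a..b} (\<lambda>x. q (Complex x v)) = cinner F (slice R v (\<lambda>x. \<phi> (Complex x v)) F')" if "v \<in> ball u e" for v
    unfolding q_def r_def using eI[OF that]
    by (intro slice_eq(4)[OF K1 _ _ _ _ ab', symmetric])
      (auto simp: zero Complex_eq intro!: continuous_intros continuous_on_compose2[OF c\<phi>])
  show ?thesis
    using has_vector_derivative_transform_within_open[OF 1[unfolded 2] open_ball, of u e] e(1) 3 by simp
qed

end

section \<open>Growth of slices near the axis and their limits\<close>

definition C1supp :: "real set \<Rightarrow> (real \<Rightarrow> complex) \<Rightarrow> (real \<Rightarrow> complex) \<Rightarrow> bool" where
  "C1supp K \<psi> \<psi>' \<longleftrightarrow> (\<forall>x. (\<psi> has_vector_derivative \<psi>' x) (at x)) \<and> continuous_on UNIV \<psi>' \<and> (\<forall>x. x \<notin> K \<longrightarrow> \<psi> x = 0)"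

lemma C1supp_continuous: "C1supp K \<psi> \<psi>' \<Longrightarrow> continuous_on UNIV \<psi>"
  by (auto simp: C1supp_def intro!: continuous_at_imp_continuous_on has_vector_derivative_continuous)

lemma C1supp_deriv_zero:
  assumes "closed K" "C1supp K \<psi> \<psi>'" "x \<notin> K" shows "\<psi>' x = 0"
proof -
  have "(\<psi> has_derivative (\<lambda>_. 0)) (at x)"
    by (rule partial_outside_support(1)[OF assms(1) _ assms(3)]) (use assms in \<open>auto simp: C1supp_def\<close>)
  then have "(\<psi> has_vector_derivative 0) (at x)" by (simp add: has_vector_derivative_def)
  with assms show ?thesis by (auto simp: C1supp_def dest: vector_derivative_unique_at)
qed

context boundary_resolvent
begin

text \<open>The case \<open>\<phi> z = \<psi> (Re z)\<close> of the preceding formula, in which the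
  vertical derivative vanishes.\<close>

lemma slice_deriv_real:
  assumes K1: "compact K1" "K1 \<subseteq> G1" and \<psi>: "C1supp K1 \<psi> \<psi>'" and u: "u \<in> I" "u \<noteq> 0"
  shows "((\<lambda>u. cinner F (slice R u \<psi> F')) has_vector_derivative - \<i> * cinner F (slice R u \<psi>' F')) (at u)"
proof -
  note z = C1supp_deriv_zero[OF compact_imp_closed[OF K1(1)] \<psi>]
  have c': "continuous_on UNIV \<psi>'" using \<psi> by (simp add: C1supp_def)
  have "((\<lambda>z. \<psi> (Re z)) has_derivative (\<lambda>h. Re h *\<^sub>R \<psi>' (Re z) + Im h *\<^sub>R 0)) (at z)" for z
  proof -
    have "(\<psi> has_derivative (\<lambda>h. h *\<^sub>R \<psi>' (Re z))) (at (Re z))"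
      using \<psi> by (auto simp: C1supp_def has_vector_derivative_def)
    from has_derivative_compose[OF bounded_linear.has_derivative[OF bounded_linear_Re has_derivative_ident] this]
    show ?thesis by simp
  qed
  moreover have "continuous_on UNIV (\<lambda>z. \<psi>' (Re z))"
    by (rule continuous_on_compose2[OF c']) (auto intro!: continuous_intros)
  ultimately have "((\<lambda>u. cinner F (slice R u \<psi> F')) has_vector_derivative cinner F (slice R u (\<lambda>x. - \<i> * \<psi>' x) F')) (at u)"
    using slice_has_vector_derivative[OF K1 _ _ _ _ u, of "\<lambda>z. \<psi> (Re z)" "\<lambda>z. \<psi>' (Re z)" "\<lambda>_. 0" F F'] \<psi>
    by (simp add: C1supp_def)
  also have "slice R u (\<lambda>x. - \<i> * \<psi>' x) = - \<i> *\<^sub>O slice R u \<psi>'"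
    by (rule slice_diff(3)[OF K1 u c' z]) (use c' z in auto)
  finally show ?thesis by (simp add: cinner_scaleC_right)
qed

lemma norm_slice_le:
  assumes K1: "compact K1" "K1 \<subseteq> G1" "K1 \<subseteq> {a..b}" "a \<le> b"
    and \<psi>: "continuous_on UNIV \<psi>" "\<And>x. x \<notin> K1 \<Longrightarrow> \<psi> x = 0" "\<And>x. norm (\<psi> x) \<le> N"
    and u: "u \<in> I" "u \<noteq> 0" and B: "B \<ge> 0" "\<And>x. x \<in> K1 \<Longrightarrow> norm (R (Complex x u)) \<le> B"
  shows "norm (slice R u \<psi>) \<le> N * B * (b - a)"
proof -
  have eq: "slice R u \<psi> = integral {a..b} (\<lambda>x. \<psi> x *\<^sub>O R (Complex x u))"
    by (rule slice_eq(2)[OF K1(1,2) \<psi>(1) _ u K1(3)]) (rule \<psi>(2))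
  show ?thesis unfolding eq
proof (rule integral_bound[OF K1(4)])
  show "continuous_on {a..b} (\<lambda>x. \<psi> x *\<^sub>O R (Complex x u))"
    by (rule continuous_on_subset[OF slice_continuous[OF K1(1,2) \<psi>(1) _ u]]) (use \<psi>(2) in auto)
  fix x
  have N: "N \<ge> 0" by (rule order_trans[OF norm_ge_zero \<psi>(3)])
  show "norm (\<psi> x *\<^sub>O R (Complex x u)) \<le> N * B"
    by (cases "x \<in> K1") (auto simp: norm_scale_op \<psi>(2) N B(1) intro!: mult_mono \<psi>(3) B(2))
qed
qed

text \<open>One derivative of the test function buys one integration in \<open>t\<close>: a majorant
  for the slices of \<open>\<psi>'\<close> yields a bound for the variation of the slices of
  \<open>\<psi>\<close>. The factor \<open>s\<close> chooses the half plane, with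
  \<open>t > 0\<close> throughout. The mean value inequality is applied to matrix elements, with
  \<open>\<Phi>\<close> scaled by \<open>norm F * norm F'\<close>.\<close>

lemma slice_variation:
  assumes K1: "compact K1" "K1 \<subseteq> G1" and \<psi>: "C1supp K1 \<psi> \<psi>'"
    and s: "s \<in> {-1, 1 :: real}" and t: "0 < t1" "t1 \<le> t2" "\<And>t. t \<in> {t1..t2} \<Longrightarrow> s * t \<in> I"
    and \<Phi>: "\<And>t. t \<in> {t1..t2} \<Longrightarrow> (\<Phi> has_vector_derivative \<Phi>' t) (at t)"
    and b: "\<And>t. t \<in> {t1..t2} \<Longrightarrow> norm (slice R (s * t) \<psi>') \<le> \<Phi>' t"
  shows "norm (slice R (s * t2) \<psi> - slice R (s * t1) \<psi>) \<le> \<Phi> t2 - \<Phi> t1"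
proof (cases "t1 = t2")
  case False
  then have lt: "t1 < t2" using t by simp
  have cont: "continuous_on {t1..t2} \<Phi>"
    using \<Phi> by (meson continuous_at_imp_continuous_on has_vector_derivative_continuous)
  have main: "norm (f t2 - f t1) \<le> \<Phi> t2 * m - \<Phi> t1 * m"
    if m: "m \<ge> 0" and f: "\<And>t. t \<in> {t1..t2} \<Longrightarrow> (f has_vector_derivative f' t) (at t)"
      "\<And>t. t \<in> {t1..t2} \<Longrightarrow> norm (f' t) \<le> \<Phi>' t * m" for f f' :: "real \<Rightarrow> complex" and m
  proof (rule differentiable_bound_general[OF lt, where f' = f' and \<phi>' = "\<lambda>t. \<Phi>' t * m"])
    show "continuous_on {t1..t2} f"
      using f(1) by (meson continuous_at_imp_continuous_on has_vector_derivative_continuous)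
    show "continuous_on {t1..t2} (\<lambda>t. \<Phi> t * m)" by (intro continuous_intros cont)
    show "((\<lambda>t. \<Phi> t * m) has_vector_derivative \<Phi>' t * m) (at t)" if "t1 < t" "t < t2" for t
      using \<Phi>[of t] that by (intro has_vector_derivative_mult_left) auto
  qed (use f in auto)
  show ?thesis
  proof (rule norm_op_le_matrix_element)
    \<comment> \<open>The same comparison, applied to the zero function, yields
      \<open>\<Phi> t1 \<le> \<Phi> t2\<close>.\<close>
    have "norm ((0::complex) - 0) \<le> \<Phi> t2 * 1 - \<Phi> t1 * 1"
      using order_trans[OF norm_ge_zero b] by (intro main[where f' = "\<lambda>_. 0"]) auto
    then show "0 \<le> \<Phi> t2 - \<Phi> t1" by simp
    fix F F'
    have "norm (cinner F (slice R (s * t2) \<psi> F') - cinner F (slice R (s * t1) \<psi> F')) \<le>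
        \<Phi> t2 * (norm F * norm F') - \<Phi> t1 * (norm F * norm F')"
    proof (rule main)
      fix t assume t': "t \<in> {t1..t2}"
      have "(((\<lambda>u. cinner F (slice R u \<psi> F')) \<circ> (\<lambda>t. s * t)) has_vector_derivative
          s *\<^sub>R (- \<i> * cinner F (slice R (s * t) \<psi>' F'))) (at t)"
      proof (rule vector_diff_chain_at)
        show "((\<lambda>t. s * t) has_vector_derivative s) (at t)"
          by (auto intro!: derivative_eq_intros simp: has_vector_derivative_def)
        show "((\<lambda>u. cinner F (slice R u \<psi> F')) has_vector_derivative - \<i> * cinner F (slice R (s * t) \<psi>' F')) (at (s * t))"
          using t' t s by (intro slice_deriv_real[OF K1 \<psi>]) auto
      qed
      then show "((\<lambda>t. cinner F (slice R (s * t) \<psi> F')) has_vector_derivative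
          s *\<^sub>R (- \<i> * cinner F (slice R (s * t) \<psi>' F'))) (at t)" by (simp add: o_def)
      have "norm (s *\<^sub>R (- \<i> * cinner F (slice R (s * t) \<psi>' F'))) = norm (cinner F (slice R (s * t) \<psi>' F'))"
        using s by (auto simp: norm_mult)
      also have "\<dots> \<le> norm (slice R (s * t) \<psi>') * (norm F * norm F')" by (rule norm_matrix_element_le)
      also have "\<dots> \<le> \<Phi>' t * (norm F * norm F')" by (intro mult_right_mono b t') auto
      finally show "norm (s *\<^sub>R (- \<i> * cinner F (slice R (s * t) \<psi>' F'))) \<le> \<Phi>' t * (norm F * norm F')" .
    qed simp
    then show "norm (cinner F ((slice R (s * t2) \<psi> - slice R (s * t1) \<psi>) F')) \<le> (\<Phi> t2 - \<Phi> t1) * (norm F * norm F')"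
      by (simp add: blinfun.diff_left cinner_diff_right left_diff_distrib)
  qed
qed simp

text \<open>The trivial bound \<open>A * N / t\<close> for the slices of \<open>\<psi>'\<close>,
  integrated from \<open>t\<close> to \<open>d\<close>, gives \<open>A * N * ln (d / t)\<close> for
  those of \<open>\<psi>\<close>, and the slice at \<open>d\<close> is at most
  \<open>A * N / d\<close>. Both are absorbed into \<open>1 / sqrt t\<close>, a singularity that is
  integrable and has an explicit primitive. The constant is uniform in
  \<open>\<psi>\<close>.\<close>

lemma slice_bound:
  assumes K1: "compact K1" "K1 \<subseteq> G1" and s: "s \<in> {-1, 1 :: real}"
    and d: "d > 0" "\<And>t. t \<in> {0..d} \<Longrightarrow> s * t \<in> I"
  shows "\<exists>c\<ge>0. \<forall>\<psi> \<psi>' N t. C1supp K1 \<psi> \<psi>' \<longrightarrow> (\<forall>x. norm (\<psi> x) \<le> N) \<longrightarrow> (\<forall>x. norm (\<psi>' x) \<le> N) \<longrightarrow>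
    0 < t \<longrightarrow> t \<le> d \<longrightarrow> norm (slice R (s * t) \<psi>) \<le> c * N / sqrt t"
proof -
  obtain a b where ab: "a < b" "K1 \<subseteq> {a<..<b}" by (rule compact_real_interval[OF K1(1)])
  then have ab': "K1 \<subseteq> {a..b}" "a \<le> b" by auto
  define L where "L = (\<lambda>(x, t). Complex x (s * t)) ` (K1 \<times> {0..d})"
  have "continuous_on (K1 \<times> {0..d}) (\<lambda>p. Complex (fst p) (s * snd p))"
    unfolding Complex_eq by (intro continuous_intros)
  then have "compact L" unfolding L_def case_prod_beta
    by (intro compact_continuous_image compact_Times K1) auto
  moreover have "Re z \<in> G1 \<and> Im z \<in> I" if "z \<in> L" for z using that K1 d by (auto simp: L_def)
  ultimately obtain M where M: "M \<ge> 0" "\<And>z. z \<in> L \<Longrightarrow> Im z \<noteq> 0 \<Longrightarrow> norm (R z) \<le> M / \<bar>Im z\<bar>"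
    using R_bound[of L] by auto
  have RM: "norm (R (Complex x (s * t))) \<le> M / t" if "x \<in> K1" "0 < t" "t \<le> d" for x t
  proof -
    have "Complex x (s * t) \<in> L" unfolding L_def using that by (intro rev_image_eqI[of "(x, t)"]) auto
    from M(2)[OF this] that s show ?thesis by (auto simp: abs_mult)
  qed
  define A where "A = M * (b - a)"
  have A: "A \<ge> 0" using M ab by (simp add: A_def)
  have triv: "norm (slice R (s * t) \<psi>) \<le> A * N / t"
    if "continuous_on UNIV \<psi>" "\<And>x. x \<notin> K1 \<Longrightarrow> \<psi> x = 0" "\<And>x. norm (\<psi> x) \<le> N" "0 < t" "t \<le> d" for \<psi> N t
  proof -
    have "norm (slice R (s * t) \<psi>) \<le> N * (M / t) * (b - a)"
      by (rule norm_slice_le[OF K1 ab' that(1-3)]) (use that s d M RM in auto)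
    then show ?thesis by (simp add: A_def mult_ac)
  qed
  show ?thesis
  proof (intro exI[of _ "A * (1 / sqrt d + 2 * sqrt d)"] conjI allI impI)
    show "0 \<le> A * (1 / sqrt d + 2 * sqrt d)" using A d by simp
    fix \<psi> \<psi>' N t
    assume \<psi>: "C1supp K1 \<psi> \<psi>'" "\<forall>x. norm (\<psi> x) \<le> N" "\<forall>x. norm (\<psi>' x) \<le> N" and t: "0 < t" "t \<le> d"
    have N: "N \<ge> 0" using \<psi>(2) by (meson norm_ge_zero order_trans)
    have "norm (slice R (s * d) \<psi> - slice R (s * t) \<psi>) \<le> A * N * ln d - A * N * ln t"
    proof (rule slice_variation[OF K1 \<psi>(1) s t])
      show "s * v \<in> I" if "v \<in> {t..d}" for v using that t by (intro d) auto
      show "((\<lambda>t. A * N * ln t) has_vector_derivative A * N / v) (at v)" if "v \<in> {t..d}" for v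
        unfolding has_real_derivative_iff_has_vector_derivative[symmetric]
        using that t by (auto intro!: derivative_eq_intros)
      show "norm (slice R (s * v) \<psi>') \<le> A * N / v" if "v \<in> {t..d}" for v
        using that t \<psi> C1supp_deriv_zero[OF compact_imp_closed[OF K1(1)] \<psi>(1)]
        by (intro triv) (auto simp: C1supp_def)
    qed
    also have "\<dots> = A * N * ln (d / t)" using t by (simp add: ln_div algebra_simps)
    also have "ln (d / t) \<le> 2 * (sqrt d / sqrt t)"
    proof -
      have "ln (d / t) = 2 * ln (sqrt (d / t))" using t by (simp add: ln_sqrt)
      also have "\<dots> \<le> 2 * sqrt (d / t)" using t ln_bound[of "sqrt (d / t)"] by simp
      finally show ?thesis by (simp add: real_sqrt_divide)
    qed
    finally have 1: "norm (slice R (s * d) \<psi> - slice R (s * t) \<psi>) \<le> A * N * (2 * (sqrt d / sqrt t))"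
      using A N by (simp add: mult_left_mono)
    have "norm (slice R (s * d) \<psi>) \<le> A * N / d"
      using \<psi> d(1) C1supp_continuous[OF \<psi>(1)] by (intro triv) (auto simp: C1supp_def)
    also have "\<dots> \<le> A * N * (1 / (sqrt d * sqrt t))"
    proof -
      have "sqrt d * sqrt t \<le> sqrt d * sqrt d" using t by (intro mult_left_mono) auto
      then have "1 / d \<le> 1 / (sqrt d * sqrt t)" using t by (intro divide_left_mono) auto
      then have "A * N * (1 / d) \<le> A * N * (1 / (sqrt d * sqrt t))" using A N by (intro mult_left_mono) auto
      then show ?thesis by simp
    qed
    finally have 2: "norm (slice R (s * d) \<psi>) \<le> A * N * (1 / (sqrt d * sqrt t))" .
    have "norm (slice R (s * t) \<psi>) \<le> norm (slice R (s * d) \<psi>) + norm (slice R (s * d) \<psi> - slice R (s * t) \<psi>)"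
      using norm_triangle_ineq4[of "slice R (s * d) \<psi>" "slice R (s * d) \<psi> - slice R (s * t) \<psi>"] by simp
    also have "\<dots> \<le> A * N * (1 / (sqrt d * sqrt t)) + A * N * (2 * (sqrt d / sqrt t))" using 1 2 by linarith
    also have "\<dots> = A * (1 / sqrt d + 2 * sqrt d) * N / sqrt t"
      by (simp add: add_divide_distrib algebra_simps)
    finally show "norm (slice R (s * t) \<psi>) \<le> A * (1 / sqrt d + 2 * sqrt d) * N / sqrt t" .
  qed
qed

text \<open>A second round of the same argument: the bound \<open>c * N / sqrt t\<close> for the
  slices of \<open>\<psi>'\<close> integrates to \<open>2 * c * N * sqrt t\<close>, so the slices of
  \<open>\<psi>\<close> have a limit by \<open>sqrt_Cauchy_limit\<close>. The price is a bound on
  \<open>\<psi>''\<close>, so the boundary values come out as distributions of order at most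
  2.\<close>

lemma slice_limit:
  assumes K1: "compact K1" "K1 \<subseteq> G1" and s: "s \<in> {-1, 1 :: real}"
    and d: "d > 0" "\<And>t. t \<in> {0..d} \<Longrightarrow> s * t \<in> I"
  shows "\<exists>c\<ge>0. \<forall>\<psi> \<psi>' \<psi>'' N. C1supp K1 \<psi> \<psi>' \<longrightarrow> C1supp K1 \<psi>' \<psi>'' \<longrightarrow>
    (\<forall>x. norm (\<psi> x) \<le> N) \<longrightarrow> (\<forall>x. norm (\<psi>' x) \<le> N) \<longrightarrow> (\<forall>x. norm (\<psi>'' x) \<le> N) \<longrightarrow>
    ((\<lambda>t. slice R (s * t) \<psi>) \<longlongrightarrow> Lim (at_right 0) (\<lambda>t. slice R (s * t) \<psi>)) (at_right 0) \<and>
    norm (Lim (at_right 0) (\<lambda>t. slice R (s * t) \<psi>)) \<le> c * N"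
proof -
  obtain c where c: "c \<ge> 0" "\<And>\<psi> \<psi>' N t. C1supp K1 \<psi> \<psi>' \<Longrightarrow> (\<forall>x. norm (\<psi> x) \<le> N) \<Longrightarrow>
    (\<forall>x. norm (\<psi>' x) \<le> N) \<Longrightarrow> 0 < t \<Longrightarrow> t \<le> d \<Longrightarrow> norm (slice R (s * t) \<psi>) \<le> c * N / sqrt t"
    using slice_bound[OF K1 s d] by blast
  show ?thesis
  proof (intro exI[of _ "c / sqrt d + 2 * c * sqrt d"] conjI allI impI)
    show "0 \<le> c / sqrt d + 2 * c * sqrt d" using c d by simp
    fix \<psi> \<psi>' \<psi>'' :: "real \<Rightarrow> complex" and N
    assume \<psi>: "C1supp K1 \<psi> \<psi>'" "C1supp K1 \<psi>' \<psi>''"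
      and N: "\<forall>x. norm (\<psi> x) \<le> N" "\<forall>x. norm (\<psi>' x) \<le> N" "\<forall>x. norm (\<psi>'' x) \<le> N"
    have var: "norm (slice R (s * t2) \<psi> - slice R (s * t1) \<psi>) \<le> 2 * c * N * (sqrt t2 - sqrt t1)"
      if t: "0 < t1" "t1 \<le> t2" "t2 \<le> d" for t1 t2
    proof -
      have "norm (slice R (s * t2) \<psi> - slice R (s * t1) \<psi>) \<le> 2 * c * N * sqrt t2 - 2 * c * N * sqrt t1"
      proof (rule slice_variation[OF K1 \<psi>(1) s t(1,2)])
        show "s * v \<in> I" if "v \<in> {t1..t2}" for v using that t by (intro d) auto
        show "((\<lambda>t. 2 * c * N * sqrt t) has_vector_derivative c * N / sqrt v) (at v)" if "v \<in> {t1..t2}" for v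
          unfolding has_real_derivative_iff_has_vector_derivative[symmetric]
          using that t by (auto intro!: derivative_eq_intros simp: field_simps)
        show "norm (slice R (s * v) \<psi>') \<le> c * N / sqrt v" if "v \<in> {t1..t2}" for v
          using that t by (intro c(2)[OF \<psi>(2) N(2,3)]) auto
      qed
      then show ?thesis by (simp add: right_diff_distrib)
    qed
    note lim = sqrt_Cauchy_limit[where f = "\<lambda>t. slice R (s * t) \<psi>", OF d(1) var]
    show "((\<lambda>t. slice R (s * t) \<psi>) \<longlongrightarrow> Lim (at_right 0) (\<lambda>t. slice R (s * t) \<psi>)) (at_right 0)"
      by (rule lim(1)) auto
    have "norm (slice R (s * d) \<psi> - Lim (at_right 0) (\<lambda>t. slice R (s * t) \<psi>)) \<le> 2 * c * N * sqrt d"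
      by (rule lim(2)) (use d in auto)
    moreover have "norm (slice R (s * d) \<psi>) \<le> c * N / sqrt d" using d by (intro c(2)[OF \<psi>(1) N(1,2)]) auto
    ultimately have "norm (Lim (at_right 0) (\<lambda>t. slice R (s * t) \<psi>)) \<le> c * N / sqrt d + 2 * c * N * sqrt d"
      using norm_triangle_ineq4[of "slice R (s * d) \<psi>" "slice R (s * d) \<psi> - Lim (at_right 0) (\<lambda>t. slice R (s * t) \<psi>)"]
      by simp
    then show "norm (Lim (at_right 0) (\<lambda>t. slice R (s * t) \<psi>)) \<le> (c / sqrt d + 2 * c * sqrt d) * N"
      by (simp add: algebra_simps)
  qed
qed

text \<open>Inserting 0 yields an interval around the axis that also reaches past \<open>S\<close>
  on both sides. If \<open>S\<close> contains the imaginary parts of a support, slices at heights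
  outside the interval vanish, and \<open>slice_bound\<close> covers those inside.\<close>

lemma I_interval:
  assumes "compact S" "S \<subseteq> I"
  obtains a b where "a < 0" "0 < b" "{a..b} \<subseteq> I" "S \<subseteq> {a<..<b}"
proof -
  have S: "compact (insert 0 S)" "insert 0 S \<subseteq> I" using assms I(3) by auto
  define m where "m = Inf (insert 0 S)"
  define M where "M = Sup (insert 0 S)"
  have bdd: "bdd_above (insert 0 S)" "bdd_below (insert 0 S)"
    using bounded_imp_bdd_above bounded_imp_bdd_below compact_imp_bounded[OF S(1)] by auto
  have m: "m \<in> insert 0 S" "M \<in> insert 0 S"
    unfolding m_def M_def
    by (rule closed_contains_Inf[OF _ bdd(2) compact_imp_closed[OF S(1)]], simp)
      (rule closed_contains_Sup[OF _ bdd(1) compact_imp_closed[OF S(1)]], simp)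
  have le: "m \<le> x" "x \<le> M" if "x \<in> insert 0 S" for x
    unfolding m_def M_def by (rule cInf_lower[OF that bdd(2)], rule cSup_upper[OF that bdd(1)])
  obtain e1 where e1: "e1 > 0" "cball m e1 \<subseteq> I"
    using open_contains_cball_eq[OF I(1)] subsetD[OF S(2) m(1)] by blast
  obtain e2 where e2: "e2 > 0" "cball M e2 \<subseteq> I"
    using open_contains_cball_eq[OF I(1)] subsetD[OF S(2) m(2)] by blast
  have "m - e1 \<in> I" "M + e2 \<in> I"
    by (rule subsetD[OF e1(2)], use e1(1) in \<open>simp add: dist_real_def\<close>)
      (rule subsetD[OF e2(2)], use e2(1) in \<open>simp add: dist_real_def\<close>)
  then have "{m - e1..M + e2} \<subseteq> I"
    using I(2)[unfolded is_interval_1] by (meson atLeastAtMost_iff subsetI)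
  moreover have "S \<subseteq> {m - e1<..<M + e2}"
  proof
    fix x assume "x \<in> S"
    then show "x \<in> {m - e1<..<M + e2}" using le[of x] e1(1) e2(1) by auto
  qed
  ultimately show ?thesis using le[of 0] e1(1) e2(1) by (intro that[of "m - e1" "M + e2"]) auto
qed

end

section \<open>The resolvent as a distribution\<close>

lemma negligible_Im: "negligible {z. Im z = c}"
proof -
  have "{z. Im z = c} = {z. z \<bullet> \<i> = c}" by (auto simp: inner_complex_def)
  moreover have "negligible {z. z \<bullet> \<i> = c}" by (rule negligible_standard_hyperplane) (simp add: Basis_complex_def)
  ultimately show ?thesis by simp
qed

context boundary_resolvent
begin

definition in_G0 :: "complex set \<Rightarrow> bool" where
  "in_G0 L \<longleftrightarrow> compact L \<and> (\<forall>z\<in>L. Re z \<in> G1 \<and> Im z \<in> I)"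

definition sliced :: "(complex \<Rightarrow> complex) \<Rightarrow> real \<Rightarrow> 'a l2 \<Rightarrow>\<^sub>L 'a l2" where
  "sliced f u = slice R u (\<lambda>x. f (Complex x u))"

lemma in_G0_Re: "in_G0 L \<Longrightarrow> compact (Re ` L)" "in_G0 L \<Longrightarrow> Re ` L \<subseteq> G1"
  by (auto simp: in_G0_def intro!: compact_continuous_image continuous_intros)

lemma continuous_off_axis:
  fixes h :: "complex \<Rightarrow> 'b::real_normed_vector"
  assumes L: "in_G0 L" and h: "continuous_on U h" "\<And>z. z \<notin> L \<Longrightarrow> h z = 0"
  shows "continuous_on {z. Im z \<noteq> 0} h"
proof -
  have clL: "closed L" using L by (auto simp: in_G0_def compact_imp_closed)
  have "continuous_on (- L) h" by (rule continuous_on_eq[of _ "\<lambda>_. 0"]) (use h in auto)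
  then have "continuous_on (U \<union> - L) h"
    using h clL by (intro continuous_on_open_Un open_U) auto
  then show ?thesis by (rule continuous_on_subset) (use L in \<open>auto simp: in_G0_def U_iff\<close>)
qed

context
  fixes L and f :: "complex \<Rightarrow> complex" assumes L: "in_G0 L" and f: "continuous_on UNIV f" "\<And>z. z \<notin> L \<Longrightarrow> f z = 0"
begin

lemma continuous_fR: "continuous_on {z. Im z \<noteq> 0} (\<lambda>z. f z *\<^sub>O R z)"
  by (rule continuous_off_axis[OF L])
    (auto simp: f(2) scale_op.zero_left intro!: continuous_intros continuous_R continuous_on_subset[OF f(1)])

lemma sliced_zero: "(\<And>z. z \<in> L \<Longrightarrow> Im z \<noteq> u) \<Longrightarrow> sliced f u = 0"
proof -
  assume "\<And>z. z \<in> L \<Longrightarrow> Im z \<noteq> u"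
  then have "Complex x u \<notin> L" for x by fastforce
  then have "f (Complex x u) = 0" for x by (rule f(2))
  then show ?thesis by (simp add: sliced_def slice_def scale_op.zero_left)
qed

lemma sliced_eq:
  assumes ab: "Re ` L \<subseteq> {a..b}" and u: "u \<noteq> 0"
  shows "sliced f u = integral {a..b} (\<lambda>x. f (Complex x u) *\<^sub>O R (Complex x u))"
  unfolding sliced_def slice_def
proof (rule has_integral_zero_extend(2))
  have "continuous_on {a..b} (\<lambda>x. f (Complex x u) *\<^sub>O R (Complex x u))"
    by (rule continuous_on_compose2[OF continuous_fR]) (use u in \<open>auto simp: Complex_eq intro!: continuous_intros\<close>)
  then show "(\<lambda>x. f (Complex x u) *\<^sub>O R (Complex x u)) integrable_on {a..b}"
    by (rule integrable_continuous_real)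
  fix x assume "x \<notin> {a..b}"
  then have "Complex x u \<notin> L" using ab by force
  then show "f (Complex x u) *\<^sub>O R (Complex x u) = 0" by (simp add: f(2) scale_op.zero_left)
qed simp

lemma continuous_sliced: "continuous_on (- {0}) (sliced f)"
proof -
  obtain a b where ab: "Re ` L \<subseteq> {a<..<b}" by (rule compact_real_interval[OF in_G0_Re(1)[OF L]])
  then have ab: "Re ` L \<subseteq> {a..b}" by auto
  have "continuous_on (- {0}) (\<lambda>u. integral (cbox a b) (\<lambda>x. f (Complex x u) *\<^sub>O R (Complex x u)))"
  proof (rule integral_continuous_on_param)
    have "continuous_on ((- {0}) \<times> cbox a b) (\<lambda>p. Complex (snd p) (fst p))"
      unfolding Complex_eq by (intro continuous_intros)
    then show "continuous_on ((- {0}) \<times> cbox a b) (\<lambda>(u, x). f (Complex x u) *\<^sub>O R (Complex x u))"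
      unfolding case_prod_beta by (rule continuous_on_compose2[OF continuous_fR]) auto
  qed
  then show ?thesis
    by (rule continuous_on_eq) (use sliced_eq[OF ab] in auto)
qed

text \<open>Both the area integral and the iterated integral in the definition of
  \<open>R(\<phi>)\<close> are folded onto \<open>{e..B}\<close>, where \<open>e\<close> enters as a
  single lower limit.\<close>

lemma cut_integral_eq:
  assumes B: "\<And>z. z \<in> L \<Longrightarrow> \<bar>Im z\<bar> \<le> B" and e: "0 < e"
  shows "(\<lambda>z. f z *\<^sub>O R z) integrable_on {z. e < \<bar>Im z\<bar>}"
    and "sliced f integrable_on {u. e < \<bar>u\<bar>}"
    and "cut_integral R e f = integral {e..B} (\<lambda>u. sliced f u + sliced f (- u))"
    and "integral {u. e < \<bar>u\<bar>} (sliced f) = integral {e..B} (\<lambda>u. sliced f u + sliced f (- u))"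
proof -
  define F where "F z = f z *\<^sub>O R z" for z
  have F0: "F z = 0" if "z \<notin> L" for z using f(2)[OF that] by (simp add: F_def scale_op.zero_left)
  obtain a b where ab: "Re ` L \<subseteq> {a<..<b}" by (rule compact_real_interval[OF in_G0_Re(1)[OF L]])
  then have ab': "Re ` L \<subseteq> {a..b}" by auto
  define b1 where "b1 = cbox (Complex a e) (Complex b B)"
  define b2 where "b2 = cbox (Complex a (- B)) (Complex b (- e))"
  have c: "continuous_on b1 F" "continuous_on b2 F"
    unfolding F_def by (rule continuous_on_subset[OF continuous_fR], use e in \<open>auto simp: b1_def b2_def in_cbox_complex_iff\<close>)+
  define J1 where "J1 = integral {e..B} (sliced f)"
  define J2 where "J2 = integral {e..B} (\<lambda>u. sliced f (- u))"
  have J2': "J2 = integral {- B..- e} (sliced f)"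
    unfolding J2_def using Henstock_Kurzweil_Integration.integral_reflect_real[of "- e" "- B" "sliced f"] by simp
  have i1: "integral b1 F = J1"
    unfolding b1_def J1_def complex_box_Fubini[OF c(1)[unfolded b1_def]]
    using e by (intro Henstock_Kurzweil_Integration.integral_cong) (simp add: F_def sliced_eq[OF ab'])
  have i2: "integral b2 F = J2"
    unfolding b2_def J2' complex_box_Fubini[OF c(2)[unfolded b2_def]]
    using e by (intro Henstock_Kurzweil_Integration.integral_cong) (simp add: F_def sliced_eq[OF ab'])
  have "(F has_integral J1) b1" "(F has_integral J2) b2"
    using c i1 i2 integrable_continuous[of _ _ F] unfolding b1_def b2_def by (auto intro!: integrable_integral)
  moreover have "b1 \<inter> b2 = {}" using e by (auto simp: b1_def b2_def in_cbox_complex_iff)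
  ultimately have "(F has_integral (J1 + J2)) (b1 \<union> b2)" by (intro has_integral_Un) auto
  \<comment> \<open>The two closed boxes differ from \<open>{z. e < |Im z|}\<close> by the lines
    \<open>Im z = e\<close> and \<open>Im z = - e\<close> and by points at which \<open>f\<close>
    vanishes.\<close>
  moreover have "negligible {z \<in> (b1 \<union> b2) - {z. e < \<bar>Im z\<bar>}. F z \<noteq> 0}"
    by (rule negligible_subset[OF negligible_Un[OF negligible_Im[of e] negligible_Im[of "- e"]]])
      (auto simp: b1_def b2_def in_cbox_complex_iff)
  moreover have "negligible {z \<in> {z. e < \<bar>Im z\<bar>} - (b1 \<union> b2). F z \<noteq> 0}"
  proof (rule negligible_subset[OF negligible_empty])
    have "z \<in> b1 \<union> b2" if "z \<in> L" "e < \<bar>Im z\<bar>" for z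
    proof -
      have "Re z \<in> {a..b}" using that ab' by auto
      then show ?thesis using that B[of z] by (auto simp: b1_def b2_def in_cbox_complex_iff)
    qed
    then show "{z \<in> {z. e < \<bar>Im z\<bar>} - (b1 \<union> b2). F z \<noteq> 0} \<subseteq> {}" using F0 by blast
  qed
  ultimately have "(F has_integral (J1 + J2)) {z. e < \<bar>Im z\<bar>}"
    using has_integral_spike_set_eq[of "b1 \<union> b2" "{z. e < \<bar>Im z\<bar>}" F "J1 + J2"] by blast
  then have 1: "F integrable_on {z. e < \<bar>Im z\<bar>}" "integral {z. e < \<bar>Im z\<bar>} F = J1 + J2"
    by (auto simp: integral_unique)
  have cs: "continuous_on {e..B} (sliced f)" "continuous_on {- B..- e} (sliced f)"
    "continuous_on {e..B} (\<lambda>u. sliced f (- u))"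
    using e by (auto intro!: continuous_on_subset[OF continuous_sliced] continuous_on_compose2[OF continuous_sliced] continuous_intros)
  have "(sliced f has_integral J1) {e..B}" "(sliced f has_integral J2) {- B..- e}"
    unfolding J1_def J2' by (intro integrable_integral integrable_continuous_real cs)+
  then have "(sliced f has_integral (J1 + J2)) ({e..B} \<union> {- B..- e})"
  proof (rule has_integral_Un)
    have "{e..B} \<inter> {- B..- e} = {}" using e by auto
    then show "negligible ({e..B} \<inter> {- B..- e})" by simp
  qed
  moreover have "negligible {u \<in> ({e..B} \<union> {- B..- e}) - {u. e < \<bar>u\<bar>}. sliced f u \<noteq> 0}"
    by (rule negligible_subset[of "{e, - e}"]) auto
  moreover have "negligible {u \<in> {u. e < \<bar>u\<bar>} - ({e..B} \<union> {- B..- e}). sliced f u \<noteq> 0}"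
  proof (rule negligible_subset[OF negligible_empty])
    have "sliced f u = 0" if "e < \<bar>u\<bar>" "u \<notin> {e..B} \<union> {- B..- e}" for u
      by (rule sliced_zero) (use that B in fastforce)
    then show "{u \<in> {u. e < \<bar>u\<bar>} - ({e..B} \<union> {- B..- e}). sliced f u \<noteq> 0} \<subseteq> {}" by blast
  qed
  ultimately have "(sliced f has_integral (J1 + J2)) {u. e < \<bar>u\<bar>}"
    using has_integral_spike_set_eq[of "{e..B} \<union> {- B..- e}" "{u. e < \<bar>u\<bar>}" "sliced f" "J1 + J2"] by blast
  then have 2: "sliced f integrable_on {u. e < \<bar>u\<bar>}" "integral {u. e < \<bar>u\<bar>} (sliced f) = J1 + J2"
    by (auto simp: integral_unique)
  have 3: "J1 + J2 = integral {e..B} (\<lambda>u. sliced f u + sliced f (- u))"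
    unfolding J1_def J2_def by (intro Henstock_Kurzweil_Integration.integral_add[symmetric] integrable_continuous_real cs)
  show "(\<lambda>z. f z *\<^sub>O R z) integrable_on {z. e < \<bar>Im z\<bar>}" "sliced f integrable_on {u. e < \<bar>u\<bar>}"
    "cut_integral R e f = integral {e..B} (\<lambda>u. sliced f u + sliced f (- u))"
    "integral {u. e < \<bar>u\<bar>} (sliced f) = integral {e..B} (\<lambda>u. sliced f u + sliced f (- u))"
    using 1 2 3 by (simp_all add: F_def[abs_def] cut_integral_def)
qed

lemma cut_integral_ops: "0 < e \<Longrightarrow> cut_integral R e f \<in> ops G"
  unfolding cut_integral_def
proof (rule ops_integral[OF Gb])
  fix z assume e: "0 < e" "z \<in> {z. e < \<bar>Im z\<bar>}"
  show "f z *\<^sub>O R z \<in> ops G"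
  proof (cases "z \<in> L")
    case True
    then show ?thesis using L e by (intro ops_scale R_ops) (auto simp: in_G0_def)
  qed (simp add: f scale_op.zero_left ops_zero)
qed

end

lemma xreg_line:
  assumes "xreg L f f'" shows "C1supp (Re ` L) (\<lambda>x. f (Complex x u)) (\<lambda>x. f' (Complex x u))"
proof -
  have "continuous_on UNIV (\<lambda>x. f' (Complex x u))"
    by (rule continuous_on_compose2[of UNIV f']) (use assms in \<open>auto simp: xreg_def Complex_eq intro!: continuous_intros\<close>)
  moreover have "f (Complex x u) = 0" if "x \<notin> Re ` L" for x
    using assms that by (force simp: xreg_def)
  ultimately show ?thesis using assms by (auto simp: xreg_def C1supp_def)
qed

text \<open>Joins the estimates of the two half planes in one constant, uniform in \<open>f\<close>
  and \<open>u\<close>; at heights beyond the chosen interval the slice vanishes.\<close>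

lemma sliced_bound:
  assumes L: "in_G0 L"
  shows "\<exists>c\<ge>0. \<forall>f f' N u. xreg L f f' \<longrightarrow> (\<forall>z. norm (f z) \<le> N) \<longrightarrow> (\<forall>z. norm (f' z) \<le> N) \<longrightarrow> u \<noteq> 0 \<longrightarrow>
    norm (sliced f u) \<le> c * N / sqrt \<bar>u\<bar>"
proof -
  have K1: "compact (Re ` L)" "Re ` L \<subseteq> G1" using in_G0_Re[OF L] by auto
  have cL: "compact (Im ` L)" "Im ` L \<subseteq> I"
    using L by (auto simp: in_G0_def intro!: compact_continuous_image continuous_intros)
  obtain \<alpha> \<beta> where ab: "\<alpha> < 0" "0 < \<beta>" "{\<alpha>..\<beta>} \<subseteq> I" "Im ` L \<subseteq> {\<alpha><..<\<beta>}"
    by (rule I_interval[OF cL])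
  have I1: "1 * t \<in> I" if "t \<in> {0..\<beta>}" for t using that ab by (auto intro!: subsetD[OF ab(3)])
  have I2: "-1 * t \<in> I" if "t \<in> {0..-\<alpha>}" for t using that ab by (auto intro!: subsetD[OF ab(3)])
  have a': "0 < - \<alpha>" using ab by simp
  obtain c1 where c1: "c1 \<ge> 0" "\<And>\<psi> \<psi>' N t. C1supp (Re ` L) \<psi> \<psi>' \<Longrightarrow> (\<forall>x. norm (\<psi> x) \<le> N) \<Longrightarrow> (\<forall>x. norm (\<psi>' x) \<le> N) \<Longrightarrow>
      0 < t \<Longrightarrow> t \<le> \<beta> \<Longrightarrow> norm (slice R (1 * t) \<psi>) \<le> c1 * N / sqrt t"
    using slice_bound[OF K1, of 1 \<beta>] ab(2) I1 by blast
  obtain c2 where c2: "c2 \<ge> 0" "\<And>\<psi> \<psi>' N t. C1supp (Re ` L) \<psi> \<psi>' \<Longrightarrow> (\<forall>x. norm (\<psi> x) \<le> N) \<Longrightarrow> (\<forall>x. norm (\<psi>' x) \<le> N) \<Longrightarrow>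
      0 < t \<Longrightarrow> t \<le> - \<alpha> \<Longrightarrow> norm (slice R (-1 * t) \<psi>) \<le> c2 * N / sqrt t"
    using slice_bound[OF K1, of "-1" "- \<alpha>"] a' I2 by blast
  show ?thesis
  proof (intro exI[of _ "c1 + c2"] conjI allI impI)
    show "0 \<le> c1 + c2" using c1 c2 by simp
    fix f f' N and u :: real
    assume f: "xreg L f f'" and N: "\<forall>z. norm (f z) \<le> N" "\<forall>z. norm (f' z) \<le> N" and u: "u \<noteq> 0"
    have N0: "N \<ge> 0" using N(1) by (meson norm_ge_zero order_trans)
    have le: "c1 * N / sqrt \<bar>u\<bar> \<le> (c1 + c2) * N / sqrt \<bar>u\<bar>" "c2 * N / sqrt \<bar>u\<bar> \<le> (c1 + c2) * N / sqrt \<bar>u\<bar>"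
      using c1 c2 N0 by (auto intro!: divide_right_mono mult_right_mono)
    show "norm (sliced f u) \<le> (c1 + c2) * N / sqrt \<bar>u\<bar>"
    proof (cases "u \<in> {\<alpha>..\<beta>}")
      case False
      have "sliced f u = 0"
        by (rule sliced_zero[OF L]) (use f False ab(4) in \<open>auto simp: xreg_def\<close>)
      then show ?thesis using c1 c2 N0 by simp
    next
      case True
      show ?thesis
      proof (cases "u > 0")
        case u': True
        have "norm (slice R (1 * u) (\<lambda>x. f (Complex x u))) \<le> c1 * N / sqrt u"
          by (rule c1(2)[OF xreg_line[OF f]]) (use N u' True in auto)
        then show ?thesis using le(1) u' by (simp add: sliced_def)
      next
        case False
        have "norm (slice R (-1 * (- u)) (\<lambda>x. f (Complex x u))) \<le> c2 * N / sqrt (- u)"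
          by (rule c2(2)[OF xreg_line[OF f]]) (use N u False True in auto)
        then show ?thesis using le(2) False by (simp add: sliced_def)
      qed
    qed
  qed
qed

text \<open>Integrating \<open>c * N / sqrt |u|\<close> over both half planes bounds the variation
  of the truncated integrals by \<open>4 * c * N * (sqrt b - sqrt a)\<close>. The last estimate,
  small for functions supported near the axis, is the tool for removing cutoffs.\<close>

lemma resolvent_dist_limit:
  assumes L: "in_G0 L"
  obtains c where "c \<ge> 0"
    "\<And>f f'. xreg L f f' \<Longrightarrow> ((\<lambda>e. cut_integral R e f) \<longlongrightarrow> resolvent_dist R f) (at_right 0)"
    "\<And>f f' N. xreg L f f' \<Longrightarrow> (\<And>z. norm (f z) \<le> N) \<Longrightarrow> (\<And>z. norm (f' z) \<le> N) \<Longrightarrow> norm (resolvent_dist R f) \<le> c * N"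
    "\<And>f f' N e. xreg L f f' \<Longrightarrow> (\<And>z. norm (f z) \<le> N) \<Longrightarrow> (\<And>z. norm (f' z) \<le> N) \<Longrightarrow> e > 0 \<Longrightarrow>
      (\<And>z. e < \<bar>Im z\<bar> \<Longrightarrow> f z = 0) \<Longrightarrow> norm (resolvent_dist R f) \<le> c * N * sqrt e"
proof -
  obtain c where c: "c \<ge> 0" "\<And>f f' N u. xreg L f f' \<Longrightarrow> (\<forall>z. norm (f z) \<le> N) \<Longrightarrow> (\<forall>z. norm (f' z) \<le> N) \<Longrightarrow> u \<noteq> 0 \<Longrightarrow>
    norm (sliced f u) \<le> c * N / sqrt \<bar>u\<bar>"
    using sliced_bound[OF L] by blast
  have cL: "compact L" using L by (simp add: in_G0_def)
  obtain B where B: "B > 0" "\<And>z. z \<in> L \<Longrightarrow> norm z \<le> B" by (rule compact_complex_box[OF cL]) blast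
  have B': "\<bar>Im z\<bar> \<le> B'" if "z \<in> L" "B \<le> B'" for z B'
    using abs_Im_le_cmod[of z] B(2)[OF that(1)] that(2) by linarith
  have fc: "continuous_on UNIV f" "\<And>z. z \<notin> L \<Longrightarrow> f z = 0" if "xreg L f f'" for f f'
    using that by (auto simp: xreg_def)
  have Cauchy: "norm (cut_integral R b f - cut_integral R a f) \<le> 4 * c * N * (sqrt b - sqrt a)"
    if f: "xreg L f f'" and N: "\<And>z. norm (f z) \<le> N" "\<And>z. norm (f' z) \<le> N" and ab: "0 < a" "a \<le> b" for f f' N a b
  proof -
    define q where "q u = sliced f u + sliced f (- u)" for u
    \<comment> \<open>Beyond \<open>B\<close> the slices vanish; the maximum with \<open>b\<close>
      gives the truncations at \<open>a\<close> and at \<open>b\<close> a common upper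
      limit.\<close>
    define B1 where "B1 = max B b"
    have cq: "continuous_on {a..B1} q"
      unfolding q_def using ab
      by (auto intro!: continuous_intros continuous_on_subset[OF continuous_sliced[OF L fc[OF f]]]
          continuous_on_compose2[OF continuous_sliced[OF L fc[OF f]]])
    have cut: "cut_integral R e f = integral {e..B1} q" if "e > 0" for e
      unfolding q_def[abs_def] by (rule cut_integral_eq(3)[OF L fc[OF f] _ that], assumption, rule B') (auto simp: B1_def)
    have "integral {a..b} q + integral {b..B1} q = integral {a..B1} q"
      using ab by (intro Henstock_Kurzweil_Integration.integral_combine integrable_continuous_real cq) (auto simp: B1_def)
    then have "cut_integral R b f - cut_integral R a f = - integral {a..b} q"
      using ab by (simp add: cut algebra_simps)
    also have "norm \<dots> \<le> integral {a..b} (\<lambda>u. 2 * c * N / sqrt u)"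
      unfolding norm_minus_cancel
    proof (rule integral_norm_bound_integral)
      show "q integrable_on {a..b}"
        by (intro integrable_continuous_real continuous_on_subset[OF cq]) (auto simp: B1_def)
      show "(\<lambda>u. 2 * c * N / sqrt u) integrable_on {a..b}"
        using ab by (intro integrable_continuous_real continuous_intros) auto
      fix u assume u: "u \<in> {a..b}"
      have "norm (q u) \<le> norm (sliced f u) + norm (sliced f (- u))" unfolding q_def by (rule norm_triangle_ineq)
      also have "\<dots> \<le> c * N / sqrt \<bar>u\<bar> + c * N / sqrt \<bar>- u\<bar>"
        using f N u ab by (intro add_mono c(2)) auto
      finally show "norm (q u) \<le> 2 * c * N / sqrt u" using u ab by (simp add: mult_ac)
    qed
    also have "integral {a..b} (\<lambda>u. 2 * c * N / sqrt u) = 4 * c * N * sqrt b - 4 * c * N * sqrt a"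
    proof (intro integral_unique fundamental_theorem_of_calculus ab)
      fix u assume u: "u \<in> {a..b}"
      have "((\<lambda>u. 4 * c * N * sqrt u) has_real_derivative 2 * c * N / sqrt u) (at u within {a..b})"
        using u ab by (auto intro!: derivative_eq_intros simp: field_simps)
      then show "((\<lambda>u. 4 * c * N * sqrt u) has_vector_derivative 2 * c * N / sqrt u) (at u within {a..b})"
        by (simp only: has_real_derivative_iff_has_vector_derivative)
    qed
    finally show ?thesis by (simp add: right_diff_distrib)
  qed
  have bdd: "\<exists>N. (\<forall>z. norm (f z) \<le> N) \<and> (\<forall>z. norm (f' z) \<le> N)" if f: "xreg L f f'" for f f'
  proof -
    obtain N1 where N1: "\<And>z. norm (f z) \<le> N1"
      by (rule bounded_compact_support[OF cL, of f]) (use f in \<open>auto simp: xreg_def\<close>)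
    obtain N2 where N2: "\<And>z. norm (f' z) \<le> N2"
      by (rule bounded_compact_support[OF cL, of f']) (use f in \<open>auto simp: xreg_def\<close>)
    show ?thesis using N1 N2 by (intro exI[of _ "max N1 N2"]) (auto simp: le_max_iff_disj)
  qed
  have near: "norm (cut_integral R a f - resolvent_dist R f) \<le> 4 * c * N * sqrt a"
    if f: "xreg L f f'" and N: "\<And>z. norm (f z) \<le> N" "\<And>z. norm (f' z) \<le> N" and a: "0 < a" for f f' N a
    unfolding resolvent_dist_def
    by (rule sqrt_Cauchy_limit(2)[of a, OF _ Cauchy[OF f N]]) (use a in auto)
  have near0: "norm (resolvent_dist R f) \<le> 4 * c * N * sqrt a"
    if f: "xreg L f f'" and N: "\<And>z. norm (f z) \<le> N" "\<And>z. norm (f' z) \<le> N" and a: "0 < a"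
      and z: "\<And>z. a < \<bar>Im z\<bar> \<Longrightarrow> f z = 0" for f f' N a
  proof -
    have "cut_integral R a f = integral {z. a < \<bar>Im z\<bar>} (\<lambda>_. 0)"
      unfolding cut_integral_def by (intro Henstock_Kurzweil_Integration.integral_cong) (simp add: z scale_op.zero_left)
    then show ?thesis using near[OF f N a] by simp
  qed
  show ?thesis
  proof (rule that)
    \<comment> \<open>One constant for two bounds: the summand \<open>sqrt B\<close> serves the
      general one, which is the strip estimate at \<open>e = B\<close>, and the summand 1 serves the
      strip estimate itself.\<close>
    show "0 \<le> 4 * c * (1 + sqrt B)" using c B by simp
    show "((\<lambda>e. cut_integral R e f) \<longlongrightarrow> resolvent_dist R f) (at_right 0)" if f: "xreg L f f'" for f f'
    proof -
      obtain N where N: "\<And>z. norm (f z) \<le> N" "\<And>z. norm (f' z) \<le> N" using bdd[OF f] by blast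
      show ?thesis unfolding resolvent_dist_def
        by (rule sqrt_Cauchy_limit(1)[of 1, OF _ Cauchy[OF f N]]) auto
    qed
    fix f f' N assume f: "xreg L f f'" and N: "\<And>z. norm (f z) \<le> N" "\<And>z. norm (f' z) \<le> N"
    have N0: "N \<ge> 0" by (rule order_trans[OF norm_ge_zero N(1)])
    have "norm (resolvent_dist R f) \<le> 4 * c * N * sqrt B"
    proof (rule near0[OF f N B(1)])
      fix z assume "B < \<bar>Im z\<bar>"
      then have "z \<notin> L" using B'[of z B] by auto
      then show "f z = 0" by (rule fc(2)[OF f])
    qed
    also have "\<dots> = 4 * c * N * (0 + sqrt B)" by simp
    also have "\<dots> \<le> 4 * c * N * (1 + sqrt B)" using c N0 by (intro mult_left_mono) auto
    finally show "norm (resolvent_dist R f) \<le> 4 * c * (1 + sqrt B) * N" by (simp add: mult_ac)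
    fix e assume e: "e > 0" "\<And>z. e < \<bar>Im z\<bar> \<Longrightarrow> f z = 0"
    have "norm (resolvent_dist R f) \<le> 4 * c * N * sqrt e" by (rule near0[OF f N e])
    also have "\<dots> = 4 * c * 1 * N * sqrt e" by simp
    also have "\<dots> \<le> 4 * c * (1 + sqrt B) * N * sqrt e"
      using c N0 B e by (intro mult_right_mono mult_left_mono) auto
    finally show "norm (resolvent_dist R f) \<le> 4 * c * (1 + sqrt B) * N * sqrt e" .
  qed
qed

end

section \<open>The distribution resolvent equation\<close>

text \<open>The kernel \<open>1 / (w - z)\<close> is antisymmetric, and Fubini turns this into the
  sign. The double integral converges absolutely because the bound on the kernel is uniform in
  \<open>z\<close>.\<close>

lemma cauchy_transform_symmetric:
  assumes f: "continuous_on UNIV f" "compact L" "\<And>z. z \<notin> L \<Longrightarrow> f z = 0"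
    and h: "continuous_on UNIV h" "compact L'" "\<And>z. z \<notin> L' \<Longrightarrow> h z = 0"
  shows "(LINT z|lborel. f z * cauchy_transform h z) = - (LINT w|lborel. h w * cauchy_transform f w)"
proof -
  have [measurable]: "f \<in> borel_measurable borel" "h \<in> borel_measurable borel"
    using f h by (auto intro: borel_measurable_continuous_onI)
  obtain s where s: "s > 0" "L' \<subseteq> cbox (Complex (- s) (- s)) (Complex s s)" by (rule compact_complex_box[OF h(2)]) blast
  obtain N where N: "\<And>z. norm (h z) \<le> N" using bounded_compact_support[OF h(2,1,3)] by auto
  have supp: "h w = 0" if "w \<notin> cbox (Complex (- s) (- s)) (Complex s s)" for w using h(3)[of w] s(2) that by auto
  have box: "- s \<le> s" using s by simp
  note bd = cauchy_transform_bound[OF \<open>h \<in> borel_measurable borel\<close> box box supp N]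
  have fi: "integrable lborel f" by (rule integrable_compact_support[OF f(2,1,3)])
  have "integrable (lborel \<Otimes>\<^sub>M lborel) (\<lambda>(z, w). f z * (h w / (w - z)))"
  proof (rule lborel_pair.Fubini_integrable)
    show "(\<lambda>(z, w). f z * (h w / (w - z))) \<in> borel_measurable (lborel \<Otimes>\<^sub>M lborel)" by measurable
    show "AE z in lborel. integrable lborel (\<lambda>w. case (z, w) of (z, w) \<Rightarrow> f z * (h w / (w - z)))"
      using bd(1) by (auto intro!: integrable_mult_right simp del: times_divide_eq_right)
    show "integrable lborel (\<lambda>z. LINT w|lborel. norm (case (z, w) of (z, w) \<Rightarrow> f z * (h w / (w - z))))"
    proof (rule Bochner_Integration.integrable_bound)
      show "integrable lborel (\<lambda>z. norm (f z) * (16 * sqrt ((s - - s) * (s - - s)) * N))" using fi by simp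
      show "AE z in lborel. norm (LINT w|lborel. norm (case (z, w) of (z, w) \<Rightarrow> f z * (h w / (w - z))))
          \<le> norm (norm (f z) * (16 * sqrt ((s - - s) * (s - - s)) * N))"
      proof (rule AE_I2)
        fix z
        have "(LINT w|lborel. norm (case (z, w) of (z, w) \<Rightarrow> f z * (h w / (w - z)))) =
            norm (f z) * (LINT w|lborel. norm (h w) / norm (w - z))"
          by (simp add: norm_mult norm_divide del: times_divide_eq_right)
        also have "\<dots> \<le> norm (f z) * (16 * sqrt ((s - - s) * (s - - s)) * N)"
          by (intro mult_left_mono bd(3)) auto
        finally show "norm (LINT w|lborel. norm (case (z, w) of (z, w) \<Rightarrow> f z * (h w / (w - z))))
          \<le> norm (norm (f z) * (16 * sqrt ((s - - s) * (s - - s)) * N))"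
          by (subst real_norm_def, subst abs_of_nonneg) (auto intro: order_trans[OF _ abs_ge_self])
      qed
    qed measurable
  qed
  from lborel_pair.Fubini_integral[OF this]
  have "(LINT w|lborel. LINT z|lborel. f z * (h w / (w - z))) = (LINT z|lborel. LINT w|lborel. f z * (h w / (w - z)))"
    by simp
  also have "\<dots> = (LINT z|lborel. f z * cauchy_transform h z)"
    unfolding cauchy_transform_def by (simp only: integral_mult_right_zero)
  finally have "(LINT z|lborel. f z * cauchy_transform h z) = (LINT w|lborel. LINT z|lborel. f z * (h w / (w - z)))" ..
  also have "\<dots> = (LINT w|lborel. - (h w * cauchy_transform f w))"
  proof (rule Bochner_Integration.integral_cong[OF refl])
    fix w
    have "f z * (h w / (w - z)) = - h w * (f z / (z - w))" for z
      by (cases "z = w") (auto simp: field_simps minus_divide_right)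
    then have "(LINT z|lborel. f z * (h w / (w - z))) = (LINT z|lborel. - h w * (f z / (z - w)))" by presburger
    also have "\<dots> = - (h w * cauchy_transform f w)"
      unfolding cauchy_transform_def by (simp only: integral_mult_right_zero minus_mult_left)
    finally show "(LINT z|lborel. f z * (h w / (w - z))) = - (h w * cauchy_transform f w)" .
  qed
  also have "\<dots> = - (LINT w|lborel. h w * cauchy_transform f w)" by simp
  finally show ?thesis .
qed

text \<open>Vanishes for \<open>|Im z| \<le> e\<close> and equals 1 for
  \<open>|Im z| \<ge> 2 * e\<close>. Piecewise linear is smooth enough: being constant on horizontal
  lines it multiplies \<open>f'\<close> just as it multiplies \<open>f\<close>, and its slope
  \<open>1 / e\<close> never enters an estimate.\<close>

definition axis_cutoff :: "real \<Rightarrow> complex \<Rightarrow> complex" where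
  "axis_cutoff e z = of_real (min 1 (max 0 (\<bar>Im z\<bar> / e - 1)))"

lemma axis_cutoff:
  assumes e: "e > 0"
  shows "continuous_on UNIV (axis_cutoff e)" "norm (axis_cutoff e z) \<le> 1" "norm (1 - axis_cutoff e z) \<le> 1"
    "\<bar>Im z\<bar> \<le> e \<Longrightarrow> axis_cutoff e z = 0" "2 * e < \<bar>Im z\<bar> \<Longrightarrow> 1 - axis_cutoff e z = 0"
proof -
  show "continuous_on UNIV (axis_cutoff e)"
    unfolding axis_cutoff_def using e by (intro continuous_intros) auto
  show "norm (axis_cutoff e z) \<le> 1" by (auto simp: axis_cutoff_def)
  have "1 - axis_cutoff e z = of_real (1 - min 1 (max 0 (\<bar>Im z\<bar> / e - 1)))" by (simp add: axis_cutoff_def)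
  then have "norm (1 - axis_cutoff e z) = \<bar>1 - min 1 (max 0 (\<bar>Im z\<bar> / e - 1))\<bar>" by (simp only: norm_of_real)
  then show "norm (1 - axis_cutoff e z) \<le> 1" by (simp add: min_def max_def)
  show "\<bar>Im z\<bar> \<le> e \<Longrightarrow> axis_cutoff e z = 0" using e by (simp add: axis_cutoff_def field_simps max_def)
  assume "2 * e < \<bar>Im z\<bar>"
  then have "2 < \<bar>Im z\<bar> / e" using e by (simp add: field_simps)
  then show "1 - axis_cutoff e z = 0" by (simp add: axis_cutoff_def)
qed

lemma xreg_mult_Im:
  assumes f: "xreg L f f'" and k: "continuous_on UNIV k" "\<And>z w. Im z = Im w \<Longrightarrow> k z = k w"
  shows "xreg L (\<lambda>z. f z * k z) (\<lambda>z. f' z * k z)"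
proof -
  have "((\<lambda>x. f (Complex x u) * k (Complex x u)) has_vector_derivative f' (Complex x u) * k (Complex x u)) (at x)" for x u
  proof -
    have "(\<lambda>t. f (Complex t u) * k (Complex t u)) = (\<lambda>t. f (Complex t u) * k (Complex x u))"
    proof
      fix t
      show "f (Complex t u) * k (Complex t u) = f (Complex t u) * k (Complex x u)"
        by (subst k(2)[of "Complex t u" "Complex x u"]) simp_all
    qed
    moreover have "((\<lambda>t. f (Complex t u) * k (Complex x u)) has_vector_derivative f' (Complex x u) * k (Complex x u)) (at x)"
      using f by (intro has_vector_derivative_mult_left) (simp add: xreg_def)
    ultimately show ?thesis by (simp only:)
  qed
  then show ?thesis using f k(1) by (auto simp: xreg_def intro!: continuous_intros)
qed

lemma xreg_axis_cutoff:
  assumes "xreg L f f'" "e > 0"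
  shows "xreg L (\<lambda>z. f z * axis_cutoff e z) (\<lambda>z. f' z * axis_cutoff e z)"
    "xreg L (\<lambda>z. f z * (1 - axis_cutoff e z)) (\<lambda>z. f' z * (1 - axis_cutoff e z))"
  by (intro xreg_mult_Im[OF assms(1)] continuous_intros axis_cutoff(1) assms; simp add: axis_cutoff_def)+

lemma xreg_diff: "xreg L f f' \<Longrightarrow> xreg L g g' \<Longrightarrow> xreg L (\<lambda>z. f z - g z) (\<lambda>z. f' z - g' z)"
  by (auto simp: xreg_def intro!: continuous_intros derivative_intros)

lemma xreg_add: "xreg L f f' \<Longrightarrow> xreg L g g' \<Longrightarrow> xreg L (\<lambda>z. f z + g z) (\<lambda>z. f' z + g' z)"
  by (auto simp: xreg_def intro!: continuous_intros derivative_intros)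

lemma xreg_cmult: "xreg L f f' \<Longrightarrow> xreg L (\<lambda>z. c * f z) (\<lambda>z. c * f' z)"
  by (auto simp: xreg_def intro!: continuous_intros has_vector_derivative_mult_right)

lemma xreg_bounded:
  assumes "compact L" "xreg L f f'"
  obtains N where "N > 0" "\<And>z. norm (f z) \<le> N" "\<And>z. norm (f' z) \<le> N"
proof -
  obtain N1 where N1: "N1 > 0" "\<And>z. norm (f z) \<le> N1"
    by (rule bounded_compact_support[OF assms(1), of f]) (use assms in \<open>auto simp: xreg_def\<close>)
  obtain N2 where N2: "\<And>z. norm (f' z) \<le> N2"
    by (rule bounded_compact_support[OF assms(1), of f']) (use assms in \<open>auto simp: xreg_def\<close>)
  show ?thesis using N1 N2 by (intro that[of "max N1 N2"]) (auto simp: le_max_iff_disj)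
qed

lemma xreg_mono: "xreg L f f' \<Longrightarrow> L \<subseteq> L' \<Longrightarrow> xreg L' f f'"
  by (auto simp: xreg_def)

section \<open>The resolvent equation off the axis and the removal of the cutoff\<close>

context boundary_resolvent
begin

abbreviation "T \<equiv> resolvent_dist R"

lemma T_limit: "in_G0 L \<Longrightarrow> xreg L f f' \<Longrightarrow> ((\<lambda>e. cut_integral R e f) \<longlongrightarrow> T f) (at_right 0)"
  by (rule resolvent_dist_limit) blast+

lemma cut_integrable:
  assumes L: "in_G0 L" and f: "xreg L f f'" and e: "e > 0"
  shows "(\<lambda>z. f z *\<^sub>O R z) integrable_on {z. e < \<bar>Im z\<bar>}"
proof -
  have cL: "compact L" using L by (simp add: in_G0_def)
  obtain B where B: "\<And>z. z \<in> L \<Longrightarrow> norm z \<le> B" by (rule compact_complex_box[OF cL]) blast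
  show ?thesis
    by (rule cut_integral_eq(1)[OF L _ _ _ e, of _ B])
      (use f order_trans[OF abs_Im_le_cmod B] in \<open>auto simp: xreg_def\<close>)
qed

lemma T_linear:
  assumes L: "in_G0 L" and f: "xreg L f f'" and g: "xreg L g g'"
  shows "T (\<lambda>z. f z + g z) = T f + T g" "T (\<lambda>z. f z - g z) = T f - T g" "T (\<lambda>z. c * f z) = c *\<^sub>O T f"
proof -
  have ev: "eventually (\<lambda>e. e > 0) (at_right (0::real))" by (rule eventually_at_right_less)
  have "((\<lambda>e. cut_integral R e (\<lambda>z. f z + g z)) \<longlongrightarrow> T f + T g) (at_right 0)"
  proof (rule Lim_transform_eventually[OF tendsto_add[OF T_limit[OF L f] T_limit[OF L g]]])
    show "\<forall>\<^sub>F e in at_right 0. cut_integral R e f + cut_integral R e g = cut_integral R e (\<lambda>z. f z + g z)"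
      using ev by eventually_elim
        (simp add: cut_integral_def scale_op.add_left Henstock_Kurzweil_Integration.integral_add
          cut_integrable[OF L f] cut_integrable[OF L g])
  qed
  from tendsto_unique[OF _ T_limit[OF L xreg_add[OF f g]] this] show "T (\<lambda>z. f z + g z) = T f + T g" by simp
  have "((\<lambda>e. cut_integral R e (\<lambda>z. f z - g z)) \<longlongrightarrow> T f - T g) (at_right 0)"
  proof (rule Lim_transform_eventually[OF tendsto_diff[OF T_limit[OF L f] T_limit[OF L g]]])
    show "\<forall>\<^sub>F e in at_right 0. cut_integral R e f - cut_integral R e g = cut_integral R e (\<lambda>z. f z - g z)"
      using ev by eventually_elim
        (simp add: cut_integral_def scale_op.diff_left Henstock_Kurzweil_Integration.integral_diff
          cut_integrable[OF L f] cut_integrable[OF L g])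
  qed
  from tendsto_unique[OF _ T_limit[OF L xreg_diff[OF f g]] this] show "T (\<lambda>z. f z - g z) = T f - T g" by simp
  have "((\<lambda>e. cut_integral R e (\<lambda>z. c * f z)) \<longlongrightarrow> c *\<^sub>O T f) (at_right 0)"
  proof (rule Lim_transform_eventually[OF scale_op.tendsto[OF tendsto_const T_limit[OF L f]]])
    show "\<forall>\<^sub>F e in at_right 0. c *\<^sub>O cut_integral R e f = cut_integral R e (\<lambda>z. c * f z)"
      using ev
    proof eventually_elim
      case (elim e)
      from integral_linear[OF cut_integrable[OF L f elim] scale_op.bounded_linear_right[of c]]
      show ?case by (simp add: cut_integral_def o_def)
    qed
  qed
  from tendsto_unique[OF _ T_limit[OF L xreg_cmult[OF f]] this] show "T (\<lambda>z. c * f z) = c *\<^sub>O T f" by simp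
qed

lemma T_ops:
  assumes L: "in_G0 L" and f: "xreg L f f'" shows "T f \<in> ops G"
proof (rule ops_limit[OF Gb T_limit[OF L f]])
  show "\<forall>\<^sub>F e in at_right 0. cut_integral R e f \<in> ops G"
    using eventually_at_right_less[of "0::real"]
    by eventually_elim (rule cut_integral_ops[OF L], use f in \<open>auto simp: xreg_def\<close>)
qed simp

text \<open>For \<open>f\<close> vanishing near the axis the limit defining \<open>T f\<close> is
  attained, and the matrix elements are Lebesgue integrals of continuous functions. The operator
  \<open>B\<close> is inserted for the sake of products: in \<open>T f o\<^sub>L T g\<close> the
  inner integral stands behind a fixed \<open>R z\<close>.\<close>

lemma matrix_element_T_off_axis:
  assumes L: "in_G0 L" and f: "xreg L f f'" and e: "e > 0" "\<And>z. \<bar>Im z\<bar> \<le> e \<Longrightarrow> f z = 0" and B: "B \<in> ops G"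
  shows "cinner F (B (T f F')) = (LINT z|lborel. f z * cinner F (B (R z F')))"
    and "continuous_on UNIV (\<lambda>z. f z * cinner F (B (R z F')))"
proof -
  have cL: "compact L" using L by (simp add: in_G0_def)
  have z0: "f z *\<^sub>O R z = 0" if "z \<notin> {z. d < \<bar>Im z\<bar>}" "d \<le> e" for z d
    using e(2)[of z] that by (simp add: scale_op.zero_left)
  have i: "(\<lambda>z. f z *\<^sub>O R z) integrable_on UNIV" "integral UNIV (\<lambda>z. f z *\<^sub>O R z) = cut_integral R d f"
    if "0 < d" "d \<le> e" for d
    unfolding cut_integral_def
    by (rule has_integral_zero_extend[OF cut_integrable[OF L f that(1)] _ z0[OF _ that(2)]]; simp)+
  have "((\<lambda>d. cut_integral R d f) \<longlongrightarrow> integral UNIV (\<lambda>z. f z *\<^sub>O R z)) (at_right 0)"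
  proof (rule tendsto_eventually)
    show "\<forall>\<^sub>F d in at_right 0. cut_integral R d f = integral UNIV (\<lambda>z. f z *\<^sub>O R z)"
      using eventually_at_right_real[OF e(1)] by eventually_elim (use i(2) in auto)
  qed
  from tendsto_unique[OF _ T_limit[OF L f] this] have T: "T f = integral UNIV (\<lambda>z. f z *\<^sub>O R z)" by simp
  have Bs: "B (c *\<^sub>C X) = c *\<^sub>C B X" for c X using B by (simp add: ops_apply_scaleC)
  have bl: "bounded_linear (\<lambda>A. cinner F (B (blinfun_apply A F')))"
    by (rule bounded_linear_compose[OF bounded_linear_cinner bounded_linear_compose[OF blinfun.bounded_linear_right blinfun.bounded_linear_left]])
  have 1: "cinner F (B (T f F')) = integral UNIV (\<lambda>z. f z * cinner F (B (R z F')))"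
    using integral_linear[OF i(1)[OF e(1) order_refl] bl] by (simp add: T o_def Bs cinner_scaleC_right)
  show c: "continuous_on UNIV (\<lambda>z. f z * cinner F (B (R z F')))"
  proof -
    have cf: "continuous_on U f" using f by (auto simp: xreg_def intro: continuous_on_subset)
    have "continuous_on {z. Im z \<noteq> 0} (\<lambda>z. f z * cinner F (B (R z F')))"
    proof (rule continuous_off_axis[OF L])
      show "continuous_on U (\<lambda>z. f z * cinner F (B (R z F')))"
        by (intro continuous_intros cf bounded_linear.continuous_on[OF bounded_linear_cinner]
            blinfun.continuous_on continuous_R)
    qed (use f in \<open>auto simp: xreg_def\<close>)
    then show ?thesis
    proof (rule continuous_on_extend_zero[rotated 3])
      show "open {z. Im z \<noteq> (0::real)}"
        using open_vimage[of "- {0::real}" Im] by (simp add: vimage_def continuous_intros open_Compl Collect_neg_eq[symmetric])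
      show "closed {z. e \<le> \<bar>Im z\<bar>}" by (intro closed_Collect_le continuous_intros)
    qed (use e in auto)
  qed
  have "integrable lborel (\<lambda>z. f z * cinner F (B (R z F')))"
    by (rule integrable_compact_support[OF cL c]) (use f in \<open>auto simp: xreg_def\<close>)
  from integral_lborel[OF this] 1
  show "cinner F (B (T f F')) = (LINT z|lborel. f z * cinner F (B (R z F')))" by simp
qed

text \<open>The product is the double integral of \<open>f z * g w\<close> against
  \<open>R z R w = (R z - R w) / (w - z)\<close>. The two terms may be integrated separately because
  the kernel is locally integrable. The first gives \<open>f\<close> times the transform of
  \<open>g\<close> at once, the second needs the exchange of integrations in
  \<open>cauchy_transform_symmetric\<close>, whose sign turns the difference into a sum.\<close>

lemma resolvent_eq_off_axis:
  assumes L1: "in_G0 L1" "xreg L1 f f'" and L2: "in_G0 L2" "xreg L2 g g'"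
    and e: "e > 0" "\<And>z. \<bar>Im z\<bar> \<le> e \<Longrightarrow> f z = 0" "\<And>z. \<bar>Im z\<bar> \<le> e \<Longrightarrow> g z = 0"
  shows "T f o\<^sub>L T g = T (\<lambda>z. f z * cauchy_transform g z) + T (\<lambda>z. g z * cauchy_transform f z)"
proof (rule op_eq_matrix_element)
  fix F F'
  have c: "compact L1" "compact L2" using L1 L2 by (auto simp: in_G0_def)
  define r where "r z = cinner F (R z F')" for z
  \<comment> \<open>Plain matrix elements are the case \<open>B = id_op G\<close>, which acts as the
    identity on the ranges of \<open>R z\<close> and \<open>T k\<close>.\<close>
  have id: "id_op G \<in> ops G" by (rule mult_op_in_ops[OF multiplier_const[OF Gb]])
  have idX: "id_op G (R z X) = R z X" if "z \<in> U" for z X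
    using id_op_ops(1)[OF Gb R_ops, of z] that by (metis U_iff blinfun_apply_blinfun_compose)
  have idT: "id_op G (T k X) = T k X" if "in_G0 L" "xreg L k k'" for L k k' X
    using id_op_ops(1)[OF Gb T_ops[OF that]] by (metis blinfun_apply_blinfun_compose)
  have fU: "z \<in> U" if "f z \<noteq> 0" for z
  proof -
    have "z \<in> L1" using L1(2) that by (auto simp: xreg_def)
    moreover have "Im z \<noteq> 0" using e(1) e(2)[of z] that by force
    ultimately show ?thesis using L1(1) by (auto simp: in_G0_def U_iff)
  qed
  have gU: "z \<in> U" if "g z \<noteq> 0" for z
  proof -
    have "z \<in> L2" using L2(2) that by (auto simp: xreg_def)
    moreover have "Im z \<noteq> 0" using e(1) e(3)[of z] that by force
    ultimately show ?thesis using L2(1) by (auto simp: in_G0_def U_iff)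
  qed
  have elem: "cinner F (T k X) = (LINT z|lborel. k z * cinner F (R z X))"
    "continuous_on UNIV (\<lambda>z. k z * cinner F (R z X))"
    if k: "in_G0 L" "xreg L k k'" "\<And>z. \<bar>Im z\<bar> \<le> e \<Longrightarrow> k z = 0" for L k k' X
  proof -
    have kU: "z \<in> U" if "k z \<noteq> 0" for z
    proof -
      have "z \<in> L" using k(2) that by (auto simp: xreg_def)
      moreover have "Im z \<noteq> 0" using e(1) k(3)[of z] that by force
      ultimately show ?thesis using k(1) by (auto simp: in_G0_def U_iff)
    qed
    have eq: "(\<lambda>z. k z * cinner F (id_op G (R z X))) = (\<lambda>z. k z * cinner F (R z X))"
    proof
      fix z show "k z * cinner F (id_op G (R z X)) = k z * cinner F (R z X)"
        by (cases "k z = 0") (simp_all add: idX kU)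
    qed
    show "cinner F (T k X) = (LINT z|lborel. k z * cinner F (R z X))"
      using matrix_element_T_off_axis(1)[OF k(1,2) e(1) k(3) id, of F X] by (simp only: eq idT[OF k(1,2)])
    show "continuous_on UNIV (\<lambda>z. k z * cinner F (R z X))"
      using matrix_element_T_off_axis(2)[OF k(1,2) e(1) k(3) id, of F X] by (simp only: eq)
  qed
  have cgr: "continuous_on UNIV (\<lambda>z. g z * r z)" unfolding r_def by (rule elem(2)[OF L2 e(3)])
  have cfr: "continuous_on UNIV (\<lambda>z. f z * r z)" unfolding r_def by (rule elem(2)[OF L1 e(2)])
  have z0: "f z = 0" if "z \<notin> L1" for z using that L1 by (auto simp: xreg_def)
  have w0: "g z = 0" if "z \<notin> L2" for z using that L2 by (auto simp: xreg_def)
  have cont: "continuous_on UNIV f" "continuous_on UNIV g" using L1 L2 by (auto simp: xreg_def)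
  have integ: "integrable lborel (\<lambda>w. k w / (w - z))" if k: "continuous_on UNIV k" "compact L" "\<And>z. z \<notin> L \<Longrightarrow> k z = 0"
    for k and z :: complex and L
  proof -
    obtain s where s: "s > 0" "L \<subseteq> cbox (Complex (- s) (- s)) (Complex s s)" by (rule compact_complex_box[OF k(2)]) blast
    obtain N where N: "\<And>z. norm (k z) \<le> N" using bounded_compact_support[OF k(2,1,3)] by auto
    show ?thesis
      by (rule cauchy_transform_bound(1)[of _ "- s" s "- s" s N])
        (use s N k in \<open>auto intro: borel_measurable_continuous_onI\<close>)
  qed
  have inner: "f z * cinner F (R z (T g F')) = f z * r z * cauchy_transform g z - f z * cauchy_transform (\<lambda>w. g w * r w) z" for z
  proof (cases "f z = 0")
    case False
    note zU = fU[OF False]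
    have "cinner F (R z (T g F')) = (LINT w|lborel. g w * cinner F (R z (R w F')))"
      by (rule matrix_element_T_off_axis(1)[OF L2 e(1,3) R_ops]) (use zU in \<open>auto simp: U_iff\<close>)
    also have "\<dots> = (LINT w|lborel. r z * (g w / (w - z)) - g w * r w / (w - z))"
    proof (rule integral_cong_AE)
      \<comment> \<open>Only almost everywhere: at \<open>w = z\<close> the quotients are 0 by
        convention, while the left-hand side need not be.\<close>
      show "AE w in lborel. g w * cinner F (R z (R w F')) = r z * (g w / (w - z)) - g w * r w / (w - z)"
        using AE_lborel_singleton[of z]
      proof eventually_elim
        fix w assume "w \<noteq> z"
        show "g w * cinner F (R z (R w F')) = r z * (g w / (w - z)) - g w * r w / (w - z)"
        proof (cases "g w = 0")
          case g: False
          have "r z - r w = cinner F ((R z - R w) F')" by (simp add: r_def blinfun.diff_left cinner_diff_right)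
          also have "\<dots> = (w - z) * cinner F (R z (R w F'))"
            by (simp add: R_diff[OF zU gU[OF g]] cinner_scaleC_right)
          finally have "cinner F (R z (R w F')) = (r z - r w) / (w - z)" using \<open>w \<noteq> z\<close> by simp
          then show ?thesis by (simp add: diff_divide_distrib right_diff_distrib mult_ac)
        qed simp
      qed
      show "(\<lambda>w. g w * cinner F (R z (R w F'))) \<in> borel_measurable lborel"
        using matrix_element_T_off_axis(2)[OF L2 e(1,3) R_ops, of z F F'] zU
        by (auto simp: U_iff intro: borel_measurable_continuous_onI)
      have [measurable]: "g \<in> borel_measurable borel" "(\<lambda>w. g w * r w) \<in> borel_measurable borel"
        using cgr cont by (auto intro: borel_measurable_continuous_onI)
      show "(\<lambda>w. r z * (g w / (w - z)) - g w * r w / (w - z)) \<in> borel_measurable lborel" by measurable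
    qed
    also have "\<dots> = (LINT w|lborel. r z * (g w / (w - z))) - (LINT w|lborel. g w * r w / (w - z))"
      by (rule Bochner_Integration.integral_diff[OF integrable_mult_right[OF integ[OF cont(2) c(2) w0]] integ[OF cgr c(2)]])
        (simp_all add: w0)
    also have "\<dots> = r z * cauchy_transform g z - cauchy_transform (\<lambda>w. g w * r w) z"
      by (simp only: cauchy_transform_def integral_mult_right_zero)
    finally show ?thesis by (simp only: right_diff_distrib mult.assoc)
  qed simp
  have ct: "continuous_on UNIV (cauchy_transform g)" "continuous_on UNIV (cauchy_transform (\<lambda>w. g w * r w))"
    by (rule continuous_cauchy_transform[OF cont(2) c(2) w0], assumption)
      (rule continuous_cauchy_transform[OF cgr c(2)], simp add: w0)
  have i1: "integrable lborel (\<lambda>z. f z * r z * cauchy_transform g z)"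
    by (rule integrable_compact_support[OF c(1)]) (auto intro!: continuous_intros cfr ct simp: z0)
  have i2: "integrable lborel (\<lambda>z. f z * cauchy_transform (\<lambda>w. g w * r w) z)"
    by (rule integrable_compact_support[OF c(1)]) (auto intro!: continuous_intros cont ct simp: z0)
  have "cinner F ((T f o\<^sub>L T g) F') = (LINT z|lborel. f z * cinner F (R z (T g F')))"
    using elem(1)[OF L1 e(2)] by simp
  also have "\<dots> = (LINT z|lborel. f z * r z * cauchy_transform g z) - (LINT z|lborel. f z * cauchy_transform (\<lambda>w. g w * r w) z)"
    unfolding inner using i1 i2 by simp
  also have "(LINT z|lborel. f z * cauchy_transform (\<lambda>w. g w * r w) z) = - (LINT w|lborel. g w * r w * cauchy_transform f w)"
    by (rule cauchy_transform_symmetric[OF cont(1) c(1) z0 cgr c(2)]) (simp_all add: w0)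
  also have "(LINT z|lborel. f z * r z * cauchy_transform g z) = cinner F (T (\<lambda>z. f z * cauchy_transform g z) F')"
    using elem(1)[OF L1(1) xreg_mult_cauchy_transform[OF L1(2) c(1) L2(2) c(2)], of F'] e(2) by (simp add: r_def mult_ac)
  also have "(LINT w|lborel. g w * r w * cauchy_transform f w) = cinner F (T (\<lambda>z. g z * cauchy_transform f z) F')"
    using elem(1)[OF L2(1) xreg_mult_cauchy_transform[OF L2(2) c(2) L1(2) c(1)], of F'] e(3) by (simp add: r_def mult_ac)
  finally show "cinner F ((T f o\<^sub>L T g) F') =
      cinner F ((T (\<lambda>z. f z * cauchy_transform g z) + T (\<lambda>z. g z * cauchy_transform f z)) F')"
    by (simp add: blinfun.add_left cinner_add_right)
qed

text \<open>The difference is \<open>T\<close> of \<open>f\<close> times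
  \<open>1 - axis_cutoff e\<close>, which lives in \<open>|Im z| \<le> 2 * e\<close> and obeys the
  same bounds \<open>N\<close> as \<open>f\<close>; the strip estimate makes it of order
  \<open>sqrt e\<close>.\<close>

lemma T_axis_cutoff_limit:
  assumes L: "in_G0 L" "xreg L f f'"
  shows "((\<lambda>e. T (\<lambda>z. f z * axis_cutoff e z)) \<longlongrightarrow> T f) (at_right 0)"
proof -
  have cL: "compact L" using L by (simp add: in_G0_def)
  obtain c where c: "c \<ge> 0" "\<And>f f' N e. xreg L f f' \<Longrightarrow> (\<And>z. norm (f z) \<le> N) \<Longrightarrow> (\<And>z. norm (f' z) \<le> N) \<Longrightarrow> e > 0 \<Longrightarrow>
      (\<And>z. e < \<bar>Im z\<bar> \<Longrightarrow> f z = 0) \<Longrightarrow> norm (T f) \<le> c * N * sqrt e"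
    by (rule resolvent_dist_limit[OF L(1)]) blast
  obtain N where N: "N > 0" "\<And>z. norm (f z) \<le> N" "\<And>z. norm (f' z) \<le> N" by (rule xreg_bounded[OF cL L(2)]) blast
  have "((\<lambda>e. norm (T (\<lambda>z. f z * axis_cutoff e z) - T f)) \<longlongrightarrow> 0) (at_right 0)"
  proof (rule tendsto_sandwich[OF _ _ tendsto_const])
    show "\<forall>\<^sub>F e in at_right 0. norm (T (\<lambda>z. f z * axis_cutoff e z) - T f) \<le> c * N * sqrt (2 * e)"
      using eventually_at_right_less[of "0::real"]
    proof eventually_elim
      case (elim e)
      have "T f - T (\<lambda>z. f z * axis_cutoff e z) = T (\<lambda>z. f z * (1 - axis_cutoff e z))"
        using T_linear(2)[OF L xreg_axis_cutoff(1)[OF L(2) elim]] by (simp add: algebra_simps)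
      moreover have "norm (T (\<lambda>z. f z * (1 - axis_cutoff e z))) \<le> c * N * sqrt (2 * e)"
      proof (rule c(2)[OF xreg_axis_cutoff(2)[OF L(2) elim]])
        show "norm (f z * (1 - axis_cutoff e z)) \<le> N" "norm (f' z * (1 - axis_cutoff e z)) \<le> N" for z
          using N axis_cutoff(3)[OF elim, of z] mult_mono[OF N(2)[of z] axis_cutoff(3)[OF elim, of z]]
            mult_mono[OF N(3)[of z] axis_cutoff(3)[OF elim, of z]] by (auto simp: norm_mult)
      qed (use elim axis_cutoff(5)[OF elim] in auto)
      ultimately show ?case by (simp add: norm_minus_commute)
    qed
    show "((\<lambda>e. c * N * sqrt (2 * e)) \<longlongrightarrow> 0) (at_right 0)" by (auto intro!: tendsto_eq_intros)
  qed auto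
  then show ?thesis by (simp add: tendsto_norm_zero_iff LIM_zero_iff)
qed

text \<open>The transform of the cut \<open>g\<close> is that of \<open>g\<close> minus that of
  \<open>g\<close> times \<open>1 - axis_cutoff e\<close>. The latter function is supported in a box
  of area of order \<open>e\<close>, so its transform and the horizontal derivative of this are
  uniformly of order \<open>sqrt e\<close>. In the former term only the outer cutoff remains to be
  removed.\<close>

lemma T_axis_cutoff_transform_limit:
  assumes L: "in_G0 L" "xreg L f f'" and L': "compact L'" "xreg L' g g'"
  shows "((\<lambda>e. T (\<lambda>z. f z * axis_cutoff e z * cauchy_transform (\<lambda>w. g w * axis_cutoff e w) z)) \<longlongrightarrow>
    T (\<lambda>z. f z * cauchy_transform g z)) (at_right 0)"
proof -
  have cL: "compact L" using L by (simp add: in_G0_def)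
  obtain c where c: "c \<ge> 0" "\<And>f f' N. xreg L f f' \<Longrightarrow> (\<And>z. norm (f z) \<le> N) \<Longrightarrow> (\<And>z. norm (f' z) \<le> N) \<Longrightarrow>
      norm (T f) \<le> c * N"
    by (rule resolvent_dist_limit[OF L(1)]) blast
  obtain N where N: "N > 0" "\<And>z. norm (f z) \<le> N" "\<And>z. norm (f' z) \<le> N" by (rule xreg_bounded[OF cL L(2)]) blast
  obtain M where M: "M > 0" "\<And>z. norm (g z) \<le> M" "\<And>z. norm (g' z) \<le> M" by (rule xreg_bounded[OF L']) blast
  obtain s where s: "s > 0" "L' \<subseteq> cbox (Complex (- s) (- s)) (Complex s s)" by (rule compact_complex_box[OF L'(1)]) blast
  have fg: "xreg L (\<lambda>z. f z * cauchy_transform g z) (\<lambda>z. f z * cauchy_transform g' z + f' z * cauchy_transform g z)"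
    by (rule xreg_mult_cauchy_transform[OF L(2) cL L'(2,1)])
  have small: "((\<lambda>e. T (\<lambda>z. f z * axis_cutoff e z * cauchy_transform (\<lambda>w. g w * (1 - axis_cutoff e w)) z)) \<longlongrightarrow> 0) (at_right 0)"
  proof (rule Lim_null_comparison)
    show "\<forall>\<^sub>F e in at_right 0. norm (T (\<lambda>z. f z * axis_cutoff e z * cauchy_transform (\<lambda>w. g w * (1 - axis_cutoff e w)) z))
        \<le> c * (2 * N * (16 * sqrt ((2 * s) * (4 * e)) * M))"
      using eventually_at_right_less[of "0::real"]
    proof eventually_elim
      case (elim e)
      have W: "norm (cauchy_transform (\<lambda>w. k w * (1 - axis_cutoff e w)) z) \<le> 16 * sqrt ((2 * s) * (4 * e)) * M"
        if k: "continuous_on UNIV k" "\<And>z. z \<notin> L' \<Longrightarrow> k z = 0" "\<And>z. norm (k z) \<le> M" for k z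
      proof -
        \<comment> \<open>The box has width \<open>2 * s\<close>, from the support of
          \<open>k\<close>, and height \<open>4 * e\<close>, from the cutoff.\<close>
        have "norm (cauchy_transform (\<lambda>w. k w * (1 - axis_cutoff e w)) z) \<le> 16 * sqrt ((s - - s) * (2 * e - - (2 * e))) * M"
        proof (rule cauchy_transform_bound(4))
          show "(\<lambda>w. k w * (1 - axis_cutoff e w)) \<in> borel_measurable borel"
            by (intro borel_measurable_continuous_onI continuous_intros k axis_cutoff(1) elim)
          show "- s \<le> s" "- (2 * e) \<le> 2 * e" using s elim by auto
          show "k w * (1 - axis_cutoff e w) = 0" if "w \<notin> cbox (Complex (- s) (- (2 * e))) (Complex s (2 * e))" for w
          proof (cases "w \<in> L'")
            case True
            then have "2 * e < \<bar>Im w\<bar>" using that s(2) by (auto simp: in_cbox_complex_iff abs_le_iff)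
            then show ?thesis using axis_cutoff(5)[OF elim, of w] by simp
          qed (simp add: k)
          show "norm (k w * (1 - axis_cutoff e w)) \<le> M" for w
            using M mult_mono[OF k(3)[of w] axis_cutoff(3)[OF elim, of w]] by (simp add: norm_mult)
        qed
        then show ?thesis by simp
      qed
      define w where "w = 16 * sqrt ((2 * s) * (4 * e)) * M"
      have Wg: "norm (cauchy_transform (\<lambda>w. g w * (1 - axis_cutoff e w)) z) \<le> w"
        "norm (cauchy_transform (\<lambda>w. g' w * (1 - axis_cutoff e w)) z) \<le> w" for z
        unfolding w_def by (rule W; use L'(2) M in \<open>simp add: xreg_def\<close>)+
      have w0: "w \<ge> 0" using Wg(1) by (rule order_trans[OF norm_ge_zero])
      have fN: "norm (f z * axis_cutoff e z) \<le> N" "norm (f' z * axis_cutoff e z) \<le> N" for z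
        using N(1) mult_mono[OF N(2)[of z] axis_cutoff(2)[OF elim, of z]] mult_mono[OF N(3)[of z] axis_cutoff(2)[OF elim, of z]]
        by (auto simp: norm_mult)
      have prod: "norm (a * b) \<le> N * w" if "norm a \<le> N" "norm b \<le> w" for a b :: complex
        unfolding norm_mult using that N(1) by (intro mult_mono) auto
      show ?case unfolding w_def[symmetric]
      proof (rule c(2)[OF xreg_mult_cauchy_transform[OF xreg_axis_cutoff(1)[OF L(2) elim] cL xreg_axis_cutoff(2)[OF L'(2) elim] L'(1)]])
        fix z
        show "norm (f z * axis_cutoff e z * cauchy_transform (\<lambda>w. g w * (1 - axis_cutoff e w)) z) \<le> 2 * N * w"
          using prod[OF fN(1) Wg(1), of z z] mult_nonneg_nonneg[OF less_imp_le[OF N(1)] w0] by linarith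
        show "norm (f z * axis_cutoff e z * cauchy_transform (\<lambda>z. g' z * (1 - axis_cutoff e z)) z +
            f' z * axis_cutoff e z * cauchy_transform (\<lambda>z. g z * (1 - axis_cutoff e z)) z) \<le> 2 * N * w"
          using norm_triangle_le[OF add_mono[OF prod[OF fN(1)[of z] Wg(2)[of z]] prod[OF fN(2)[of z] Wg(1)[of z]]]] by simp
      qed
    qed
    show "((\<lambda>e. c * (2 * N * (16 * sqrt ((2 * s) * (4 * e)) * M))) \<longlongrightarrow> 0) (at_right 0)"
      by (auto intro!: tendsto_eq_intros)
  qed
  have main: "((\<lambda>e. T (\<lambda>z. f z * cauchy_transform g z * axis_cutoff e z)) \<longlongrightarrow> T (\<lambda>z. f z * cauchy_transform g z)) (at_right 0)"
    by (rule T_axis_cutoff_limit[OF L(1) fg])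
  have "((\<lambda>e. T (\<lambda>z. f z * cauchy_transform g z * axis_cutoff e z) -
      T (\<lambda>z. f z * axis_cutoff e z * cauchy_transform (\<lambda>w. g w * (1 - axis_cutoff e w)) z)) \<longlongrightarrow>
      T (\<lambda>z. f z * cauchy_transform g z) - 0) (at_right 0)"
    by (rule tendsto_diff[OF main small])
  then have "((\<lambda>e. T (\<lambda>z. f z * axis_cutoff e z * cauchy_transform (\<lambda>w. g w * axis_cutoff e w) z)) \<longlongrightarrow>
      T (\<lambda>z. f z * cauchy_transform g z) - 0) (at_right 0)"
  proof (rule Lim_transform_eventually)
    show "\<forall>\<^sub>F e in at_right 0. T (\<lambda>z. f z * cauchy_transform g z * axis_cutoff e z) -
        T (\<lambda>z. f z * axis_cutoff e z * cauchy_transform (\<lambda>w. g w * (1 - axis_cutoff e w)) z) =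
        T (\<lambda>z. f z * axis_cutoff e z * cauchy_transform (\<lambda>w. g w * axis_cutoff e w) z)"
      using eventually_at_right_less[of "0::real"]
    proof eventually_elim
      case (elim e)
      have int: "integrable lborel (\<lambda>w. g w * k w / (w - z))" if k: "continuous_on UNIV k" for k z
      proof -
        have ck: "continuous_on UNIV (\<lambda>w. g w * k w)" using L'(2) k by (auto simp: xreg_def intro!: continuous_intros)
        have zk: "g w * k w = 0" if "w \<notin> L'" for w using L'(2) that by (auto simp: xreg_def)
        obtain Q where Q: "\<And>w. norm (g w * k w) \<le> Q" using bounded_compact_support[OF L'(1) ck zk] by auto
        show ?thesis
          by (rule cauchy_transform_bound(1)[of _ "- s" s "- s" s Q])
            (use s Q zk ck in \<open>auto intro: borel_measurable_continuous_onI simp del: mult_eq_0_iff\<close>)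
      qed
      have "cauchy_transform g z = cauchy_transform (\<lambda>w. g w * axis_cutoff e w) z + cauchy_transform (\<lambda>w. g w * (1 - axis_cutoff e w)) z" for z
      proof -
        have "cauchy_transform (\<lambda>w. g w * axis_cutoff e w) z + cauchy_transform (\<lambda>w. g w * (1 - axis_cutoff e w)) z =
          (LINT w|lborel. g w * axis_cutoff e w / (w - z) + g w * (1 - axis_cutoff e w) / (w - z))"
          unfolding cauchy_transform_def
          by (rule Bochner_Integration.integral_add[symmetric]) (intro int continuous_intros axis_cutoff(1) elim)+
        also have "\<dots> = cauchy_transform g z"
          unfolding cauchy_transform_def
          by (intro Bochner_Integration.integral_cong refl) (simp add: add_divide_distrib[symmetric] distrib_left[symmetric])
        finally show ?thesis by simp
      qed
      then have "(\<lambda>z. f z * axis_cutoff e z * cauchy_transform (\<lambda>w. g w * axis_cutoff e w) z) =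
          (\<lambda>z. f z * cauchy_transform g z * axis_cutoff e z - f z * axis_cutoff e z * cauchy_transform (\<lambda>w. g w * (1 - axis_cutoff e w)) z)"
        by (simp add: fun_eq_iff algebra_simps)
      then show ?case
        using T_linear(2)[OF L(1) xreg_axis_cutoff(1)[OF fg elim]
            xreg_mult_cauchy_transform[OF xreg_axis_cutoff(1)[OF L(2) elim] cL xreg_axis_cutoff(2)[OF L'(2) elim] L'(1)]]
        by simp
    qed
  qed
  then show ?thesis by simp
qed

lemma resolvent_eq:
  assumes L1: "in_G0 L1" "xreg L1 f f'" and L2: "in_G0 L2" "xreg L2 g g'"
  shows "T f o\<^sub>L T g = T (\<lambda>z. f z * cauchy_transform g z) + T (\<lambda>z. g z * cauchy_transform f z)"
proof -
  have c: "compact L1" "compact L2" using L1 L2 by (auto simp: in_G0_def)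
  have 1: "((\<lambda>e. T (\<lambda>z. f z * axis_cutoff e z) o\<^sub>L T (\<lambda>z. g z * axis_cutoff e z)) \<longlongrightarrow> T f o\<^sub>L T g) (at_right 0)"
    by (intro bounded_bilinear.tendsto[OF bounded_bilinear_blinfun_compose] T_axis_cutoff_limit[OF L1] T_axis_cutoff_limit[OF L2])
  have 2: "((\<lambda>e. T (\<lambda>z. f z * axis_cutoff e z * cauchy_transform (\<lambda>w. g w * axis_cutoff e w) z) +
      T (\<lambda>z. g z * axis_cutoff e z * cauchy_transform (\<lambda>w. f w * axis_cutoff e w) z)) \<longlongrightarrow>
      T (\<lambda>z. f z * cauchy_transform g z) + T (\<lambda>z. g z * cauchy_transform f z)) (at_right 0)"
    by (rule tendsto_add[OF T_axis_cutoff_transform_limit[OF L1 c(2) L2(2)] T_axis_cutoff_transform_limit[OF L2 c(1) L1(2)]])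
  have "\<forall>\<^sub>F e in at_right 0. T (\<lambda>z. f z * axis_cutoff e z * cauchy_transform (\<lambda>w. g w * axis_cutoff e w) z) +
      T (\<lambda>z. g z * axis_cutoff e z * cauchy_transform (\<lambda>w. f w * axis_cutoff e w) z) =
      T (\<lambda>z. f z * axis_cutoff e z) o\<^sub>L T (\<lambda>z. g z * axis_cutoff e z)"
    using eventually_at_right_less[of "0::real"]
  proof eventually_elim
    case (elim e)
    show ?case
      by (rule resolvent_eq_off_axis[OF L1(1) xreg_axis_cutoff(1)[OF L1(2) elim] L2(1) xreg_axis_cutoff(1)[OF L2(2) elim] elim, symmetric])
        (use axis_cutoff(4)[OF elim] in auto)
  qed
  from Lim_transform_eventually[OF 2 this] 1 show ?thesis by (intro tendsto_unique[OF _ 1]) auto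
qed

end

section \<open>Boundary values and the spectral distribution\<close>

lemma test_function_partials:
  assumes "\<phi> \<in> test_functions V" "bs \<in> lists Basis"
  shows "partials bs \<phi> differentiable at x" "continuous_on UNIV (partials bs \<phi>)"
    "x \<notin> supp \<phi> \<Longrightarrow> partials bs \<phi> x = 0"
proof -
  show d: "partials bs \<phi> differentiable at x" for x using assms by (auto simp: test_functions_def smooth_on_def)
  then show "continuous_on UNIV (partials bs \<phi>)"
    by (simp add: continuous_at_imp_continuous_on differentiable_imp_continuous_within)
  assume "x \<notin> supp \<phi>"
  then show "partials bs \<phi> x = 0"
  proof (induction bs arbitrary: x)
    case Nil
    then show ?case using closure_subset[of "{x. \<phi> x \<noteq> 0}"] by (auto simp: supp_def)
  next
    case (Cons b bs)
    have "partials [b] (partials bs \<phi>) x = 0"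
      by (rule partial_outside_support(2)[OF _ Cons.IH Cons.prems]) (simp_all add: supp_def)
    then show ?case by (simp add: partials.simps)
  qed
qed

lemma test_function_bounded:
  assumes "\<phi> \<in> test_functions V" "bs \<in> lists Basis"
  obtains B where "B > 0" "\<And>x. norm (partials bs \<phi> x) \<le> B"
proof -
  have "compact (supp \<phi>)" using assms by (simp add: test_functions_def)
  from bounded_compact_support[OF this test_function_partials(2)[OF assms] test_function_partials(3)[OF assms]] that
  show ?thesis by metis
qed

lemma norm_partials_le_Cm_norm:
  fixes \<phi> :: "'a::euclidean_space \<Rightarrow> complex"
  assumes \<phi>: "\<phi> \<in> test_functions V" and bs: "set bs \<subseteq> Basis" "length bs \<le> m"
  shows "norm (partials bs \<phi> x) \<le> Cm_norm m \<phi>"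
proof -
  have bdd: "bdd_above (range (\<lambda>x. cmod (partials cs \<phi> x)))" if "set cs \<subseteq> Basis" for cs
  proof -
    have "cs \<in> lists Basis" using that by auto
    then obtain B where "\<And>x. norm (partials cs \<phi> x) \<le> B" using test_function_bounded[OF \<phi>] by metis
    then show ?thesis by (intro bdd_aboveI2)
  qed
  have "norm (partials bs \<phi> x) \<le> (SUP x. cmod (partials bs \<phi> x))"
    by (rule cSUP_upper[OF _ bdd[OF bs(1)]]) simp
  also have "\<dots> \<le> Cm_norm m \<phi>"
    unfolding Cm_norm_def
  proof (rule member_le_sum)
    show "finite {bs :: 'a list. set bs \<subseteq> Basis \<and> length bs \<le> m}" by (rule finite_lists_length_le) simp
    fix cs :: "'a list" assume "cs \<in> {bs. set bs \<subseteq> Basis \<and> length bs \<le> m} - {bs}"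
    then have "set cs \<subseteq> Basis" by simp
    then have "norm (partials cs \<phi> x) \<le> (SUP x. cmod (partials cs \<phi> x))"
      by (intro cSUP_upper bdd) auto
    then show "0 \<le> (SUP x. cmod (partials cs \<phi> x))" by (rule order_trans[OF norm_ge_zero])
  qed (use bs in auto)
  finally show ?thesis .
qed

lemma Basis_complex_lists [simp]: "1 \<in> (Basis :: complex set)" "\<i> \<in> Basis"
  by (simp_all add: Basis_complex_def)

lemma has_derivative_complex_partials:
  assumes "f differentiable at z"
  shows "(f has_derivative (\<lambda>h. Re h *\<^sub>R partials [1] f z + Im h *\<^sub>R partials [\<i>] f z)) (at z)"
proof -
  note D = differentiable_has_derivative[OF assms]
  have lin: "linear (\<lambda>b. partials [b] f z)" by (rule has_derivative_linear[OF D])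
  have "partials [h] f z = Re h *\<^sub>R partials [1] f z + Im h *\<^sub>R partials [\<i>] f z" for h
  proof -
    have "h = Re h *\<^sub>R 1 + Im h *\<^sub>R \<i>" by (simp add: complex_eq_iff)
    then have "partials [h] f z = partials [Re h *\<^sub>R 1 + Im h *\<^sub>R \<i>] f z"
      by (rule arg_cong[where f = "\<lambda>h. partials [h] f z"])
    also have "\<dots> = Re h *\<^sub>R partials [1] f z + Im h *\<^sub>R partials [\<i>] f z"
      unfolding linear_add[OF lin] linear_cmul[OF lin] ..
    finally show ?thesis .
  qed
  then have eq: "(\<lambda>h. partials [h] f z) = (\<lambda>h. Re h *\<^sub>R partials [1] f z + Im h *\<^sub>R partials [\<i>] f z)"
    by (rule ext)
  show ?thesis by (rule subst[OF eq, of "\<lambda>D. (f has_derivative D) (at z)"]) (rule D)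
qed

lemma has_vector_derivative_complex_lines:
  assumes "\<And>z. f differentiable at z"
  shows "((\<lambda>x. f (Complex x u)) has_vector_derivative partials [1] f (Complex x u)) (at x)"
    "((\<lambda>u. f (Complex x u)) has_vector_derivative partials [\<i>] f (Complex x u)) (at u)"
proof -
  have "Complex 0 u + t *\<^sub>R 1 = Complex t u" for t by (simp add: complex_eq_iff)
  with has_vector_derivative_partial[of f "Complex 0 u" x 1, OF assms]
  show "((\<lambda>x. f (Complex x u)) has_vector_derivative partials [1] f (Complex x u)) (at x)" by simp
  have "Complex x 0 + t *\<^sub>R \<i> = Complex x t" for t by (simp add: complex_eq_iff)
  with has_vector_derivative_partial[of f "Complex x 0" u \<i>, OF assms]
  show "((\<lambda>u. f (Complex x u)) has_vector_derivative partials [\<i>] f (Complex x u)) (at u)" by simp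
qed

lemma partials_Cons: "partials [b] (partials bs f) = partials (b # bs) f"
  by (simp add: partials.simps)

lemma xreg_test_function:
  assumes "\<phi> \<in> test_functions V" "bs \<in> lists Basis"
  shows "xreg (supp \<phi>) (partials bs \<phi>) (partials (1 # bs) \<phi>)"
proof -
  have bs: "1 # bs \<in> lists Basis" using assms(2) by simp
  show ?thesis unfolding xreg_def
    using test_function_partials[OF assms] test_function_partials[OF assms(1) bs]
      has_vector_derivative_complex_lines(1)[of "partials bs \<phi>", unfolded partials_Cons]
    by auto
qed

lemma dbar_eq: "dbar \<phi> = (\<lambda>z. (1/2) * partials [1] \<phi> z + (\<i>/2) * partials [\<i>] \<phi> z)"
  by (simp add: dbar_def partials.simps fun_eq_iff field_simps)

lemma xreg_dbar:
  assumes "\<phi> \<in> test_functions V"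
  shows "xreg (supp \<phi>) (dbar \<phi>) (\<lambda>z. (1/2) * partials [1,1] \<phi> z + (\<i>/2) * partials [1,\<i>] \<phi> z)"
  unfolding dbar_eq by (intro xreg_add xreg_cmult xreg_test_function[OF assms]) auto

lemma C1supp_test_function:
  assumes "\<psi> \<in> test_functions V" "bs \<in> lists Basis" "supp \<psi> \<subseteq> L"
  shows "C1supp L (partials bs \<psi>) (partials (1 # bs) \<psi>)"
proof -
  have bs: "1 # bs \<in> lists Basis" using assms(2) by simp
  have "(partials bs \<psi> has_vector_derivative partials (1 # bs) \<psi> x) (at x)" for x
    using has_vector_derivative_partial[of "partials bs \<psi>" 0 x 1] test_function_partials(1)[OF assms(1,2)]
    by (simp add: partials_Cons)
  moreover have "partials bs \<psi> x = 0" if "x \<notin> L" for x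
    by (rule test_function_partials(3)[OF assms(1,2)]) (use that assms(3) in auto)
  ultimately show ?thesis
    using test_function_partials(2)[OF assms(1) bs] by (simp add: C1supp_def)
qed

lemma supp_zero: "x \<notin> supp \<phi> \<Longrightarrow> \<phi> x = 0"
  using closure_subset[of "{x. \<phi> x \<noteq> 0}"] by (auto simp: supp_def)

context boundary_resolvent
begin

abbreviation "G0 \<equiv> {z. Re z \<in> G1 \<and> Im z \<in> I}"

lemma in_G0_iff: "in_G0 L \<longleftrightarrow> compact L \<and> L \<subseteq> G0"
  by (auto simp: in_G0_def)

lemma in_G0_supp: "\<phi> \<in> test_functions G0 \<Longrightarrow> in_G0 (supp \<phi>)"
  by (simp add: in_G0_iff test_functions_def)

lemma xreg_test: "\<phi> \<in> test_functions V \<Longrightarrow> xreg (supp \<phi>) \<phi> (partials [1] \<phi>)"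
  using xreg_test_function[of \<phi> V "[]"] by simp

lemma in_G0_Un: "in_G0 L \<Longrightarrow> in_G0 L' \<Longrightarrow> in_G0 (L \<union> L')"
  by (auto simp: in_G0_iff compact_Un)

text \<open>Only \<open>\<phi>\<close> and its horizontal derivative enter the bound, so the
  distribution has order at most 1.\<close>

lemma op_distribution_T: "op_distribution G G0 T"
  unfolding op_distribution_def
proof (intro conjI ballI allI impI)
  fix \<phi> assume \<phi>: "\<phi> \<in> test_functions G0"
  show "T \<phi> \<in> ops G" by (rule T_ops[OF in_G0_supp[OF \<phi>] xreg_test[OF \<phi>]])
  show "T (\<lambda>x. c * \<phi> x) = c *\<^sub>O T \<phi>" for c
    by (rule T_linear(3)[OF in_G0_supp[OF \<phi>] xreg_test[OF \<phi>] xreg_test[OF \<phi>]])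
  fix \<psi> assume \<psi>: "\<psi> \<in> test_functions G0"
  show "T (\<lambda>x. \<phi> x + \<psi> x) = T \<phi> + T \<psi>"
    by (rule T_linear(1)[OF in_G0_Un[OF in_G0_supp[OF \<phi>] in_G0_supp[OF \<psi>]]
          xreg_mono[OF xreg_test[OF \<phi>]] xreg_mono[OF xreg_test[OF \<psi>]]]) auto
next
  fix L assume "compact L \<and> L \<subseteq> G0"
  then have L: "in_G0 L" by (simp add: in_G0_iff)
  obtain c where c: "c \<ge> 0" "\<And>f f' N. xreg L f f' \<Longrightarrow> (\<And>z. norm (f z) \<le> N) \<Longrightarrow> (\<And>z. norm (f' z) \<le> N) \<Longrightarrow>
      norm (T f) \<le> c * N"
    by (rule resolvent_dist_limit[OF L]) blast
  show "\<exists>c m. \<forall>\<phi>\<in>test_functions G0. supp \<phi> \<subseteq> L \<longrightarrow> norm (T \<phi>) \<le> c * Cm_norm m \<phi>"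
  proof (intro exI ballI impI)
    fix \<phi> assume \<phi>: "\<phi> \<in> test_functions G0" "supp \<phi> \<subseteq> L"
    show "norm (T \<phi>) \<le> c * Cm_norm 1 \<phi>"
      by (rule c(2)[OF xreg_mono[OF xreg_test[OF \<phi>(1)] \<phi>(2)]])
        (use norm_partials_le_Cm_norm[OF \<phi>(1), of "[]" 1] norm_partials_le_Cm_norm[OF \<phi>(1), of "[1]" 1] in auto)
  qed
qed

lemma dist_resolvent_eq_T: "dist_resolvent_eq G0 T"
  unfolding dist_resolvent_eq_def
proof (intro ballI)
  fix \<phi> \<psi> assume \<phi>: "\<phi> \<in> test_functions G0" and \<psi>: "\<psi> \<in> test_functions G0"
  note L = in_G0_supp[OF \<phi>] in_G0_supp[OF \<psi>] and x = xreg_test[OF \<phi>] xreg_test[OF \<psi>]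
  have c: "compact (supp \<phi>)" "compact (supp \<psi>)" using \<phi> \<psi> by (auto simp: test_functions_def)
  \<comment> \<open>In the second term of the equation the first variable is integrated, and the
    kernel is the negative of that of \<open>cauchy_transform\<close>; hence the sum in
    \<open>resolvent_eq\<close> becomes a difference.\<close>
  have eq: "(LINT w|lborel. \<phi> w / (z - w)) = - cauchy_transform \<phi> z" for z
  proof -
    have "\<phi> w / (z - w) = - (\<phi> w / (w - z))" for w by (metis minus_diff_eq minus_divide_right)
    then show ?thesis by (simp add: cauchy_transform_def)
  qed
  have "T \<phi> o\<^sub>L T \<psi> = T (\<lambda>z. \<phi> z * cauchy_transform \<psi> z) + T (\<lambda>z. \<psi> z * cauchy_transform \<phi> z)"
    by (rule resolvent_eq[OF L(1) x(1) L(2) x(2)])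
  also have "\<dots> = T (\<lambda>z. \<phi> z * cauchy_transform \<psi> z) - T (\<lambda>z. - 1 * (\<psi> z * cauchy_transform \<phi> z))"
    using T_linear(3)[OF L(2) xreg_mult_cauchy_transform[OF x(2) c(2) x(1) c(1)] xreg_mult_cauchy_transform[OF x(2) c(2) x(1) c(1)], of "-1"]
    by (simp add: scale_op.minus_left)
  also have "\<dots> = T (\<lambda>z. \<phi> z * (LINT w|lborel. \<psi> w / (w - z))) - T (\<lambda>z. \<psi> z * (LINT w|lborel. \<phi> w / (z - w)))"
    unfolding eq by (simp add: cauchy_transform_def)
  finally show "T \<phi> o\<^sub>L T \<psi> = T (\<lambda>z. \<phi> z * (LINT w|lborel. \<psi> w / (w - z))) - T (\<lambda>z. \<psi> z * (LINT w|lborel. \<phi> w / (z - w)))" .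
qed

lemma I_symmetric:
  obtains d where "d > 0" "\<And>t. \<bar>t\<bar> \<le> d \<Longrightarrow> t \<in> I"
proof -
  obtain d where "d > 0" "cball 0 d \<subseteq> I" using open_contains_cball_eq[OF I(1)] I(3) by blast
  then show ?thesis by (intro that[of d]) (auto simp: subset_iff dist_real_def)
qed

text \<open>The reflection \<open>u = - t\<close> reduces the lower value to a limit from the right
  with \<open>s = -1\<close>. The class \<open>C1supp\<close> with two derivatives takes the place
  of test functions, because sums, multiples and restrictions to the real axis are treated through
  it as well.\<close>

lemma boundary_values:
  assumes K1: "compact K1" "K1 \<subseteq> G1"
  obtains c where "c \<ge> 0"
    "\<And>\<psi> \<psi>' \<psi>'' N. C1supp K1 \<psi> \<psi>' \<Longrightarrow> C1supp K1 \<psi>' \<psi>'' \<Longrightarrow> (\<And>x. norm (\<psi> x) \<le> N) \<Longrightarrow> (\<And>x. norm (\<psi>' x) \<le> N) \<Longrightarrow>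
      (\<And>x. norm (\<psi>'' x) \<le> N) \<Longrightarrow>
      ((\<lambda>u. slice R u \<psi>) \<longlongrightarrow> upper_value R \<psi>) (at_right 0) \<and> ((\<lambda>u. slice R u \<psi>) \<longlongrightarrow> lower_value R \<psi>) (at_left 0) \<and>
      norm (upper_value R \<psi>) \<le> c * N \<and> norm (lower_value R \<psi>) \<le> c * N"
proof -
  obtain d where d: "d > 0" "\<And>t. \<bar>t\<bar> \<le> d \<Longrightarrow> t \<in> I" by (rule I_symmetric, rule that)
  have "\<exists>c\<ge>0. \<forall>\<psi> \<psi>' \<psi>'' N. C1supp K1 \<psi> \<psi>' \<longrightarrow> C1supp K1 \<psi>' \<psi>'' \<longrightarrow>
    (\<forall>x. norm (\<psi> x) \<le> N) \<longrightarrow> (\<forall>x. norm (\<psi>' x) \<le> N) \<longrightarrow> (\<forall>x. norm (\<psi>'' x) \<le> N) \<longrightarrow>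
    ((\<lambda>t. slice R (s * t) \<psi>) \<longlongrightarrow> Lim (at_right 0) (\<lambda>t. slice R (s * t) \<psi>)) (at_right 0) \<and>
    norm (Lim (at_right 0) (\<lambda>t. slice R (s * t) \<psi>)) \<le> c * N" if s: "s \<in> {-1, 1}" for s :: real
    using s d by (intro slice_limit[OF K1 s d(1)]) auto
  note lim = this
  obtain c1 where c1: "c1 \<ge> 0" "\<forall>\<psi> \<psi>' \<psi>'' N. C1supp K1 \<psi> \<psi>' \<longrightarrow> C1supp K1 \<psi>' \<psi>'' \<longrightarrow>
    (\<forall>x. norm (\<psi> x) \<le> N) \<longrightarrow> (\<forall>x. norm (\<psi>' x) \<le> N) \<longrightarrow> (\<forall>x. norm (\<psi>'' x) \<le> N) \<longrightarrow>
    ((\<lambda>t. slice R (1 * t) \<psi>) \<longlongrightarrow> Lim (at_right 0) (\<lambda>t. slice R (1 * t) \<psi>)) (at_right 0) \<and>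
    norm (Lim (at_right 0) (\<lambda>t. slice R (1 * t) \<psi>)) \<le> c1 * N"
    using lim[of 1] by auto
  obtain c2 where c2: "c2 \<ge> 0" "\<forall>\<psi> \<psi>' \<psi>'' N. C1supp K1 \<psi> \<psi>' \<longrightarrow> C1supp K1 \<psi>' \<psi>'' \<longrightarrow>
    (\<forall>x. norm (\<psi> x) \<le> N) \<longrightarrow> (\<forall>x. norm (\<psi>' x) \<le> N) \<longrightarrow> (\<forall>x. norm (\<psi>'' x) \<le> N) \<longrightarrow>
    ((\<lambda>t. slice R (-1 * t) \<psi>) \<longlongrightarrow> Lim (at_right 0) (\<lambda>t. slice R (-1 * t) \<psi>)) (at_right 0) \<and>
    norm (Lim (at_right 0) (\<lambda>t. slice R (-1 * t) \<psi>)) \<le> c2 * N"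
    using lim[of "-1"] by auto
  show ?thesis
  proof (rule that[of "c1 + c2"])
    show "0 \<le> c1 + c2" using c1 c2 by simp
    fix \<psi> \<psi>' \<psi>'' N
    assume \<psi>: "C1supp K1 \<psi> \<psi>'" "C1supp K1 \<psi>' \<psi>''" "\<And>x. norm (\<psi> x) \<le> N" "\<And>x. norm (\<psi>' x) \<le> N" "\<And>x. norm (\<psi>'' x) \<le> N"
    have N: "N \<ge> 0" by (rule order_trans[OF norm_ge_zero \<psi>(3)])
    have 1: "((\<lambda>t. slice R (1 * t) \<psi>) \<longlongrightarrow> Lim (at_right 0) (\<lambda>t. slice R (1 * t) \<psi>)) (at_right 0)"
      "norm (Lim (at_right 0) (\<lambda>t. slice R (1 * t) \<psi>)) \<le> c1 * N" using c1(2) \<psi> by blast+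
    have 2: "((\<lambda>t. slice R (-1 * t) \<psi>) \<longlongrightarrow> Lim (at_right 0) (\<lambda>t. slice R (-1 * t) \<psi>)) (at_right 0)"
      "norm (Lim (at_right 0) (\<lambda>t. slice R (-1 * t) \<psi>)) \<le> c2 * N" using c2(2) \<psi> by blast+
    have up: "upper_value R \<psi> = Lim (at_right 0) (\<lambda>t. slice R (1 * t) \<psi>)" by (simp add: upper_value_def)
    have l: "((\<lambda>u. slice R u \<psi>) \<longlongrightarrow> Lim (at_right 0) (\<lambda>t. slice R (-1 * t) \<psi>)) (at_left 0)"
      using 2(1) by (simp add: filterlim_at_left_to_right)
    then have low: "lower_value R \<psi> = Lim (at_right 0) (\<lambda>t. slice R (-1 * t) \<psi>)"
      unfolding lower_value_def by (intro tendsto_Lim) auto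
    have le: "c1 * N \<le> (c1 + c2) * N" "c2 * N \<le> (c1 + c2) * N" using c1 c2 N by (auto intro!: mult_right_mono)
    show "((\<lambda>u. slice R u \<psi>) \<longlongrightarrow> upper_value R \<psi>) (at_right 0) \<and> ((\<lambda>u. slice R u \<psi>) \<longlongrightarrow> lower_value R \<psi>) (at_left 0) \<and>
      norm (upper_value R \<psi>) \<le> (c1 + c2) * N \<and> norm (lower_value R \<psi>) \<le> (c1 + c2) * N"
      using 1 l 2(2) le unfolding up low by auto
  qed
qed

lemma test_function_boundary_values:
  assumes \<psi>: "\<psi> \<in> test_functions G1"
  shows "((\<lambda>u. slice R u \<psi>) \<longlongrightarrow> upper_value R \<psi>) (at_right 0)" "((\<lambda>u. slice R u \<psi>) \<longlongrightarrow> lower_value R \<psi>) (at_left 0)"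
proof -
  have K: "compact (supp \<psi>)" "supp \<psi> \<subseteq> G1" using \<psi> by (auto simp: test_functions_def)
  have b: "norm (partials bs \<psi> x) \<le> Cm_norm 2 \<psi>" if "bs \<in> {[], [1], [1,1]}" for bs x
    using that by (intro norm_partials_le_Cm_norm[OF \<psi>]) auto
  have C: "C1supp (supp \<psi>) \<psi> (partials [1] \<psi>)" "C1supp (supp \<psi>) (partials [1] \<psi>) (partials [1,1] \<psi>)"
    using C1supp_test_function[OF \<psi>, of "[]"] C1supp_test_function[OF \<psi>, of "[1]"] by auto
  obtain d where d: "\<And>\<psi>' \<psi>'' N. C1supp (supp \<psi>) \<psi> \<psi>' \<Longrightarrow> C1supp (supp \<psi>) \<psi>' \<psi>'' \<Longrightarrow> (\<And>x. norm (\<psi> x) \<le> N) \<Longrightarrow>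
      (\<And>x. norm (\<psi>' x) \<le> N) \<Longrightarrow> (\<And>x. norm (\<psi>'' x) \<le> N) \<Longrightarrow>
      ((\<lambda>u. slice R u \<psi>) \<longlongrightarrow> upper_value R \<psi>) (at_right 0) \<and> ((\<lambda>u. slice R u \<psi>) \<longlongrightarrow> lower_value R \<psi>) (at_left 0) \<and>
      norm (upper_value R \<psi>) \<le> d * N \<and> norm (lower_value R \<psi>) \<le> d * N" by (rule boundary_values[OF K]) blast
  show "((\<lambda>u. slice R u \<psi>) \<longlongrightarrow> upper_value R \<psi>) (at_right 0)" "((\<lambda>u. slice R u \<psi>) \<longlongrightarrow> lower_value R \<psi>) (at_left 0)"
    using d[OF C, of "Cm_norm 2 \<psi>"] b[of "[]"] b[of "[1]"] b[of "[1,1]"] by simp_all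
qed

lemma op_distribution_boundary: "op_distribution G G1 (upper_value R)" "op_distribution G G1 (lower_value R)"
proof -
  have ev: "\<forall>\<^sub>F u in at_right 0. u \<in> I \<and> u \<noteq> 0" "\<forall>\<^sub>F u in at_left 0. u \<in> I \<and> u \<noteq> 0"
    using eventually_nhds_in_open[OF I(1,3)] by (auto simp: eventually_at_filter elim!: eventually_mono)
  \<comment> \<open>Both sides are treated at once, \<open>net\<close> standing for
    \<open>at_right 0\<close> or \<open>at_left 0\<close>; the limits for sums and multiples are
    supplied through \<open>lim'\<close>.\<close>
  have gen: "op_distribution G G1 V"
    if lim: "\<And>\<psi>. \<psi> \<in> test_functions G1 \<Longrightarrow> ((\<lambda>u. slice R u \<psi>) \<longlongrightarrow> V \<psi>) net"
      and net: "net \<noteq> bot" "\<forall>\<^sub>F u in net. u \<in> I \<and> u \<noteq> 0"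
      and bd: "\<And>L c \<psi> N. compact L \<Longrightarrow> L \<subseteq> G1 \<Longrightarrow> \<exists>c. \<forall>\<psi>\<in>test_functions G1. supp \<psi> \<subseteq> L \<longrightarrow> norm (V \<psi>) \<le> c * Cm_norm 2 \<psi>"
      and lim': "\<And>\<psi> \<phi> c. \<psi> \<in> test_functions G1 \<Longrightarrow> \<phi> \<in> test_functions G1 \<Longrightarrow>
        ((\<lambda>u. slice R u (\<lambda>x. \<psi> x + \<phi> x)) \<longlongrightarrow> V (\<lambda>x. \<psi> x + \<phi> x)) net \<and> ((\<lambda>u. slice R u (\<lambda>x. c * \<psi> x)) \<longlongrightarrow> V (\<lambda>x. c * \<psi> x)) net"
    for V net
    unfolding op_distribution_def
  proof (intro conjI ballI allI impI)
    fix \<psi> assume \<psi>: "\<psi> \<in> test_functions G1"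
    have K: "compact (supp \<psi>)" "supp \<psi> \<subseteq> G1" using \<psi> by (auto simp: test_functions_def)
    have c\<psi>: "continuous_on UNIV \<psi>" using test_function_partials(2)[OF \<psi>, of "[]"] by simp
    show "V \<psi> \<in> ops G"
      by (rule ops_limit[OF Gb lim[OF \<psi>] net(1)], use net(2) in eventually_elim)
        (rule slice_ops[OF K supp_zero], auto)
    show "V (\<lambda>x. c * \<psi> x) = c *\<^sub>O V \<psi>" for c
    proof (rule tendsto_unique[OF net(1)])
      show "((\<lambda>u. slice R u (\<lambda>x. c * \<psi> x)) \<longlongrightarrow> V (\<lambda>x. c * \<psi> x)) net" using lim'[OF \<psi> \<psi>, of c] by simp
      show "((\<lambda>u. slice R u (\<lambda>x. c * \<psi> x)) \<longlongrightarrow> c *\<^sub>O V \<psi>) net"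
      proof (rule Lim_transform_eventually[OF scale_op.tendsto[OF tendsto_const lim[OF \<psi>]]])
        show "\<forall>\<^sub>F u in net. c *\<^sub>O slice R u \<psi> = slice R u (\<lambda>x. c * \<psi> x)"
          using net(2)
        proof eventually_elim
          case (elim u)
          show ?case
            by (rule slice_diff(3)[OF K, symmetric, where \<psi>' = \<psi>]) (use elim c\<psi> supp_zero[of _ \<psi>] in auto)
        qed
      qed
    qed
    fix \<phi> assume \<phi>: "\<phi> \<in> test_functions G1"
    have c\<phi>: "continuous_on UNIV \<phi>" using test_function_partials(2)[OF \<phi>, of "[]"] by simp
    have K': "compact (supp \<psi> \<union> supp \<phi>)" "supp \<psi> \<union> supp \<phi> \<subseteq> G1" using \<psi> \<phi> by (auto simp: test_functions_def)
    show "V (\<lambda>x. \<psi> x + \<phi> x) = V \<psi> + V \<phi>"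
    proof (rule tendsto_unique[OF net(1)])
      show "((\<lambda>u. slice R u (\<lambda>x. \<psi> x + \<phi> x)) \<longlongrightarrow> V (\<lambda>x. \<psi> x + \<phi> x)) net" using lim'[OF \<psi> \<phi>] by simp
      show "((\<lambda>u. slice R u (\<lambda>x. \<psi> x + \<phi> x)) \<longlongrightarrow> V \<psi> + V \<phi>) net"
      proof (rule Lim_transform_eventually[OF tendsto_add[OF lim[OF \<psi>] lim[OF \<phi>]]])
        show "\<forall>\<^sub>F u in net. slice R u \<psi> + slice R u \<phi> = slice R u (\<lambda>x. \<psi> x + \<phi> x)"
          using net(2)
        proof eventually_elim
          case (elim u)
          show ?case
            by (rule slice_diff(2)[OF K', symmetric]) (use elim c\<psi> c\<phi> supp_zero[of _ \<psi>] supp_zero[of _ \<phi>] in auto)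
        qed
      qed
    qed
  next
    fix L :: "real set" assume "compact L \<and> L \<subseteq> G1"
    then show "\<exists>c m. \<forall>\<phi>\<in>test_functions G1. supp \<phi> \<subseteq> L \<longrightarrow> norm (V \<phi>) \<le> c * Cm_norm m \<phi>"
      using bd[of L] by blast
  qed
  have C2: "\<exists>\<psi>' \<psi>''. C1supp (supp \<psi>) \<psi> \<psi>' \<and> C1supp (supp \<psi>) \<psi>' \<psi>'' \<and> (\<exists>N. \<forall>x. norm (\<psi> x) \<le> N \<and> norm (\<psi>' x) \<le> N \<and> norm (\<psi>'' x) \<le> N)"
    if \<psi>: "\<psi> \<in> test_functions G1" for \<psi> :: "real \<Rightarrow> complex"
    using C1supp_test_function[OF \<psi>, of "[]"] C1supp_test_function[OF \<psi>, of "[1]"]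
      norm_partials_le_Cm_norm[OF \<psi>, of "[]" 2] norm_partials_le_Cm_norm[OF \<psi>, of "[1]" 2] norm_partials_le_Cm_norm[OF \<psi>, of "[1,1]" 2]
    by (intro exI[of _ "partials [1] \<psi>"] exI[of _ "partials [1,1] \<psi>"] conjI exI[of _ "Cm_norm 2 \<psi>"]) auto
  have lim': "((\<lambda>u. slice R u (\<lambda>x. \<psi> x + \<phi> x)) \<longlongrightarrow> upper_value R (\<lambda>x. \<psi> x + \<phi> x)) (at_right 0) \<and>
      ((\<lambda>u. slice R u (\<lambda>x. \<psi> x + \<phi> x)) \<longlongrightarrow> lower_value R (\<lambda>x. \<psi> x + \<phi> x)) (at_left 0) \<and>
      ((\<lambda>u. slice R u (\<lambda>x. c * \<psi> x)) \<longlongrightarrow> upper_value R (\<lambda>x. c * \<psi> x)) (at_right 0) \<and>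
      ((\<lambda>u. slice R u (\<lambda>x. c * \<psi> x)) \<longlongrightarrow> lower_value R (\<lambda>x. c * \<psi> x)) (at_left 0)"
    if \<psi>: "\<psi> \<in> test_functions G1" and \<phi>: "\<phi> \<in> test_functions G1" for \<psi> \<phi> :: "real \<Rightarrow> complex" and c
  proof -
    define S where "S = supp \<psi> \<union> supp \<phi>"
    have K': "compact S" "S \<subseteq> G1" using \<psi> \<phi> by (auto simp: test_functions_def S_def)
    obtain \<psi>' \<psi>'' N where p: "C1supp (supp \<psi>) \<psi> \<psi>'" "C1supp (supp \<psi>) \<psi>' \<psi>''"
      "\<And>x. norm (\<psi> x) \<le> N" "\<And>x. norm (\<psi>' x) \<le> N" "\<And>x. norm (\<psi>'' x) \<le> N" using C2[OF \<psi>] by blast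
    obtain \<phi>' \<phi>'' M where q: "C1supp (supp \<phi>) \<phi> \<phi>'" "C1supp (supp \<phi>) \<phi>' \<phi>''"
      "\<And>x. norm (\<phi> x) \<le> M" "\<And>x. norm (\<phi>' x) \<le> M" "\<And>x. norm (\<phi>'' x) \<le> M" using C2[OF \<phi>] by blast
    have add: "C1supp S (\<lambda>x. \<psi> x + \<phi> x) (\<lambda>x. \<psi>' x + \<phi>' x)" "C1supp S (\<lambda>x. \<psi>' x + \<phi>' x) (\<lambda>x. \<psi>'' x + \<phi>'' x)"
      using p q by (auto simp: C1supp_def S_def intro!: has_vector_derivative_add continuous_intros)
    have mul: "C1supp S (\<lambda>x. c * \<psi> x) (\<lambda>x. c * \<psi>' x)" "C1supp S (\<lambda>x. c * \<psi>' x) (\<lambda>x. c * \<psi>'' x)"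
      using p by (auto simp: C1supp_def S_def intro!: has_vector_derivative_mult_right continuous_intros)
    have nadd: "norm (a + b) \<le> N + M" if "norm a \<le> N" "norm b \<le> M" for a b :: complex
      using norm_triangle_le[of a b "N + M"] that by simp
    have nmul: "norm (c * a) \<le> norm c * N" if "norm a \<le> N" for a :: complex
      using that by (simp add: norm_mult mult_left_mono)
    obtain d where d: "\<And>\<psi> \<psi>' \<psi>'' N. C1supp S \<psi> \<psi>' \<Longrightarrow> C1supp S \<psi>' \<psi>'' \<Longrightarrow> (\<And>x. norm (\<psi> x) \<le> N) \<Longrightarrow> (\<And>x. norm (\<psi>' x) \<le> N) \<Longrightarrow>
      (\<And>x. norm (\<psi>'' x) \<le> N) \<Longrightarrow>
      ((\<lambda>u. slice R u \<psi>) \<longlongrightarrow> upper_value R \<psi>) (at_right 0) \<and> ((\<lambda>u. slice R u \<psi>) \<longlongrightarrow> lower_value R \<psi>) (at_left 0) \<and>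
      norm (upper_value R \<psi>) \<le> d * N \<and> norm (lower_value R \<psi>) \<le> d * N" by (rule boundary_values[OF K']) blast
    show ?thesis
      using d[OF add, of "N + M"] d[OF mul, of "norm c * N"] nadd nmul p q by auto
  qed
  have bd: "\<exists>c. \<forall>\<psi>\<in>test_functions G1. supp \<psi> \<subseteq> L \<longrightarrow> norm (upper_value R \<psi>) \<le> c * Cm_norm 2 \<psi>"
    "\<exists>c. \<forall>\<psi>\<in>test_functions G1. supp \<psi> \<subseteq> L \<longrightarrow> norm (lower_value R \<psi>) \<le> c * Cm_norm 2 \<psi>"
    if L: "compact L" "L \<subseteq> G1" for L
  proof -
    obtain d where d: "\<And>\<psi> \<psi>' \<psi>'' N. C1supp L \<psi> \<psi>' \<Longrightarrow> C1supp L \<psi>' \<psi>'' \<Longrightarrow> (\<And>x. norm (\<psi> x) \<le> N) \<Longrightarrow> (\<And>x. norm (\<psi>' x) \<le> N) \<Longrightarrow>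
      (\<And>x. norm (\<psi>'' x) \<le> N) \<Longrightarrow>
      ((\<lambda>u. slice R u \<psi>) \<longlongrightarrow> upper_value R \<psi>) (at_right 0) \<and> ((\<lambda>u. slice R u \<psi>) \<longlongrightarrow> lower_value R \<psi>) (at_left 0) \<and>
      norm (upper_value R \<psi>) \<le> d * N \<and> norm (lower_value R \<psi>) \<le> d * N" by (rule boundary_values[OF L]) blast
    have "norm (upper_value R \<psi>) \<le> d * Cm_norm 2 \<psi> \<and> norm (lower_value R \<psi>) \<le> d * Cm_norm 2 \<psi>"
      if \<psi>: "\<psi> \<in> test_functions G1" "supp \<psi> \<subseteq> L" for \<psi>
      using d[OF C1supp_test_function[OF \<psi>(1) _ \<psi>(2), of "[]"] C1supp_test_function[OF \<psi>(1) _ \<psi>(2), of "[1]"], of "Cm_norm 2 \<psi>"]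
        norm_partials_le_Cm_norm[OF \<psi>(1), of "[]" 2] norm_partials_le_Cm_norm[OF \<psi>(1), of "[1]" 2] norm_partials_le_Cm_norm[OF \<psi>(1), of "[1,1]" 2]
      by auto
    then show "\<exists>c. \<forall>\<psi>\<in>test_functions G1. supp \<psi> \<subseteq> L \<longrightarrow> norm (upper_value R \<psi>) \<le> c * Cm_norm 2 \<psi>"
      "\<exists>c. \<forall>\<psi>\<in>test_functions G1. supp \<psi> \<subseteq> L \<longrightarrow> norm (lower_value R \<psi>) \<le> c * Cm_norm 2 \<psi>" by blast+
  qed
  show "op_distribution G G1 (upper_value R)"
    by (rule gen[OF test_function_boundary_values(1) _ ev(1) bd(1)]) (use lim' in auto)
  show "op_distribution G G1 (lower_value R)"
    by (rule gen[OF test_function_boundary_values(2) _ ev(2) bd(2)]) (use lim' in auto)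
qed

end

section \<open>Vertical derivatives, Stokes' theorem and the value of \<open>M\<close>\<close>

context boundary_resolvent
begin

text \<open>The combination \<open>partials [\<i>] \<phi> - \<i> * partials [1] \<phi>\<close>,
  which the derivative of a slice produces, is \<open>- 2 * \<i>\<close> times
  \<open>dbar \<phi>\<close>.\<close>

lemma sliced_dbar_deriv:
  assumes \<phi>: "\<phi> \<in> test_functions G0" and u: "u \<noteq> 0"
  shows "((\<lambda>u. cinner F (sliced \<phi> u F')) has_vector_derivative - 2 * \<i> * cinner F (sliced (dbar \<phi>) u F')) (at u)"
proof (cases "u \<in> I")
  case True
  note L = in_G0_supp[OF \<phi>]
  have dz: "\<phi> differentiable at z" for z using test_function_partials(1)[OF \<phi>, of "[]"] by simp
  have c: "continuous_on UNIV (partials [1] \<phi>)" "continuous_on UNIV (partials [\<i>] \<phi>)"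
    by (rule test_function_partials(2)[OF \<phi>], simp)+
  have z: "\<phi> z = 0" if "Re z \<notin> Re ` supp \<phi>" for z
    by (rule supp_zero) (use that in auto)
  have "((\<lambda>u. cinner F (slice R u (\<lambda>x. \<phi> (Complex x u)) F')) has_vector_derivative
      cinner F (slice R u (\<lambda>x. partials [\<i>] \<phi> (Complex x u) - \<i> * partials [1] \<phi> (Complex x u)) F')) (at u)"
    by (rule slice_has_vector_derivative[OF in_G0_Re[OF L] has_derivative_complex_partials[OF dz] c z True u])
  moreover have "slice R u (\<lambda>x. partials [\<i>] \<phi> (Complex x u) - \<i> * partials [1] \<phi> (Complex x u)) =
      (- 2 * \<i>) *\<^sub>O sliced (dbar \<phi>) u"
  proof -
    have x: "xreg (supp \<phi>) (dbar \<phi>) (\<lambda>z. (1/2) * partials [1,1] \<phi> z + (\<i>/2) * partials [1,\<i>] \<phi> z)"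
      by (rule xreg_dbar[OF \<phi>])
    from xreg_line[OF this, of u] have C: "C1supp (Re ` supp \<phi>) (\<lambda>x. dbar \<phi> (Complex x u))
      (\<lambda>x. (1/2) * partials [1,1] \<phi> (Complex x u) + (\<i>/2) * partials [1,\<i>] \<phi> (Complex x u))" .
    have "slice R u (\<lambda>x. (- 2 * \<i>) * dbar \<phi> (Complex x u)) = (- 2 * \<i>) *\<^sub>O slice R u (\<lambda>x. dbar \<phi> (Complex x u))"
      by (rule slice_diff(3)[OF in_G0_Re[OF L] True u, where \<psi>' = "\<lambda>_. 0"])
        (use C1supp_continuous[OF C] C in \<open>auto simp: C1supp_def\<close>)
    moreover have "(- 2 * \<i>) * dbar \<phi> z = partials [\<i>] \<phi> z - \<i> * partials [1] \<phi> z" for z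
      by (simp add: dbar_eq algebra_simps)
    ultimately show ?thesis by (simp add: sliced_def)
  qed
  ultimately show ?thesis by (simp add: sliced_def cinner_scaleC_right)
next
  \<comment> \<open>Outside \<open>I\<close> the slices vanish on a neighbourhood of
    \<open>u\<close>, because the imaginary parts of the support form a closed subset of
    \<open>I\<close>.\<close>
  case False
  note L = in_G0_supp[OF \<phi>]
  have cl: "closed (Im ` supp \<phi>)"
    using L by (auto simp: in_G0_def intro!: compact_imp_closed compact_continuous_image continuous_intros)
  have uL: "u \<notin> Im ` supp \<phi>" using False L by (auto simp: in_G0_def)
  have z: "sliced f v = 0" if "xreg (supp \<phi>) f f'" "v \<notin> Im ` supp \<phi>" for f f' v
    by (rule sliced_zero[OF L]) (use that in \<open>auto simp: xreg_def\<close>)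
  have "((\<lambda>u. cinner F (sliced \<phi> u F')) has_derivative (\<lambda>_. 0)) (at u)"
    by (rule partial_outside_support(1)[OF cl _ uL]) (simp add: z[OF xreg_test[OF \<phi>]])
  then show ?thesis using z[OF xreg_dbar[OF \<phi>] uL] by (simp add: has_vector_derivative_def)
qed

text \<open>Fundamental theorem of calculus in \<open>u\<close> on both half planes; only the
  boundary terms at heights \<open>e\<close> and \<open>- e\<close> survive. The factor
  \<open>\<i> / 2\<close> is the reciprocal of \<open>- 2 * \<i>\<close>.\<close>

lemma cut_integral_dbar:
  assumes \<phi>: "\<phi> \<in> test_functions G0" and e: "e > 0"
  shows "cut_integral R e (dbar \<phi>) = (\<i> / 2) *\<^sub>O (sliced \<phi> (- e) - sliced \<phi> e)"
proof (rule op_eq_matrix_element)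
  fix F F'
  note L = in_G0_supp[OF \<phi>]
  have cL: "compact (supp \<phi>)" using L by (simp add: in_G0_def)
  obtain B0 where B0: "B0 > 0" "\<And>z. z \<in> supp \<phi> \<Longrightarrow> norm z \<le> B0" by (rule compact_complex_box[OF cL]) blast
  \<comment> \<open>The summand 1 puts \<open>B\<close> strictly above the support, so that the
    slices at \<open>B\<close> and \<open>- B\<close> vanish; the maximum with \<open>e\<close>
    keeps \<open>{e..B}\<close> nonempty.\<close>
  define B where "B = max e (B0 + 1)"
  have B: "\<bar>Im z\<bar> < B" if "z \<in> supp \<phi>" for z
    using abs_Im_le_cmod[of z] B0(2)[OF that] by (simp add: B_def)
  have eB: "e \<le> B" by (simp add: B_def)
  have x: "continuous_on UNIV (dbar \<phi>)" "\<And>z. z \<notin> supp \<phi> \<Longrightarrow> dbar \<phi> z = 0"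
    using xreg_dbar[OF \<phi>] by (auto simp: xreg_def)
  define s where "s u = cinner F (sliced \<phi> u F')" for u
  define q where "q u = cinner F (sliced (dbar \<phi>) u F')" for u
  have sD: "(s has_vector_derivative - 2 * \<i> * q u) (at u)" if "u \<noteq> 0" for u
    unfolding s_def q_def by (rule sliced_dbar_deriv[OF \<phi> that])
  have sB: "sliced \<phi> B = 0" "sliced \<phi> (- B) = 0"
    by (rule sliced_zero[OF L]; use xreg_test[OF \<phi>] B in \<open>force simp: xreg_def\<close>)+
  have 1: "((\<lambda>u. - 2 * \<i> * q u) has_integral s B - s e) {e..B}"
    by (rule fundamental_theorem_of_calculus[OF eB]) (use e sD in \<open>auto intro: has_vector_derivative_at_within\<close>)
  have sN: "((\<lambda>u. s (- u)) has_vector_derivative - (- 2 * \<i> * q (- u))) (at u)" if "u \<noteq> 0" for u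
  proof -
    have "((\<lambda>u. - u) has_vector_derivative - 1) (at u)"
      by (auto intro!: derivative_eq_intros simp: has_vector_derivative_def)
    moreover have "(s has_vector_derivative - 2 * \<i> * q (- u)) (at (- u))" using that by (intro sD) simp
    ultimately show ?thesis using vector_diff_chain_at[of "\<lambda>u. - u" "- 1" u s "- 2 * \<i> * q (- u)"] by (simp add: o_def)
  qed
  have "((\<lambda>u. - (- 2 * \<i> * q (- u))) has_integral s (- B) - s (- e)) {e..B}"
    by (rule fundamental_theorem_of_calculus[OF eB, where f = "\<lambda>u. s (- u)"], rule has_vector_derivative_at_within[OF sN])
      (use e in auto)
  from has_integral_neg[OF this] have 2: "((\<lambda>u. - 2 * \<i> * q (- u)) has_integral s (- e) - s (- B)) {e..B}" by simp
  have "((\<lambda>u. - 2 * \<i> * (q u + q (- u))) has_integral s (- e) - s e) {e..B}"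
    using has_integral_add[OF 1 2] sB by (simp add: s_def distrib_left)
  from has_integral_mult_right[OF this, of "\<i> / 2"]
  have 3: "((\<lambda>u. q u + q (- u)) has_integral (\<i> / 2) * (s (- e) - s e)) {e..B}"
    by (simp add: add.commute)
  have cq: "continuous_on {e..B} (\<lambda>u. sliced (dbar \<phi>) u + sliced (dbar \<phi>) (- u))"
    using e by (auto intro!: continuous_intros continuous_on_subset[OF continuous_sliced[OF L x]]
        continuous_on_compose2[OF continuous_sliced[OF L x]])
  have "cut_integral R e (dbar \<phi>) = integral {e..B} (\<lambda>u. sliced (dbar \<phi>) u + sliced (dbar \<phi>) (- u))"
    by (rule cut_integral_eq(3)[OF L x _ e]) (use B in \<open>auto intro: less_imp_le\<close>)
  then have "cinner F (cut_integral R e (dbar \<phi>) F') = integral {e..B} (\<lambda>u. q u + q (- u))"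
    using integral_linear[OF integrable_continuous_real[OF cq] bounded_linear_matrix_element[of F F']]
    by (simp add: o_def q_def blinfun.add_left cinner_add_right)
  also have "\<dots> = (\<i> / 2) * (s (- e) - s e)" using 3 by (rule integral_unique)
  also have "\<dots> = cinner F (((\<i> / 2) *\<^sub>O (sliced \<phi> (- e) - sliced \<phi> e)) F')"
    by (simp add: s_def blinfun.diff_left cinner_scaleC_right cinner_diff_right)
  finally show "cinner F (cut_integral R e (dbar \<phi>) F') = cinner F (((\<i> / 2) *\<^sub>O (sliced \<phi> (- e) - sliced \<phi> e)) F')" .
qed

text \<open>Replacing \<open>\<phi> (Complex x u)\<close> by \<open>\<phi> (of_real x)\<close>
  changes the test function and its horizontal derivative by order \<open>|u|\<close>, while a slice
  costs only \<open>1 / sqrt |u|\<close>; the error is of order \<open>sqrt |u|\<close>. The mixed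
  derivative involved is the reason for \<open>Cm_norm 2\<close>.\<close>

lemma sliced_limit:
  assumes \<phi>: "\<phi> \<in> test_functions G0"
  shows "(sliced \<phi> \<longlongrightarrow> upper_value R (\<lambda>x. \<phi> (of_real x))) (at_right 0)"
    and "((\<lambda>u. sliced \<phi> (- u)) \<longlongrightarrow> lower_value R (\<lambda>x. \<phi> (of_real x))) (at_right 0)"
proof -
  note L = in_G0_supp[OF \<phi>]
  note K = in_G0_Re[OF L]
  have line: "C1supp (Re ` supp \<phi>) (\<lambda>x. partials bs \<phi> (Complex x u)) (\<lambda>x. partials (1 # bs) \<phi> (Complex x u))"
    if "bs \<in> lists Basis" for bs u
    by (rule xreg_line[OF xreg_test_function[OF \<phi> that]])
  have b: "norm (partials bs \<phi> z) \<le> Cm_norm 2 \<phi>" if "bs \<in> {[], [1], [1,1], [\<i>], [\<i>,1]}" for bs z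
    using that by (intro norm_partials_le_Cm_norm[OF \<phi>]) auto
  have re: "Complex x 0 = of_real x" for x by (simp add: complex_eq_iff)
  have C: "C1supp (Re ` supp \<phi>) (\<lambda>x. \<phi> (of_real x)) (\<lambda>x. partials [1] \<phi> (of_real x))"
    "C1supp (Re ` supp \<phi>) (\<lambda>x. partials [1] \<phi> (of_real x)) (\<lambda>x. partials [1,1] \<phi> (of_real x))"
    using line[of "[]" 0] line[of "[1]" 0] by (simp_all add: re)
  obtain d where d: "\<And>\<psi> \<psi>' \<psi>'' N. C1supp (Re ` supp \<phi>) \<psi> \<psi>' \<Longrightarrow> C1supp (Re ` supp \<phi>) \<psi>' \<psi>'' \<Longrightarrow> (\<And>x. norm (\<psi> x) \<le> N) \<Longrightarrow>
      (\<And>x. norm (\<psi>' x) \<le> N) \<Longrightarrow> (\<And>x. norm (\<psi>'' x) \<le> N) \<Longrightarrow>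
      ((\<lambda>u. slice R u \<psi>) \<longlongrightarrow> upper_value R \<psi>) (at_right 0) \<and> ((\<lambda>u. slice R u \<psi>) \<longlongrightarrow> lower_value R \<psi>) (at_left 0) \<and>
      norm (upper_value R \<psi>) \<le> d * N \<and> norm (lower_value R \<psi>) \<le> d * N" by (rule boundary_values[OF K]) blast
  have lim: "((\<lambda>u. slice R u (\<lambda>x. \<phi> (of_real x))) \<longlongrightarrow> upper_value R (\<lambda>x. \<phi> (of_real x))) (at_right 0)"
    "((\<lambda>u. slice R u (\<lambda>x. \<phi> (of_real x))) \<longlongrightarrow> lower_value R (\<lambda>x. \<phi> (of_real x))) (at_left 0)"
    using d[OF C, of "Cm_norm 2 \<phi>"] b[of "[]"] b[of "[1]"] b[of "[1,1]"] by simp_all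
  obtain \<delta> where \<delta>: "\<delta> > 0" "\<And>t. \<bar>t\<bar> \<le> \<delta> \<Longrightarrow> t \<in> I" by (rule I_symmetric, rule that)
  have diff: "((\<lambda>t. sliced \<phi> (s * t) - slice R (s * t) (\<lambda>x. \<phi> (of_real x))) \<longlongrightarrow> 0) (at_right 0)"
    if s: "s \<in> {-1, 1}" for s :: real
  proof -
    have sI: "s * t \<in> I" if "t \<in> {0..\<delta>}" for t using that s by (intro \<delta>(2)) auto
    obtain c where c: "c \<ge> 0" "\<And>\<psi> \<psi>' N t. C1supp (Re ` supp \<phi>) \<psi> \<psi>' \<Longrightarrow> (\<forall>x. norm (\<psi> x) \<le> N) \<Longrightarrow> (\<forall>x. norm (\<psi>' x) \<le> N) \<Longrightarrow>
      0 < t \<Longrightarrow> t \<le> \<delta> \<Longrightarrow> norm (slice R (s * t) \<psi>) \<le> c * N / sqrt t"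
      using slice_bound[OF K s \<delta>(1) sI] by blast
    show ?thesis
    proof (rule Lim_null_comparison)
      show "((\<lambda>t. c * Cm_norm 2 \<phi> * sqrt t) \<longlongrightarrow> 0) (at_right 0)" by (auto intro!: tendsto_eq_intros)
      show "\<forall>\<^sub>F t in at_right 0. norm (sliced \<phi> (s * t) - slice R (s * t) (\<lambda>x. \<phi> (of_real x))) \<le> c * Cm_norm 2 \<phi> * sqrt t"
        using eventually_at_right_real[OF \<delta>(1)]
      proof eventually_elim
        case (elim t)
        then have t: "0 < t" "t \<le> \<delta>" by auto
        have u: "s * t \<in> I" "s * t \<noteq> 0" using sI[of t] t s by auto
        define \<psi> where "\<psi> x = \<phi> (Complex x (s * t)) - \<phi> (of_real x)" for x
        define \<psi>' where "\<psi>' x = partials [1] \<phi> (Complex x (s * t)) - partials [1] \<phi> (of_real x)" for x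
        have C\<psi>: "C1supp (Re ` supp \<phi>) \<psi> \<psi>'"
          using line[of "[]" "s * t"] C(1)
          by (auto simp: C1supp_def \<psi>_def[abs_def] \<psi>'_def[abs_def] intro!: derivative_intros continuous_intros)
        have var: "norm (partials bs \<phi> (Complex x (s * t)) - partials bs \<phi> (of_real x)) \<le> Cm_norm 2 \<phi> * t"
          if "bs \<in> {[], [1]}" for bs x
        proof -
          have "norm (partials bs \<phi> (Complex x (s * t)) - partials bs \<phi> (Complex x 0)) \<le> Cm_norm 2 \<phi> * \<bar>s * t - 0\<bar>"
          proof (rule vector_derivative_bound)
            show "((\<lambda>v. partials bs \<phi> (Complex x v)) has_vector_derivative partials (\<i> # bs) \<phi> (Complex x v)) (at v)" for v
              using has_vector_derivative_complex_lines(2)[of "partials bs \<phi>", OF test_function_partials(1)[OF \<phi>]] that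
              by (auto simp: partials_Cons)
            show "norm (partials (\<i> # bs) \<phi> (Complex x v)) \<le> Cm_norm 2 \<phi>" for v using that by (intro b) auto
          qed
          then show ?thesis using s t by (auto simp: re abs_mult)
        qed
        have "sliced \<phi> (s * t) - slice R (s * t) (\<lambda>x. \<phi> (of_real x)) = slice R (s * t) \<psi>"
          unfolding sliced_def \<psi>_def
          by (rule slice_diff(1)[OF K u, symmetric])
            (use C1supp_continuous[OF C(1)] C1supp_continuous[OF line[of "[]" "s * t"]] C(1) line[of "[]" "s * t"]
              in \<open>auto simp: C1supp_def\<close>)
        also have "norm \<dots> \<le> c * (Cm_norm 2 \<phi> * t) / sqrt t"
          by (rule c(2)[OF C\<psi> _ _ t]) (use var[of "[]"] var[of "[1]"] in \<open>auto simp: \<psi>_def \<psi>'_def\<close>)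
        also have "\<dots> = c * Cm_norm 2 \<phi> * sqrt t" using t by (simp add: field_simps flip: real_sqrt_mult)
        finally show ?case .
      qed
    qed
  qed
  show "(sliced \<phi> \<longlongrightarrow> upper_value R (\<lambda>x. \<phi> (of_real x))) (at_right 0)"
    using tendsto_add[OF diff[of 1] lim(1)] by simp
  show "((\<lambda>u. sliced \<phi> (- u)) \<longlongrightarrow> lower_value R (\<lambda>x. \<phi> (of_real x))) (at_right 0)"
  proof -
    have "((\<lambda>u. slice R (-1 * u) (\<lambda>x. \<phi> (of_real x))) \<longlongrightarrow> lower_value R (\<lambda>x. \<phi> (of_real x))) (at_right 0)"
      using lim(2) by (simp add: filterlim_at_left_to_right)
    from tendsto_add[OF diff[of "-1"] this] show ?thesis by simp
  qed
qed

lemma spectral_dist_eq: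
  assumes \<phi>: "\<phi> \<in> test_functions G0"
  shows "spectral_dist T \<phi> = times_delta (jump_dist R) \<phi>"
proof -
  let ?\<psi> = "\<lambda>x. \<phi> (of_real x)"
  have "((\<lambda>e. cut_integral R e (dbar \<phi>)) \<longlongrightarrow> (\<i> / 2) *\<^sub>O (lower_value R ?\<psi> - upper_value R ?\<psi>)) (at_right 0)"
  proof (rule Lim_transform_eventually)
    show "((\<lambda>e. (\<i> / 2) *\<^sub>O (sliced \<phi> (- e) - sliced \<phi> e)) \<longlongrightarrow> (\<i> / 2) *\<^sub>O (lower_value R ?\<psi> - upper_value R ?\<psi>)) (at_right 0)"
      by (intro tendsto_intros sliced_limit[OF \<phi>])
    show "\<forall>\<^sub>F e in at_right 0. (\<i> / 2) *\<^sub>O (sliced \<phi> (- e) - sliced \<phi> e) = cut_integral R e (dbar \<phi>)"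
      using eventually_at_right_less[of "0::real"] by eventually_elim (simp add: cut_integral_dbar[OF \<phi>])
  qed
  from tendsto_unique[OF _ T_limit[OF in_G0_supp[OF \<phi>] xreg_dbar[OF \<phi>]] this]
  have "T (dbar \<phi>) = (\<i> / 2) *\<^sub>O (lower_value R ?\<psi> - upper_value R ?\<psi>)" by simp
  then have "spectral_dist T \<phi> = (1 / of_real pi) *\<^sub>O (- ((\<i> / 2) *\<^sub>O (lower_value R ?\<psi> - upper_value R ?\<psi>)))"
    by (simp add: spectral_dist_def dbar_dist_def)
  also have "\<dots> = (- \<i> / (2 * of_real pi)) *\<^sub>O (lower_value R ?\<psi> - upper_value R ?\<psi>)"
    by (simp add: scale_op.minus_right scale_op.minus_left mult.commute)
  also have "- \<i> / (2 * of_real pi) = 1 / (2 * of_real pi * \<i>)" by (simp add: field_simps)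
  finally show ?thesis by (simp add: times_delta_def jump_dist_def)
qed

lemma test_function_limits:
  assumes \<phi>: "\<phi> \<in> test_functions G0"
  shows "\<forall>\<epsilon>>0. (\<lambda>z. \<phi> z *\<^sub>O R z) integrable_on {z. \<epsilon> < \<bar>Im z\<bar>}"
    and "\<forall>\<epsilon>>0. (\<lambda>u. slice R u (\<lambda>x. \<phi> (Complex x u))) integrable_on {u. \<epsilon> < \<bar>u\<bar>}"
    and "((\<lambda>\<epsilon>. cut_integral R \<epsilon> \<phi>) \<longlongrightarrow> T \<phi>) (at_right 0)"
    and "((\<lambda>\<epsilon>. integral {u. \<epsilon> < \<bar>u\<bar>} (\<lambda>u. slice R u (\<lambda>x. \<phi> (Complex x u)))) \<longlongrightarrow> T \<phi>) (at_right 0)"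
proof -
  note L = in_G0_supp[OF \<phi>]
  have cL: "compact (supp \<phi>)" using L by (simp add: in_G0_def)
  have c: "continuous_on UNIV \<phi>" "\<And>z. z \<notin> supp \<phi> \<Longrightarrow> \<phi> z = 0"
    using xreg_test[OF \<phi>] by (auto simp: xreg_def)
  obtain B where B: "\<And>z. z \<in> supp \<phi> \<Longrightarrow> norm z \<le> B" by (rule compact_complex_box[OF cL]) blast
  have B: "\<bar>Im z\<bar> \<le> B" if "z \<in> supp \<phi>" for z using order_trans[OF abs_Im_le_cmod B[OF that]] .
  have s: "(\<lambda>u. slice R u (\<lambda>x. \<phi> (Complex x u))) = sliced \<phi>" by (simp add: sliced_def fun_eq_iff)
  show "\<forall>\<epsilon>>0. (\<lambda>z. \<phi> z *\<^sub>O R z) integrable_on {z. \<epsilon> < \<bar>Im z\<bar>}"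
    using cut_integral_eq(1)[OF L c B] by blast
  show "\<forall>\<epsilon>>0. (\<lambda>u. slice R u (\<lambda>x. \<phi> (Complex x u))) integrable_on {u. \<epsilon> < \<bar>u\<bar>}"
    unfolding s using cut_integral_eq(2)[OF L c B] by blast
  show l: "((\<lambda>\<epsilon>. cut_integral R \<epsilon> \<phi>) \<longlongrightarrow> T \<phi>) (at_right 0)" by (rule T_limit[OF L xreg_test[OF \<phi>]])
  show "((\<lambda>\<epsilon>. integral {u. \<epsilon> < \<bar>u\<bar>} (\<lambda>u. slice R u (\<lambda>x. \<phi> (Complex x u)))) \<longlongrightarrow> T \<phi>) (at_right 0)"
    unfolding s
  proof (rule Lim_transform_eventually[OF l])
    show "\<forall>\<^sub>F e in at_right 0. cut_integral R e \<phi> = integral {u. e < \<bar>u\<bar>} (sliced \<phi>)"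
      using eventually_at_right_less[of "0::real"]
      by eventually_elim (simp add: cut_integral_eq(3,4)[OF L c B])
  qed
qed

lemma slice_integrable_test_function:
  assumes "\<psi> \<in> test_functions G1" "u \<in> I - {0}"
  shows "(\<lambda>x. \<psi> x *\<^sub>O R (Complex x u)) integrable_on UNIV"
proof -
  have K: "compact (supp \<psi>)" "supp \<psi> \<subseteq> G1" using assms by (auto simp: test_functions_def)
  obtain a b where "supp \<psi> \<subseteq> {a<..<b}" by (rule compact_real_interval[OF K(1)])
  then have "supp \<psi> \<subseteq> {a..b}" by auto
  then show ?thesis
    using test_function_partials(2)[OF assms(1), of "[]"] assms(2)
    by (intro slice_eq(1)[OF K]) (auto intro: supp_zero)
qed

end

section \<open>Integrability in operator norm away from \<open>P(K)\<close>\<close>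

text \<open>The multiplier of the free part of the integrand, with \<open>p = P y\<close> kept as a
  parameter. The value 0 on the axis, a null set, makes the kernel bounded in \<open>p\<close> for
  each fixed \<open>z\<close>.\<close>

definition off_axis_kernel :: "(complex \<Rightarrow> complex) \<Rightarrow> real \<Rightarrow> complex \<Rightarrow> complex" where
  "off_axis_kernel \<phi> p z = (if Im z = 0 then 0 else \<phi> z / (z - of_real p))"

text \<open>Uniform in \<open>p\<close> because the bound on the Cauchy kernel is. The predicate
  \<open>s\<close> selects a part of the box between the heights \<open>c'\<close> and
  \<open>d'\<close>: a thin strip makes the integral small, and the constant predicate
  \<open>True\<close> gives the whole box.\<close>

lemma off_axis_kernel_integral:
  assumes \<phi>: "continuous_on UNIV \<phi>" "\<And>z. norm (\<phi> z) \<le> N" and box: "a \<le> b" "c \<le> d"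
    and strip: "c' \<le> d'" "\<And>w. w \<in> cbox (Complex a c) (Complex b d) \<Longrightarrow> s w \<Longrightarrow> Im w \<in> {c'..d'}"
    and [measurable]: "Measurable.pred borel s"
  shows "off_axis_kernel \<phi> p integrable_on cbox (Complex a c) (Complex b d)"
    "(\<lambda>w. if s w then norm (off_axis_kernel \<phi> p w) else 0) integrable_on cbox (Complex a c) (Complex b d)"
    "integral (cbox (Complex a c) (Complex b d)) (\<lambda>w. if s w then norm (off_axis_kernel \<phi> p w) else 0) \<le> 16 * sqrt ((b - a) * (d' - c')) * N"
proof -
  have N0: "N \<ge> 0" by (rule order_trans[OF norm_ge_zero \<phi>(2)])
  have [measurable]: "\<phi> \<in> borel_measurable borel" using \<phi>(1) by (rule borel_measurable_continuous_onI)
  define X where "X = cbox (Complex a c) (Complex b d)"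
  have [measurable]: "X \<in> sets borel" by (simp add: X_def)
  have [measurable]: "(\<lambda>w. if w \<in> X \<and> Im w \<noteq> 0 then \<phi> w else 0) \<in> borel_measurable borel"
    "(\<lambda>w. if w \<in> X \<and> Im w \<noteq> 0 \<and> s w then \<phi> w else 0) \<in> borel_measurable borel" by measurable
  have "integrable lborel (\<lambda>w. (if w \<in> X \<and> Im w \<noteq> 0 then \<phi> w else 0) / (w - of_real p))"
    by (rule cauchy_transform_bound(1)[OF _ box, of _ N]) (use \<phi> N0 in \<open>auto simp: X_def\<close>)
  then have "(\<lambda>w. (if w \<in> X \<and> Im w \<noteq> 0 then \<phi> w else 0) / (w - of_real p)) integrable_on UNIV"
    using has_integral_integral_lborel by blast
  then have "(\<lambda>w. (if w \<in> X \<and> Im w \<noteq> 0 then \<phi> w else 0) / (w - of_real p)) integrable_on X"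
    unfolding X_def by (rule integrable_on_subcbox) simp
  then show "off_axis_kernel \<phi> p integrable_on cbox (Complex a c) (Complex b d)"
    unfolding X_def by (rule integrable_eq) (simp add: off_axis_kernel_def)
  define k where "k w = norm (if w \<in> X \<and> Im w \<noteq> 0 \<and> s w then \<phi> w else 0) / norm (w - of_real p)" for w
  have supp: "(if w \<in> X \<and> Im w \<noteq> 0 \<and> s w then \<phi> w else 0) = 0" if "w \<notin> cbox (Complex a c') (Complex b d')" for w
    using that strip(2)[of w] by (auto simp: X_def in_cbox_complex_iff)
  have k: "integrable lborel k" "integral\<^sup>L lborel k \<le> 16 * sqrt ((b - a) * (d' - c')) * N"
    unfolding k_def
    by (rule cauchy_transform_bound(2,3)[OF _ box(1) strip(1) supp, where N = N]; use \<phi> N0 in auto)+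
  have kX: "(k has_integral integral\<^sup>L lborel k) UNIV" by (rule has_integral_integral_lborel[OF k(1)])
  have eq: "(if w \<in> X then if s w then norm (off_axis_kernel \<phi> p w) else 0 else 0) = k w" for w
    by (simp add: k_def off_axis_kernel_def norm_divide)
  have "((\<lambda>w. if s w then norm (off_axis_kernel \<phi> p w) else 0) has_integral integral\<^sup>L lborel k) X"
    using kX by (subst has_integral_restrict_UNIV[symmetric]) (simp only: eq[abs_def] eq)
  then show "(\<lambda>w. if s w then norm (off_axis_kernel \<phi> p w) else 0) integrable_on cbox (Complex a c) (Complex b d)"
    "integral (cbox (Complex a c) (Complex b d)) (\<lambda>w. if s w then norm (off_axis_kernel \<phi> p w) else 0) \<le> 16 * sqrt ((b - a) * (d' - c')) * N"
    using k(2) by (auto simp: X_def integral_unique)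
qed

text \<open>At a non-real \<open>z\<close> the denominator keeps the distance \<open>|Im z|\<close>
  from 0 for every real \<open>p\<close>, so the modulus of continuity does not depend on
  \<open>p\<close>.\<close>

lemma kernel_locally_uniform:
  assumes \<phi>: "continuous_on UNIV \<phi>" "\<And>z. norm (\<phi> z) \<le> N" and z: "Im z \<noteq> 0" and e: "e > 0"
  obtains d where "d > 0" "\<And>w. dist z w < d \<Longrightarrow> Im w \<noteq> 0"
    "\<And>w p. dist z w < d \<Longrightarrow> norm (off_axis_kernel \<phi> p z - off_axis_kernel \<phi> p w) \<le> e"
proof -
  have N0: "N \<ge> 0" by (rule order_trans[OF norm_ge_zero \<phi>(2)])
  define m where "m = \<bar>Im z\<bar>"
  have m: "m > 0" using z by (simp add: m_def)
  have "isCont \<phi> z" using \<phi>(1) by (simp add: continuous_on_eq_continuous_at)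
  then obtain d1 where d1: "d1 > 0" "\<And>w. dist w z < d1 \<Longrightarrow> dist (\<phi> w) (\<phi> z) < e * m / 4"
    using e m unfolding continuous_at_eps_delta by (metis divide_pos_pos mult_pos_pos zero_less_numeral)
  \<comment> \<open>\<open>m / 2\<close> keeps \<open>|Im w|\<close> at least \<open>m / 2\<close>;
    \<open>d1\<close> and the third entry make the errors from \<open>\<phi>\<close> and from the
    denominator at most \<open>e / 2\<close> each. \<open>N + 1\<close> avoids division by
    0.\<close>
  define d where "d = min d1 (min (m / 2) (e * m\<^sup>2 / (4 * (N + 1))))"
  have d: "d > 0" using d1 m e N0 by (auto simp: d_def intro!: divide_pos_pos mult_pos_pos)
  have im: "\<bar>Im w\<bar> \<ge> m / 2" if "dist z w < d" for w
    using that abs_Im_le_cmod[of "z - w"] by (auto simp: d_def dist_norm m_def)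
  show ?thesis
  proof (rule that[OF d])
    show nz: "Im w \<noteq> 0" if "dist z w < d" for w using im[OF that] m by auto
    fix w p assume w: "dist z w < d"
    have zp: "norm (z - of_real p) \<ge> m" using cmod_minus_of_real_ge[of z p] by (simp add: m_def)
    have wp: "norm (w - of_real p) \<ge> m / 2" using cmod_minus_of_real_ge[of w p] im[OF w] by linarith
    have ne: "z - of_real p \<noteq> 0" "w - of_real p \<noteq> 0" using zp wp m by auto
    have "off_axis_kernel \<phi> p z - off_axis_kernel \<phi> p w =
        \<phi> z * (w - z) / ((z - of_real p) * (w - of_real p)) + (\<phi> z - \<phi> w) / (w - of_real p)"
    proof -
      have "f / A - g / B = f * (B - A) / (A * B) + (f - g) / B" if "A \<noteq> 0" "B \<noteq> 0" for f g A B :: complex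
        using that by (simp add: field_simps)
      from this[OF ne, of "\<phi> z" "\<phi> w"] show ?thesis
        using z nz[OF w] by (simp add: off_axis_kernel_def)
    qed
    also have "norm \<dots> \<le> e / 2 + e / 2"
    proof (rule norm_triangle_le[OF add_mono])
      have "norm (\<phi> z * (w - z) / ((z - of_real p) * (w - of_real p))) \<le> N * (e * m\<^sup>2 / (4 * (N + 1))) / (m * (m / 2))"
        unfolding norm_divide norm_mult
        using w \<phi>(2)[of z] zp wp m N0 e by (intro frac_le mult_mono mult_nonneg_nonneg mult_pos_pos)
          (auto simp: d_def dist_norm norm_minus_commute)
      also have "\<dots> = e / 2 * (N / (N + 1))"
      proof -
        have "N * (e * m\<^sup>2 / (4 * n)) / (m * (m / 2)) = e / 2 * (N / n)" if "n > 0" for n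
          using m that by (simp add: field_simps power2_eq_square)
        from this[of "N + 1"] N0 show ?thesis by simp
      qed
      also have "\<dots> \<le> e / 2 * 1" using e N0 by (intro mult_left_mono) auto
      finally show "norm (\<phi> z * (w - z) / ((z - of_real p) * (w - of_real p))) \<le> e / 2" by simp
      have "norm ((\<phi> z - \<phi> w) / (w - of_real p)) \<le> (e * m / 4) / (m / 2)"
        unfolding norm_divide using d1(2)[of w] w wp m e
        by (intro frac_le) (auto simp: d_def dist_norm norm_minus_commute dist_commute)
      then show "norm ((\<phi> z - \<phi> w) / (w - of_real p)) \<le> e / 2" using m by simp
    qed
    finally show "norm (off_axis_kernel \<phi> p z - off_axis_kernel \<phi> p w) \<le> e" by simp
  qed
qed

text \<open>One gauge serves all \<open>p\<close>: cells tagged on the axis lie in a strip so thin that the kernel has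
  small integral over it, whatever \<open>p\<close> is. This gives Henstock integrability in the operator
  norm although \<open>1 / \<bar>Im z\<bar>\<close> is not integrable.\<close>
lemma uniform_kernel_gauge:
  assumes \<phi>: "continuous_on UNIV \<phi>" "\<And>z. norm (\<phi> z) \<le> N" and box: "a \<le> b" "c \<le> d" and e: "e > 0"
  obtains \<gamma> where "gauge \<gamma>" "\<And>p D. D tagged_division_of cbox (Complex a c) (Complex b d) \<Longrightarrow> \<gamma> fine D \<Longrightarrow>
    norm ((\<Sum>(z, K)\<in>D. measure lborel K *\<^sub>R off_axis_kernel \<phi> p z) - integral (cbox (Complex a c) (Complex b d)) (off_axis_kernel \<phi> p)) \<le> e"
proof -
  define X where "X = cbox (Complex a c) (Complex b d)"
  have N0: "N \<ge> 0" by (rule order_trans[OF norm_ge_zero \<phi>(2)])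
  \<comment> \<open>\<open>\<eta>\<close> is chosen from \<open>Q\<close> so that the kernel has
    integral at most \<open>e / 2\<close> over the part of the box with
    \<open>|Im w| \<le> \<eta>\<close>; the summand 1 keeps \<open>Q\<close> positive.\<close>
  define Q where "Q = 16 * N * sqrt (2 * (b - a)) + 1"
  have Q: "Q > 0" using N0 box by (simp add: Q_def add_nonneg_pos)
  define \<eta> where "\<eta> = (e / (2 * Q))\<^sup>2"
  have \<eta>: "\<eta> > 0" using e Q by (simp add: \<eta>_def)
  have sq\<eta>: "16 * sqrt ((b - a) * (\<eta> - - \<eta>)) * N \<le> e / 2"
  proof -
    have "16 * sqrt ((b - a) * (\<eta> - - \<eta>)) * N = 16 * N * sqrt (2 * (b - a)) * sqrt \<eta>"
      by (simp add: real_sqrt_mult mult_ac)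
    also have "\<dots> \<le> Q * sqrt \<eta>" using \<eta> by (intro mult_right_mono) (auto simp: Q_def)
    also have "sqrt \<eta> = e / (2 * Q)" unfolding \<eta>_def using e Q by (simp only: real_sqrt_abs) simp
    also have "Q * (e / (2 * Q)) = e / 2" using Q by simp
    finally show ?thesis .
  qed
  \<comment> \<open>Error per unit area allowed to cells tagged off the axis; it adds up to at most
    \<open>e / 2\<close>.\<close>
  define e' where "e' = e / (2 * (measure lborel X + 1))"
  have e': "e' > 0" using e by (auto simp: e'_def intro!: divide_pos_pos add_nonneg_pos)
  have "\<exists>r. Im z \<noteq> 0 \<longrightarrow> r > 0 \<and> (\<forall>w. dist z w < r \<longrightarrow> Im w \<noteq> 0) \<and>
      (\<forall>w p. dist z w < r \<longrightarrow> norm (off_axis_kernel \<phi> p z - off_axis_kernel \<phi> p w) \<le> e')" for z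
  proof (cases "Im z = 0")
    case False
    show ?thesis by (rule kernel_locally_uniform[OF \<phi> False e']) blast
  qed simp
  then obtain r where r: "\<And>z. Im z \<noteq> 0 \<Longrightarrow> r z > 0" "\<And>z w. Im z \<noteq> 0 \<Longrightarrow> dist z w < r z \<Longrightarrow> Im w \<noteq> 0"
    "\<And>z w p. Im z \<noteq> 0 \<Longrightarrow> dist z w < r z \<Longrightarrow> norm (off_axis_kernel \<phi> p z - off_axis_kernel \<phi> p w) \<le> e'" by metis
  define \<gamma> where "\<gamma> z = ball z (if Im z = 0 then \<eta> else r z)" for z
  show ?thesis
  proof (rule that)
    show "gauge \<gamma>" using \<eta> r(1) by (auto simp: gauge_def \<gamma>_def)
    fix p D assume D: "D tagged_division_of cbox (Complex a c) (Complex b d)" "\<gamma> fine D"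
    define k where "k = off_axis_kernel \<phi> p"
    define s where "s w = (if \<bar>Im w\<bar> \<le> \<eta> then norm (k w) else 0)" for w
    have ki: "k integrable_on X" and si: "s integrable_on X" and sb: "integral X s \<le> e / 2"
    proof -
      have 1: "- \<eta> \<le> \<eta>" using \<eta> by simp
      have 2: "Im w \<in> {- \<eta>..\<eta>}" if "\<bar>Im w\<bar> \<le> \<eta>" for w using that by auto
      note A = off_axis_kernel_integral[OF \<phi> box 1 2, of "\<lambda>w. \<bar>Im w\<bar> \<le> \<eta>" p]
      show "k integrable_on X" unfolding k_def X_def by (rule A(1)) auto
      show "s integrable_on X" unfolding s_def[abs_def] k_def X_def by (rule A(2)) auto
      show "integral X s \<le> e / 2" unfolding s_def[abs_def] k_def X_def
        by (rule order_trans[OF A(3) sq\<eta>]) auto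
    qed
    have fin: "finite D" using D(1) by (rule tagged_division_ofD(1))
    have cell: "\<exists>u v. K = cbox u v" "K \<subseteq> X" "K \<subseteq> \<gamma> z" if "(z, K) \<in> D" for z K
      using tagged_division_ofD(4)[OF D(1) that] tagged_division_ofD(3)[OF D(1) that] fineD[OF D(2) that] by (auto simp: X_def)
    have kK: "k integrable_on K" "s integrable_on K" if "(z, K) \<in> D" for z K
      using cell[OF that] ki si unfolding X_def by (auto intro: integrable_on_subcbox)
    have le: "norm (measure lborel K *\<^sub>R k z - integral K k) \<le> measure lborel K * e' + integral K s"
      if zK: "(z, K) \<in> D" for z K
    proof -
      obtain u v where K: "K = cbox u v" using cell(1)[OF zK] by blast
      have s0: "integral K s \<ge> 0" by (rule Henstock_Kurzweil_Integration.integral_nonneg[OF kK(2)[OF zK]]) (simp add: s_def)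
      show ?thesis
      proof (cases "Im z = 0")
        \<comment> \<open>A tag on the axis contributes 0, so the whole integral over its cell is
          error; it is absorbed by the integral of \<open>s\<close>.\<close>
        case True
        have "norm (integral K k) \<le> integral K s"
        proof (rule integral_norm_bound_integral[OF kK[OF zK]])
          fix w assume "w \<in> K"
          then have "dist z w < \<eta>" using cell(3)[OF zK] True by (auto simp: \<gamma>_def)
          then have "\<bar>Im w\<bar> \<le> \<eta>" using True abs_Im_le_cmod[of "z - w"] by (simp add: dist_norm)
          then show "norm (k w) \<le> s w" by (simp add: s_def)
        qed
        moreover have "k z = 0" using True by (simp add: k_def off_axis_kernel_def)
        ultimately show ?thesis using e' by (simp add: add_increasing)
      next
        case False
        have "measure lborel K *\<^sub>R k z - integral K k = integral K (\<lambda>w. k z - k w)"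
          using Henstock_Kurzweil_Integration.integral_diff[OF integrable_const kK(1)[OF zK, unfolded K], of "k z"]
          by (simp add: K)
        also have "norm \<dots> \<le> e' * measure lborel K"
          unfolding K
        proof (rule integrable_bound)
          show "(\<lambda>w. k z - k w) integrable_on cbox u v" using kK(1)[OF zK] by (auto simp: K intro: integrable_diff)
          fix w assume "w \<in> cbox u v"
          then have "dist z w < r z" using cell(3)[OF zK] False by (auto simp: \<gamma>_def K)
          then show "norm (k z - k w) \<le> e'" unfolding k_def by (rule r(3)[OF False])
        qed (use e' in simp)
        finally show ?thesis using s0 by (simp add: mult.commute)
      qed
    qed
    have "(\<Sum>(z, K)\<in>D. measure lborel K *\<^sub>R k z) - integral X k =
        (\<Sum>(z, K)\<in>D. measure lborel K *\<^sub>R k z - integral K k)"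
      using integral_combine_tagged_division_topdown[OF ki[unfolded X_def] D(1)]
      by (simp add: X_def sum_subtractf case_prod_beta)
    also have "norm \<dots> \<le> (\<Sum>(z, K)\<in>D. measure lborel K * e' + integral K s)"
      using le by (intro sum_norm_le) auto
    also have "\<dots> = (\<Sum>(z, K)\<in>D. measure lborel K) * e' + integral X s"
      using integral_combine_tagged_division_topdown[OF si[unfolded X_def] D(1)]
      by (simp add: X_def sum.distrib case_prod_beta sum_distrib_right)
    also have "(\<Sum>(z, K)\<in>D. measure lborel K) = measure lborel X"
      using additive_content_tagged_division[OF D(1)] by (simp add: X_def)
    also have "measure lborel X * e' \<le> e / 2"
    proof -
      have "measure lborel X * e' = e / 2 * (measure lborel X / (measure lborel X + 1))" by (simp add: e'_def)
      also have "\<dots> \<le> e / 2 * 1" using e by (intro mult_left_mono) (auto simp: divide_le_eq_1 add_nonneg_pos)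
      finally show ?thesis by simp
    qed
    finally show "norm ((\<Sum>(z, K)\<in>D. measure lborel K *\<^sub>R off_axis_kernel \<phi> p z) -
        integral (cbox (Complex a c) (Complex b d)) (off_axis_kernel \<phi> p)) \<le> e"
      using sb by (simp add: X_def k_def)
  qed
qed

section \<open>The free part as a gauge integral in operator norm\<close>

lemma multiplier_sum:
  assumes "G \<in> sets borel" "\<And>i. i \<in> A \<Longrightarrow> multiplier G (m i)"
  shows "multiplier G (\<lambda>y. \<Sum>i\<in>A. m i y)" "mult_op G (\<lambda>y. \<Sum>i\<in>A. m i y) = (\<Sum>i\<in>A. mult_op G (m i))"
proof -
  have z: "mult_op G (\<lambda>_. 0) = 0"
    using mult_op_cmult[OF multiplier_const[OF assms(1), of 0], of 0] by (simp add: scale_op.zero_left)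
  have "multiplier G (\<lambda>y. \<Sum>i\<in>A. m i y) \<and> mult_op G (\<lambda>y. \<Sum>i\<in>A. m i y) = (\<Sum>i\<in>A. mult_op G (m i))"
    using assms(2)
  proof (induction A rule: infinite_finite_induct)
    case (insert i A)
    then show ?case by (simp add: multiplier_add mult_op_add)
  qed (auto simp: z multiplier_const[OF assms(1)])
  then show "multiplier G (\<lambda>y. \<Sum>i\<in>A. m i y)" "mult_op G (\<lambda>y. \<Sum>i\<in>A. m i y) = (\<Sum>i\<in>A. mult_op G (m i))" by auto
qed

context rank_one_perturbation
begin

definition free_integrand :: "(complex \<Rightarrow> complex) \<Rightarrow> complex \<Rightarrow> 'a l2 \<Rightarrow>\<^sub>L 'a l2" where
  "free_integrand \<phi> z = (if Im z = 0 then 0 else \<phi> z *\<^sub>O R0 z)"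

lemma free_integrand_eq:
  "multiplier G (\<lambda>y. off_axis_kernel \<phi> (P y) z)" "free_integrand \<phi> z = mult_op G (\<lambda>y. off_axis_kernel \<phi> (P y) z)"
proof -
  have "multiplier G (\<lambda>y. off_axis_kernel \<phi> (P y) z) \<and> free_integrand \<phi> z = mult_op G (\<lambda>y. off_axis_kernel \<phi> (P y) z)"
  proof (cases "Im z = 0")
    case True
    then show ?thesis
      using multiplier_const[OF Gb, of 0] mult_op_cmult[OF multiplier_const[OF Gb, of 0], of 0]
      by (simp add: off_axis_kernel_def free_integrand_def scale_op.zero_left)
  next
    case False
    then show ?thesis
      using multiplier_cmult[OF R0_multiplier[OF False], of "\<phi> z"] mult_op_cmult[OF R0_multiplier[OF False], of "\<phi> z"]
      by (simp add: off_axis_kernel_def free_integrand_def R0_def)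
  qed
  then show "multiplier G (\<lambda>y. off_axis_kernel \<phi> (P y) z)" "free_integrand \<phi> z = mult_op G (\<lambda>y. off_axis_kernel \<phi> (P y) z)"
    by auto
qed

text \<open>Lets the operator norm of a Riemann sum be controlled by the supremum over
  \<open>p\<close> of scalar Riemann sums, to which a gauge uniform in \<open>p\<close>
  applies.\<close>

lemma free_Riemann_sum:
  fixes D :: "(complex \<times> complex set) set"
  shows "multiplier G (\<lambda>y. \<Sum>(z, K)\<in>D. measure lborel K *\<^sub>R off_axis_kernel \<phi> (P y) z)"
  "(\<Sum>(z, K)\<in>D. measure lborel K *\<^sub>R free_integrand \<phi> z) =
    mult_op G (\<lambda>y. \<Sum>(z, K)\<in>D. measure lborel K *\<^sub>R off_axis_kernel \<phi> (P y) z)"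
proof -
  have m: "multiplier G (\<lambda>y. of_real (measure lborel (snd i)) * off_axis_kernel \<phi> (P y) (fst i))" for i :: "complex \<times> complex set"
    by (rule multiplier_cmult[OF free_integrand_eq(1)])
  have o: "mult_op G (\<lambda>y. of_real (measure lborel (snd i)) * off_axis_kernel \<phi> (P y) (fst i)) =
      measure lborel (snd i) *\<^sub>R free_integrand \<phi> (fst i)" for i :: "complex \<times> complex set"
    unfolding mult_op_cmult[OF free_integrand_eq(1)] free_integrand_eq(2)
    by (rule blinfun_eqI) (simp add: scaleR_scaleC blinfun.scaleR_left)
  show "multiplier G (\<lambda>y. \<Sum>(z, K)\<in>D. measure lborel K *\<^sub>R off_axis_kernel \<phi> (P y) z)"
    "(\<Sum>(z, K)\<in>D. measure lborel K *\<^sub>R free_integrand \<phi> z) =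
      mult_op G (\<lambda>y. \<Sum>(z, K)\<in>D. measure lborel K *\<^sub>R off_axis_kernel \<phi> (P y) z)"
    using multiplier_sum[OF Gb, of D "\<lambda>i y. of_real (measure lborel (snd i)) * off_axis_kernel \<phi> (P y) (fst i)", OF m]
    unfolding o by (simp_all add: case_prod_beta scaleR_conv_of_real)
qed

text \<open>The Cauchy criterion is checked with the gauge that is uniform in \<open>p\<close>: the
  difference of two fine Riemann sums is a multiplication operator with small symbol. So no
  candidate for the integral has to be named. The bound is inherited from fine Riemann sums, whose
  symbols are close to the scalar integrals.\<close>

lemma free_integrand_integrable:
  assumes \<phi>: "continuous_on UNIV \<phi>" "\<And>z. norm (\<phi> z) \<le> N" and box: "a \<le> b" "c \<le> d"
  shows "free_integrand \<phi> integrable_on cbox (Complex a c) (Complex b d)"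
    "norm (integral (cbox (Complex a c) (Complex b d)) (free_integrand \<phi>)) \<le> 16 * sqrt ((b - a) * (d - c)) * N"
proof -
  define X where "X = cbox (Complex a c) (Complex b d)"
  define S where "S D p = (\<Sum>(z, K)\<in>D. measure lborel K *\<^sub>R off_axis_kernel \<phi> p z)" for D :: "(complex \<times> complex set) set" and p
  have Sop: "multiplier G (\<lambda>y. S D (P y))" "(\<Sum>(z, K)\<in>D. measure lborel K *\<^sub>R free_integrand \<phi> z) = mult_op G (\<lambda>y. S D (P y))" for D
    unfolding S_def by (rule free_Riemann_sum)+
  have N0: "N \<ge> 0" by (rule order_trans[OF norm_ge_zero \<phi>(2)])
  have J: "norm (integral X (off_axis_kernel \<phi> p)) \<le> 16 * sqrt ((b - a) * (d - c)) * N" for p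
  proof -
    note A = off_axis_kernel_integral[OF \<phi> box box(2), of "\<lambda>_. True" p]
    have "norm (integral X (off_axis_kernel \<phi> p)) \<le> integral X (\<lambda>w. if True then norm (off_axis_kernel \<phi> p w) else 0)"
      unfolding X_def by (rule integral_norm_bound_integral[OF A(1,2)]) (auto simp: in_cbox_complex_iff)
    also have "\<dots> \<le> 16 * sqrt ((b - a) * (d - c)) * N"
      unfolding X_def by (rule A(3)) (auto simp: in_cbox_complex_iff)
    finally show ?thesis .
  qed
  have int: "free_integrand \<phi> integrable_on X"
    unfolding X_def integrable_Cauchy
  proof (intro allI impI)
    fix e :: real assume e: "e > 0"
    obtain \<gamma> where \<gamma>: "gauge \<gamma>" "\<And>p D. D tagged_division_of X \<Longrightarrow> \<gamma> fine D \<Longrightarrow> norm (S D p - integral X (off_axis_kernel \<phi> p)) \<le> e / 3"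
      unfolding X_def S_def by (rule uniform_kernel_gauge[OF \<phi> box, of "e / 3"]) (use e in auto)
    show "\<exists>\<gamma>. gauge \<gamma> \<and> (\<forall>\<D>1 \<D>2. \<D>1 tagged_division_of cbox (Complex a c) (Complex b d) \<and> \<gamma> fine \<D>1 \<and>
        \<D>2 tagged_division_of cbox (Complex a c) (Complex b d) \<and> \<gamma> fine \<D>2 \<longrightarrow>
        norm ((\<Sum>(x, K)\<in>\<D>1. measure lborel K *\<^sub>R free_integrand \<phi> x) - (\<Sum>(x, K)\<in>\<D>2. measure lborel K *\<^sub>R free_integrand \<phi> x)) < e)"
    proof (intro exI[of _ \<gamma>] conjI allI impI \<gamma>(1))
      fix D1 D2 assume D: "D1 tagged_division_of cbox (Complex a c) (Complex b d) \<and> \<gamma> fine D1 \<and>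
        D2 tagged_division_of cbox (Complex a c) (Complex b d) \<and> \<gamma> fine D2"
      have "norm (S D1 p + - 1 * S D2 p) \<le> 2 * e / 3" for p
        using norm_triangle_ineq4[of "S D1 p - integral X (off_axis_kernel \<phi> p)" "S D2 p - integral X (off_axis_kernel \<phi> p)"]
          \<gamma>(2)[of D1 p] \<gamma>(2)[of D2 p] D by (simp add: X_def)
      then have "norm (mult_op G (\<lambda>y. S D1 (P y) + - 1 * S D2 (P y))) \<le> 2 * e / 3"
        using e by (intro norm_mult_op_le multiplier_add multiplier_cmult Sop) auto
      also have "mult_op G (\<lambda>y. S D1 (P y) + - 1 * S D2 (P y)) = mult_op G (\<lambda>y. S D1 (P y)) - mult_op G (\<lambda>y. S D2 (P y))"
        by (simp only: mult_op_add[OF Sop(1) multiplier_cmult[OF Sop(1)]] mult_op_cmult[OF Sop(1)])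
          (simp add: scale_op.minus_left)
      finally show "norm ((\<Sum>(x, K)\<in>D1. measure lborel K *\<^sub>R free_integrand \<phi> x) - (\<Sum>(x, K)\<in>D2. measure lborel K *\<^sub>R free_integrand \<phi> x)) < e"
        unfolding Sop(2) using e by simp
    qed
  qed
  then show "free_integrand \<phi> integrable_on cbox (Complex a c) (Complex b d)" by (simp add: X_def)
  have "norm (integral X (free_integrand \<phi>)) \<le> 16 * sqrt ((b - a) * (d - c)) * N + e" if e: "e > 0" for e
  proof -
    obtain \<gamma> where \<gamma>: "gauge \<gamma>" "\<And>p D. D tagged_division_of X \<Longrightarrow> \<gamma> fine D \<Longrightarrow> norm (S D p - integral X (off_axis_kernel \<phi> p)) \<le> e / 2"
      unfolding X_def S_def by (rule uniform_kernel_gauge[OF \<phi> box, of "e / 2"]) (use e in auto)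
    obtain \<gamma>' where \<gamma>': "gauge \<gamma>'" "\<And>D. D tagged_division_of X \<Longrightarrow> \<gamma>' fine D \<Longrightarrow>
        norm ((\<Sum>(z, K)\<in>D. measure lborel K *\<^sub>R free_integrand \<phi> z) - integral X (free_integrand \<phi>)) < e / 2"
      using has_integral[of "free_integrand \<phi>" "integral X (free_integrand \<phi>)" "Complex a c" "Complex b d"]
        integrable_integral[OF int] e unfolding X_def by (meson half_gt_zero)
    obtain D where D': "D tagged_division_of cbox (Complex a c) (Complex b d)" "(\<lambda>x. \<gamma> x \<inter> \<gamma>' x) fine D"
      by (rule fine_division_exists[OF gauge_Int[OF \<gamma>(1) \<gamma>'(1)]])
    then have D: "D tagged_division_of X" "\<gamma> fine D" "\<gamma>' fine D" by (auto simp: X_def fine_Int)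
    have "norm (S D p) \<le> 16 * sqrt ((b - a) * (d - c)) * N + e / 2" for p
      using \<gamma>(2)[OF D(1,2), of p] J[of p] norm_triangle_ineq2[of "S D p" "integral X (off_axis_kernel \<phi> p)"] by linarith
    then have "norm (mult_op G (\<lambda>y. S D (P y))) \<le> 16 * sqrt ((b - a) * (d - c)) * N + e / 2"
      using e N0 box by (intro norm_mult_op_le Sop) auto
    then show ?thesis
      using \<gamma>'(2)[OF D(1,3)] norm_triangle_ineq3[of "mult_op G (\<lambda>y. S D (P y))" "integral X (free_integrand \<phi>)"] unfolding Sop(2) by linarith
  qed
  then show "norm (integral (cbox (Complex a c) (Complex b d)) (free_integrand \<phi>)) \<le> 16 * sqrt ((b - a) * (d - c)) * N"
    unfolding X_def by (rule field_le_epsilon)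
qed

end

section \<open>Truncation of the free resolvent to \<open>K\<close> and the extension
  property\<close>

context rank_one_perturbation
begin

text \<open>\<open>R0\<close> cut down to \<open>K\<close>, where \<open>g\<close> and
  \<open>h\<close> live. Unlike \<open>R0\<close> it stays bounded at real points of
  \<open>P(G)\<close> that lie outside \<open>P(K)\<close>.\<close>

definition RK :: "complex \<Rightarrow> 'a l2 \<Rightarrow>\<^sub>L 'a l2" where
  "RK z = mult_op G (\<lambda>y. if y \<in> K then 1 / (z - of_real (P y)) else 0)"

lemma RK_multiplier:
  assumes "\<delta> > 0" "\<And>y. y \<in> K \<Longrightarrow> \<delta> \<le> norm (z - of_real (P y))"
  shows "multiplier G (\<lambda>y. if y \<in> K then 1 / (z - of_real (P y)) else 0)"
proof -
  define q where "q y = (if y \<in> G then of_real (P y) else 0 :: complex)" for y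
  have [measurable]: "q \<in> borel_measurable borel" "K \<in> sets borel"
    using P_multiplier K(1) by (auto simp: multiplier_def q_def[abs_def] borel_compact)
  have m: "(\<lambda>y. indicator K y * (1 / (z - q y))) \<in> borel_measurable borel" by measurable
  have "(\<lambda>y. if y \<in> G then if y \<in> K then 1 / (z - of_real (P y)) else 0 else 0) = (\<lambda>y. indicator K y * (1 / (z - q y)))"
    using K(2) by (auto simp: q_def fun_eq_iff indicator_def)
  moreover have bd: "norm (if y \<in> K then 1 / (z - of_real (P y)) else 0) \<le> 1 / \<delta>" for y
  proof (cases "y \<in> K")
    case True
    then show ?thesis using assms(1) assms(2)[OF True] by (auto simp: norm_divide intro!: divide_left_mono mult_pos_pos)
  qed (use assms in simp)
  have "bounded ((\<lambda>y. if y \<in> K then 1 / (z - of_real (P y)) else 0) ` G)"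
    by (rule boundedI[of _ "1 / \<delta>"], erule imageE, simp only: bd)
  ultimately show ?thesis using m \<open>bounded _\<close> by (simp add: multiplier_def)
qed

lemma PK_compact: "compact (complex_of_real ` P ` K)"
  by (intro compact_continuous_image continuous_intros K smooth_on_continuous[OF smooth_on_subset[OF P K(2)]])

lemma away_from_PK:
  assumes "z \<notin> complex_of_real ` P ` K"
  obtains \<delta> where "\<delta> > 0" "\<And>w y. w \<in> ball z \<delta> \<Longrightarrow> y \<in> K \<Longrightarrow> \<delta> \<le> norm (w - of_real (P y))"
proof -
  have "open (- (complex_of_real ` P ` K))" using PK_compact by (simp add: compact_imp_closed open_Compl)
  then obtain e where e: "e > 0" "ball z e \<subseteq> - (complex_of_real ` P ` K)" using assms open_contains_ball by blast
  show ?thesis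
  proof (rule that[of "e / 2"])
    fix w y assume w: "w \<in> ball z (e / 2)" and y: "y \<in> K"
    have "of_real (P y) \<notin> ball z e" using e(2) y by auto
    then have "e \<le> norm (z - of_real (P y))" by (simp add: dist_norm)
    also have "\<dots> \<le> norm (z - w) + norm (w - of_real (P y))" using norm_triangle_ineq[of "z - w" "w - of_real (P y)"] by simp
    finally show "e / 2 \<le> norm (w - of_real (P y))" using w by (simp add: dist_norm)
  qed (use e in simp)
qed

lemma continuous_RK: "continuous_on (- (complex_of_real ` P ` K)) RK"
proof -
  have op: "open (- (complex_of_real ` P ` K))" using PK_compact by (simp add: compact_imp_closed open_Compl)
  show ?thesis
    unfolding continuous_on_eq_continuous_at[OF op]
  proof
    fix z assume "z \<in> - (complex_of_real ` P ` K)"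
    then have "z \<notin> complex_of_real ` P ` K" by simp
    then obtain \<delta> where \<delta>: "\<delta> > 0" "\<And>w y. w \<in> ball z \<delta> \<Longrightarrow> y \<in> K \<Longrightarrow> \<delta> \<le> norm (w - of_real (P y))"
      by (rule away_from_PK) blast
    note m = RK_multiplier[OF \<delta>(1) \<delta>(2)]
    have "norm (RK w - RK z) \<le> norm (z - w) / \<delta>\<^sup>2" if w: "w \<in> ball z \<delta>" for w
    proof -
      have z: "z \<in> ball z \<delta>" using \<delta>(1) by simp
      define a where "a w y = (if y \<in> K then 1 / (w - of_real (P y)) else 0)" for w :: complex and y
      have ma: "multiplier G (a w)" "multiplier G (a z)" unfolding a_def by (intro m w z; assumption)+
      have "RK w - RK z = mult_op G (\<lambda>y. a w y + - 1 * a z y)"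
        by (simp only: mult_op_add[OF ma(1) multiplier_cmult[OF ma(2)]] mult_op_cmult[OF ma(2)])
          (simp add: scale_op.minus_left RK_def a_def[abs_def])
      also have "norm \<dots> \<le> norm (z - w) / \<delta>\<^sup>2"
      proof (rule norm_mult_op_le[OF multiplier_add[OF ma(1) multiplier_cmult[OF ma(2)]]])
        fix y
        show "norm (a w y + - 1 * a z y) \<le> norm (z - w) / \<delta>\<^sup>2"
        proof (cases "y \<in> K")
          case True
          have d: "\<delta> \<le> norm (w - of_real (P y))" "\<delta> \<le> norm (z - of_real (P y))" using \<delta>(2)[OF _ True] w z by auto
          then have ne: "w - of_real (P y) \<noteq> 0" "z - of_real (P y) \<noteq> 0" using \<delta>(1) by auto
          have "a w y + - 1 * a z y = (z - w) / ((w - of_real (P y)) * (z - of_real (P y)))"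
            using ne True by (simp add: a_def field_simps)
          also have "norm \<dots> \<le> norm (z - w) / (\<delta> * \<delta>)"
            unfolding norm_divide norm_mult using d \<delta>(1) by (intro divide_left_mono mult_mono mult_pos_pos) auto
          finally show ?thesis by (simp add: power2_eq_square)
        qed (use \<delta>(1) in \<open>simp add: a_def\<close>)
      qed (use \<delta>(1) in simp)
      finally show ?thesis .
    qed
    then have "\<forall>\<^sub>F w in at z. norm (RK w - RK z) \<le> norm (z - w) / \<delta>\<^sup>2"
      using eventually_at_in_open'[OF open_ball, of z z \<delta>] \<delta>(1) by (auto elim: eventually_mono)
    moreover have "((\<lambda>w. norm (z - w) / \<delta>\<^sup>2) \<longlongrightarrow> 0) (at z)"
      using \<delta>(1) by (auto intro!: tendsto_eq_intros)
    ultimately have "((\<lambda>w. RK w - RK z) \<longlongrightarrow> 0) (at z)" by (rule Lim_null_comparison)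
    then show "isCont RK z" by (simp add: isCont_def LIM_zero_iff)
  qed
qed

text \<open>On \<open>g\<close> both operators agree because \<open>g\<close> vanishes off
  \<open>K\<close>; on the other side the adjoint moves them onto \<open>h\<close>. The form with
  \<open>RK\<close> continues across real points outside \<open>P(K)\<close>.\<close>

lemma rank_one_part_eq:
  assumes z: "Im z \<noteq> 0"
  shows "R0 z o\<^sub>L rank_one (abs_l2 g) (abs_l2 h) o\<^sub>L R0 z = RK z o\<^sub>L rank_one (abs_l2 g) (abs_l2 h) o\<^sub>L RK z"
proof (rule blinfun_eqI)
  fix F
  have mK: "multiplier G (\<lambda>y. if y \<in> K then 1 / (w - of_real (P y)) else 0)" if "Im w \<noteq> 0" for w
    by (rule RK_multiplier[of "\<bar>Im w\<bar>"]) (use that cmod_minus_of_real_ge in auto)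
  have eq: "R0 w (abs_l2 k) = RK w (abs_l2 k)" if k: "smooth_in K k" and w: "Im w \<noteq> 0" for k w
  proof -
    have "(\<lambda>y. if y \<in> G then 1 / (w - of_real (P y)) * k y else 0) =
        (\<lambda>y. if y \<in> G then (if y \<in> K then 1 / (w - of_real (P y)) else 0) * k y else 0)"
      using k by (auto simp: fun_eq_iff smooth_in_def)
    then show ?thesis
      unfolding R0_def RK_def mult_op_abs_l2[OF R0_multiplier[OF w] smooth_in_sq_integrable[OF K(1) k]]
        mult_op_abs_l2[OF mK[OF w] smooth_in_sq_integrable[OF K(1) k]] by simp
  qed
  have z': "Im (cnj z) \<noteq> 0" using z by simp
  have c1: "(\<lambda>y. cnj (1 / (z - of_real (P y)))) = (\<lambda>y. 1 / (cnj z - of_real (P y)))" by simp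
  have c2: "(\<lambda>y. cnj (if y \<in> K then 1 / (z - of_real (P y)) else 0)) = (\<lambda>y. if y \<in> K then 1 / (cnj z - of_real (P y)) else 0)"
    by auto
  have "cinner (abs_l2 h) (R0 z F) = cinner (R0 (cnj z) (abs_l2 h)) F"
    using cinner_mult_op_adjoint[OF R0_multiplier[OF z], of "abs_l2 h" F] R0_multiplier[OF z'] unfolding c1 by (simp add: R0_def)
  also have "\<dots> = cinner (RK (cnj z) (abs_l2 h)) F" by (simp only: eq[OF h z'])
  also have "\<dots> = cinner (abs_l2 h) (RK z F)"
    using cinner_mult_op_adjoint[OF mK[OF z], of "abs_l2 h" F] mK[OF z'] unfolding c2 by (simp add: RK_def)
  finally have i: "cinner (abs_l2 h) (R0 z F) = cinner (abs_l2 h) (RK z F)" .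
  have s: "R0 z (c *\<^sub>C X) = c *\<^sub>C R0 z X" "RK z (c *\<^sub>C X) = c *\<^sub>C RK z X" for c X
    unfolding R0_def RK_def by (rule mult_op_scaleC[OF R0_multiplier[OF z]], rule mult_op_scaleC[OF mK[OF z]])
  show "(R0 z o\<^sub>L rank_one (abs_l2 g) (abs_l2 h) o\<^sub>L R0 z) F = (RK z o\<^sub>L rank_one (abs_l2 g) (abs_l2 h) o\<^sub>L RK z) F"
    by (simp add: s i eq[OF g z])
qed

lemma boundary_resolvent:
  assumes "open G1" "open I" "is_interval I" "0 \<in> I"
  shows "boundary_resolvent G G1 I R"
proof
  show "G \<in> sets borel" by (rule Gb)
  show "R z \<in> ops G" if "Re z \<in> G1" "Im z \<in> I" "Im z \<noteq> 0" for z
    using R_is_resolvent[OF that] by (simp add: is_resolvent_def)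
  show "R z - R w = (w - z) *\<^sub>O (R z o\<^sub>L R w)"
    if "Re z \<in> G1" "Im z \<in> I" "Im z \<noteq> 0" "Re w \<in> G1" "Im w \<in> I" "Im w \<noteq> 0" for z w
    by (rule resolvent_identity[OF Gb R_is_resolvent R_is_resolvent]) (use that in auto)
  show "\<exists>M\<ge>0. \<forall>z\<in>L. Im z \<noteq> 0 \<longrightarrow> norm (R z) \<le> M / \<bar>Im z\<bar>"
    if "compact L" "\<And>z. z \<in> L \<Longrightarrow> Re z \<in> G1 \<and> Im z \<in> I" for L
    by (rule norm_R_le[OF that]) blast+
qed (use assms in auto)

text \<open>Off the axis the integrand is the free part plus a function \<open>q\<close> that is
  continuous on the whole plane; the axis is a null set, so the values of \<open>R\<close> on it are
  immaterial. The truncated integrals miss a strip of height \<open>2 * e\<close>, over which the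
  estimate for boxes tends to 0.\<close>

lemma resolvent_dist_extends:
  assumes G1I: "open G1" "open I" "is_interval I" "0 \<in> I"
    and \<phi>: "\<phi> \<in> test_functions ({z. Re z \<in> G1 \<and> Im z \<in> I} - complex_of_real ` P ` K)"
  shows "((\<lambda>z. \<phi> z *\<^sub>O R z) has_integral resolvent_dist R \<phi>) UNIV"
proof -
  interpret B: boundary_resolvent G G1 I R by (rule boundary_resolvent[OF G1I])
  define F where "F z = \<phi> z *\<^sub>O R z" for z
  define L where "L = supp \<phi>"
  have \<phi>': "\<phi> \<in> test_functions {z. Re z \<in> G1 \<and> Im z \<in> I}" using \<phi> by (auto simp: test_functions_def)
  have cL: "compact L" and LG: "L \<subseteq> {z. Re z \<in> G1 \<and> Im z \<in> I} - complex_of_real ` P ` K"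
    using \<phi> by (auto simp: test_functions_def L_def)
  have c\<phi>: "continuous_on UNIV \<phi>" using test_function_partials(2)[OF \<phi>, of "[]"] by simp
  have z\<phi>: "\<phi> z = 0" if "z \<notin> L" for z using that unfolding L_def by (rule supp_zero)
  obtain N where N: "\<And>z. norm (\<phi> z) \<le> N" using bounded_compact_support[OF cL c\<phi> z\<phi>] by auto
  obtain s where s: "s > 0" "L \<subseteq> cbox (Complex (- s) (- s)) (Complex s s)" by (rule compact_complex_box[OF cL]) blast
  define W where "W = {z. Re z \<in> G1 \<and> Im z \<in> I} - complex_of_real ` P ` K"
  have "open {z. Re z \<in> G1 \<and> Im z \<in> I}"
  proof -
    have "{z. Re z \<in> G1 \<and> Im z \<in> I} = Re -` G1 \<inter> Im -` I" by auto
    then show ?thesis using G1I by (auto intro!: open_Int open_vimage continuous_intros)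
  qed
  then have W: "open W" unfolding W_def using PK_compact by (intro open_Diff compact_imp_closed)
  \<comment> \<open>The rank one part, written with \<open>RK\<close>: it has no singularity at the
    real points of \<open>W\<close>, since \<open>C\<close> is continuous and nonzero there.\<close>
  define q where "q z = (\<phi> z * (1 / C z)) *\<^sub>O (RK z o\<^sub>L rank_one (abs_l2 g) (abs_l2 h) o\<^sub>L RK z)" for z
  have cq: "continuous_on UNIV q"
  proof (rule continuous_on_extend_zero[OF W compact_imp_closed[OF cL]])
    show "L \<subseteq> W" using LG by (simp add: W_def)
    have "continuous_on W C" using C_hol unfolding W_def by (rule holomorphic_on_imp_continuous_on)
    moreover have "continuous_on W RK" by (rule continuous_on_subset[OF continuous_RK]) (auto simp: W_def)
    ultimately show "continuous_on W q"
      unfolding q_def using C_nz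
      by (intro continuous_intros bounded_bilinear.continuous_on[OF bounded_bilinear_blinfun_compose]
          continuous_on_subset[OF c\<phi>]) (auto simp: W_def)
  qed (simp add: q_def z\<phi> scale_op.zero_left)
  have zq: "q z = 0" if "z \<notin> L" for z using z\<phi>[OF that] by (simp add: q_def scale_op.zero_left)
  obtain Q where Q: "Q > 0" "\<And>z. norm (q z) \<le> Q" using bounded_compact_support[OF cL cq zq] by auto
  have Fsplit: "F z = free_integrand \<phi> z + q z" if "Im z \<noteq> 0" for z
  proof (cases "z \<in> L")
    case True
    then have "Re z \<in> G1" "Im z \<in> I" using LG by auto
    then have "R z = R0 z + (1 / C z) *\<^sub>O (R0 z o\<^sub>L rank_one (abs_l2 g) (abs_l2 h) o\<^sub>L R0 z)"
      using that by (intro resolvent_at(2))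
    then show ?thesis
      using that by (simp add: F_def free_integrand_def q_def scale_op.add_right rank_one_part_eq)
  next
    case False
    then show ?thesis using zq that by (simp add: F_def free_integrand_def z\<phi> scale_op.zero_left)
  qed
  \<comment> \<open>Needed for a box containing the support, to have the integral over the plane,
    and for the strip around the axis, to compare with the truncation.\<close>
  have box: "F integrable_on cbox (Complex a c) (Complex b d) \<and>
      norm (integral (cbox (Complex a c) (Complex b d)) F) \<le> 16 * sqrt ((b - a) * (d - c)) * N + Q * ((b - a) * (d - c))"
    if ab: "a \<le> b" "c \<le> d" for a b c d
  proof -
    let ?X = "cbox (Complex a c) (Complex b d)"
    note f = free_integrand_integrable[OF c\<phi> N ab]
    have qi: "q integrable_on ?X" by (intro integrable_continuous continuous_on_subset[OF cq]) auto
    have "((\<lambda>z. free_integrand \<phi> z + q z) has_integral (integral ?X (free_integrand \<phi>) + integral ?X q)) ?X"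
      by (intro has_integral_add integrable_integral f qi)
    then have Fi: "(F has_integral (integral ?X (free_integrand \<phi>) + integral ?X q)) ?X"
      by (rule has_integral_spike[OF negligible_Im[of 0], rotated]) (use Fsplit in auto)
    have "norm (integral ?X q) \<le> Q * measure lborel ?X"
      by (rule integrable_bound[OF _ qi]) (use Q in auto)
    also have "measure lborel ?X = (b - a) * (d - c)"
      using ab by (simp add: measure_lborel_cbox_eq Basis_complex_prod) (auto simp: Basis_complex_def)
    finally show ?thesis
      using Fi f(2) norm_triangle_ineq[of "integral ?X (free_integrand \<phi>)" "integral ?X q"]
      by (auto simp: integral_unique)
  qed
  have FL: "F z = 0" if "z \<notin> L" for z using z\<phi>[OF that] by (simp add: F_def scale_op.zero_left)
  have FU: "F integrable_on UNIV"
    by (rule has_integral_zero_extend(1)[OF conjunct1[OF box[of "- s" s "- s" s]]]) (use s FL in auto)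
  define J where "J = integral UNIV F"
  have J: "(F has_integral J) UNIV" using FU by (simp add: J_def integrable_integral)
  have xr: "xreg L \<phi> (partials [1] \<phi>)" unfolding L_def by (rule B.xreg_test[OF \<phi>'])
  have L0: "B.in_G0 L" unfolding L_def by (rule B.in_G0_supp[OF \<phi>'])
  have near: "norm (cut_integral R e \<phi> - J) \<le> 16 * sqrt (4 * s * e) * N + Q * (4 * s * e)" if e: "e > 0" for e
  proof -
    let ?S = "cbox (Complex (- s) (- e)) (Complex s e)"
    have "((\<lambda>z. if z \<in> {z. e < \<bar>Im z\<bar>} then F z else 0) has_integral cut_integral R e \<phi>) UNIV"
      unfolding has_integral_restrict_UNIV cut_integral_def F_def
      by (rule integrable_integral[OF B.cut_integrable[OF L0 xr e]])
    from has_integral_diff[OF J this]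
    have "((\<lambda>z. if z \<in> ?S then F z else 0) has_integral (J - cut_integral R e \<phi>)) UNIV"
    proof (rule has_integral_eq[rotated])
      fix z
      show "F z - (if z \<in> {z. e < \<bar>Im z\<bar>} then F z else 0) = (if z \<in> ?S then F z else 0)"
      proof (cases "z \<in> L")
        case True
        then have "z \<in> cbox (Complex (- s) (- s)) (Complex s s)" using s by auto
        then show ?thesis by (auto simp: in_cbox_complex_iff)
      qed (simp add: FL)
    qed
    then have "(F has_integral (J - cut_integral R e \<phi>)) ?S" by (simp only: has_integral_restrict_UNIV)
    then have "J - cut_integral R e \<phi> = integral ?S F" by (simp add: integral_unique)
    also have "norm \<dots> \<le> 16 * sqrt ((s - - s) * (e - - e)) * N + Q * ((s - - s) * (e - - e))"
      by (rule conjunct2[OF box]) (use s e in auto)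
    finally show ?thesis by (simp add: norm_minus_commute mult_ac)
  qed
  have "((\<lambda>e. cut_integral R e \<phi> - J) \<longlongrightarrow> 0) (at_right 0)"
  proof (rule Lim_null_comparison)
    show "\<forall>\<^sub>F e in at_right 0. norm (cut_integral R e \<phi> - J) \<le> 16 * sqrt (4 * s * e) * N + Q * (4 * s * e)"
      using eventually_at_right_less[of "0::real"] by eventually_elim (rule near)
    show "((\<lambda>e. 16 * sqrt (4 * s * e) * N + Q * (4 * s * e)) \<longlongrightarrow> 0) (at_right 0)" by (auto intro!: tendsto_eq_intros)
  qed
  then have "((\<lambda>e. cut_integral R e \<phi>) \<longlongrightarrow> J) (at_right 0)" by (rule LIM_zero_cancel)
  from tendsto_unique[OF _ B.T_limit[OF L0 xr] this] have "resolvent_dist R \<phi> = J" by simp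
  with J show ?thesis by (simp add: F_def[abs_def])
qed

end

section \<open>Matching the hypotheses of the theorem with the two locales\<close>

lemma smooth_in_test_function: "k \<in> test_functions V \<Longrightarrow> supp k \<subseteq> K \<Longrightarrow> smooth_in K k"
  using supp_zero[of _ k] by (auto simp: smooth_in_def test_functions_def)

lemma grad_sum_squares:
  assumes "GDERIV P y :> D" "D \<noteq> 0"
  shows "(\<Sum>c\<in>Basis. (partials [c] P y)\<^sup>2) \<noteq> 0"
proof -
  have "partials [c] P y = c \<bullet> D" for c
    using partial_eq[OF assms(1)[unfolded gderiv_def]] by simp
  then have "(\<Sum>c\<in>Basis. (partials [c] P y)\<^sup>2) = (\<Sum>c\<in>Basis. (D \<bullet> c) * (D \<bullet> c))"
    by (simp add: power2_eq_square inner_commute)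
  also have "\<dots> = D \<bullet> D" by (rule euclidean_inner[symmetric])
  finally show ?thesis using assms(2) by simp
qed

theorem proposition5:
  fixes G K :: "(real ^ 'n) set" and P :: "real ^ 'n \<Rightarrow> real" and g h :: "real ^ 'n \<Rightarrow> complex"
    and G\<^sub>1 I :: "real set" and G\<^sub>0 PK :: "complex set" and C :: "complex \<Rightarrow> complex"
    and H :: "(real ^ 'n) l2 \<Rightarrow>\<^sub>L (real ^ 'n) l2" and R :: "complex \<Rightarrow> (real ^ 'n) l2 \<Rightarrow>\<^sub>L (real ^ 'n) l2"
  defines "PK \<equiv> complex_of_real ` P ` K"
    and "G\<^sub>0 \<equiv> {z. Re z \<in> G\<^sub>1 \<and> Im z \<in> I}"
    and "C \<equiv> \<lambda>z. 1 - (LINT y:G|lborel. cnj (h y) * g y / (z - of_real (P y)))"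
    and "H \<equiv> mult_op G (\<lambda>y. of_real (P y)) + rank_one (abs_l2 g) (abs_l2 h)"
    and "R \<equiv> resolvent G H"
  assumes G: "open G" "bounded G"
    and P: "smooth_on G P" "\<forall>bs\<in>lists Basis. bounded (partials bs P ` G)"
    and grad: "\<forall>y\<in>G. \<exists>D. GDERIV P y :> D \<and> D \<noteq> 0"
    and gh: "g \<in> test_functions G" "h \<in> test_functions G"
    and K: "compact K" "K \<subseteq> G" "supp g \<subseteq> K" "supp h \<subseteq> K"
    and G1: "open G\<^sub>1" "P ` K \<subseteq> G\<^sub>1"
    and I: "open I" "is_interval I" "0 \<in> I"
    and C: "C holomorphic_on (G\<^sub>0 - PK)" "\<forall>z\<in>G\<^sub>0 - PK. C z \<noteq> 0"
    and C_upper: "\<forall>x\<in>G\<^sub>1. \<exists>c. ((\<lambda>u. C (Complex x u)) \<longlongrightarrow> c) (at_right 0) \<and> c \<noteq> 0"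
    and C_lower: "\<forall>x\<in>G\<^sub>1. \<exists>c. ((\<lambda>u. C (Complex x u)) \<longlongrightarrow> c) (at_left 0) \<and> c \<noteq> 0"
  shows
    "(\<comment> \<open>the limit defining \<open>R(\<phi>)\<close> exists and is given by both formulas\<close>
      \<forall>\<phi>\<in>test_functions G\<^sub>0.
        (\<forall>\<epsilon>>0. (\<lambda>z. \<phi> z *\<^sub>O R z) integrable_on {z. \<epsilon> < \<bar>Im z\<bar>}) \<and>
        (\<forall>\<epsilon>>0. (\<lambda>u. slice R u (\<lambda>x. \<phi> (Complex x u))) integrable_on {u. \<epsilon> < \<bar>u\<bar>}) \<and>
        ((\<lambda>\<epsilon>. cut_integral R \<epsilon> \<phi>) \<longlongrightarrow> resolvent_dist R \<phi>) (at_right 0) \<and>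
        ((\<lambda>\<epsilon>. integral {u. \<epsilon> < \<bar>u\<bar>} (\<lambda>u. slice R u (\<lambda>x. \<phi> (Complex x u))))
           \<longlongrightarrow> resolvent_dist R \<phi>) (at_right 0)) \<and>
     \<comment> \<open>it is a distribution on \<open>G\<^sub>0\<close> extending the function \<open>R(z)\<close> on \<open>G\<^sub>0 - P(K)\<close>\<close>
     op_distribution G G\<^sub>0 (resolvent_dist R) \<and>
     (\<forall>z\<in>G\<^sub>0. Im z \<noteq> 0 \<longrightarrow> z \<in> resolvent_set G H) \<and>
     (\<forall>\<phi>\<in>test_functions (G\<^sub>0 - PK).
        ((\<lambda>z. \<phi> z *\<^sub>O R z) has_integral resolvent_dist R \<phi>) UNIV) \<and>
     dist_resolvent_eq G\<^sub>0 (resolvent_dist R) \<and>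
     \<comment> \<open>the boundary values exist as distributions on \<open>G\<^sub>1\<close>, and \<open>M = \<mu>(x) \<delta>(y)\<close>\<close>
     (\<forall>\<psi>\<in>test_functions G\<^sub>1.
        (\<forall>u\<in>I - {0}. (\<lambda>x. \<psi> x *\<^sub>O R (Complex x u)) integrable_on UNIV) \<and>
        ((\<lambda>u. slice R u \<psi>) \<longlongrightarrow> upper_value R \<psi>) (at_right 0) \<and>
        ((\<lambda>u. slice R u \<psi>) \<longlongrightarrow> lower_value R \<psi>) (at_left 0)) \<and>
     op_distribution G G\<^sub>1 (upper_value R) \<and> op_distribution G G\<^sub>1 (lower_value R) \<and>
     (\<forall>\<phi>\<in>test_functions G\<^sub>0. spectral_dist (resolvent_dist R) \<phi> = times_delta (jump_dist R) \<phi>)"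
  proof -
  interpret S: rank_one_perturbation G K P g h G\<^sub>1 I C H R
  proof
    show "C = (\<lambda>z. 1 - (LINT y:G|lborel. cnj (h y) * g y / (z - of_real (P y))))" by (simp add: C_def)
    show "H = mult_op G (\<lambda>y. of_real (P y)) + rank_one (abs_l2 g) (abs_l2 h)" by (simp add: H_def)
    show "R = resolvent G H" by (simp add: R_def)
    show "bounded (P ` G)" using P(2) by (auto dest!: bspec[of _ _ "[]"])
    show "(\<Sum>c\<in>Basis. (partials [c] P y)\<^sup>2) \<noteq> 0" if "y \<in> G" for y
      using grad that grad_sum_squares by blast
    show "smooth_in K g" "smooth_in K h" using gh K by (auto intro: smooth_in_test_function)
    show "C holomorphic_on ({z. Re z \<in> G\<^sub>1 \<and> Im z \<in> I} - of_real ` P ` K)"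
      using C(1) by (simp add: G\<^sub>0_def PK_def)
    show "C z \<noteq> 0" if "Re z \<in> G\<^sub>1" "Im z \<in> I" "z \<notin> of_real ` P ` K" for z
      using C(2) that by (auto simp: G\<^sub>0_def PK_def)
    show "\<exists>c. ((\<lambda>u. C (Complex x u)) \<longlongrightarrow> c) (at_right 0) \<and> c \<noteq> 0" if "x \<in> G\<^sub>1" for x
      using C_upper that by blast
    show "\<exists>c. ((\<lambda>u. C (Complex x u)) \<longlongrightarrow> c) (at_left 0) \<and> c \<noteq> 0" if "x \<in> G\<^sub>1" for x
      using C_lower that by blast
  qed (use G K P in auto)
  note G1I = G1(1) I
  interpret B: boundary_resolvent G G\<^sub>1 I R by (rule S.boundary_resolvent[OF G1I])
  show ?thesis
    unfolding G\<^sub>0_def PK_def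
  proof (intro conjI ballI)
    fix \<phi> assume "\<phi> \<in> test_functions B.G0"
    note t = B.test_function_limits[OF this]
    show "\<forall>\<epsilon>>0. (\<lambda>z. \<phi> z *\<^sub>O R z) integrable_on {z. \<epsilon> < \<bar>Im z\<bar>}"
      "\<forall>\<epsilon>>0. (\<lambda>u. slice R u (\<lambda>x. \<phi> (Complex x u))) integrable_on {u. \<epsilon> < \<bar>u\<bar>}"
      "((\<lambda>\<epsilon>. cut_integral R \<epsilon> \<phi>) \<longlongrightarrow> resolvent_dist R \<phi>) (at_right 0)"
      "((\<lambda>\<epsilon>. integral {u. \<epsilon> < \<bar>u\<bar>} (\<lambda>u. slice R u (\<lambda>x. \<phi> (Complex x u)))) \<longlongrightarrow> resolvent_dist R \<phi>) (at_right 0)"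
      by (rule t)+
  next
    show "op_distribution G B.G0 (resolvent_dist R)" by (rule B.op_distribution_T)
  next
    fix z assume "z \<in> B.G0"
    then show "Im z \<noteq> 0 \<longrightarrow> z \<in> resolvent_set G H" using S.resolvent_at(1) by auto
  next
    fix \<phi> assume "\<phi> \<in> test_functions (B.G0 - complex_of_real ` P ` K)"
    then show "((\<lambda>z. \<phi> z *\<^sub>O R z) has_integral resolvent_dist R \<phi>) UNIV"
      by (rule S.resolvent_dist_extends[OF G1I])
  next
    show "dist_resolvent_eq B.G0 (resolvent_dist R)" by (rule B.dist_resolvent_eq_T)
  next
    fix \<psi> u assume "\<psi> \<in> test_functions G\<^sub>1" "u \<in> I - {0}"
    then show "(\<lambda>x. \<psi> x *\<^sub>O R (Complex x u)) integrable_on UNIV" by (rule B.slice_integrable_test_function)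
  next
    fix \<psi> assume "\<psi> \<in> test_functions G\<^sub>1"
    note b = B.test_function_boundary_values[OF this]
    show "((\<lambda>u. slice R u \<psi>) \<longlongrightarrow> upper_value R \<psi>) (at_right 0)" by (rule b(1))
    show "((\<lambda>u. slice R u \<psi>) \<longlongrightarrow> lower_value R \<psi>) (at_left 0)" by (rule b(2))
  next
    show "op_distribution G G\<^sub>1 (upper_value R)" "op_distribution G G\<^sub>1 (lower_value R)"
      by (rule B.op_distribution_boundary)+
  next
    fix \<phi> assume "\<phi> \<in> test_functions B.G0"
    then show "spectral_dist (resolvent_dist R) \<phi> = times_delta (jump_dist R) \<phi>" by (rule B.spectral_dist_eq)
  qed
qed

end
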